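(* Let $\Gamma$ be a distance-regular graph with vertex set $X$ and diameter $d\geqslant 3$ which is $Q$-polynomial with respect to the ordering $\{E_i\}_{i=0}^d$ of its primitive idempotents, and let $Y$ be a nontrivial descendent of $\Gamma$ with width $w$ and dual width $w^*=d-w$. Pick any $x\in Y$ and let the parameter array $p(\Phi)$ of the Leonard system $\Phi=\Phi(\Gamma;x)$ be given in one of the forms I, IA, II, IIA, IIB, IIC, III listed in the context. Suppose $w>1$. Then the induced subgraph $\Gamma_Y$ is a $Q$-polynomial distance-regular graph if and only if either $p(\Phi)$ is of Case I, IA, II, IIA, IIB or IIC, or $p(\Phi)$ is of Case III and $w^*$ is even. Moreover, if this is the case then the bilinear form $(\cdot|\cdot):\boldsymbol{A}\hat x\times\boldsymbol{A}'\hat x\to\mathbb{C}$ defined by $(u|u')=u^{\mathsf T}u'$ is $0$-balanced with respect to $\Phi$ and $\Phi(\Gamma_Y;x)$, where $\boldsymbol{A}$ and $\boldsymbol{A}'$ are the Bose--Mesner algebras of $\Gamma$ and of the association scheme induced on $Y$.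
   Context: All graphs are finite, simple and undirected. Let $\Gamma$ be a connected graph with vertex set $X$, path-length distance $\partial$ and diameter $d$; let $A_i\in\mathbb{C}^{X\times X}$ be the adjacency matrix of the distance-$i$ graph ($A_0=I$), $A=A_1$. $\Gamma$ is distance-regular if there are integers $b_i,c_i$ such that whenever $\partial(x,y)=i$, $y$ has exactly $b_i$ (resp. $c_i$) neighbours at distance $i+1$ (resp. $i-1$) from $x$. Then the Bose--Mesner algebra $\boldsymbol{A}=\langle A_0,\dots,A_d\rangle$ (complex span) is a commutative semisimple algebra with a basis of primitive idempotents $E_0=|X|^{-1}J,E_1,\dots,E_d$. $\Gamma$ is $Q$-polynomial with respect to the ordering $\{E_i\}_{i=0}^d$ if there are scalars $a_i^*,b_i^*,c_i^*$ with $b_d^*=c_0^*=0$, $b_{i-1}^*c_i^*\neq 0$ $(1\leqslant i\leqslant d)$ and $E_1\circ E_i=|X|^{-1}(b_{i-1}^*E_{i-1}+a_i^*E_i+c_{i+1}^*E_{i+1})$ $(0\leqslant i\leqslant d)$, where $\circ$ is the entrywise product, $E_{-1}=E_{d+1}=0$, $b_{-1}^*=c_{d+1}^*=0$. For a nonempty $Y\subseteq X$ with characteristic vector $\hat Y$, the width is $w=\max\{i:\hat Y^{\mathsf T}A_i\hat Y\neq 0\}$ and the dual width is $w^*=\max\{i:\hat Y^{\mathsf T}E_i\hat Y\neq 0\}$. One always has $w+w^*\geqslant d$; $Y$ is a descendent of $\Gamma$ if $w+w^*=d$, trivial if moreover $w=0$ or $w=d$, nontrivial otherwise. $\Gamma_Y$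 is the induced subgraph on $Y$. For a descendent $Y$ the relations $\{(x,y)\in Y\times Y:\partial(x,y)=i\}$ $(0\leqslant i\leqslant w)$ form an association scheme with $w$ classes on $Y$; its Bose--Mesner algebra $\boldsymbol{A}'=\langle\breve A_0,\dots,\breve A_w\rangle$ ($\breve B$ is the principal submatrix of $B$ on $Y$) has a $Q$-polynomial ordering $E_0',\dots,E_w'$ of its primitive idempotents determined by $\langle E_0',\dots,E_i'\rangle=\langle\breve E_0,\dots,\breve E_i\rangle$ $(0\leqslant i\leqslant w)$. If $\Gamma_Y$ is connected it is distance-regular with diameter $w$ and regarded as $Q$-polynomial with respect to this ordering. Vectors in $\mathbb{C}^Y$ are viewed in $\mathbb{C}^X$ by extending by $0$; $\hat x$ is the unit coordinate vector at $x$. Leonard systems. Let $\mathfrak A\cong\mathbb{C}^{(d+1)\times(d+1)}$ be a $\mathbb{C}$-algebra with irreducible left module $W$. A Leonard system in $\mathfrak A$ of diameter $d$ is $\Phi=(\mathfrak a;\mathfrak a^*;\{\mathfrak e_i\}_{i=0}^d;\{\mathfrak e_i^*\}_{i=0}^d)$ where $\mathfrak a,\mathfrak a^*$ each have $d+1$ distinct eigenvalues, $\{\mathfrak e_i\}$ (resp. $\{\mathfrak e_i^*\}$) is an ordering of the primitive idempotents of $\mathfrak a$ (resp. $\mathfrak a^*$), and for $0\leqslant i,j\leqslant d$ both $\mathfrak e_i^*\mathfrak a\mathfrak e_j^*$ and $\mathfrak e_i\mathfrak a^*\mathfrak e_j$ are $0$ if $|i-j|>1$ and nonzero if $|i-j|=1$.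 For $\Gamma$ and $x\in X$ put $A^*=|X|\,\mathrm{diag}(E_1\hat x)$, $E_i^*=\mathrm{diag}(A_i\hat x)$, $W=\boldsymbol{A}\hat x$; then $\Phi(\Gamma;x)=(A|_W;A^*|_W;\{E_i|_W\};\{E_i^*|_W\})$ is a Leonard system. $\Phi(\Gamma_Y;x)$ is defined likewise from $\Gamma_Y$ with ordering $\{E_i'\}_{i=0}^w$, with underlying space $\boldsymbol{A}'\hat x$. Balanced forms. Let $\Phi$, $\Phi'$ be Leonard systems with diameters $d\geqslant d'$, underlying spaces $W,W'$ and idempotents $\mathfrak e_i,\mathfrak e_i^*,\mathfrak e_j',\mathfrak e_j^{*\prime}$. For $0\leqslant\rho\leqslant d-d'$, a nonzero bilinear form $(\cdot|\cdot):W\times W'\to\mathbb{C}$ is $\rho$-balanced with respect to $\Phi,\Phi'$ if $(\mathfrak e_i^*W|\mathfrak e_j^{*\prime}W')=0$ whenever $i-\rho\neq j$, and $(\mathfrak e_iW|\mathfrak e_j'W')=0$ whenever $i<j$ or $i>j+d-d'$ $(0\leqslant i\leqslant d,\ 0\leqslant j\leqslant d')$. Parameter arrays. For a Leonard system $\Phi$, let $\theta_i$ (resp. $\theta_i^*$) be the eigenvalue of $\mathfrak a$ (resp. $\mathfrak a^*$) associated with $\mathfrak e_i$ (resp. $\mathfrak e_i^*$). There are scalars $\varphi_1,\dots,\varphi_d$ and an algebra isomorphism $\mathfrak A\to\mathbb{C}^{(d+1)\times(d+1)}$ sending $\mathfrak a$ to the lower bidiagonal matrix with diagonal $\theta_0,\dots,\theta_d$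 and subdiagonal entries $1$, and $\mathfrak a^*$ to the upper bidiagonal matrix with diagonal $\theta_0^*,\dots,\theta_d^*$ and $(i-1,i)$-entry $\varphi_i$. Let $\phi_i=\varphi_i(\Phi^{\Downarrow})$ where $\Phi^{\Downarrow}=(\mathfrak a;\mathfrak a^*;\{\mathfrak e_{d-i}\};\{\mathfrak e_i^*\})$. The parameter array is $p(\Phi)=(\{\theta_i\}_{i=0}^d;\{\theta_i^*\}_{i=0}^d;\{\varphi_i\}_{i=1}^d;\{\phi_i\}_{i=1}^d)$. It is known that $p(\Phi)$ always has at least one of the following forms for suitable complex scalars $q,h,h^*,r,r_1,r_2,s,s^*$ ($0\leqslant i\leqslant d$ for $\theta_i,\theta_i^*$; $1\leqslant i\leqslant d$ for $\varphi_i,\phi_i$): (I) $r_1r_2=ss^*q^{d+1}$; $\theta_i=\theta_0+h(1-q^i)(1-sq^{i+1})q^{-i}$; $\theta_i^*=\theta_0^*+h^*(1-q^i)(1-s^*q^{i+1})q^{-i}$; $\varphi_i=hh^*q^{1-2i}(1-q^i)(1-q^{i-d-1})(1-r_1q^i)(1-r_2q^i)$; $\phi_i=hh^*q^{1-2i}(1-q^i)(1-q^{i-d-1})(r_1-s^*q^i)(r_2-s^*q^i)/s^*$ if $s^*\neq0$, and $\phi_i=hh^*q^{d+2-2i}(1-q^i)(1-q^{i-d-1})(s-r_1q^{i-d-1}-r_2q^{i-d-1})$ if $s^*=0$. (IA) $\theta_i=\theta_0-sq(1-q^i)$; $\theta_i^*=\theta_0^*+h^*(1-q^i)q^{-i}$;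 $\varphi_i=-rh^*q^{1-i}(1-q^i)(1-q^{i-d-1})$; $\phi_i=h^*q^{d+2-2i}(1-q^i)(1-q^{i-d-1})(s-rq^{i-d-1})$. (II) $r_1+r_2=s+s^*+d+1$; $\theta_i=\theta_0+hi(i+1+s)$; $\theta_i^*=\theta_0^*+h^*i(i+1+s^* )$; $\varphi_i=hh^*i(i-d-1)(i+r_1)(i+r_2)$; $\phi_i=hh^*i(i-d-1)(i+s^*-r_1)(i+s^*-r_2)$. (IIA) $\theta_i=\theta_0+hi(i+1+s)$; $\theta_i^*=\theta_0^*+s^*i$; $\varphi_i=hs^*i(i-d-1)(i+r)$; $\phi_i=hs^*i(i-d-1)(i+r-s-d-1)$. (IIB) $\theta_i=\theta_0+si$; $\theta_i^*=\theta_0^*+h^*i(i+1+s^* )$; $\varphi_i=h^*si(i-d-1)(i+r)$; $\phi_i=-h^*si(i-d-1)(i+s^*-r)$. (IIC) $\theta_i=\theta_0+si$; $\theta_i^*=\theta_0^*+s^*i$; $\varphi_i=ri(i-d-1)$; $\phi_i=(r-ss^* )i(i-d-1)$. (III) $r_1+r_2=-s-s^*+d+1$; $\theta_i=\theta_0+h(s-1+(1-s+2i)(-1)^i)$; $\theta_i^*=\theta_0^*+h^*(s^*-1+(1-s^*+2i)(-1)^i)$. If $d$ is even: $\varphi_i=-4hh^*i(i+r_1)$ and $\phi_i=4hh^*i(i-s^*-r_1)$ for $i$ even, $\varphi_i=-4hh^*(i-d-1)(i+r_2)$ and $\phi_i=4hh^*(i-d-1)(i-s^*-r_2)$ for $i$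 odd. If $d$ is odd: $\varphi_i=\phi_i=-4hh^*i(i-d-1)$ for $i$ even, $\varphi_i=-4hh^*(i+r_1)(i+r_2)$ and $\phi_i=-4hh^*(i-s^*-r_1)(i-s^*-r_2)$ for $i$ odd. *)

theory Defs
  imports
    "HOL-Analysis.Analysis"
    "Graph_Theory.Digraph_Component"
    "Jordan_Normal_Form.Matrix"
begin

no_notation Matrix.vec_index (infixl \<open>$\<close> 100)
no_notation Matrix.scalar_prod (infix \<open>\<bullet>\<close> 70)
hide_const (open) Matrix.mat Matrix.vec Matrix.row Matrix.transpose_mat Matrix.diag_mat
hide_type (open) Matrix.mat Matrix.vec

section \<open>Graphs\<close>

text \<open>Finite simple undirected graphs are the models of \<^locale>\<open>graph\<close> (symmetric loop-free
  digraphs without parallel arcs).\<close>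

definition gdist :: "('v, 'e) pre_digraph \<Rightarrow> 'v \<Rightarrow> 'v \<Rightarrow> nat" where
  "gdist G x y = (LEAST n. \<exists>p. pre_digraph.awalk G x p y \<and> length p = n)"

definition graph_diameter :: "('v, 'e) pre_digraph \<Rightarrow> nat" where
  "graph_diameter G = Max {gdist G x y | x y. x \<in> verts G \<and> y \<in> verts G}"

definition distance_regular :: "('v, 'e) pre_digraph \<Rightarrow> bool" where
  "distance_regular G \<longleftrightarrow> graph G \<and> Digraph_Component.connected G \<and>
    (\<exists>b c :: nat \<Rightarrow> nat. \<forall>x \<in> verts G. \<forall>y \<in> verts G.
       card {z \<in> verts G. y \<rightarrow>\<^bsub>G\<^esub> z \<and> gdist G x z = gdist G x y + 1} = b (gdist G x y) \<and>
       card {z \<in> verts G. y \<rightarrow>\<^bsub>G\<^esub> z \<and> gdist G x z + 1 = gdist G x y} = c (gdist G x y))"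

section \<open>Matrices indexed by vertices\<close>

text \<open>The vertex set of a graph is a subset of a finite type \<open>'v\<close>. Vectors and matrices indexed by
  vertices have type \<^typ>\<open>complex ^ 'v\<close> and \<^typ>\<open>complex ^ 'v ^ 'v\<close> and vanish outside the vertex
  set; for a set \<open>Y\<close> of vertices this is the extension by \<open>0\<close> of vectors and matrices indexed
  by \<open>Y\<close>. In particular the identity matrix of a graph \<open>G\<close> is \<open>dist_matrix G 0\<close>.\<close>

definition dist_matrix :: "('v::finite, 'e) pre_digraph \<Rightarrow> nat \<Rightarrow> complex ^ 'v ^ 'v" where
  "dist_matrix G i = (\<chi> x y. if x \<in> verts G \<and> y \<in> verts G \<and> gdist G x y = i then 1 else 0)"

definition all_ones :: "'v::finite set \<Rightarrow> complex ^ 'v ^ 'v" where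
  "all_ones V = (\<chi> x y. if x \<in> V \<and> y \<in> V then 1 else 0)"

definition cscale :: "complex \<Rightarrow> complex ^ 'v ^ 'v \<Rightarrow> complex ^ 'v ^ 'v" where
  "cscale c M = (\<chi> x y. c * M $ x $ y)"

definition hadamard :: "complex ^ 'v ^ 'v \<Rightarrow> complex ^ 'v ^ 'v \<Rightarrow> complex ^ 'v ^ 'v" (infixl \<open>\<circ>\<^sub>H\<close> 70)
  where "M \<circ>\<^sub>H N = (\<chi> x y. M $ x $ y * N $ x $ y)"

definition diag :: "complex ^ 'v \<Rightarrow> complex ^ 'v ^ 'v" where
  "diag u = (\<chi> x y. if x = y then u $ x else 0)"

definition submatrix_on :: "'v set \<Rightarrow> complex ^ 'v ^ 'v \<Rightarrow> complex ^ 'v ^ 'v" where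
  "submatrix_on Y M = (\<chi> x y. if x \<in> Y \<and> y \<in> Y then M $ x $ y else 0)"

definition char_vec :: "'v set \<Rightarrow> complex ^ 'v" where
  "char_vec Y = (\<chi> x. if x \<in> Y then 1 else 0)"

definition tprod :: "complex ^ 'v \<Rightarrow> complex ^ 'v \<Rightarrow> complex" where
  "tprod u v = (\<Sum>x\<in>UNIV. u $ x * v $ x)"

text \<open>The complex span of \<open>M 0, \<dots>, M n\<close> (the library's \<^const>\<open>span\<close> is the real one).\<close>

definition cspan_upto :: "nat \<Rightarrow> (nat \<Rightarrow> complex ^ 'v ^ 'v) \<Rightarrow> (complex ^ 'v ^ 'v) set" where
  "cspan_upto n M = {\<Sum>i\<le>n. cscale (c i) (M i) | c. True}"

section \<open>Bose--Mesner algebras and the Q-polynomial property\<close>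

text \<open>Primitive idempotents of a commutative algebra with carrier \<open>A\<close>, product \<open>mul\<close> and zero
  \<open>z\<close>: the minimal nonzero idempotents.\<close>

definition primitive_idempotents :: "('a \<Rightarrow> 'a \<Rightarrow> 'a) \<Rightarrow> 'a \<Rightarrow> 'a set \<Rightarrow> 'a set" where
  "primitive_idempotents mul z A = {e \<in> A. e \<noteq> z \<and> mul e e = e \<and>
     (\<forall>f \<in> A. mul f f = f \<and> mul e f = f \<longrightarrow> f = z \<or> f = e)}"

definition bose_mesner :: "('v::finite, 'e) pre_digraph \<Rightarrow> (complex ^ 'v ^ 'v) set" where
  "bose_mesner G = cspan_upto (graph_diameter G) (dist_matrix G)"

definition idempotent_ordering ::
    "nat \<Rightarrow> (complex ^ 'v ^ 'v) set \<Rightarrow> (nat \<Rightarrow> complex ^ 'v ^ 'v) \<Rightarrow> bool" where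
  "idempotent_ordering n A E \<longleftrightarrow> bij_betw E {..n} (primitive_idempotents (**) 0 A)"

definition Q_polynomial ::
    "('v::finite, 'e) pre_digraph \<Rightarrow> (nat \<Rightarrow> complex ^ 'v ^ 'v) \<Rightarrow> bool" where
  "Q_polynomial G E \<longleftrightarrow>
     (let d = graph_diameter G; X = verts G in
      idempotent_ordering d (bose_mesner G) E \<and>
      E 0 = cscale (1 / of_nat (card X)) (all_ones X) \<and>
      (\<exists>as bs cs :: nat \<Rightarrow> complex. bs d = 0 \<and> cs 0 = 0 \<and>
         (\<forall>i \<in> {1..d}. bs (i - 1) * cs i \<noteq> 0) \<and>
         (\<forall>i \<le> d. E 1 \<circ>\<^sub>H E i = cscale (1 / of_nat (card X))
            ((if i = 0 then 0 else cscale (bs (i - 1)) (E (i - 1))) +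
             cscale (as i) (E i) +
             (if i = d then 0 else cscale (cs (i + 1)) (E (i + 1)))))))"

definition Q_polynomial_drg :: "('v::finite, 'e) pre_digraph \<Rightarrow> bool" where
  "Q_polynomial_drg G \<longleftrightarrow> distance_regular G \<and> (\<exists>E. Q_polynomial G E)"

section \<open>Descendents\<close>

definition width :: "('v::finite, 'e) pre_digraph \<Rightarrow> 'v set \<Rightarrow> nat" where
  "width G Y = Max {i. i \<le> graph_diameter G \<and> tprod (char_vec Y) (dist_matrix G i *v char_vec Y) \<noteq> 0}"

definition dual_width ::
    "('v::finite, 'e) pre_digraph \<Rightarrow> (nat \<Rightarrow> complex ^ 'v ^ 'v) \<Rightarrow> 'v set \<Rightarrow> nat" where
  "dual_width G E Y = Max {i. i \<le> graph_diameter G \<and> tprod (char_vec Y) (E i *v char_vec Y) \<noteq> 0}"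

definition descendent ::
    "('v::finite, 'e) pre_digraph \<Rightarrow> (nat \<Rightarrow> complex ^ 'v ^ 'v) \<Rightarrow> 'v set \<Rightarrow> bool" where
  "descendent G E Y \<longleftrightarrow> Y \<noteq> {} \<and> Y \<subseteq> verts G \<and> width G Y + dual_width G E Y = graph_diameter G"

definition nontrivial_descendent ::
    "('v::finite, 'e) pre_digraph \<Rightarrow> (nat \<Rightarrow> complex ^ 'v ^ 'v) \<Rightarrow> 'v set \<Rightarrow> bool" where
  "nontrivial_descendent G E Y \<longleftrightarrow>
     descendent G E Y \<and> width G Y \<noteq> 0 \<and> width G Y \<noteq> graph_diameter G"

text \<open>The Bose--Mesner algebra of the scheme that the distance relations of \<open>G\<close> (not those of the
  induced subgraph) induce on \<open>Y\<close>.\<close>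

definition induced_bose_mesner ::
    "('v::finite, 'e) pre_digraph \<Rightarrow> 'v set \<Rightarrow> (complex ^ 'v ^ 'v) set" where
  "induced_bose_mesner G Y = cspan_upto (width G Y) (\<lambda>i. submatrix_on Y (dist_matrix G i))"

definition induced_ordering ::
    "('v::finite, 'e) pre_digraph \<Rightarrow> (nat \<Rightarrow> complex ^ 'v ^ 'v) \<Rightarrow> 'v set \<Rightarrow>
     (nat \<Rightarrow> complex ^ 'v ^ 'v) \<Rightarrow> bool" where
  "induced_ordering G E Y E' \<longleftrightarrow>
     idempotent_ordering (width G Y) (induced_bose_mesner G Y) E' \<and>
     (\<forall>i \<le> width G Y. cspan_upto i E' = cspan_upto i (\<lambda>j. submatrix_on Y (E j)))"

section \<open>Leonard systems\<close>

text \<open>The ambient algebra is taken to be the full endomorphism algebra of its irreducible module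
  \<open>W\<close>, a subspace of some \<^typ>\<open>complex ^ 'n\<close>. Endomorphisms of \<open>W\<close> are extensional functions, so
  that equality of functions is equality on \<open>W\<close>; the product is \<^term>\<open>compose W\<close>.\<close>

definition endo :: "(complex ^ 'n) set \<Rightarrow> (complex ^ 'n \<Rightarrow> complex ^ 'n) set" where
  "endo W = {f \<in> W \<rightarrow>\<^sub>E W. (\<forall>u \<in> W. \<forall>v \<in> W. f (u + v) = f u + f v) \<and>
                            (\<forall>c. \<forall>u \<in> W. f (c *s u) = c *s f u)}"

abbreviation endo_zero :: "(complex ^ 'n) set \<Rightarrow> complex ^ 'n \<Rightarrow> complex ^ 'n" where
  "endo_zero W \<equiv> (\<lambda>v \<in> W. 0)"

definition generated_algebra ::
    "(complex ^ 'n) set \<Rightarrow> (complex ^ 'n \<Rightarrow> complex ^ 'n) \<Rightarrow> (complex ^ 'n \<Rightarrow> complex ^ 'n) set" where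
  "generated_algebra W a = {\<lambda>v \<in> W. \<Sum>k\<le>n. c k *s (a ^^ k) v | n c. True}"

definition eigenvalues_on ::
    "(complex ^ 'n) set \<Rightarrow> (complex ^ 'n \<Rightarrow> complex ^ 'n) \<Rightarrow> complex set" where
  "eigenvalues_on W a = {t. \<exists>v \<in> W. v \<noteq> 0 \<and> a v = t *s v}"

record 'n leonard_data =
  lspace :: "(complex ^ 'n) set"
  ldiam :: nat
  lop :: "complex ^ 'n \<Rightarrow> complex ^ 'n"
  ldop :: "complex ^ 'n \<Rightarrow> complex ^ 'n"
  lidem :: "nat \<Rightarrow> complex ^ 'n \<Rightarrow> complex ^ 'n"
  ldidem :: "nat \<Rightarrow> complex ^ 'n \<Rightarrow> complex ^ 'n"

definition multiplicity_free_ordering ::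
    "(complex ^ 'n) set \<Rightarrow> nat \<Rightarrow> (complex ^ 'n \<Rightarrow> complex ^ 'n) \<Rightarrow>
     (nat \<Rightarrow> complex ^ 'n \<Rightarrow> complex ^ 'n) \<Rightarrow> bool" where
  "multiplicity_free_ordering W d a e \<longleftrightarrow> a \<in> endo W \<and> card (eigenvalues_on W a) = d + 1 \<and>
     bij_betw e {..d} (primitive_idempotents (compose W) (endo_zero W) (generated_algebra W a))"

definition tridiagonal_wrt ::
    "(complex ^ 'n) set \<Rightarrow> nat \<Rightarrow> (complex ^ 'n \<Rightarrow> complex ^ 'n) \<Rightarrow>
     (nat \<Rightarrow> complex ^ 'n \<Rightarrow> complex ^ 'n) \<Rightarrow> bool" where
  "tridiagonal_wrt W d a e \<longleftrightarrow> (\<forall>i \<le> d. \<forall>j \<le> d.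
     (\<bar>int i - int j\<bar> > 1 \<longrightarrow> compose W (e i) (compose W a (e j)) = endo_zero W) \<and>
     (\<bar>int i - int j\<bar> = 1 \<longrightarrow> compose W (e i) (compose W a (e j)) \<noteq> endo_zero W))"

definition leonard_system :: "'n::finite leonard_data \<Rightarrow> bool" where
  "leonard_system \<Phi> \<longleftrightarrow>
     vec.subspace (lspace \<Phi>) \<and> vec.dim (lspace \<Phi>) = ldiam \<Phi> + 1 \<and>
     multiplicity_free_ordering (lspace \<Phi>) (ldiam \<Phi>) (lop \<Phi>) (lidem \<Phi>) \<and>
     multiplicity_free_ordering (lspace \<Phi>) (ldiam \<Phi>) (ldop \<Phi>) (ldidem \<Phi>) \<and>
     tridiagonal_wrt (lspace \<Phi>) (ldiam \<Phi>) (lop \<Phi>) (ldidem \<Phi>) \<and>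
     tridiagonal_wrt (lspace \<Phi>) (ldiam \<Phi>) (ldop \<Phi>) (lidem \<Phi>)"

text \<open>The Leonard system of a graph \<open>G\<close> with ordering \<open>E\<close> and base vertex \<open>x\<close>; \<open>A\<close> is the
  Bose--Mesner algebra, so that the underlying space is \<open>A\<close> applied to the unit vector at \<open>x\<close>.\<close>

definition graph_leonard ::
    "('v::finite, 'e) pre_digraph \<Rightarrow> (complex ^ 'v ^ 'v) set \<Rightarrow> (nat \<Rightarrow> complex ^ 'v ^ 'v) \<Rightarrow> 'v \<Rightarrow>
     'v leonard_data" where
  "graph_leonard G A E x =
     (let W = (\<lambda>M. M *v axis x 1) ` A in
      \<lparr> lspace = W,
        ldiam = graph_diameter G,
        lop = (\<lambda>v \<in> W. dist_matrix G 1 *v v),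
        ldop = (\<lambda>v \<in> W. cscale (of_nat (card (verts G))) (diag (E 1 *v axis x 1)) *v v),
        lidem = (\<lambda>i. \<lambda>v \<in> W. E i *v v),
        ldidem = (\<lambda>i. \<lambda>v \<in> W. diag (dist_matrix G i *v axis x 1) *v v) \<rparr>)"

section \<open>Balanced bilinear forms\<close>

definition bilinear_form_on ::
    "(complex ^ 'n) set \<Rightarrow> (complex ^ 'm) set \<Rightarrow> (complex ^ 'n \<Rightarrow> complex ^ 'm \<Rightarrow> complex) \<Rightarrow> bool" where
  "bilinear_form_on W W' B \<longleftrightarrow>
     (\<forall>u \<in> W. \<forall>v \<in> W. \<forall>u' \<in> W'. B (u + v) u' = B u u' + B v u') \<and>
     (\<forall>c. \<forall>u \<in> W. \<forall>u' \<in> W'. B (c *s u) u' = c * B u u') \<and>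
     (\<forall>u \<in> W. \<forall>u' \<in> W'. \<forall>v' \<in> W'. B u (u' + v') = B u u' + B u v') \<and>
     (\<forall>c. \<forall>u \<in> W. \<forall>u' \<in> W'. B u (c *s u') = c * B u u')"

definition balanced ::
    "nat \<Rightarrow> 'n::finite leonard_data \<Rightarrow> 'm::finite leonard_data \<Rightarrow>
     (complex ^ 'n \<Rightarrow> complex ^ 'm \<Rightarrow> complex) \<Rightarrow> bool" where
  "balanced \<rho> \<Phi> \<Phi>' B \<longleftrightarrow>
     (let W = lspace \<Phi>; W' = lspace \<Phi>'; d = ldiam \<Phi>; d' = ldiam \<Phi>' in
      leonard_system \<Phi> \<and> leonard_system \<Phi>' \<and> d' \<le> d \<and> \<rho> \<le> d - d' \<and>
      bilinear_form_on W W' B \<and> (\<exists>u \<in> W. \<exists>u' \<in> W'. B u u' \<noteq> 0) \<and>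
      (\<forall>i \<le> d. \<forall>j \<le> d'. int i - int \<rho> \<noteq> int j \<longrightarrow>
         (\<forall>u \<in> W. \<forall>u' \<in> W'. B (ldidem \<Phi> i u) (ldidem \<Phi>' j u') = 0)) \<and>
      (\<forall>i \<le> d. \<forall>j \<le> d'. i < j \<or> i > j + d - d' \<longrightarrow>
         (\<forall>u \<in> W. \<forall>u' \<in> W'. B (lidem \<Phi> i u) (lidem \<Phi>' j u') = 0)))"

section \<open>Parameter arrays\<close>

definition matrix_algebra_iso ::
    "(complex ^ 'n) set \<Rightarrow> nat \<Rightarrow> ((complex ^ 'n \<Rightarrow> complex ^ 'n) \<Rightarrow> complex Matrix.mat) \<Rightarrow> bool" where
  "matrix_algebra_iso W n F \<longleftrightarrow> bij_betw F (endo W) (carrier_mat n n) \<and>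
     F (\<lambda>v \<in> W. v) = 1\<^sub>m n \<and>
     (\<forall>f \<in> endo W. \<forall>g \<in> endo W. F (\<lambda>v \<in> W. f v + g v) = F f + F g) \<and>
     (\<forall>c. \<forall>f \<in> endo W. F (\<lambda>v \<in> W. c *s f v) = c \<cdot>\<^sub>m F f) \<and>
     (\<forall>f \<in> endo W. \<forall>g \<in> endo W. F (compose W f g) = F f * F g)"

definition eigenvalue_sequence ::
    "(complex ^ 'n) set \<Rightarrow> nat \<Rightarrow> (complex ^ 'n \<Rightarrow> complex ^ 'n) \<Rightarrow>
     (nat \<Rightarrow> complex ^ 'n \<Rightarrow> complex ^ 'n) \<Rightarrow> (nat \<Rightarrow> complex) \<Rightarrow> bool" where
  "eigenvalue_sequence W d a e \<theta> \<longleftrightarrow> (\<forall>i \<le> d. \<forall>v \<in> W. a (e i v) = \<theta> i *s e i v)"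

text \<open>In a parameter array only the values of \<open>\<theta>\<close>, \<open>\<theta>s\<close> at \<open>0, \<dots>, d\<close> and of \<open>vphi\<close> (first split
  sequence), \<open>phi\<close> (second split sequence) at \<open>1, \<dots>, d\<close> matter.\<close>

definition split_sequence ::
    "'n::finite leonard_data \<Rightarrow> (nat \<Rightarrow> complex) \<Rightarrow> (nat \<Rightarrow> complex) \<Rightarrow> (nat \<Rightarrow> complex) \<Rightarrow> bool" where
  "split_sequence \<Phi> \<theta> \<theta>s vphi \<longleftrightarrow>
     (let n = ldiam \<Phi> + 1 in
      eigenvalue_sequence (lspace \<Phi>) (ldiam \<Phi>) (lop \<Phi>) (lidem \<Phi>) \<theta> \<and>
      eigenvalue_sequence (lspace \<Phi>) (ldiam \<Phi>) (ldop \<Phi>) (ldidem \<Phi>) \<theta>s \<and>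
      (\<exists>F. matrix_algebra_iso (lspace \<Phi>) n F \<and>
         F (lop \<Phi>) = Matrix.mat n n (\<lambda>(i, j). if i = j then \<theta> i else if i = j + 1 then 1 else 0) \<and>
         F (ldop \<Phi>) = Matrix.mat n n (\<lambda>(i, j). if i = j then \<theta>s i else if j = i + 1 then vphi j else 0)))"

definition reverse_idempotents :: "'n::finite leonard_data \<Rightarrow> 'n leonard_data" where
  "reverse_idempotents \<Phi> = \<Phi>\<lparr>lidem := (\<lambda>i. lidem \<Phi> (ldiam \<Phi> - i))\<rparr>"

definition parameter_array ::
    "'n::finite leonard_data \<Rightarrow> (nat \<Rightarrow> complex) \<Rightarrow> (nat \<Rightarrow> complex) \<Rightarrow> (nat \<Rightarrow> complex) \<Rightarrow> (nat \<Rightarrow> complex) \<Rightarrow> bool"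
    where
  "parameter_array \<Phi> \<theta> \<theta>s vphi phi \<longleftrightarrow> split_sequence \<Phi> \<theta> \<theta>s vphi \<and>
     split_sequence (reverse_idempotents \<Phi>) (\<lambda>i. \<theta> (ldiam \<Phi> - i)) \<theta>s phi"

text \<open>A suffix \<open>s\<close> stands for a star: \<open>\<theta>s\<close>, \<open>hs\<close>, \<open>ss\<close> are the scalars dual to \<open>\<theta>\<close>, \<open>h\<close>, \<open>s\<close>. Negative
  powers of \<open>q\<close> presuppose \<open>q \<noteq> 0\<close>, which is stated since \<^const>\<open>power_int\<close> is total.\<close>

definition case_I where
  "case_I d (\<theta> :: nat \<Rightarrow> complex) (\<theta>s :: nat \<Rightarrow> complex) (vphi :: nat \<Rightarrow> complex) (phi :: nat \<Rightarrow> complex) \<longleftrightarrow>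
     (\<exists>q h hs r1 r2 s ss :: complex. q \<noteq> 0 \<and> r1 * r2 = s * ss * q ^ (d + 1) \<and>
       (\<forall>i \<le> d. \<theta> i = \<theta> 0 + h * (1 - q ^ i) * (1 - s * q ^ (i + 1)) * q powi (- int i) \<and>
                \<theta>s i = \<theta>s 0 + hs * (1 - q ^ i) * (1 - ss * q ^ (i + 1)) * q powi (- int i)) \<and>
       (\<forall>i \<in> {1..d}.
          vphi i = h * hs * q powi (1 - 2 * int i) * (1 - q ^ i) * (1 - q powi (int i - int d - 1)) *
                (1 - r1 * q ^ i) * (1 - r2 * q ^ i) \<and>
          phi i = (if ss \<noteq> 0
             then h * hs * q powi (1 - 2 * int i) * (1 - q ^ i) * (1 - q powi (int i - int d - 1)) *
                  (r1 - ss * q ^ i) * (r2 - ss * q ^ i) / ss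
             else h * hs * q powi (int d + 2 - 2 * int i) * (1 - q ^ i) *
                  (1 - q powi (int i - int d - 1)) *
                  (s - r1 * q powi (int i - int d - 1) - r2 * q powi (int i - int d - 1)))))"

definition case_IA where
  "case_IA d (\<theta> :: nat \<Rightarrow> complex) (\<theta>s :: nat \<Rightarrow> complex) (vphi :: nat \<Rightarrow> complex) (phi :: nat \<Rightarrow> complex) \<longleftrightarrow>
     (\<exists>q hs r s :: complex. q \<noteq> 0 \<and>
       (\<forall>i \<le> d. \<theta> i = \<theta> 0 - s * q * (1 - q ^ i) \<and>
                \<theta>s i = \<theta>s 0 + hs * (1 - q ^ i) * q powi (- int i)) \<and>
       (\<forall>i \<in> {1..d}.
          vphi i = - r * hs * q powi (1 - int i) * (1 - q ^ i) * (1 - q powi (int i - int d - 1)) \<and>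
          phi i = hs * q powi (int d + 2 - 2 * int i) * (1 - q ^ i) * (1 - q powi (int i - int d - 1)) *
                (s - r * q powi (int i - int d - 1))))"

definition case_II where
  "case_II d (\<theta> :: nat \<Rightarrow> complex) (\<theta>s :: nat \<Rightarrow> complex) (vphi :: nat \<Rightarrow> complex) (phi :: nat \<Rightarrow> complex) \<longleftrightarrow>
     (\<exists>h hs r1 r2 s ss :: complex. r1 + r2 = s + ss + of_nat d + 1 \<and>
       (\<forall>i \<le> d. \<theta> i = \<theta> 0 + h * of_nat i * (of_nat i + 1 + s) \<and>
                \<theta>s i = \<theta>s 0 + hs * of_nat i * (of_nat i + 1 + ss)) \<and>
       (\<forall>i \<in> {1..d}.
          vphi i = h * hs * of_nat i * (of_nat i - of_nat d - 1) * (of_nat i + r1) * (of_nat i + r2) \<and>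
          phi i = h * hs * of_nat i * (of_nat i - of_nat d - 1) *
                (of_nat i + ss - r1) * (of_nat i + ss - r2)))"

definition case_IIA where
  "case_IIA d (\<theta> :: nat \<Rightarrow> complex) (\<theta>s :: nat \<Rightarrow> complex) (vphi :: nat \<Rightarrow> complex) (phi :: nat \<Rightarrow> complex) \<longleftrightarrow>
     (\<exists>h r s ss :: complex.
       (\<forall>i \<le> d. \<theta> i = \<theta> 0 + h * of_nat i * (of_nat i + 1 + s) \<and>
                \<theta>s i = \<theta>s 0 + ss * of_nat i) \<and>
       (\<forall>i \<in> {1..d}.
          vphi i = h * ss * of_nat i * (of_nat i - of_nat d - 1) * (of_nat i + r) \<and>
          phi i = h * ss * of_nat i * (of_nat i - of_nat d - 1) * (of_nat i + r - s - of_nat d - 1)))"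

definition case_IIB where
  "case_IIB d (\<theta> :: nat \<Rightarrow> complex) (\<theta>s :: nat \<Rightarrow> complex) (vphi :: nat \<Rightarrow> complex) (phi :: nat \<Rightarrow> complex) \<longleftrightarrow>
     (\<exists>hs r s ss :: complex.
       (\<forall>i \<le> d. \<theta> i = \<theta> 0 + s * of_nat i \<and>
                \<theta>s i = \<theta>s 0 + hs * of_nat i * (of_nat i + 1 + ss)) \<and>
       (\<forall>i \<in> {1..d}.
          vphi i = hs * s * of_nat i * (of_nat i - of_nat d - 1) * (of_nat i + r) \<and>
          phi i = - hs * s * of_nat i * (of_nat i - of_nat d - 1) * (of_nat i + ss - r)))"

definition case_IIC where
  "case_IIC d (\<theta> :: nat \<Rightarrow> complex) (\<theta>s :: nat \<Rightarrow> complex) (vphi :: nat \<Rightarrow> complex) (phi :: nat \<Rightarrow> complex) \<longleftrightarrow>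
     (\<exists>r s ss :: complex.
       (\<forall>i \<le> d. \<theta> i = \<theta> 0 + s * of_nat i \<and> \<theta>s i = \<theta>s 0 + ss * of_nat i) \<and>
       (\<forall>i \<in> {1..d}.
          vphi i = r * of_nat i * (of_nat i - of_nat d - 1) \<and>
          phi i = (r - s * ss) * of_nat i * (of_nat i - of_nat d - 1)))"

definition case_III where
  "case_III d (\<theta> :: nat \<Rightarrow> complex) (\<theta>s :: nat \<Rightarrow> complex) (vphi :: nat \<Rightarrow> complex) (phi :: nat \<Rightarrow> complex) \<longleftrightarrow>
     (\<exists>h hs r1 r2 s ss :: complex. r1 + r2 = - s - ss + of_nat d + 1 \<and>
       (\<forall>i \<le> d. \<theta> i = \<theta> 0 + h * (s - 1 + (1 - s + 2 * of_nat i) * (-1) ^ i) \<and>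
                \<theta>s i = \<theta>s 0 + hs * (ss - 1 + (1 - ss + 2 * of_nat i) * (-1) ^ i)) \<and>
       (\<forall>i \<in> {1..d}.
          vphi i = (if even d
             then (if even i then - 4 * h * hs * of_nat i * (of_nat i + r1)
                   else - 4 * h * hs * (of_nat i - of_nat d - 1) * (of_nat i + r2))
             else (if even i then - 4 * h * hs * of_nat i * (of_nat i - of_nat d - 1)
                   else - 4 * h * hs * (of_nat i + r1) * (of_nat i + r2))) \<and>
          phi i = (if even d
             then (if even i then 4 * h * hs * of_nat i * (of_nat i - ss - r1)
                   else 4 * h * hs * (of_nat i - of_nat d - 1) * (of_nat i - ss - r2))
             else (if even i then - 4 * h * hs * of_nat i * (of_nat i - of_nat d - 1)
                   else - 4 * h * hs * (of_nat i - ss - r1) * (of_nat i - ss - r2)))))"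

definition case_I_or_II where
  "case_I_or_II d \<theta> \<theta>s vphi phi \<longleftrightarrow>
     case_I d \<theta> \<theta>s vphi phi \<or> case_IA d \<theta> \<theta>s vphi phi \<or> case_II d \<theta> \<theta>s vphi phi \<or>
     case_IIA d \<theta> \<theta>s vphi phi \<or> case_IIB d \<theta> \<theta>s vphi phi \<or> case_IIC d \<theta> \<theta>s vphi phi"

end

(* The idempotents E_0, ..., E_d restricted to Y are almost orthogonal: E_i E'_j = 0 unless
   j <= i <= j + w*. Hence E'_w is proportional to E_d restricted to Y, while E'_1 lies in the span
   of E_0 and E_1 restricted to Y. Each of these gives a linear equation between the numbers of
   neighbours in Y of a vertex y of Y that are farther from, respectively closer to, a vertex x of Y.
   The two equations determine these numbers as functions of the distance of x and y.

   If the induced subgraph is disconnected, then for some 1 <= j < w no vertex of Y at distance j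
   from x has a neighbour in Y at distance j + 1, and so j satisfies the same equation as j = w
   does. Expressed through the split sequences phi and varphi, which are determined by the dual
   eigenvalues and by the cosines of E_d, this equation becomes
   t_j / (theta_{d+1-j} - theta_0) = const, where t_j = sum_{l<j} (theta_l - theta_{d-l}). In
   cases I to IIC the left-hand side is injective in j. In case III (where d is even) it takes the
   value -1 at every odd j and another value at each even j, so that it separates j from w when
   w* = d - w is even, whereas for w odd the equation for j = w makes two eigenvalues of the induced
   subgraph coincide. *)

theory Submission
  imports Defs
begin

text \<open>The band relation rests on the dual Bose-Mesner algebra: for a vertex y the diagonal
  matrix of the column of E_k at y is a polynomial of degree k in the dual adjacency matrix, which
  is tridiagonal with respect to the E_i. Summed over y in Y, these diagonals form E_k applied to
  the characteristic vector, which vanishes for k > w*; so the projection onto Y is a sum of terms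
  with k <= w*.

  The obstacle is that the scheme on Y uses the distances of the big graph, whose shortest paths may
  leave Y. The condition \<open>geodetic\<close>, that inside Y one can always step closer, is
  equivalent to connectedness of the induced subgraph and makes both distances agree. When it fails,
  regularity of the scheme turns one bad pair into a cut between consecutive distances, which is
  where j comes from.

  Evenness of d in case III is a consequence: for odd d the split sequences agree at index 2, hence
  E_d has equal cosines at distances 1 and 2, and then no edge would leave Y. Split sequences and
  cosines are linked because the two split bases end in vectors of the eigenspaces of E_d and
  E_0.\<close>

declare One_nat_def [simp del] Suc_eq_plus1 [symmetric, simp]

section \<open>Families of vectors\<close>

text \<open>A locale of its own, because \<^locale>\<open>vector_space\<close> is globally interpreted for real vector
  spaces without a mandatory prefix.\<close>

locale vector_space_families = vector_space
begin

lemma in_span_image_iff: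
  assumes "finite I"
  shows "u \<in> span (v ` I) \<longleftrightarrow> (\<exists>a. u = (\<Sum>i\<in>I. scale (a i) (v i)))"
proof
  show "\<exists>a. u = (\<Sum>i\<in>I. scale (a i) (v i)) \<Longrightarrow> u \<in> span (v ` I)"
    by (auto intro!: span_sum span_scale intro: span_base)
  assume "u \<in> span (v ` I)"
  then show "\<exists>a. u = (\<Sum>i\<in>I. scale (a i) (v i))"
  proof (induction rule: span_induct_alt)
    case base
    show ?case by (rule exI[of _ "\<lambda>_. 0"]) simp
  next
    case (step r x y)
    from step obtain j a where j: "j \<in> I" "x = v j" and a: "y = (\<Sum>i\<in>I. scale (a i) (v i))" by blast
    have "scale r x + y = (\<Sum>i\<in>I. scale (a i + (if i = j then r else 0)) (v i))"
      using assms j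
      by (simp add: a scale_left_distrib sum.distrib if_distrib[of "\<lambda>r. scale r _"] sum.delta add.commute
          cong: if_cong)
    then show ?case by (rule exI[where x="\<lambda>i. a i + (if i = j then r else 0)"])
  qed
qed

text \<open>Indexed rather than set-based, so that a repetition inside the family already counts as
  a dependence and dimension counts can be made over index sets.\<close>

definition independent_family :: "('i \<Rightarrow> 'b) \<Rightarrow> 'i set \<Rightarrow> bool" where
  "independent_family v I \<longleftrightarrow> (\<forall>c. (\<Sum>i\<in>I. scale (c i) (v i)) = 0 \<longrightarrow> (\<forall>i\<in>I. c i = 0))"

lemma independent_familyD:
  "independent_family v I \<Longrightarrow> (\<Sum>i\<in>I. scale (c i) (v i)) = 0 \<Longrightarrow> i \<in> I \<Longrightarrow> c i = 0"
  unfolding independent_family_def by blast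

lemma family_member_in_span_of_others:
  assumes "finite I" "(\<Sum>i\<in>I. scale (c i) (v i)) = 0" "j \<in> I" "c j \<noteq> 0"
  shows "v j \<in> span (v ` (I - {j}))"
proof -
  have "scale (c j) (v j) = - (\<Sum>i\<in>I - {j}. scale (c i) (v i))"
    using assms by (simp add: sum.remove[of I j] eq_neg_iff_add_eq_0)
  then have "scale (c j) (v j) \<in> span (v ` (I - {j}))"
    by (auto intro!: span_neg span_sum span_scale intro: span_base)
  then have "scale (1 / c j) (scale (c j) (v j)) \<in> span (v ` (I - {j}))" by (rule span_scale)
  then show ?thesis using assms by simp
qed

lemma independent_family_card_le:
  assumes "independent_family v I" "finite I" "finite T" "\<And>i. i \<in> I \<Longrightarrow> v i \<in> span T"
  shows "card I \<le> card T"
proof -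
  have inj: "inj_on v I"
  proof (rule inj_onI, rule ccontr)
    fix i j assume ij: "i \<in> I" "j \<in> I" "v i = v j" "i \<noteq> j"
    let ?c = "\<lambda>k. if k = i then 1 else if k = j then - 1 else 0"
    have "(\<Sum>k\<in>I. scale (?c k) (v k)) = (\<Sum>k\<in>{i, j}. scale (?c k) (v k))"
      using ij assms by (intro sum.mono_neutral_right) auto
    also have "\<dots> = 0" using ij by simp
    finally have "(\<Sum>k\<in>I. scale (?c k) (v k)) = 0" .
    from independent_familyD[OF assms(1) this ij(1)] show False by simp
  qed
  have "independent (v ` I)"
  proof
    assume "dependent (v ` I)"
    then obtain u y where u: "(\<Sum>x\<in>v ` I. scale (u x) x) = 0" and y: "y \<in> v ` I" "u y \<noteq> 0"
      using dependent_finite[of "v ` I"] assms(2) by auto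
    from u have "(\<Sum>i\<in>I. scale (u (v i)) (v i)) = 0" by (simp add: sum.reindex[OF inj])
    then show False using independent_familyD[OF assms(1), of "\<lambda>i. u (v i)"] y by auto
  qed
  then have "card (v ` I) \<le> card T"
    using independent_span_bound[OF assms(3), of "v ` I"] assms(4) by auto
  then show ?thesis using card_image[OF inj] by simp
qed

lemma family_dependent:
  assumes "finite I" "finite T" "card T < card I" "\<And>i. i \<in> I \<Longrightarrow> v i \<in> span T"
  obtains c j where "(\<Sum>i\<in>I. scale (c i) (v i)) = 0" "j \<in> I" "c j \<noteq> 0"
  using independent_family_card_le[of v I T] assms unfolding independent_family_def by fastforce

lemma independent_family_spans:
  assumes "independent_family v I" "finite I" "finite T" "card T \<le> card I"
    "\<And>i. i \<in> I \<Longrightarrow> v i \<in> span T" "u \<in> span T"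
  shows "u \<in> span (v ` I)"
proof -
  \<comment> \<open>The index \<open>None\<close> adjoins \<open>u\<close> to the family, which then
    has more members than \<open>T\<close>; independence of \<open>v\<close> forces the coefficient
    at \<open>None\<close> in a relation to be nonzero.\<close>
  let ?v = "\<lambda>k. case k of None \<Rightarrow> u | Some i \<Rightarrow> v i"
  let ?I = "insert None (Some ` I)"
  have card: "card ?I = Suc (card I)" using assms(2) by (simp add: card_image)
  obtain c j where c: "(\<Sum>k\<in>?I. scale (c k) (?v k)) = 0" "j \<in> ?I" "c j \<noteq> 0"
    by (rule family_dependent[of ?I T ?v]) (use assms card in auto)
  have c': "scale (c None) u + (\<Sum>i\<in>I. scale (c (Some i)) (v i)) = 0"
    using c(1) assms(2) by (simp add: sum.reindex)
  have "c None \<noteq> 0"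
  proof
    assume "c None = 0"
    then show False using c c' independent_familyD[OF assms(1), of "\<lambda>i. c (Some i)"] by auto
  qed
  have "?v None \<in> span (?v ` (?I - {None}))"
    using c(1) assms(2) \<open>c None \<noteq> 0\<close> by (intro family_member_in_span_of_others) auto
  also have "?v ` (?I - {None}) = v ` I" by force
  finally show ?thesis by simp
qed

lemma spanning_family_independent:
  assumes "finite I" "independent_family u J" "finite J" "card I \<le> card J"
    "\<And>j. j \<in> J \<Longrightarrow> u j \<in> span (v ` I)"
  shows "independent_family v I"
  unfolding independent_family_def
proof (intro allI impI ballI, rule ccontr)
  fix c i assume c: "(\<Sum>i\<in>I. scale (c i) (v i)) = 0" "i \<in> I" "c i \<noteq> 0"
  have vi: "v i \<in> span (v ` (I - {i}))"
    by (rule family_member_in_span_of_others[OF assms(1) c])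
  have "v ` I \<subseteq> span (v ` (I - {i}))"
    using vi by (auto intro: span_base)
  then have "span (v ` I) \<subseteq> span (v ` (I - {i}))" by (simp add: span_minimal)
  then have "card J \<le> card (v ` (I - {i}))"
    using independent_family_card_le[OF assms(2,3), of "v ` (I - {i})"] assms by blast
  also have "\<dots> \<le> card (I - {i})" using assms(1) by (simp add: card_image_le)
  also have "\<dots> < card I" using assms(1) c(2) by (rule card_Diff1_less)
  finally show False using assms(4) by simp
qed

lemma independent_family_subset:
  assumes "independent_family v I" "J \<subseteq> I" "finite I"
  shows "independent_family v J"
  unfolding independent_family_def
proof (intro allI impI)
  fix c assume "(\<Sum>i\<in>J. scale (c i) (v i)) = 0"
  then have "(\<Sum>i\<in>I. scale (if i \<in> J then c i else 0) (v i)) = 0"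
    using assms by (simp add: if_distrib[of "\<lambda>r. scale r _"] sum.If_cases Int_absorb1 Int_absorb2 cong: if_cong)
  from independent_familyD[OF assms(1) this] show "\<forall>i\<in>J. c i = 0" using assms(2) by force
qed

end

section \<open>Complex matrices\<close>

lemmas cvec_eq_iff = Finite_Cartesian_Product.vec_eq_iff

lemma cscale_nth [simp]: "cscale c M $ x $ y = c * M $ x $ y"
  by (simp add: cscale_def)

lemma hadamard_nth [simp]: "(M \<circ>\<^sub>H N) $ x $ y = M $ x $ y * N $ x $ y"
  by (simp add: hadamard_def)

global_interpretation cm: vector_space_families "cscale :: complex \<Rightarrow> complex ^ 'v ^ 'v \<Rightarrow> complex ^ 'v ^ 'v"
  by unfold_locales (auto simp: cvec_eq_iff algebra_simps)

lemma cspan_upto_eq_span: "cspan_upto n M = cm.span (M ` {..n})"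
  unfolding cspan_upto_def by (auto simp: cm.in_span_image_iff)

lemma cscale_mult_left: "cscale c M ** N = cscale c (M ** N)"
  by (simp add: cvec_eq_iff matrix_matrix_mult_def sum_distrib_left mult.assoc)

lemma cscale_mult_right: "M ** cscale c N = cscale c (M ** N)"
  by (simp add: cvec_eq_iff matrix_matrix_mult_def sum_distrib_left mult.left_commute)

lemma matrix_add_rdistrib: "(M + N) ** K = M ** K + N ** (K :: complex ^ 'v ^ 'v)"
  by (simp add: cvec_eq_iff matrix_matrix_mult_def sum.distrib algebra_simps)

lemma matrix_mult_zero_left [simp]: "(0 :: complex ^ 'v ^ 'v) ** M = 0"
  by (simp add: cvec_eq_iff matrix_matrix_mult_def)

lemma matrix_mult_zero_right [simp]: "M ** (0 :: complex ^ 'v ^ 'v) = 0"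
  by (simp add: cvec_eq_iff matrix_matrix_mult_def)

lemma sum_matrix_mult: "(\<Sum>i\<in>I. f i) ** (N :: complex ^ 'v ^ 'v) = (\<Sum>i\<in>I. f i ** N)"
  by (induction I rule: infinite_finite_induct) (simp_all add: matrix_add_rdistrib)

lemma matrix_mult_sum: "(N :: complex ^ 'v ^ 'v) ** (\<Sum>i\<in>I. f i) = (\<Sum>i\<in>I. N ** f i)"
  by (induction I rule: infinite_finite_induct) (simp_all add: matrix_add_ldistrib)

lemma cscale_mult_vec: "cscale c M *v v = c *s (M *v v)"
  by (simp add: cvec_eq_iff matrix_vector_mult_def sum_distrib_left mult.assoc)

lemma mult_span_zero:
  fixes M N :: "complex ^ 'v ^ 'v"
  assumes "\<And>M N. M \<in> S \<Longrightarrow> N \<in> T \<Longrightarrow> M ** N = 0" "M \<in> cm.span S" "N \<in> cm.span T"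
  shows "M ** N = 0"
proof -
  have "cm.subspace {N :: complex ^ 'v ^ 'v. \<forall>M\<in>S. M ** N = 0}" for S :: "(complex ^ 'v ^ 'v) set"
    by (auto simp: cm.subspace_def matrix_add_ldistrib cscale_mult_right)
  then have 1: "\<forall>M\<in>S. M ** N = 0"
    using cm.span_minimal[of T "{N. \<forall>M\<in>S. M ** N = 0}"] assms by auto
  have "cm.subspace {M. M ** N = 0}"
    by (auto simp: cm.subspace_def matrix_add_rdistrib cscale_mult_left)
  then show ?thesis
    using cm.span_minimal[of S "{M. M ** N = 0}"] assms 1 by auto
qed

text \<open>By symmetry the diagonal entry of either product at \<open>x\<close> is the sum of
  squared moduli of row \<open>x\<close>. This is the nondegeneracy available for complex symmetric
  matrices, whose own square may be 0.\<close>

lemma trace_mult_cnj: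
  fixes M :: "complex ^ 'v ^ 'v"
  assumes "\<And>x y. M $ x $ y = M $ y $ x" "M \<noteq> 0"
  shows "M ** (\<chi> x y. cnj (M $ x $ y)) \<noteq> 0" "(\<chi> x y. cnj (M $ x $ y)) ** M \<noteq> 0"
proof -
  obtain x y where xy: "M $ x $ y \<noteq> 0" using assms(2) by (auto simp: cvec_eq_iff)
  have *: "(\<Sum>z\<in>UNIV. M $ x $ z * cnj (M $ x $ z)) = of_real (\<Sum>z\<in>UNIV. (cmod (M $ x $ z))\<^sup>2)"
    by (simp add: complex_norm_square del: of_real_power)
  have "(\<Sum>z\<in>UNIV. (cmod (M $ x $ z))\<^sup>2) > 0"
    using xy by (intro sum_pos2[of _ y]) auto
  then have **: "(\<Sum>z\<in>UNIV. M $ x $ z * cnj (M $ x $ z)) \<noteq> 0"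
    unfolding * of_real_eq_0_iff by simp
  have "(M ** (\<chi> x y. cnj (M $ x $ y))) $ x $ x = (\<Sum>z\<in>UNIV. M $ x $ z * cnj (M $ x $ z))"
    by (simp add: matrix_matrix_mult_def assms(1)[of _ x])
  then show "M ** (\<chi> x y. cnj (M $ x $ y)) \<noteq> 0" using ** by (metis zero_index)
  have "((\<chi> x y. cnj (M $ x $ y)) ** M) $ x $ x = (\<Sum>z\<in>UNIV. M $ x $ z * cnj (M $ x $ z))"
    by (simp add: matrix_matrix_mult_def assms(1)[of _ x] mult.commute)
  then show "(\<chi> x y. cnj (M $ x $ y)) ** M \<noteq> 0" using ** by (metis zero_index)
qed

section \<open>Bose--Mesner algebras of distance-regular graphs\<close>

text \<open>Formulated for a set with a distance function instead of a graph, so that it applies to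
  the vertex set and also to \<open>Y\<close> with the distance inherited from the big graph.
  Adjacency is distance 1.\<close>

locale drg =
  fixes X :: "'v::finite set" and dl :: "'v \<Rightarrow> 'v \<Rightarrow> nat" and d :: nat and b c :: "nat \<Rightarrow> nat"
  assumes X_ne: "X \<noteq> {}"
    and dl_0: "x \<in> X \<Longrightarrow> y \<in> X \<Longrightarrow> dl x y = 0 \<longleftrightarrow> x = y"
    and dl_sym: "x \<in> X \<Longrightarrow> y \<in> X \<Longrightarrow> dl x y = dl y x"
    and dl_le: "x \<in> X \<Longrightarrow> y \<in> X \<Longrightarrow> dl x y \<le> d"
    and dl_step: "x \<in> X \<Longrightarrow> y \<in> X \<Longrightarrow> z \<in> X \<Longrightarrow> dl y z = 1 \<Longrightarrow> dl x z \<le> dl x y + 1"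
    and card_b: "x \<in> X \<Longrightarrow> y \<in> X \<Longrightarrow> card {z \<in> X. dl y z = 1 \<and> dl x z = dl x y + 1} = b (dl x y)"
    and card_c: "x \<in> X \<Longrightarrow> y \<in> X \<Longrightarrow> card {z \<in> X. dl y z = 1 \<and> dl x z + 1 = dl x y} = c (dl x y)"
    and c_pos: "1 \<le> i \<Longrightarrow> i \<le> d \<Longrightarrow> c i > 0"
    and b_pos: "i < d \<Longrightarrow> b i > 0"
begin

definition dmat :: "(nat \<Rightarrow> complex) \<Rightarrow> complex ^ 'v ^ 'v" where
  "dmat f = (\<chi> x y. if x \<in> X \<and> y \<in> X then f (dl x y) else 0)"

definition Am :: "nat \<Rightarrow> complex ^ 'v ^ 'v" where
  "Am i = dmat (\<lambda>t. of_bool (t = i))"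

definition BM :: "(complex ^ 'v ^ 'v) set" where
  "BM = range dmat"

text \<open>The intersection matrix acting on functions of the distance, with a_i = b_0 - b_i - c_i.
  The values of \<open>f\<close> at the fictitious distances 0 - 1 and d + 1 carry the coefficients
  \<open>c 0\<close> and \<open>b d\<close>, which count no vertices.\<close>

definition shift :: "(nat \<Rightarrow> complex) \<Rightarrow> nat \<Rightarrow> complex" where
  "shift f i = of_nat (c i) * f (i - 1) + (of_nat (b 0) - of_nat (b i) - of_nat (c i)) * f i
     + of_nat (b i) * f (i + 1)"

lemma dmat_nth: "dmat f $ x $ y = (if x \<in> X \<and> y \<in> X then f (dl x y) else 0)"
  by (simp add: dmat_def)

lemma dmat_symmetric: "dmat f $ x $ y = dmat f $ y $ x"
  by (auto simp: dmat_nth dl_sym)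

lemma exists_at_dist:
  assumes "x \<in> X" "i \<le> d"
  obtains y where "y \<in> X" "dl x y = i"
proof -
  have "\<exists>y\<in>X. dl x y = i" using assms(2)
  proof (induction i)
    case 0
    then show ?case using assms(1) dl_0 by blast
  next
    case (Suc i)
    then obtain y where y: "y \<in> X" "dl x y = i" by auto
    have "b i > 0" using b_pos Suc by simp
    then have "card {z \<in> X. dl y z = 1 \<and> dl x z = dl x y + 1} > 0"
      using card_b[OF assms(1) y(1)] y(2) by metis
    then obtain z where "z \<in> X" "dl x z = i + 1" using y(2) by (auto simp: card_gt_0_iff)
    then show ?case by auto
  qed
  then show ?thesis using that by blast
qed

lemma dmat_eq_iff: "dmat f = dmat g \<longleftrightarrow> (\<forall>t\<le>d. f t = g t)"
proof
  assume eq: "dmat f = dmat g"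
  show "\<forall>t\<le>d. f t = g t"
  proof (intro allI impI)
    fix t assume "t \<le> d"
    obtain x where x: "x \<in> X" using X_ne by blast
    obtain y where y: "y \<in> X" "dl x y = t" using exists_at_dist[OF x \<open>t \<le> d\<close>] by blast
    have "dmat f $ x $ y = dmat g $ x $ y" using eq by simp
    then show "f t = g t" using x y by (simp add: dmat_nth)
  qed
next
  assume "\<forall>t\<le>d. f t = g t"
  then show "dmat f = dmat g" using dl_le by (auto simp: cvec_eq_iff dmat_nth)
qed

lemma dmat_zero: "dmat (\<lambda>_. 0) = 0"
  by (simp add: cvec_eq_iff dmat_nth)

lemma dmat_add: "dmat f + dmat g = dmat (\<lambda>t. f t + g t)"
  by (simp add: cvec_eq_iff dmat_nth)

lemma dmat_scale: "cscale a (dmat f) = dmat (\<lambda>t. a * f t)"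
  by (simp add: cvec_eq_iff dmat_nth)

lemma dmat_hadamard: "dmat f \<circ>\<^sub>H dmat g = dmat (\<lambda>t. f t * g t)"
  by (simp add: cvec_eq_iff dmat_nth)

lemma dmat_sum: "(\<Sum>i\<in>I. dmat (f i)) = dmat (\<lambda>t. \<Sum>i\<in>I. f i t)"
  by (induction I rule: infinite_finite_induct) (simp_all add: dmat_zero dmat_add)

lemma dmat_conv_sum: "dmat f = (\<Sum>i\<le>d. cscale (f i) (Am i))"
  by (simp add: Am_def dmat_scale dmat_sum dmat_eq_iff of_bool_def if_distrib cong: if_cong)

lemma BM_eq_span: "BM = cm.span (Am ` {..d})"
proof (intro equalityI subsetI)
  fix M assume "M \<in> BM"
  then show "M \<in> cm.span (Am ` {..d})" unfolding BM_def
    by (auto simp: dmat_conv_sum[of _ ] intro!: cm.span_sum cm.span_scale intro: cm.span_base)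
next
  fix M assume "M \<in> cm.span (Am ` {..d})"
  then obtain f where "M = (\<Sum>i\<le>d. cscale (f i) (Am i))" by (auto simp: cm.in_span_image_iff)
  then show "M \<in> BM" unfolding BM_def by (simp flip: dmat_conv_sum)
qed

lemma BM_subspace: "cm.subspace BM"
  unfolding BM_eq_span by (rule cm.subspace_span)

lemma dmat_in_BM [simp]: "dmat f \<in> BM"
  by (simp add: BM_def)

lemma Am_in_BM [simp]: "Am i \<in> BM"
  by (simp add: Am_def)

lemma valency: "x \<in> X \<Longrightarrow> card {z \<in> X. dl x z = 1} = b 0"
  using card_b[of x x] dl_0[of x x] by (simp flip: One_nat_def)

text \<open>The neighbours of x are split by their distance to y, which differs from that of x by at
  most 1; the three parts have b, c and, by the constant valency, b_0 - b - c members.\<close>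

lemma Am_1_mult_dmat: "Am 1 ** dmat f = dmat (shift f)"
proof -
  have "(\<Sum>z\<in>UNIV. Am 1 $ x $ z * dmat f $ z $ y) = shift f (dl x y)" if xy: "x \<in> X" "y \<in> X" for x y
  proof -
    let ?N = "{z \<in> X. dl x z = 1}"
    let ?U = "{z \<in> X. dl x z = 1 \<and> dl y z = dl y x + 1}"
    let ?D = "{z \<in> X. dl x z = 1 \<and> dl y z + 1 = dl y x}"
    let ?S = "?N - ?U - ?D"
    let ?i = "dl y x"
    have "(\<Sum>z\<in>UNIV. Am 1 $ x $ z * dmat f $ z $ y) = (\<Sum>z\<in>?N. f (dl y z))"
      using xy dl_sym by (intro sum.mono_neutral_cong_right) (auto simp: Am_def dmat_nth)
    also have "\<dots> = (\<Sum>z\<in>?U. f (dl y z)) + ((\<Sum>z\<in>?D. f (dl y z)) + (\<Sum>z\<in>?S. f (dl y z)))"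
    proof -
      have "(\<Sum>z\<in>?N. f (dl y z)) = (\<Sum>z\<in>?U. f (dl y z)) + (\<Sum>z\<in>?N - ?U. f (dl y z))"
        by (subst add.commute, intro sum.subset_diff) auto
      moreover have "(\<Sum>z\<in>?N - ?U. f (dl y z)) = (\<Sum>z\<in>?D. f (dl y z)) + (\<Sum>z\<in>?S. f (dl y z))"
        by (subst add.commute, intro sum.subset_diff) auto
      ultimately show ?thesis by simp
    qed
    also have "(\<Sum>z\<in>?U. f (dl y z)) = of_nat (b ?i) * f (?i + 1)"
      using card_b[OF xy(2,1)] by simp
    also have "(\<Sum>z\<in>?D. f (dl y z)) = (\<Sum>z\<in>?D. f (?i - 1))"
      by (intro sum.cong refl arg_cong[of _ _ f]) auto
    also have "\<dots> = of_nat (c ?i) * f (?i - 1)"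
      using card_c[OF xy(2,1)] by simp
    also have "(\<Sum>z\<in>?S. f (dl y z)) = (\<Sum>z\<in>?S. f ?i)"
    proof (intro sum.cong refl arg_cong[of _ _ f])
      fix z assume z: "z \<in> ?S"
      have "dl y z \<le> ?i + 1" using dl_step[of y x z] xy z by auto
      moreover have "?i \<le> dl y z + 1" using dl_step[of y z x] xy z dl_sym[of x z] by auto
      ultimately show "dl y z = ?i" using z by auto
    qed
    also have "\<dots> = of_nat (card ?S) * f ?i" by simp
    also have "of_nat (card ?S) = (of_nat (b 0) - of_nat (b ?i) - of_nat (c ?i) :: complex)"
    proof -
      have "card ?N = card ?U + card (?N - ?U)"
        by (subst card_Un_disjoint[symmetric]) (auto intro!: arg_cong[of _ _ card])
      moreover have "card (?N - ?U) = card ?D + card ?S"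
        by (subst card_Un_disjoint[symmetric]) (auto intro!: arg_cong[of _ _ card])
      ultimately have "b 0 = b ?i + (c ?i + card ?S)"
        using valency[OF xy(1)] card_b[OF xy(2,1)] card_c[OF xy(2,1)] by simp
      then show ?thesis by simp
    qed
    finally show ?thesis using xy dl_sym by (simp add: shift_def algebra_simps)
  qed
  then have "(\<Sum>z\<in>UNIV. Am 1 $ x $ z * dmat f $ z $ y) = dmat (shift f) $ x $ y" for x y
    by (cases "x \<in> X \<and> y \<in> X") (auto simp: Am_def dmat_nth)
  then show ?thesis by (simp add: cvec_eq_iff matrix_matrix_mult_def)
qed

lemma dmat_transpose_mult: "(dmat f ** dmat g) $ x $ y = (dmat g ** dmat f) $ y $ x"
  by (simp add: matrix_matrix_mult_def dmat_symmetric[of f x] dmat_symmetric[of g _ y] mult.commute)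

lemma dmat_mult_Am_1: "dmat f ** Am 1 = dmat (shift f)"
  unfolding cvec_eq_iff
proof (intro allI)
  fix x y
  have "(dmat f ** Am 1) $ x $ y = (Am 1 ** dmat f) $ y $ x"
    unfolding Am_def by (rule dmat_transpose_mult)
  then show "(dmat f ** Am 1) $ x $ y = dmat (shift f) $ x $ y"
    unfolding Am_1_mult_dmat dmat_symmetric[of _ y x] .
qed

lemma Am_0_nth: "Am 0 $ x $ y = (if x = y \<and> x \<in> X then 1 else 0)"
  by (auto simp: Am_def dmat_nth dl_0)

lemma Am_0_mult:
  assumes "\<And>x y. x \<notin> X \<Longrightarrow> M $ x $ y = 0"
  shows "Am 0 ** M = M"
proof -
  have "(\<Sum>z\<in>UNIV. Am 0 $ x $ z * M $ z $ y) = (\<Sum>z\<in>{x}. Am 0 $ x $ z * M $ z $ y)" for x y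
    by (intro sum.mono_neutral_right) (auto simp: Am_0_nth)
  then show ?thesis using assms by (auto simp: cvec_eq_iff matrix_matrix_mult_def Am_0_nth)
qed

lemma mult_Am_0:
  assumes "\<And>x y. y \<notin> X \<Longrightarrow> M $ x $ y = 0"
  shows "M ** Am 0 = M"
proof -
  have "(\<Sum>z\<in>UNIV. M $ x $ z * Am 0 $ z $ y) = (\<Sum>z\<in>{y}. M $ x $ z * Am 0 $ z $ y)" for x y
    by (intro sum.mono_neutral_right) (auto simp: Am_0_nth)
  then show ?thesis using assms by (auto simp: cvec_eq_iff matrix_matrix_mult_def Am_0_nth)
qed

lemma Am_0_mult_BM: "M \<in> BM \<Longrightarrow> Am 0 ** M = M" and BM_mult_Am_0: "M \<in> BM \<Longrightarrow> M ** Am 0 = M"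
  by (auto simp: BM_def dmat_nth intro!: Am_0_mult mult_Am_0)

lemma c_0: "c 0 = 0"
proof -
  obtain x where "x \<in> X" using X_ne by blast
  then show ?thesis using card_c[of x x] dl_0[of x x] by simp
qed

lemma shift_indicator:
  assumes "i < d" "t \<le> d"
  shows "shift (\<lambda>t. of_bool (t = i)) t =
    (if i = 0 then 0 else of_nat (b (i - 1)) * of_bool (t = i - 1)) +
    (of_nat (b 0) - of_nat (b i) - of_nat (c i)) * of_bool (t = i) + of_nat (c (i + 1)) * of_bool (t = i + 1)"
  using assms by (auto simp: shift_def of_bool_def c_0)

text \<open>The algebra is generated by \<open>Am 1\<close>: since \<open>c (j + 1)\<close> is
  nonzero, the recurrence expresses \<open>Am (j + 1)\<close> through \<open>Am 1 ** Am j\<close>,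
  \<open>Am j\<close> and \<open>Am (j - 1)\<close>.\<close>

lemma BM_induct [consumes 1, case_names unit mult add scale]:
  assumes "M \<in> BM" "P (Am 0)" "\<And>M. M \<in> BM \<Longrightarrow> P M \<Longrightarrow> P (Am 1 ** M)"
    "\<And>M N. P M \<Longrightarrow> P N \<Longrightarrow> P (M + N)" "\<And>a M. P M \<Longrightarrow> P (cscale a M)"
  shows "P M"
proof -
  have P0: "P 0" using assms(5)[OF assms(2), of 0] by (simp add: cm.scale_zero_left)
  have A: "P (Am i)" if "i \<le> d" for i
    using that
  proof (induction i rule: less_induct)
    case (less i)
    show ?case
    proof (cases i)
      case 0
      then show ?thesis using assms(2) by simp
    next
      case (Suc j)
      have c: "of_nat (c (Suc j)) \<noteq> (0 :: complex)" using c_pos[of "Suc j"] less.prems Suc by simp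
      let ?B = "if j = 0 then 0 else cscale (of_nat (b (j - 1))) (Am (j - 1))"
      let ?C = "cscale (of_nat (b 0) - of_nat (b j) - of_nat (c j)) (Am j)"
      have eq: "Am 1 ** Am j = ?B + ?C + cscale (of_nat (c (Suc j))) (Am (Suc j))"
        unfolding Am_def[of j] Am_1_mult_dmat
        using shift_indicator[of j] less.prems Suc
        by (auto simp: Am_def dmat_scale dmat_add dmat_eq_iff)
      have eq': "Am i = cscale (1 / of_nat (c (Suc j))) (Am 1 ** Am j + (cscale (-1) ?B + cscale (-1) ?C))"
        unfolding eq using c Suc by (auto simp: cvec_eq_iff field_simps)
      have "P (cscale (-1) ?B)"
        using less Suc P0
        by (cases "j = 0") (auto simp del: cm.scale_minus_left simp: cm.scale_zero_right intro!: assms(5))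
      moreover have "P (cscale (-1) ?C)" using less Suc by (intro assms(5)) simp
      moreover have "P (Am 1 ** Am j)" using less Suc by (intro assms(3)) auto
      ultimately show ?thesis unfolding eq' by (intro assms(5)[of _ "1 / of_nat (c (Suc j))"] assms(4))
    qed
  qed
  obtain f where M: "M = dmat f" using assms(1) by (auto simp: BM_def)
  have "P (\<Sum>i\<in>I. cscale (f i) (Am i))" if "I \<subseteq> {..d}" for I
    using finite_subset[OF that finite_atMost] that
    by (induction I rule: finite_induct) (auto simp: P0 intro!: assms(4,5) A)
  then show ?thesis unfolding M dmat_conv_sum by simp
qed

text \<open>Induction on the first factor along the generator \<open>Am 1\<close>, which commutes
  with every \<open>dmat f\<close> because left and right multiplication by it are both given by
  \<open>shift\<close>.\<close>

lemma BM_mult_closed: "M \<in> BM \<Longrightarrow> N \<in> BM \<Longrightarrow> M ** N \<in> BM"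
  and BM_commute: "M \<in> BM \<Longrightarrow> N \<in> BM \<Longrightarrow> M ** N = N ** M"
proof -
  have comm1: "Am 1 ** N = N ** Am 1" if "N \<in> BM" for N
    using that by (auto simp: BM_def Am_1_mult_dmat dmat_mult_Am_1 simp del: One_nat_def)
  have A1: "Am 1 ** N \<in> BM" if "N \<in> BM" for N
    using that by (auto simp: BM_def Am_1_mult_dmat simp del: One_nat_def)
  have "\<forall>N\<in>BM. M ** N \<in> BM \<and> M ** N = N ** M" if "M \<in> BM" for M
    using that
  proof (induction M rule: BM_induct)
    case unit
    then show ?case by (simp add: Am_0_mult_BM BM_mult_Am_0)
  next
    case (mult M)
    show ?case
    proof
      fix N assume N: "N \<in> BM"
      have "Am 1 ** M ** N = Am 1 ** N ** M" using mult N by (metis matrix_mul_assoc)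
      then show "Am 1 ** M ** N \<in> BM \<and> Am 1 ** M ** N = N ** (Am 1 ** M)"
        using mult N by (metis matrix_mul_assoc comm1 A1)
    qed
  next
    case (add M N)
    then show ?case using cm.subspace_add[OF BM_subspace]
      unfolding matrix_add_rdistrib matrix_add_ldistrib by metis
  next
    case (scale a M)
    then show ?case using cm.subspace_scale[OF BM_subspace]
      unfolding cscale_mult_left cscale_mult_right by metis
  qed
  then show "M \<in> BM \<Longrightarrow> N \<in> BM \<Longrightarrow> M ** N \<in> BM" "M \<in> BM \<Longrightarrow> N \<in> BM \<Longrightarrow> M ** N = N ** M" by blast+
qed

end

section \<open>Primitive idempotents\<close>

definition cnj_matrix :: "complex ^ 'v ^ 'v \<Rightarrow> complex ^ 'v ^ 'v" where
  "cnj_matrix M = (\<chi> x y. cnj (M $ x $ y))"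

lemma cnj_matrix_nth [simp]: "cnj_matrix M $ x $ y = cnj (M $ x $ y)"
  by (simp add: cnj_matrix_def)

lemma cnj_matrix_mult: "cnj_matrix (M ** N) = cnj_matrix M ** cnj_matrix N"
  by (simp add: cvec_eq_iff matrix_matrix_mult_def)

lemma cnj_matrix_cnj_matrix [simp]: "cnj_matrix (cnj_matrix M) = M"
  by (simp add: cvec_eq_iff)

lemma cnj_matrix_0 [simp]: "cnj_matrix 0 = 0"
  by (simp add: cvec_eq_iff)

text \<open>The product of two primitive idempotents is an idempotent below both factors; minimality
  makes it 0 or equal to both.\<close>

lemma primitive_idempotents_orthogonal:
  fixes e f :: "complex ^ 'v ^ 'v"
  assumes closed: "\<And>M N. M \<in> S \<Longrightarrow> N \<in> S \<Longrightarrow> M ** N \<in> S"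
    and commute: "\<And>M N. M \<in> S \<Longrightarrow> N \<in> S \<Longrightarrow> M ** N = N ** M"
    and "e \<in> primitive_idempotents (**) 0 S" "f \<in> primitive_idempotents (**) 0 S" "e \<noteq> f"
  shows "e ** f = 0"
proof -
  have e: "e \<in> S" "e ** e = e" "\<And>g. g \<in> S \<Longrightarrow> g ** g = g \<Longrightarrow> e ** g = g \<Longrightarrow> g = 0 \<or> g = e"
    using assms(3) unfolding primitive_idempotents_def by auto
  have f: "f \<in> S" "f ** f = f" "\<And>g. g \<in> S \<Longrightarrow> g ** g = g \<Longrightarrow> f ** g = g \<Longrightarrow> g = 0 \<or> g = f"
    using assms(4) unfolding primitive_idempotents_def by auto
  let ?g = "e ** f"
  have g: "?g \<in> S" using closed e f by blast
  have eg: "e ** ?g = ?g" using e by (simp add: matrix_mul_assoc)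
  have fg: "f ** ?g = ?g" using e f commute by (metis matrix_mul_assoc)
  have gg: "?g ** ?g = ?g" using eg fg by (metis matrix_mul_assoc)
  show ?thesis using e(3)[OF g gg eg] f(3)[OF g gg fg] assms(5) by metis
qed

text \<open>Conjugation permutes the primitive idempotents. If it moved \<open>e\<close>, the
  product of \<open>e\<close> with its conjugate would be 0 by orthogonality, against
  \<open>trace_mult_cnj\<close>. Reality is what later turns sums of squares into norms.\<close>

lemma primitive_idempotent_real:
  fixes e :: "complex ^ 'v ^ 'v"
  assumes closed: "\<And>M N. M \<in> S \<Longrightarrow> N \<in> S \<Longrightarrow> M ** N \<in> S"
    and commute: "\<And>M N. M \<in> S \<Longrightarrow> N \<in> S \<Longrightarrow> M ** N = N ** M"
    and cnj: "\<And>M. M \<in> S \<Longrightarrow> cnj_matrix M \<in> S"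
    and sym: "\<And>M x y. M \<in> S \<Longrightarrow> M $ x $ y = M $ y $ x"
    and e: "e \<in> primitive_idempotents (**) 0 S"
  shows "cnj_matrix e = e"
proof (rule ccontr)
  assume ne: "cnj_matrix e \<noteq> e"
  have e': "e \<in> S" "e \<noteq> 0" "e ** e = e" using e by (auto simp: primitive_idempotents_def)
  have min: "f = 0 \<or> f = cnj_matrix e" if f: "f \<in> S" "f ** f = f" "cnj_matrix e ** f = f" for f
  proof -
    have "cnj_matrix f \<in> S" using f by (simp add: cnj)
    moreover have "cnj_matrix f ** cnj_matrix f = cnj_matrix f"
      using f by (simp flip: cnj_matrix_mult)
    moreover have "e ** cnj_matrix f = cnj_matrix f"
      using arg_cong[OF f(3), of cnj_matrix] by (simp add: cnj_matrix_mult)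
    ultimately have "cnj_matrix f = 0 \<or> cnj_matrix f = e"
      using e unfolding primitive_idempotents_def by blast
    then show ?thesis by (metis cnj_matrix_cnj_matrix cnj_matrix_0)
  qed
  have "cnj_matrix e \<noteq> 0" using e'(2) by (metis cnj_matrix_cnj_matrix cnj_matrix_0)
  moreover have "cnj_matrix e ** cnj_matrix e = cnj_matrix e"
    using e'(3) by (simp flip: cnj_matrix_mult)
  ultimately have "cnj_matrix e \<in> primitive_idempotents (**) 0 S"
    using min cnj[OF e'(1)] unfolding primitive_idempotents_def by auto
  then have "e ** cnj_matrix e = 0"
    using primitive_idempotents_orthogonal[OF closed commute e] ne by (metis (no_types))
  moreover have "e ** cnj_matrix e \<noteq> 0"
    unfolding cnj_matrix_def using e' sym by (intro trace_mult_cnj(1)) auto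
  ultimately show False by simp
qed

lemma orthogonal_idempotents_independent:
  fixes E :: "'i \<Rightarrow> complex ^ 'v ^ 'v"
  assumes "finite I" "\<And>i. i \<in> I \<Longrightarrow> E i \<noteq> 0" "\<And>i. i \<in> I \<Longrightarrow> E i ** E i = E i"
    "\<And>i j. i \<in> I \<Longrightarrow> j \<in> I \<Longrightarrow> i \<noteq> j \<Longrightarrow> E i ** E j = 0"
  shows "cm.independent_family E I"
  unfolding cm.independent_family_def
proof (intro allI impI ballI)
  fix c i assume c: "(\<Sum>j\<in>I. cscale (c j) (E j)) = 0" and i: "i \<in> I"
  have "E i ** (\<Sum>j\<in>I. cscale (c j) (E j)) = (\<Sum>j\<in>I. if j = i then cscale (c i) (E i) else 0)"
    unfolding matrix_mult_sum cscale_mult_right using assms i by (intro sum.cong) auto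
  also have "\<dots> = cscale (c i) (E i)" using assms i by simp
  finally have "cscale (c i) (E i) = 0" using c by simp
  then show "c i = 0" using assms(2)[OF i] by simp
qed

lemma trace_sum: "trace (\<Sum>i\<in>I. f i :: complex ^ 'v ^ 'v) = (\<Sum>i\<in>I. trace (f i))"
  unfolding trace_def sum_component by (rule sum.swap)

lemma all_ones_nth: "all_ones V $ x $ y = (if x \<in> V \<and> y \<in> V then 1 else 0)"
  by (simp add: all_ones_def)

locale qdrg = drg +
  fixes E :: "nat \<Rightarrow> complex ^ 'a ^ 'a"
  assumes d_pos: "1 \<le> d"
    and E_bij: "bij_betw E {..d} (primitive_idempotents (**) 0 BM)"
    and E_0: "E 0 = cscale (1 / of_nat (card X)) (all_ones X)"
    and E_three_term: "\<exists>as bs cs :: nat \<Rightarrow> complex. bs d = 0 \<and> cs 0 = 0 \<and>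
         (\<forall>i \<in> {1..d}. bs (i - 1) * cs i \<noteq> 0) \<and>
         (\<forall>i \<le> d. E 1 \<circ>\<^sub>H E i = cscale (1 / of_nat (card X))
            ((if i = 0 then 0 else cscale (bs (i - 1)) (E (i - 1))) +
             cscale (as i) (E i) +
             (if i = d then 0 else cscale (cs (i + 1)) (E (i + 1)))))"
begin

section \<open>The primitive idempotents as a basis\<close>

lemma E_prim: "i \<le> d \<Longrightarrow> E i \<in> primitive_idempotents (**) 0 BM"
  using bij_betwE[OF E_bij] by blast

lemma E_BM: "i \<le> d \<Longrightarrow> E i \<in> BM" and E_nz: "i \<le> d \<Longrightarrow> E i \<noteq> 0"
  and E_idem: "i \<le> d \<Longrightarrow> E i ** E i = E i"
  using E_prim[of i] by (auto simp: primitive_idempotents_def)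

lemma E_orth:
  assumes "i \<le> d" "j \<le> d" "i \<noteq> j"
  shows "E i ** E j = 0"
proof -
  have "E i \<noteq> E j" using E_bij assms unfolding bij_betw_def inj_on_def by auto
  then show ?thesis
    using primitive_idempotents_orthogonal[of BM "E i" "E j"] BM_mult_closed BM_commute E_prim assms
    by blast
qed

lemma E_independent: "cm.independent_family E {..d}"
  by (rule orthogonal_idempotents_independent) (auto simp: E_nz E_idem E_orth)

lemma BM_eq_span_E: "BM = cm.span (E ` {..d})"
proof
  have "card (Am ` {..d}) \<le> card {..d}" by (rule card_image_le) simp
  then show "BM \<subseteq> cm.span (E ` {..d})"
    using cm.independent_family_spans[OF E_independent, of "Am ` {..d}"] E_BM
    unfolding BM_eq_span by auto
  show "cm.span (E ` {..d}) \<subseteq> BM"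
    using E_BM by (intro cm.span_minimal BM_subspace) auto
qed

lemma mult_E_sum:
  assumes "i \<le> d"
  shows "(\<Sum>j\<le>d. cscale (f j) (E j)) ** E i = cscale (f i) (E i)"
proof -
  have "(\<Sum>j\<le>d. cscale (f j) (E j)) ** E i = (\<Sum>j\<le>d. if j = i then cscale (f i) (E i) else 0)"
    unfolding sum_matrix_mult cscale_mult_left using assms by (intro sum.cong) (auto simp: E_idem E_orth)
  then show ?thesis using assms by simp
qed

lemma BM_mult_E:
  assumes "M \<in> BM" "i \<le> d"
  obtains a where "M ** E i = cscale a (E i)"
proof -
  obtain f where "M = (\<Sum>j\<le>d. cscale (f j) (E j))"
    using assms(1) unfolding BM_eq_span_E by (auto simp: cm.in_span_image_iff)
  then show ?thesis using mult_E_sum[OF assms(2)] that by blast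
qed

lemma sum_E: "Am 0 = (\<Sum>i\<le>d. E i)"
proof -
  obtain f where f: "Am 0 = (\<Sum>j\<le>d. cscale (f j) (E j))"
    using Am_in_BM[of 0] unfolding BM_eq_span_E by (auto simp: cm.in_span_image_iff)
  have "f i = 1" if "i \<le> d" for i
  proof -
    have "cscale (f i) (E i) = cscale 1 (E i)"
      using mult_E_sum[OF that, of f] Am_0_mult_BM[OF E_BM[OF that]] unfolding f[symmetric] by simp
    then show ?thesis using E_nz[OF that] cm.scale_right_imp_eq by blast
  qed
  then show ?thesis unfolding f by (intro sum.cong) auto
qed

text \<open>The value of \<open>E i\<close> as a function of the distance: m_i / |X| times the i-th
  cosine sequence, m_i being the rank. For i = 1 it is the dual eigenvalue sequence divided by
  |X|.\<close>

definition eps :: "nat \<Rightarrow> nat \<Rightarrow> complex" where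
  "eps i = (SOME f. E i = dmat f)"

lemma E_eq: "i \<le> d \<Longrightarrow> E i = dmat (eps i)"
  using someI_ex[of "\<lambda>f. E i = dmat f"] E_BM[of i] unfolding eps_def BM_def by blast

lemma E_nth: "i \<le> d \<Longrightarrow> x \<in> X \<Longrightarrow> y \<in> X \<Longrightarrow> E i $ x $ y = eps i (dl x y)"
  by (simp add: E_eq dmat_nth)

lemma E_symmetric: "i \<le> d \<Longrightarrow> E i $ x $ y = E i $ y $ x"
  by (simp add: E_eq dmat_symmetric[of _ x])

lemma E_outside: "i \<le> d \<Longrightarrow> x \<notin> X \<or> y \<notin> X \<Longrightarrow> E i $ x $ y = 0"
  by (auto simp: E_eq dmat_nth)

lemma BM_symmetric: "M \<in> BM \<Longrightarrow> M $ x $ y = M $ y $ x"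
  by (auto simp: BM_def dmat_symmetric[of _ x])

lemma cnj_matrix_BM: "M \<in> BM \<Longrightarrow> cnj_matrix M \<in> BM"
proof -
  have "cnj_matrix (dmat f) = dmat (\<lambda>t. cnj (f t))" for f by (simp add: cvec_eq_iff dmat_nth)
  then show "M \<in> BM \<Longrightarrow> cnj_matrix M \<in> BM" by (auto simp: BM_def)
qed

lemma E_real: "i \<le> d \<Longrightarrow> cnj_matrix (E i) = E i"
  using primitive_idempotent_real[OF BM_mult_closed BM_commute cnj_matrix_BM BM_symmetric E_prim]
  by blast

lemma E_nth_real: "i \<le> d \<Longrightarrow> E i $ x $ y \<in> \<real>"
  using E_real[of i] by (metis Reals_cnj_iff cnj_matrix_nth)

text \<open>A row of \<open>E i\<close> is real and, by idempotence and symmetry, its sum of squares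
  is the diagonal entry; if that were 0 the whole matrix would vanish.\<close>

lemma eps_0_ne_0:
  assumes "i \<le> d"
  shows "eps i 0 \<noteq> 0"
proof
  assume z: "eps i 0 = 0"
  have "E i $ x $ y = 0" for x y
  proof (cases "x \<in> X")
    case True
    have "0 = (E i ** E i) $ x $ x"
      using True assms z dl_0[of x x] by (simp add: E_idem E_nth)
    also have "\<dots> = (\<Sum>y\<in>UNIV. E i $ x $ y * E i $ x $ y)"
      unfolding matrix_matrix_mult_def using E_symmetric[OF assms] by simp
    also have "\<dots> = (\<Sum>y\<in>UNIV. of_real ((Re (E i $ x $ y))\<^sup>2))"
      by (intro sum.cong refl) (metis E_nth_real[OF assms] of_real_Re of_real_mult power2_eq_square)
    finally have "complex_of_real (\<Sum>y\<in>UNIV. (Re (E i $ x $ y))\<^sup>2) = 0"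
      unfolding of_real_sum by (rule sym)
    then have "(\<Sum>y\<in>UNIV. (Re (E i $ x $ y))\<^sup>2) = 0" unfolding of_real_eq_0_iff .
    then have "\<forall>y\<in>UNIV. (Re (E i $ x $ y))\<^sup>2 = 0" by (subst (asm) sum_nonneg_eq_0_iff) auto
    then show ?thesis using E_nth_real[OF assms, of x y] by (simp add: complex_is_Real_iff complex_eq_iff)
  qed (simp add: E_outside assms)
  then show False using E_nz[OF assms] by (simp add: cvec_eq_iff)
qed

section \<open>The three-term relation and the separation of eigenvalues\<close>

lemma card_X_ne_0: "of_nat (card X) \<noteq> (0 :: complex)"
  using X_ne by simp

lemma eps_0: "t \<le> d \<Longrightarrow> eps 0 t = 1 / of_nat (card X)"
proof -
  have "dmat (eps 0) = dmat (\<lambda>_. 1 / of_nat (card X))"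
    using E_0 E_eq[of 0] by (simp add: cvec_eq_iff dmat_nth all_ones_nth)
  then show "t \<le> d \<Longrightarrow> ?thesis" by (simp add: dmat_eq_iff)
qed

text \<open>The relation for E_1 o E_i solved for its top term, possible because c*_{i+1} is
  nonzero. Iterated, it makes \<open>eps i\<close> a polynomial of degree i in
  \<open>eps 1\<close>.\<close>

lemma eps_Suc:
  assumes "i < d"
  obtains u v r where "u \<noteq> 0" "\<And>t. t \<le> d \<Longrightarrow> eps (Suc i) t = u * (eps 1 t * eps i t) + v * eps i t + r * eps (i - 1) t"
proof -
  obtain as bs cs where nz: "\<forall>i \<in> {1..d}. bs (i - 1) * cs i \<noteq> 0"
    and tt: "\<forall>i \<le> d. E 1 \<circ>\<^sub>H E i = cscale (1 / of_nat (card X))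
            ((if i = 0 then 0 else cscale (bs (i - 1)) (E (i - 1))) +
             cscale (as i) (E i) +
             (if i = d then 0 else cscale (cs (i + 1)) (E (i + 1))))" using E_three_term by blast
  \<comment> \<open>At i = 0 the truncated \<open>i - 1\<close> denotes 0, so the coefficient of
    that term must be 0 there.\<close>
  define bb where "bb = (if i = 0 then 0 else bs (i - 1))"
  let ?n = "of_nat (card X) :: complex"
  have cs: "cs (Suc i) \<noteq> 0" using nz[rule_format, of "Suc i"] assms by simp
  have "dmat (\<lambda>t. eps 1 t * eps i t) =
     dmat (\<lambda>t. 1 / ?n * (bb * eps (i - 1) t + as i * eps i t + cs (Suc i) * eps (Suc i) t))"
    using tt[rule_format, of i] assms d_pos
    by (simp add: bb_def E_eq dmat_hadamard dmat_scale dmat_add split: if_splits)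
  then have "eps 1 t * eps i t = 1 / ?n * (bb * eps (i - 1) t + as i * eps i t + cs (Suc i) * eps (Suc i) t)"
    if "t \<le> d" for t using that by (simp add: dmat_eq_iff)
  then have "eps (Suc i) t = (?n / cs (Suc i)) * (eps 1 t * eps i t) + (- as i / cs (Suc i)) * eps i t
    + (- bb / cs (Suc i)) * eps (i - 1) t" if "t \<le> d" for t
    using that cs card_X_ne_0 by (simp add: field_simps)
  moreover have "?n / cs (Suc i) \<noteq> 0" using cs card_X_ne_0 by simp
  ultimately show ?thesis using that by blast
qed

lemma hadamard_E:
  assumes "i \<le> d"
  shows "E 1 \<circ>\<^sub>H E i \<in> cm.span (E ` {l. l \<le> d \<and> l \<le> i + 1 \<and> i \<le> l + 1})"
proof -
  obtain as bs cs where tt: "\<forall>i \<le> d. E 1 \<circ>\<^sub>H E i = cscale (1 / of_nat (card X))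
            ((if i = 0 then 0 else cscale (bs (i - 1)) (E (i - 1))) +
             cscale (as i) (E i) +
             (if i = d then 0 else cscale (cs (i + 1)) (E (i + 1))))" using E_three_term by blast
  show ?thesis unfolding tt[rule_format, OF assms]
    by (intro cm.span_scale cm.span_add)
      (use assms in \<open>auto intro!: cm.span_scale[OF cm.span_base] cm.span_zero intro: cm.span_base\<close>)
qed

lemma BM_value_eqI:
  assumes "\<And>i. i \<le> d \<Longrightarrow> eps i t = eps i t'" "t \<le> d" "t' \<le> d"
  shows "t = t'"
proof -
  obtain f where "Am t = (\<Sum>j\<le>d. cscale (f j) (E j))"
    using Am_in_BM[of t] unfolding BM_eq_span_E by (auto simp: cm.in_span_image_iff)
  also have "\<dots> = dmat (\<lambda>t. \<Sum>j\<le>d. f j * eps j t)"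
    unfolding dmat_sum[symmetric] by (intro sum.cong) (auto simp: E_eq dmat_scale)
  finally have eq: "\<forall>s\<le>d. of_bool (s = t) = (\<Sum>j\<le>d. f j * eps j s)"
    by (simp add: Am_def dmat_eq_iff)
  have "of_bool (t' = t) = (of_bool (t = t) :: complex)"
    using eq[rule_format, of t] eq[rule_format, of t'] assms by simp
  then show ?thesis by (auto split: if_splits)
qed

text \<open>Every \<open>eps i\<close> is a polynomial in \<open>eps 1\<close>, hence equal values
  of \<open>eps 1\<close> at two distances would make all idempotents agree there, although they
  span the indicators of single distances.\<close>

lemma eps_1_inj:
  assumes "eps 1 t = eps 1 t'" "t \<le> d" "t' \<le> d"
  shows "t = t'"
proof (rule BM_value_eqI)
  fix i assume "i \<le> d"
  then show "eps i t = eps i t'"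
  proof (induction i rule: less_induct)
    case (less i)
    show ?case
    proof (cases i)
      case 0
      then show ?thesis using eps_0 assms by simp
    next
      case (Suc j)
      then have "j < d" using less.prems by simp
      then obtain u v r where "u \<noteq> 0"
        "\<And>t. t \<le> d \<Longrightarrow> eps (Suc j) t = u * (eps 1 t * eps j t) + v * eps j t + r * eps (j - 1) t"
        using eps_Suc[of j thesis] by blast
      moreover have "eps j t = eps j t'" "eps (j - 1) t = eps (j - 1) t'"
        using less Suc by auto
      ultimately show ?thesis using assms Suc by simp
    qed
  qed
qed (use assms in auto)

definition th :: "nat \<Rightarrow> complex" where
  "th i = (SOME a. Am 1 ** E i = cscale a (E i))"

lemma Am_1_mult_E: "i \<le> d \<Longrightarrow> Am 1 ** E i = cscale (th i) (E i)"
  unfolding th_def by (rule someI_ex) (metis BM_mult_E[OF Am_in_BM])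

text \<open>\<open>Am 1\<close> generates the algebra, so equal eigenvalues would let every element,
  in particular \<open>E i\<close> itself, act by one scalar on both \<open>E i\<close> and
  \<open>E j\<close>; but \<open>E i\<close> acts there as 1 and as 0.\<close>

lemma th_inj:
  assumes "i \<le> d" "j \<le> d" "th i = th j"
  shows "i = j"
proof (rule ccontr)
  assume ne: "i \<noteq> j"
  have "\<exists>p. M ** E i = cscale p (E i) \<and> M ** E j = cscale p (E j)" if "M \<in> BM" for M
    using that
  proof (induction M rule: BM_induct)
    case unit
    then show ?case using assms by (intro exI[of _ 1]) (simp add: Am_0_mult_BM E_BM)
  next
    case (mult M)
    then obtain p where "M ** E i = cscale p (E i)" "M ** E j = cscale p (E j)" by blast
    then show ?case using assms
      by (intro exI[of _ "p * th i"]) (simp add: Am_1_mult_E cscale_mult_right flip: matrix_mul_assoc del: One_nat_def)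
  next
    case (add M N)
    then show ?case by (metis matrix_add_rdistrib cm.scale_left_distrib)
  next
    case (scale a M)
    then show ?case by (metis cscale_mult_left cm.scale_scale)
  qed
  from this[OF E_BM[OF assms(1)]] obtain p where p: "E i = cscale p (E i)" "0 = cscale p (E j)"
    using assms ne by (auto simp: E_idem E_orth)
  then have "p = 0" using E_nz[OF assms(2)] by simp
  then show False using p E_nz[OF assms(1)] by simp
qed

lemma shift_eps:
  assumes "i \<le> d" "t \<le> d"
  shows "shift (eps i) t = th i * eps i t"
  using Am_1_mult_E[OF assms(1)] assms by (simp add: E_eq Am_1_mult_dmat dmat_scale dmat_eq_iff del: One_nat_def)

lemma valency_mult_eps_1: "i \<le> d \<Longrightarrow> of_nat (b 0) * eps i 1 = th i * eps i 0"
  using shift_eps[of i 0] by (simp add: shift_def c_0 flip: One_nat_def)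

lemma th_0: "th 0 = of_nat (b 0)"
  using valency_mult_eps_1[of 0] d_pos card_X_ne_0 by (simp add: eps_0)

lemma span_image_mono: "M \<in> cm.span (f ` S) \<Longrightarrow> S \<subseteq> T \<Longrightarrow> M \<in> cm.span (f ` T)"
  using cm.span_mono[of "f ` S" "f ` T"] by blast

lemma hadamard_span_E:
  assumes "M \<in> cm.span (E ` {..m})" "m < d"
  shows "E 1 \<circ>\<^sub>H M \<in> cm.span (E ` {..Suc m})"
proof -
  obtain f where "M = (\<Sum>j\<le>m. cscale (f j) (E j))"
    using assms(1) by (auto simp: cm.in_span_image_iff)
  then have "E 1 \<circ>\<^sub>H M = (\<Sum>j\<le>m. cscale (f j) (E 1 \<circ>\<^sub>H E j))"
    by (simp add: cvec_eq_iff sum_distrib_left mult_ac)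
  moreover have "E 1 \<circ>\<^sub>H E j \<in> cm.span (E ` {..Suc m})" if "j \<le> m" for j
    by (rule span_image_mono[OF hadamard_E]) (use that assms(2) in auto)
  ultimately show ?thesis by (auto intro!: cm.span_sum cm.span_scale)
qed

text \<open>Each linear factor in \<open>eps 1\<close> costs one index, since entrywise
  multiplication by E_1 raises the highest idempotent by at most 1. This provides elements with
  prescribed zeros inside the span of few idempotents.\<close>

lemma lagrange_in_span_E:
  assumes "finite S" "card S \<le> d"
  shows "dmat (\<lambda>t. \<Prod>l\<in>S. eps 1 t - eps 1 l) \<in> cm.span (E ` {..card S})"
  using assms
proof (induction S rule: finite_induct)
  case empty
  have "dmat (\<lambda>_. 1) = cscale (of_nat (card X)) (E 0)"
    using card_X_ne_0 by (simp add: E_eq dmat_scale dmat_eq_iff eps_0)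
  then show ?case by (auto intro!: cm.span_scale intro: cm.span_base)
next
  case (insert l S)
  let ?M = "dmat (\<lambda>t. \<Prod>l\<in>S. eps 1 t - eps 1 l)"
  have M: "?M \<in> cm.span (E ` {..card S})" using insert by simp
  have "dmat (\<lambda>t. \<Prod>l\<in>insert l S. eps 1 t - eps 1 l) = E 1 \<circ>\<^sub>H ?M + cscale (- eps 1 l) ?M"
    using insert d_pos by (simp add: E_eq dmat_hadamard dmat_scale dmat_add dmat_eq_iff algebra_simps)
  moreover have "E 1 \<circ>\<^sub>H ?M \<in> cm.span (E ` {..Suc (card S)})"
    using M insert by (intro hadamard_span_E) auto
  moreover have "?M \<in> cm.span (E ` {..Suc (card S)})"
    using M by (rule span_image_mono) auto
  ultimately show ?case using insert by (auto intro!: cm.span_add cm.span_scale simp del: cm.scale_minus_left)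
qed

section \<open>The dual Bose-Mesner algebra\<close>

definition Dg :: "(nat \<Rightarrow> complex) \<Rightarrow> 'a \<Rightarrow> complex ^ 'a ^ 'a" where
  "Dg f y = (\<chi> x z. if x = z \<and> x \<in> X then f (dl y x) else 0)"

lemma Dg_nth: "Dg f y $ x $ z = (if x = z \<and> x \<in> X then f (dl y x) else 0)"
  by (simp add: Dg_def)

lemma Dg_mult_nth: "(Dg f y ** M) $ x $ z = (if x \<in> X then f (dl y x) * M $ x $ z else 0)"
proof -
  have "(\<Sum>k\<in>UNIV. Dg f y $ x $ k * M $ k $ z) = (\<Sum>k\<in>{x}. Dg f y $ x $ k * M $ k $ z)"
    by (intro sum.mono_neutral_right) (auto simp: Dg_nth)
  then show ?thesis by (simp add: matrix_matrix_mult_def Dg_nth)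
qed

lemma mult_Dg_nth: "(M ** Dg f y) $ x $ z = (if z \<in> X then M $ x $ z * f (dl y z) else 0)"
proof -
  have "(\<Sum>k\<in>UNIV. M $ x $ k * Dg f y $ k $ z) = (\<Sum>k\<in>{z}. M $ x $ k * Dg f y $ k $ z)"
    by (intro sum.mono_neutral_right) (auto simp: Dg_nth)
  then show ?thesis by (simp add: matrix_matrix_mult_def Dg_nth)
qed

text \<open>Up to the factor |X|, \<open>Dg (eps 1) y\<close> is the dual adjacency matrix D_y at y.
  The squared norms of E_i D_y E_j, summed over all y, equal the trace of E_i (E_1 o E_j), which is
  0 when |i - j| > 1; all these matrices are real, so every summand vanishes.\<close>

lemma E_Dg_E_tridiagonal:
  assumes "i \<le> d" "j \<le> d" "i > j + 1 \<or> j > i + 1" "y \<in> X"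
  shows "E i ** Dg (eps 1) y ** E j = 0"
proof -
  define N where "N y = E i ** Dg (eps 1) y ** E j" for y
  have N_nth: "N y $ a $ b' = (\<Sum>z\<in>X. E i $ a $ z * eps 1 (dl y z) * E j $ z $ b')" for y a b'
  proof -
    have "N y $ a $ b' = (\<Sum>z\<in>UNIV. (if z \<in> X then E i $ a $ z * eps 1 (dl y z) else 0) * E j $ z $ b')"
      unfolding N_def matrix_matrix_mult_def[of _ "E j"] by (simp add: mult_Dg_nth)
    also have "\<dots> = (\<Sum>z\<in>X. E i $ a $ z * eps 1 (dl y z) * E j $ z $ b')"
      by (intro sum.mono_neutral_cong_right) auto
    finally show ?thesis .
  qed
  have trN: "(\<Sum>a\<in>UNIV. \<Sum>b'\<in>UNIV. (N y $ a $ b')\<^sup>2) = trace (E i ** (Dg (eps 1) y ** E j ** Dg (eps 1) y))"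
    if "y \<in> X" for y
  proof -
    have tr: "N y $ a $ b' = (E j ** Dg (eps 1) y ** E i) $ b' $ a" for a b'
    proof -
      have "(E j ** Dg (eps 1) y ** E i) $ b' $ a
          = (\<Sum>z\<in>UNIV. (if z \<in> X then E j $ b' $ z * eps 1 (dl y z) else 0) * E i $ z $ a)"
        unfolding matrix_matrix_mult_def[of _ "E i"] by (simp add: mult_Dg_nth)
      also have "\<dots> = (\<Sum>z\<in>X. E i $ a $ z * eps 1 (dl y z) * E j $ z $ b')"
        using assms E_symmetric by (intro sum.mono_neutral_cong_right) (auto simp: mult_ac)
      finally show ?thesis by (simp add: N_nth)
    qed
    have "(\<Sum>a\<in>UNIV. \<Sum>b'\<in>UNIV. (N y $ a $ b')\<^sup>2) = trace (N y ** (E j ** Dg (eps 1) y ** E i))"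
      unfolding trace_def matrix_matrix_mult_def[of "N y"] by (simp add: power2_eq_square tr)
    also have "N y ** (E j ** Dg (eps 1) y ** E i) = E i ** (Dg (eps 1) y ** E j ** Dg (eps 1) y ** E i)"
      unfolding N_def using E_idem[OF assms(2)] by (metis matrix_mul_assoc)
    also have "trace \<dots> = trace (Dg (eps 1) y ** E j ** Dg (eps 1) y ** E i ** E i)"
      by (rule trace_mul_sym)
    also have "\<dots> = trace (Dg (eps 1) y ** E j ** Dg (eps 1) y ** E i)"
      using E_idem[OF assms(1)] by (metis matrix_mul_assoc)
    also have "\<dots> = trace (E i ** (Dg (eps 1) y ** E j ** Dg (eps 1) y))"
      by (rule trace_mul_sym)
    finally show ?thesis .
  qed
  have real: "N y $ a $ b' \<in> \<real>" if "y \<in> X" for y a b'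
    unfolding N_nth
  proof (intro sum_in_Reals Reals_mult)
    fix z assume "z \<in> X"
    then show "eps 1 (dl y z) \<in> \<real>" using E_nth_real[of 1 y z] E_nth[of 1 y z] that d_pos by simp
  qed (use assms E_nth_real in auto)
  have "(\<Sum>y\<in>X. \<Sum>a\<in>UNIV. \<Sum>b'\<in>UNIV. (N y $ a $ b')\<^sup>2)
      = trace (E i ** (\<Sum>y\<in>X. Dg (eps 1) y ** E j ** Dg (eps 1) y))"
    unfolding matrix_mult_sum trace_sum by (intro sum.cong refl trN)
  \<comment> \<open>The entry at (a, b') is that of E_j times the sum over y of E_1(y, a) E_1(y,
    b'), and this sum is the entry of E_1 squared, hence of E_1.\<close>
  also have "(\<Sum>y\<in>X. Dg (eps 1) y ** E j ** Dg (eps 1) y) = E 1 \<circ>\<^sub>H E j"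
  proof -
    have "(\<Sum>y\<in>X. (Dg (eps 1) y ** E j ** Dg (eps 1) y) $ a $ b') = E 1 $ a $ b' * E j $ a $ b'" for a b'
    proof (cases "a \<in> X \<and> b' \<in> X")
      case True
      have "E 1 $ a $ b' = (E 1 ** E 1) $ a $ b'" using E_idem d_pos by simp
      also have "\<dots> = (\<Sum>y\<in>X. E 1 $ y $ a * E 1 $ y $ b')"
        unfolding matrix_matrix_mult_def using d_pos E_symmetric[of 1 a] E_outside[of 1 _ b']
        by simp (intro sum.mono_neutral_right, auto)
      also have "\<dots> = (\<Sum>y\<in>X. eps 1 (dl y a) * eps 1 (dl y b'))"
        using True d_pos by (intro sum.cong) (auto simp: E_nth )
      finally show ?thesis using True
        by (simp add: Dg_mult_nth mult_Dg_nth sum_distrib_left mult_ac)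
    next
      case False
      then have "(Dg (eps 1) y ** E j ** Dg (eps 1) y) $ a $ b' = 0" for y
        by (auto simp: mult_Dg_nth Dg_mult_nth)
      then show ?thesis using False assms E_outside by auto
    qed
    then show ?thesis by (simp add: cvec_eq_iff)
  qed
  also have "E i ** (E 1 \<circ>\<^sub>H E j) = 0"
    using assms E_orth
    by (intro mult_span_zero[OF _ _ hadamard_E[OF assms(2)], of "{E i}"]) (auto intro: cm.span_base)
  finally have z: "(\<Sum>y\<in>X. \<Sum>a\<in>UNIV. \<Sum>b'\<in>UNIV. (N y $ a $ b')\<^sup>2) = 0" by (simp add: trace_def)
  \<comment> \<open>Passing to real parts makes the vanishing sum a sum of nonnegative
    terms.\<close>
  define r where "r y a b' = Re (N y $ a $ b')" for y a b'
  have N_r: "N y $ a $ b' = of_real (r y a b')" if "y \<in> X" for y a b'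
    using real[OF that] by (simp add: r_def complex_is_Real_iff complex_eq_iff)
  have "(\<Sum>y\<in>X. \<Sum>a\<in>UNIV. \<Sum>b'\<in>UNIV. (N y $ a $ b')\<^sup>2)
     = (\<Sum>y\<in>X. \<Sum>a\<in>UNIV. \<Sum>b'\<in>UNIV. of_real ((r y a b')\<^sup>2))"
    by (intro sum.cong refl) (simp add: N_r)
  also have "\<dots> = of_real (\<Sum>y\<in>X. \<Sum>a\<in>UNIV. \<Sum>b'\<in>UNIV. (r y a b')\<^sup>2)"
    by (simp only: of_real_sum)
  finally have "complex_of_real (\<Sum>y\<in>X. \<Sum>a\<in>UNIV. \<Sum>b'\<in>UNIV. (r y a b')\<^sup>2) = 0"
    unfolding z by (rule sym)
  then have "(\<Sum>y\<in>X. \<Sum>a\<in>UNIV. \<Sum>b'\<in>UNIV. (r y a b')\<^sup>2) = 0"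
    by (simp only: of_real_eq_0_iff)
  then have "(\<Sum>a\<in>UNIV. \<Sum>b'\<in>UNIV. (r y a b')\<^sup>2) = 0"
    by (subst (asm) sum_nonneg_eq_0_iff) (use assms(4) in \<open>auto intro!: sum_nonneg\<close>)
  then have "(\<Sum>b'\<in>UNIV. (r y a b')\<^sup>2) = 0" for a
    by (subst (asm) sum_nonneg_eq_0_iff) (auto intro!: sum_nonneg)
  then have "(r y a b')\<^sup>2 = 0" for a b'
    by (subst (asm) sum_nonneg_eq_0_iff) auto
  then have "N y $ a $ b' = 0" for a b'
    using N_r[OF assms(4)] by simp
  then show ?thesis unfolding N_def by (simp add: cvec_eq_iff)
qed

text \<open>\<open>eps k\<close> has degree k in \<open>eps 1\<close>, so the matrix is a polynomial
  of degree k in a tridiagonal one. In the induction the identity, as the sum of all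
  \<open>E l\<close>, is inserted between the two diagonal factors.\<close>

lemma E_Dg_E_band:
  assumes "k \<le> d" "i \<le> d" "j \<le> d" "i > j + k \<or> j > i + k" "y \<in> X"
  shows "E i ** Dg (eps k) y ** E j = 0"
  using assms(1-4)
proof (induction k arbitrary: i j rule: less_induct)
  case (less k)
  show ?case
  proof (cases k)
    case 0
    have "Dg (eps 0) y = cscale (1 / of_nat (card X)) (Am 0)"
      using dl_le assms(5) by (auto simp: cvec_eq_iff Dg_nth Am_0_nth eps_0)
    moreover have "E i ** E j = 0" using less.prems 0 by (intro E_orth) auto
    ultimately show ?thesis using less.prems 0
      by (simp add: cscale_mult_right cscale_mult_left BM_mult_Am_0 E_BM)
  next
    case (Suc m)
    then have "m < d" using less.prems by simp
    then obtain u v r where "u \<noteq> 0" and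
      uvr: "\<And>t. t \<le> d \<Longrightarrow> eps (Suc m) t = u * (eps 1 t * eps m t) + v * eps m t + r * eps (m - 1) t"
      using eps_Suc[of m thesis] by blast
    have D: "Dg (eps k) y = cscale u (Dg (eps 1) y ** Dg (eps m) y) + cscale v (Dg (eps m) y) + cscale r (Dg (eps (m - 1)) y)"
      using dl_le assms(5) by (auto simp: cvec_eq_iff Dg_nth Dg_mult_nth uvr Suc )
    have 1: "E i ** Dg (eps m) y ** E j = 0" "E i ** Dg (eps (m - 1)) y ** E j = 0"
      using less Suc by auto
    have "Dg (eps 1) y ** Dg (eps m) y = Dg (eps 1) y ** (Am 0 ** Dg (eps m) y)"
      by (subst Am_0_mult) (auto simp: Dg_nth)
    also have "\<dots> = (\<Sum>l\<le>d. Dg (eps 1) y ** E l ** Dg (eps m) y)"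
      unfolding sum_E by (simp add: sum_matrix_mult matrix_mult_sum matrix_mul_assoc)
    finally have "E i ** (Dg (eps 1) y ** Dg (eps m) y) ** E j
        = (\<Sum>l\<le>d. E i ** (Dg (eps 1) y ** E l ** Dg (eps m) y) ** E j)"
      by (simp add: sum_matrix_mult matrix_mult_sum)
    also have "\<dots> = (\<Sum>l\<le>d. (E i ** Dg (eps 1) y ** E l) ** (E l ** Dg (eps m) y ** E j))"
    proof (intro sum.cong refl)
      fix l assume "l \<in> {..d}"
      then have "Dg (eps 1) y ** E l ** Dg (eps m) y = Dg (eps 1) y ** (E l ** E l) ** Dg (eps m) y"
        by (simp add: E_idem)
      then show "E i ** (Dg (eps 1) y ** E l ** Dg (eps m) y) ** E j
          = (E i ** Dg (eps 1) y ** E l) ** (E l ** Dg (eps m) y ** E j)"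
        by (simp add: matrix_mul_assoc)
    qed
    also have "\<dots> = 0"
    proof (intro sum.neutral ballI)
      fix l assume "l \<in> {..d}"
      then show "(E i ** Dg (eps 1) y ** E l) ** (E l ** Dg (eps m) y ** E j) = 0"
      proof (cases "i > l + 1 \<or> l > i + 1")
        case True
        then show ?thesis using E_Dg_E_tridiagonal[of i l y] less.prems \<open>l \<in> {..d}\<close> assms(5) by simp
      next
        case False
        then have "E l ** Dg (eps m) y ** E j = 0" using less Suc \<open>l \<in> {..d}\<close> by auto
        then show ?thesis by simp
      qed
    qed
    finally show ?thesis using 1 unfolding D
      by (simp add: matrix_add_ldistrib matrix_add_rdistrib cscale_mult_left cscale_mult_right)
  qed
qed

end

section \<open>Subsets of minimal width and dual width\<close>

lemma submatrix_on_nth [simp]: "submatrix_on Y M $ x $ y = (if x \<in> Y \<and> y \<in> Y then M $ x $ y else 0)"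
  by (simp add: submatrix_on_def)

lemma submatrix_on_sum: "submatrix_on Y (\<Sum>i\<in>I. f i) = (\<Sum>i\<in>I. submatrix_on Y (f i))"
  by (auto simp: cvec_eq_iff intro!: sum.neutral)

lemma submatrix_on_cscale: "submatrix_on Y (cscale a M) = cscale a (submatrix_on Y M)"
  by (simp add: cvec_eq_iff)

lemma submatrix_on_add: "submatrix_on Y (M + N) = submatrix_on Y M + submatrix_on Y N"
  by (simp add: cvec_eq_iff)

lemma submatrix_on_hadamard: "submatrix_on Y (M \<circ>\<^sub>H N) = submatrix_on Y M \<circ>\<^sub>H submatrix_on Y N"
  by (simp add: cvec_eq_iff)

lemma submatrix_on_span:
  assumes "M \<in> cm.span (E ` S)"
  shows "submatrix_on Y M \<in> cm.span ((\<lambda>i. submatrix_on Y (E i)) ` S)"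
  using assms
proof (induction rule: cm.span_induct_alt)
  case base
  have "submatrix_on Y 0 = 0" by (simp add: cvec_eq_iff)
  then show ?case by (simp add: cm.span_zero)
next
  case (step c x y)
  then show ?case
    by (auto simp: submatrix_on_add submatrix_on_cscale intro!: cm.span_add cm.span_scale[OF cm.span_base])
qed

lemma hadamard_sum_right: "M \<circ>\<^sub>H (\<Sum>i\<in>I. cscale (a i) (f i)) = (\<Sum>i\<in>I. cscale (a i) (M \<circ>\<^sub>H f i))"
  by (simp add: cvec_eq_iff sum_distrib_left mult_ac)

text \<open>Width and dual width enter as upper bounds whose sum is d; the dual bound is stated as
  the vanishing of E_i applied to the characteristic vector, which is how it is used. That every
  distance up to w occurs is derived in \<open>exists_pair_Y\<close>.\<close>

locale narrow_subset = qdrg X dl d b c E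
  for X :: "'v::finite set" and dl d b c E +
  fixes Y :: "'v set" and w ws :: nat
  assumes Y_sub: "Y \<subseteq> X" and Y_ne: "Y \<noteq> {}"
    and w_ws: "w + ws = d" and w_pos: "1 \<le> w" and ws_pos: "1 \<le> ws"
    and dl_Y: "x \<in> Y \<Longrightarrow> y \<in> Y \<Longrightarrow> dl x y \<le> w"
    and dual_Y: "ws < i \<Longrightarrow> i \<le> d \<Longrightarrow> E i *v char_vec Y = 0"
begin

section \<open>The projection onto Y\<close>

definition IY :: "complex ^ 'v ^ 'v" where
  "IY = (\<chi> x y. if x = y \<and> x \<in> Y then 1 else 0)"

lemma IY_nth: "IY $ x $ y = (if x = y \<and> x \<in> Y then 1 else 0)"
  by (simp add: IY_def)

lemma IY_mult_nth: "(IY ** M) $ x $ y = (if x \<in> Y then M $ x $ y else 0)"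
proof -
  have "(\<Sum>k\<in>UNIV. IY $ x $ k * M $ k $ y) = (\<Sum>k\<in>{x}. IY $ x $ k * M $ k $ y)"
    by (intro sum.mono_neutral_right) (auto simp: IY_nth)
  then show ?thesis by (simp add: matrix_matrix_mult_def IY_nth)
qed

lemma mult_IY_nth: "(M ** IY) $ x $ y = (if y \<in> Y then M $ x $ y else 0)"
proof -
  have "(\<Sum>k\<in>UNIV. M $ x $ k * IY $ k $ y) = (\<Sum>k\<in>{y}. M $ x $ k * IY $ k $ y)"
    by (intro sum.mono_neutral_right) (auto simp: IY_nth)
  then show ?thesis by (simp add: matrix_matrix_mult_def IY_nth)
qed

lemma submatrix_on_eq: "submatrix_on Y M = IY ** M ** IY"
  by (simp add: cvec_eq_iff mult_IY_nth IY_mult_nth)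

lemma IY_IY: "IY ** IY = IY"
  by (simp add: cvec_eq_iff mult_IY_nth IY_nth)

lemma sum_eps_Y:
  assumes "k \<le> d" "x \<in> X"
  shows "(\<Sum>y\<in>Y. eps k (dl y x)) = (E k *v char_vec Y) $ x"
proof -
  have "(E k *v char_vec Y) $ x = (\<Sum>y\<in>Y. E k $ x $ y)"
    unfolding matrix_vector_mult_def by (simp add: char_vec_def if_distrib cong: if_cong) (simp add: sum.If_cases)
  also have "\<dots> = (\<Sum>y\<in>Y. eps k (dl y x))"
    using assms Y_sub dl_sym by (intro sum.cong) (auto simp: E_nth subset_iff)
  finally show ?thesis by simp
qed

text \<open>The diagonal of the sum over y in Y of \<open>Dg (eps k) y\<close> is E_k applied to the
  characteristic vector, which vanishes for k > w*. So the sum over k <= w* equals the sum over all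
  k, and there the E_k add up to the identity.\<close>

lemma IY_eq_sum_Dg: "IY = (\<Sum>k\<le>ws. \<Sum>y\<in>Y. Dg (eps k) y)"
proof -
  have "(\<Sum>k\<le>ws. \<Sum>y\<in>Y. eps k (dl y x)) = (if x \<in> Y then 1 else 0)" if "x \<in> X" for x
  proof -
    have "(\<Sum>k\<le>ws. \<Sum>y\<in>Y. eps k (dl y x)) = (\<Sum>k\<le>ws. (E k *v char_vec Y) $ x)"
      using that w_ws by (intro sum.cong refl sum_eps_Y) auto
    also have "\<dots> = (\<Sum>k\<le>d. (E k *v char_vec Y) $ x)"
      using w_ws dual_Y by (intro sum.mono_neutral_left) auto
    also have "\<dots> = (\<Sum>k\<le>d. \<Sum>y\<in>Y. eps k (dl y x))"
      using that by (intro sum.cong refl sum_eps_Y[symmetric]) auto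
    also have "\<dots> = (\<Sum>y\<in>Y. \<Sum>k\<le>d. eps k (dl y x))" by (rule sum.swap)
    also have "\<dots> = (\<Sum>y\<in>Y. Am 0 $ y $ x)"
      using that Y_sub unfolding sum_E by (intro sum.cong) (auto simp: E_nth subset_iff)
    also have "\<dots> = (\<Sum>y\<in>Y. if y = x then 1 else 0)"
      using Y_sub by (intro sum.cong) (auto simp: Am_0_nth)
    finally show ?thesis by simp
  qed
  then have "IY $ x $ z = (\<Sum>k\<le>ws. \<Sum>y\<in>Y. Dg (eps k) y) $ x $ z" for x z
  proof (cases "x = z \<and> x \<in> X")
    case False
    then have "Dg (eps k) y $ x $ z = 0" for k y by (auto simp: Dg_nth)
    then show ?thesis using False Y_sub by (auto simp: IY_nth)
  qed (auto simp: Dg_nth IY_nth)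
  then show ?thesis by (simp add: cvec_eq_iff)
qed

lemma E_IY_E:
  assumes "i \<le> d" "j \<le> d" "i > j + ws \<or> j > i + ws"
  shows "E i ** IY ** E j = 0"
proof -
  have "E i ** Dg (eps k) y ** E j = 0" if "k \<le> ws" "y \<in> Y" for k y
    using assms that w_ws Y_sub by (intro E_Dg_E_band) auto
  then show ?thesis unfolding IY_eq_sum_Dg by (simp add: sum_matrix_mult matrix_mult_sum)
qed

section \<open>The restriction of the Bose-Mesner algebra to Y\<close>

abbreviation sE :: "nat \<Rightarrow> complex ^ 'v ^ 'v" where
  "sE i \<equiv> submatrix_on Y (E i)"

abbreviation sA :: "nat \<Rightarrow> complex ^ 'v ^ 'v" where
  "sA i \<equiv> submatrix_on Y (Am i)"

abbreviation sdmat :: "(nat \<Rightarrow> complex) \<Rightarrow> complex ^ 'v ^ 'v" where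
  "sdmat f \<equiv> submatrix_on Y (dmat f)"

definition BMY :: "(complex ^ 'v ^ 'v) set" where
  "BMY = range sdmat"

lemma sE_mult_sE_eq_0:
  assumes "i \<le> d" "j \<le> d" "i > j + ws \<or> j > i + ws"
  shows "sE i ** sE j = 0"
proof -
  have "sE i ** sE j = IY ** (E i ** (IY ** IY) ** E j) ** IY"
    unfolding submatrix_on_eq by (simp add: matrix_mul_assoc)
  then show ?thesis unfolding IY_IY E_IY_E[OF assms] by simp
qed

text \<open>If distance i were missing in Y, a polynomial g of degree w - 1 in \<open>eps 1\<close>
  with zeros at the remaining distances 1, ..., w would restrict on Y to a nonzero multiple of the
  identity. It lies in the span of E_0, ..., E_{w-1}, which E_d does not reach through the
  projection since (w - 1) + w* < d; hence the columns of E_d belonging to Y would vanish, but the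
  diagonal entries of E_d do not.\<close>

lemma exists_pair_Y:
  assumes "i \<le> w"
  obtains x y where "x \<in> Y" "y \<in> Y" "dl x y = i"
proof (rule ccontr)
  note found = that
  assume "\<not> thesis"
  then have none: "dl x y \<noteq> i" if xy: "x \<in> Y" "y \<in> Y" for x y using \<open>\<not> thesis\<close> found xy by blast
  obtain x0 where x0: "x0 \<in> Y" using Y_ne by blast
  have i: "i \<noteq> 0" using none[OF x0 x0] dl_0[of x0 x0] x0 Y_sub by auto
  define S where "S = {1..w} - {i}"
  have S: "finite S" "card S = w - 1" using assms i by (auto simp: S_def)
  define g where "g t = (\<Prod>l\<in>S. eps 1 t - eps 1 l)" for t
  have "g 0 \<noteq> 0"
  proof -
    have "eps 1 0 \<noteq> eps 1 l" if "l \<in> S" for l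
      using eps_1_inj[of 0 l] that w_ws by (auto simp: S_def)
    then show ?thesis using S(1) by (auto simp: g_def)
  qed
  have g0: "g (dl x y) = 0" if "x \<in> Y" "y \<in> Y" "x \<noteq> y" for x y
  proof -
    have "dl x y \<noteq> 0" using dl_0[of x y] that Y_sub by auto
    then have "dl x y \<in> S" using none[OF that(1,2)] dl_Y[OF that(1,2)] by (auto simp: S_def)
    then show ?thesis using S(1) by (auto simp: g_def)
  qed
  have "IY ** dmat g ** IY = cscale (g 0) IY"
  proof -
    have "dl x x = 0" if "x \<in> Y" for x using that Y_sub dl_0[of x x] by auto
    then show ?thesis
      unfolding submatrix_on_eq[symmetric] using Y_sub g0 by (auto simp: cvec_eq_iff dmat_nth IY_nth subset_iff)
  qed
  moreover have "E d ** IY ** dmat g = 0"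
  proof -
    have g: "dmat g \<in> cm.span (E ` {..w - 1})"
      using lagrange_in_span_E[OF S(1)] S(2) w_ws unfolding g_def[abs_def] by simp
    have "E d ** IY ** E l = 0" if "l \<le> w - 1" for l
      using that w_pos w_ws by (intro E_IY_E) auto
    then have "M ** N = 0" if "M \<in> {E d ** IY}" "N \<in> E ` {..w - 1}" for M N using that by auto
    from mult_span_zero[OF this cm.span_base[OF singletonI] g] show ?thesis .
  qed
  moreover have "E d ** (IY ** dmat g ** IY) = E d ** IY ** dmat g ** IY"
    by (simp only: matrix_mul_assoc)
  ultimately have "cscale (g 0) (E d ** IY) = 0" by (simp add: cscale_mult_right)
  then have "E d ** IY = 0" using \<open>g 0 \<noteq> 0\<close> by simp
  then have "(E d ** IY) $ x0 $ x0 = 0" by simp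
  then show False using x0 Y_sub eps_0_ne_0[of d] dl_0[of x0 x0] by (auto simp: mult_IY_nth E_nth subset_iff)
qed

lemma sdmat_nth: "sdmat f $ x $ y = (if x \<in> Y \<and> y \<in> Y then f (dl x y) else 0)"
  using Y_sub by (auto simp: dmat_nth)

lemma sdmat_eq_iff: "sdmat f = sdmat g \<longleftrightarrow> (\<forall>t\<le>w. f t = g t)"
proof
  assume eq: "sdmat f = sdmat g"
  show "\<forall>t\<le>w. f t = g t"
  proof (intro allI impI)
    fix t assume "t \<le> w"
    then obtain x y where "x \<in> Y" "y \<in> Y" "dl x y = t" using exists_pair_Y by blast
    moreover have "sdmat f $ x $ y = sdmat g $ x $ y" using eq by simp
    ultimately show "f t = g t" using sdmat_nth by metis
  qed
next
  assume "\<forall>t\<le>w. f t = g t"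
  then show "sdmat f = sdmat g"
    unfolding cvec_eq_iff sdmat_nth using dl_Y by auto
qed

lemma sdmat_in_BMY [simp]: "sdmat f \<in> BMY"
  by (simp add: BMY_def)

lemma sA_in_BMY [simp]: "sA i \<in> BMY"
  by (simp add: Am_def)

lemma sdmat_conv_sum: "sdmat f = (\<Sum>i\<le>w. cscale (f i) (sA i))"
proof -
  have "(\<Sum>i\<le>w. cscale (f i) (sA i)) = sdmat (\<lambda>t. \<Sum>i\<le>w. f i * of_bool (t = i))"
    unfolding Am_def submatrix_on_cscale[symmetric] dmat_scale submatrix_on_sum[symmetric] dmat_sum ..
  also have "\<dots> = sdmat f"
    by (auto simp: sdmat_eq_iff of_bool_def if_distrib cong: if_cong)
  finally show ?thesis by simp
qed

lemma BMY_eq_span: "BMY = cm.span (sA ` {..w})"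
proof (intro equalityI subsetI)
  fix M assume "M \<in> BMY"
  then show "M \<in> cm.span (sA ` {..w})" unfolding BMY_def
    by (auto simp: sdmat_conv_sum intro!: cm.span_sum cm.span_scale intro: cm.span_base)
next
  fix M assume "M \<in> cm.span (sA ` {..w})"
  then obtain f where "M = (\<Sum>i\<le>w. cscale (f i) (sA i))" by (auto simp: cm.in_span_image_iff)
  then show "M \<in> BMY" unfolding BMY_def by (simp flip: sdmat_conv_sum)
qed

lemma BMY_subspace: "cm.subspace BMY"
  unfolding BMY_eq_span by (rule cm.subspace_span)

lemma sA_independent: "cm.independent_family sA {..w}"
  unfolding cm.independent_family_def
proof (intro allI impI)
  fix f assume "(\<Sum>i\<le>w. cscale (f i) (sA i)) = 0"
  then have "sdmat f = sdmat (\<lambda>_. 0)" by (simp add: sdmat_conv_sum[of f]) (simp add: cvec_eq_iff dmat_zero)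
  then show "\<forall>i\<in>{..w}. f i = 0" by (simp add: sdmat_eq_iff)
qed

lemma sE_in_BMY: "i \<le> d \<Longrightarrow> sE i \<in> BMY"
  by (simp add: E_eq)

text \<open>Lagrange interpolation at the w distances other than t: the polynomial has degree w in
  \<open>eps 1\<close> and thus involves E_0, ..., E_w only.\<close>

lemma sA_in_span_sE:
  assumes "t \<le> w"
  shows "sA t \<in> cm.span (sE ` {..w})"
proof -
  define S where "S = {..w} - {t}"
  have S: "finite S" "card S = w" using assms by (auto simp: S_def)
  define g where "g t = (\<Prod>l\<in>S. eps 1 t - eps 1 l)" for t
  have g0: "g t \<noteq> 0"
  proof -
    have "eps 1 t \<noteq> eps 1 l" if "l \<in> S" for l
      using eps_1_inj[of t l] that w_ws assms by (auto simp: S_def)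
    then show ?thesis using S(1) by (auto simp: g_def)
  qed
  have "sA t = cscale (1 / g t) (sdmat g)"
    unfolding Am_def submatrix_on_cscale[symmetric] dmat_scale sdmat_eq_iff
    using g0 S(1) by (auto simp: g_def S_def)
  moreover have "sdmat g \<in> cm.span (sE ` {..w})"
    using submatrix_on_span[OF lagrange_in_span_E[OF S(1)]] S(2) w_ws unfolding g_def[abs_def] by simp
  ultimately show ?thesis by (simp add: cm.span_scale)
qed

lemma sE_independent_low: "cm.independent_family sE {..w}"
  using cm.spanning_family_independent[OF _ sA_independent, of "{..w}" sE] sA_in_span_sE by simp

text \<open>A nonzero matrix in the span of \<open>k\<close> of the \<open>E i\<close> has a nonzero entry at distance less than
  \<open>k\<close>: each factor \<open>A - \<theta>\<^sub>l\<close> lowers the smallest distance in its support by exactly one.\<close>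

lemma support_bound:
  assumes "finite S" "S \<subseteq> {..d}" "dmat f \<in> cm.span (E ` S)" "k \<le> d" "f k \<noteq> 0" "\<And>t. t < k \<Longrightarrow> f t = 0"
  shows "k < card S"
  using assms
proof (induction S arbitrary: f k rule: finite_induct)
  case empty
  then have "dmat f = dmat (\<lambda>_. 0)" by (simp add: dmat_zero)
  then show ?case using empty by (simp add: dmat_eq_iff)
next
  case (insert l S)
  show ?case
  proof (cases k)
    case 0
    then show ?thesis using insert by simp
  next
    case (Suc m)
    define g where "g t = shift f t - th l * f t" for t
    obtain a where a: "dmat f = (\<Sum>j\<in>insert l S. cscale (a j) (E j))"
      using iffD1[OF cm.in_span_image_iff insert.prems(2)] insert.hyps(1) by auto
    have "dmat g = Am 1 ** dmat f + cscale (- th l) (dmat f)"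
      by (simp add: Am_1_mult_dmat dmat_scale dmat_add g_def dmat_eq_iff del: cm.scale_minus_left)
    also have "\<dots> = (\<Sum>j\<in>insert l S. cscale (a j * (th j - th l)) (E j))"
    proof -
      have "Am 1 ** dmat f = (\<Sum>j\<in>insert l S. cscale (a j) (Am 1 ** E j))"
        unfolding a matrix_mult_sum cscale_mult_right ..
      also have "\<dots> = (\<Sum>j\<in>insert l S. cscale (a j * th j) (E j))"
        using insert.prems(1) by (intro sum.cong refl) (auto simp: Am_1_mult_E)
      finally have "Am 1 ** dmat f + cscale (- th l) (dmat f) =
          (\<Sum>j\<in>insert l S. cscale (a j * th j) (E j) + cscale (- th l) (cscale (a j) (E j)))"
        unfolding sum.distrib a cm.scale_sum_right by simp
      then show ?thesis by (simp add: cvec_eq_iff algebra_simps)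
    qed
    also have "\<dots> = (\<Sum>j\<in>S. cscale (a j * (th j - th l)) (E j))"
      using insert.hyps by (simp add: sum.insert)
    finally have "dmat g \<in> cm.span (E ` S)"
      by (auto intro!: cm.span_sum cm.span_scale intro: cm.span_base)
    moreover have "g m \<noteq> 0"
      using insert.prems Suc b_pos[of m] by (simp add: g_def shift_def)
    moreover have "g t = 0" if "t < m" for t
      using insert.prems(5) Suc that by (simp add: g_def shift_def)
    ultimately have "m < card S" using insert Suc by auto
    then show ?thesis using insert Suc by simp
  qed
qed

text \<open>A combination of these w + 1 idempotents that vanishes on Y vanishes at all distances up
  to w, because each of them occurs in Y. By \<open>support_bound\<close> a nonzero combination has
  a nonzero value at a distance at most w.\<close>

lemma sE_independent_high: "cm.independent_family sE {ws..d}"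
  unfolding cm.independent_family_def
proof (intro allI impI)
  fix a assume z: "(\<Sum>i=ws..d. cscale (a i) (sE i)) = 0"
  define f where "f t = (\<Sum>i=ws..d. a i * eps i t)" for t
  have f: "dmat f = (\<Sum>i=ws..d. cscale (a i) (E i))"
    unfolding f_def dmat_sum[symmetric] by (intro sum.cong) (auto simp: E_eq dmat_scale)
  have "sdmat f = 0"
    unfolding f submatrix_on_sum submatrix_on_cscale by (rule z)
  also have "\<dots> = sdmat (\<lambda>_. 0)" by (simp add: dmat_zero cvec_eq_iff)
  finally have fw: "\<forall>t\<le>w. f t = 0" by (simp add: sdmat_eq_iff)
  have "\<forall>t\<le>d. f t = 0"
  proof (rule ccontr)
    assume "\<not> (\<forall>t\<le>d. f t = 0)"
    then have ex: "\<exists>t. t \<le> d \<and> f t \<noteq> 0" by blast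
    define k where "k = (LEAST t. t \<le> d \<and> f t \<noteq> 0)"
    have k: "k \<le> d" "f k \<noteq> 0" using LeastI_ex[OF ex] by (auto simp: k_def)
    have "f t = 0" if "t < k" for t using not_less_Least[of t] that k by (force simp: k_def)
    moreover have "dmat f \<in> cm.span (E ` {ws..d})"
      unfolding f by (auto intro!: cm.span_sum cm.span_scale intro: cm.span_base)
    ultimately have "k < card {ws..d}" using k by (intro support_bound[of _ f]) auto
    then have "k \<le> w" using w_ws by auto
    then show False using fw k by blast
  qed
  then have "dmat f = dmat (\<lambda>_. 0)" by (simp add: dmat_eq_iff)
  then have "(\<Sum>i=ws..d. cscale (a i) (E i)) = 0" by (simp add: f dmat_zero)
  moreover have "cm.independent_family E {ws..d}"
    by (rule cm.independent_family_subset[OF E_independent]) auto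
  ultimately show "\<forall>i\<in>{ws..d}. a i = 0" unfolding cm.independent_family_def by blast
qed

section \<open>Two opposite filtrations and the idempotents they share\<close>

abbreviation V :: "nat \<Rightarrow> (complex ^ 'v ^ 'v) set" where
  "V j \<equiv> cm.span (sE ` {..j})"

abbreviation Vd :: "nat \<Rightarrow> (complex ^ 'v ^ 'v) set" where
  "Vd j \<equiv> cm.span (sE ` {ws + j..d})"

text \<open>For l <= i < j and l' >= w* + j the indices differ by more than w*, so the generators
  already multiply to 0 in either order.\<close>

lemma V_mult_Vd:
  assumes "M \<in> V i" "N \<in> Vd j" "i < j" "i \<le> d"
  shows "M ** N = 0" "N ** M = 0"
proof -
  have "sE l ** sE l' = 0 \<and> sE l' ** sE l = 0" if "l \<le> i" "l' \<in> {ws + j..d}" for l l'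
    using that assms(3,4) by (auto intro!: sE_mult_sE_eq_0)
  then show "M ** N = 0" "N ** M = 0"
    using mult_span_zero[OF _ assms(1,2)] mult_span_zero[OF _ assms(2,1)] by blast+
qed

lemma span_sE_subset_BMY: "S \<subseteq> {..d} \<Longrightarrow> cm.span (sE ` S) \<subseteq> BMY"
  using sE_in_BMY by (intro cm.span_minimal BMY_subspace) auto

lemma BMY_symmetric: "M \<in> BMY \<Longrightarrow> M $ x $ y = M $ y $ x"
  using Y_sub dl_sym by (auto simp: BMY_def sdmat_nth subset_iff simp del: submatrix_on_nth)

lemma cnj_matrix_BMY: "M \<in> BMY \<Longrightarrow> cnj_matrix M \<in> BMY"
proof -
  have "cnj_matrix (sdmat f) = sdmat (\<lambda>t. cnj (f t))" for f by (simp add: cvec_eq_iff dmat_nth)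
  then show "M \<in> BMY \<Longrightarrow> cnj_matrix M \<in> BMY" by (auto simp: BMY_def)
qed

lemma cnj_matrix_span_sE:
  assumes "M \<in> cm.span (sE ` S)" "S \<subseteq> {..d}" "finite S"
  shows "cnj_matrix M \<in> cm.span (sE ` S)"
proof -
  obtain a where "M = (\<Sum>i\<in>S. cscale (a i) (sE i))"
    using assms by (auto simp: cm.in_span_image_iff)
  moreover have real: "cnj_matrix (sE i) = sE i" if "i \<in> S" for i
    using E_real[of i] that assms(2) by (auto simp: cvec_eq_iff)
  ultimately have "cnj_matrix M = (\<Sum>i\<in>S. cscale (cnj (a i)) (cnj_matrix (sE i)))"
    by (simp only: cvec_eq_iff cnj_matrix_nth sum_component cnj_sum cscale_nth complex_cnj_mult) simp
  also have "\<dots> = (\<Sum>i\<in>S. cscale (cnj (a i)) (sE i))"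
    using real by (intro sum.cong) auto
  finally have "cnj_matrix M = (\<Sum>i\<in>S. cscale (cnj (a i)) (sE i))" .
  then show ?thesis by (auto intro!: cm.span_sum cm.span_scale intro: cm.span_base)
qed

text \<open>A dimension count: the (j + 1) + (w - j + 1) = w + 2 generators lie in a space of
  dimension w + 1, and a relation between them splits into an element of both spans. It is nonzero
  since the low and the high idempotents are separately independent.\<close>

lemma exists_V_Vd:
  assumes "j \<le> w"
  obtains F where "F \<noteq> 0" "F \<in> V j" "F \<in> Vd j"
proof -
  let ?I = "{..j} \<union> {ws + j..d}"
  have disj: "{..j} \<inter> {ws + j..d} = {}" using ws_pos by auto
  have "card ?I = card {..j} + card {ws + j..d}" using disj by (intro card_Un_disjoint) auto
  then have cI: "card ?I = w + 2" using assms w_ws by auto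
  have "card (sA ` {..w}) \<le> w + 1" using card_image_le[of "{..w}" sA] by simp
  moreover have "sE l \<in> cm.span (sA ` {..w})" if "l \<in> ?I" for l
    using sE_in_BMY[of l] that assms w_ws unfolding BMY_eq_span by auto
  ultimately obtain a i where a: "(\<Sum>l\<in>?I. cscale (a l) (sE l)) = 0" and i: "i \<in> ?I" "a i \<noteq> 0"
    using cI by (elim cm.family_dependent[of ?I "sA ` {..w}" sE, rotated 4]) auto
  define F where "F = (\<Sum>l\<le>j. cscale (a l) (sE l))"
  have sum0: "F + (\<Sum>l=ws + j..d. cscale (a l) (sE l)) = 0"
    using a disj by (simp add: F_def sum.union_disjoint)
  have "F \<noteq> 0"
  proof
    assume "F = 0"
    then have low: "(\<Sum>l\<le>j. cscale (a l) (sE l)) = 0" and high: "(\<Sum>l=ws + j..d. cscale (a l) (sE l)) = 0"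
      using sum0 by (auto simp: F_def)
    have "cm.independent_family sE {..j}" "cm.independent_family sE {ws + j..d}"
      by (rule cm.independent_family_subset[OF sE_independent_low] cm.independent_family_subset[OF sE_independent_high];
          use assms in auto)+
    then have "\<forall>l\<in>?I. a l = 0"
      using low high unfolding cm.independent_family_def by blast
    then show False using i by blast
  qed
  moreover have "F \<in> V j"
    unfolding F_def by (auto intro!: cm.span_sum cm.span_scale intro: cm.span_base)
  moreover have "F = cscale (-1) (\<Sum>l=ws + j..d. cscale (a l) (sE l))"
    using sum0 by (simp add: eq_neg_iff_add_eq_0)
  then have "F \<in> Vd j"
    by (auto intro!: cm.span_neg cm.span_sum cm.span_scale intro: cm.span_base)
  ultimately show ?thesis using that by blast
qed

text \<open>Members of the intersections of \<open>V j\<close> and \<open>Vd j\<close> for different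
  j annihilate each other, also after conjugation of one of them, while the product of a nonzero one
  with its own conjugate is nonzero. So w + 1 of them form a basis, and scaling them by the
  coefficients of the identity of Y makes them idempotent.\<close>

lemma exists_idempotents:
  obtains e where
    "\<And>j. j \<le> w \<Longrightarrow> e j \<noteq> 0" "\<And>j. j \<le> w \<Longrightarrow> e j \<in> V j" "\<And>j. j \<le> w \<Longrightarrow> e j \<in> Vd j"
    "\<And>j. j \<le> w \<Longrightarrow> e j ** e j = e j"
    "\<And>i j. i \<le> w \<Longrightarrow> j \<le> w \<Longrightarrow> i \<noteq> j \<Longrightarrow> e i ** e j = 0"
    "BMY = cm.span (e ` {..w})"
proof -
  have "\<exists>F. F \<noteq> 0 \<and> F \<in> V j \<and> F \<in> Vd j" if "j \<le> w" for j using exists_V_Vd[OF that] by metis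
  then obtain F where F: "\<And>j. j \<le> w \<Longrightarrow> F j \<noteq> 0" "\<And>j. j \<le> w \<Longrightarrow> F j \<in> V j" "\<And>j. j \<le> w \<Longrightarrow> F j \<in> Vd j"
    by metis
  have orth: "F i ** F j = 0" "cnj_matrix (F i) ** F j = 0" if "i \<le> w" "j \<le> w" "i \<noteq> j" for i j
  proof -
    have V: "cnj_matrix (F k) \<in> V k" "cnj_matrix (F k) \<in> Vd k" if "k \<le> w" for k
      using F(2,3)[OF that] that w_ws by (auto intro!: cnj_matrix_span_sE)
    show "F i ** F j = 0"
    proof (cases "i < j")
      case True
      then show ?thesis using V_mult_Vd(1)[of "F i" i "F j" j] F that w_ws by auto
    next
      case False
      then show ?thesis using V_mult_Vd(2)[of "F j" j "F i" i] F that w_ws by auto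
    qed
    show "cnj_matrix (F i) ** F j = 0"
    proof (cases "i < j")
      case True
      then show ?thesis using V_mult_Vd(1)[of "cnj_matrix (F i)" i "F j" j] F V that w_ws by auto
    next
      case False
      then show ?thesis using V_mult_Vd(2)[of "F j" j "cnj_matrix (F i)" i] F V that w_ws by auto
    qed
  qed
  have FB: "F j \<in> BMY" if "j \<le> w" for j
    using F(2)[OF that] span_sE_subset_BMY[of "{..j}"] that w_ws by auto
  have indep: "cm.independent_family F {..w}"
    unfolding cm.independent_family_def
  proof (intro allI impI ballI)
    fix a i assume a: "(\<Sum>j\<le>w. cscale (a j) (F j)) = 0" and i: "i \<in> {..w}"
    have "cnj_matrix (F i) ** (\<Sum>j\<le>w. cscale (a j) (F j))
        = (\<Sum>j\<le>w. if j = i then cscale (a i) (cnj_matrix (F i) ** F i) else 0)"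
      unfolding matrix_mult_sum cscale_mult_right using orth i by (intro sum.cong) auto
    then have "cscale (a i) (cnj_matrix (F i) ** F i) = 0" using a i by simp
    moreover have "cnj_matrix (F i) ** F i \<noteq> 0"
      unfolding cnj_matrix_def using i F(1) BMY_symmetric FB by (intro trace_mult_cnj(2)) auto
    ultimately show "a i = 0" by simp
  qed
  have BMY: "BMY \<subseteq> cm.span (F ` {..w})"
    using cm.independent_family_spans[OF indep, of "sA ` {..w}"] FB card_image_le[of "{..w}" sA]
    unfolding BMY_eq_span by auto
  have IY: "IY = sA 0" using Y_sub by (auto simp: cvec_eq_iff IY_nth Am_0_nth)
  then have "IY \<in> cm.span (F ` {..w})" using BMY sA_in_BMY by auto
  then obtain a where a: "IY = (\<Sum>j\<le>w. cscale (a j) (F j))" by (auto simp: cm.in_span_image_iff)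
  have Fi: "F i = cscale (a i) (F i ** F i)" if i: "i \<le> w" for i
  proof -
    have "F i ** IY = F i"
      using FB[OF i] by (auto simp: cvec_eq_iff mult_IY_nth BMY_def)
    moreover have "F i ** IY = (\<Sum>j\<le>w. if j = i then cscale (a i) (F i ** F i) else 0)"
      unfolding a matrix_mult_sum cscale_mult_right using orth i by (intro sum.cong) auto
    ultimately show ?thesis using i by simp
  qed
  have a0: "a i \<noteq> 0" if "i \<le> w" for i
    using Fi[OF that] F(1)[OF that] by auto
  define e where "e j = cscale (a j) (F j)" for j
  show ?thesis
  proof
    show "e j \<noteq> 0" "e j \<in> V j" "e j \<in> Vd j" if "j \<le> w" for j
      using F[OF that] a0[OF that] by (auto simp: e_def intro: cm.span_scale)
    show "e j ** e j = e j" if "j \<le> w" for j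
    proof -
      have "e j ** e j = cscale (a j) (cscale (a j) (F j ** F j))"
        by (simp add: e_def cscale_mult_left cscale_mult_right)
      then show ?thesis unfolding Fi[OF that, symmetric] e_def .
    qed
    show "e i ** e j = 0" if "i \<le> w" "j \<le> w" "i \<noteq> j" for i j
      using orth[OF that] by (simp add: e_def cscale_mult_left cscale_mult_right)
    show "BMY = cm.span (e ` {..w})"
    proof
      have "F j \<in> cm.span (e ` {..w})" if "j \<le> w" for j
      proof -
        have "F j = cscale (1 / a j) (e j)" using a0[OF that] by (simp add: e_def)
        also have "\<dots> \<in> cm.span (e ` {..w})" using that by (intro cm.span_scale cm.span_base) auto
        finally show ?thesis .
      qed
      then show "BMY \<subseteq> cm.span (e ` {..w})"
        using BMY cm.span_minimal[of "F ` {..w}" "cm.span (e ` {..w})"] by auto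
      show "cm.span (e ` {..w}) \<subseteq> BMY"
        using FB cm.subspace_scale[OF BMY_subspace] by (intro cm.span_minimal BMY_subspace) (auto simp: e_def)
    qed
  qed
qed

text \<open>Orthogonal idempotents span the space, so multiplication is componentwise. In other
  words, the distance relations form a commutative association scheme on Y.\<close>

lemma BMY_mult_closed: "M \<in> BMY \<Longrightarrow> N \<in> BMY \<Longrightarrow> M ** N \<in> BMY"
  and BMY_commute: "M \<in> BMY \<Longrightarrow> N \<in> BMY \<Longrightarrow> M ** N = N ** M"
proof -
  obtain e where e: "\<And>j. j \<le> w \<Longrightarrow> e j ** e j = e j"
    "\<And>i j. i \<le> w \<Longrightarrow> j \<le> w \<Longrightarrow> i \<noteq> j \<Longrightarrow> e i ** e j = 0" "BMY = cm.span (e ` {..w})"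
    using exists_idempotents by metis
  have *: "(\<Sum>i\<le>w. cscale (p i) (e i)) ** (\<Sum>i\<le>w. cscale (r i) (e i)) = (\<Sum>i\<le>w. cscale (p i * r i) (e i))" for p r
  proof -
    have "cscale (p i) (e i) ** (\<Sum>j\<le>w. cscale (r j) (e j)) = cscale (p i * r i) (e i)" if "i \<le> w" for i
    proof -
      have "cscale (p i) (e i) ** (\<Sum>j\<le>w. cscale (r j) (e j)) = (\<Sum>j\<le>w. if j = i then cscale (p i * r i) (e i) else 0)"
        unfolding matrix_mult_sum cscale_mult_right cscale_mult_left using e that
        by (intro sum.cong) (auto simp: mult.commute)
      then show ?thesis using that by simp
    qed
    then show ?thesis by (simp add: sum_matrix_mult)
  qed
  show "M \<in> BMY \<Longrightarrow> N \<in> BMY \<Longrightarrow> M ** N \<in> BMY" "M \<in> BMY \<Longrightarrow> N \<in> BMY \<Longrightarrow> M ** N = N ** M"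
    unfolding e(3) by (auto simp: cm.in_span_image_iff * mult.commute)
qed

end

locale descendent_scheme = narrow_subset X dl d b c E Y w ws
  for X :: "'v::finite set" and dl d b c E Y w ws +
  fixes E' :: "nat \<Rightarrow> complex ^ 'v ^ 'v"
  assumes E'_bij: "bij_betw E' {..w} (primitive_idempotents (**) 0 BMY)"
    and E'_span: "i \<le> w \<Longrightarrow> cm.span (E' ` {..i}) = V i"
begin

section \<open>The given ordering of the induced idempotents\<close>

lemma E'_prim: "i \<le> w \<Longrightarrow> E' i \<in> primitive_idempotents (**) 0 BMY"
  using bij_betwE[OF E'_bij] by blast

lemma E'_BMY: "i \<le> w \<Longrightarrow> E' i \<in> BMY" and E'_nz: "i \<le> w \<Longrightarrow> E' i \<noteq> 0"
  and E'_idem: "i \<le> w \<Longrightarrow> E' i ** E' i = E' i"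
  using E'_prim[of i] by (auto simp: primitive_idempotents_def)

lemma E'_orth:
  assumes "i \<le> w" "j \<le> w" "i \<noteq> j"
  shows "E' i ** E' j = 0"
proof -
  have "E' i \<noteq> E' j" using E'_bij assms unfolding bij_betw_def inj_on_def by auto
  then show ?thesis
    using primitive_idempotents_orthogonal[OF BMY_mult_closed BMY_commute E'_prim E'_prim] assms
    by (metis (no_types))
qed

lemma E'_independent: "cm.independent_family E' {..w}"
  by (rule orthogonal_idempotents_independent) (auto simp: E'_nz E'_idem E'_orth)

lemma BMY_eq_span_E': "BMY = cm.span (E' ` {..w})"
proof
  have "card (sA ` {..w}) \<le> card {..w}" by (rule card_image_le) simp
  then show "BMY \<subseteq> cm.span (E' ` {..w})"
    using cm.independent_family_spans[OF E'_independent, of "sA ` {..w}"] E'_BMY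
    unfolding BMY_eq_span by auto
  show "cm.span (E' ` {..w}) \<subseteq> BMY"
    using E'_BMY by (intro cm.span_minimal BMY_subspace) auto
qed

lemma BMY_cases_E':
  assumes "M \<in> BMY"
  obtains a where "M = (\<Sum>j\<le>w. cscale (a j) (E' j))"
  using assms unfolding BMY_eq_span_E' by (auto simp: cm.in_span_image_iff)

lemma mult_E'_sum:
  assumes "i \<le> w"
  shows "(\<Sum>j\<le>w. cscale (a j) (E' j)) ** E' i = cscale (a i) (E' i)"
    "E' i ** (\<Sum>j\<le>w. cscale (a j) (E' j)) = cscale (a i) (E' i)"
proof -
  have "(\<Sum>j\<le>w. cscale (a j) (E' j)) ** E' i = (\<Sum>j\<le>w. if j = i then cscale (a i) (E' i) else 0)"
    unfolding sum_matrix_mult cscale_mult_left using assms by (intro sum.cong) (auto simp: E'_idem E'_orth)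
  then show "(\<Sum>j\<le>w. cscale (a j) (E' j)) ** E' i = cscale (a i) (E' i)" using assms by simp
  have "E' i ** (\<Sum>j\<le>w. cscale (a j) (E' j)) = (\<Sum>j\<le>w. if j = i then cscale (a i) (E' i) else 0)"
    unfolding matrix_mult_sum cscale_mult_right using assms by (intro sum.cong) (auto simp: E'_idem E'_orth)
  then show "E' i ** (\<Sum>j\<le>w. cscale (a j) (E' j)) = cscale (a i) (E' i)" using assms by simp
qed

lemma E'_V: "i \<le> w \<Longrightarrow> E' i \<in> V i"
  using E'_span[of i] cm.span_base[of "E' i" "E' ` {..i}"] by auto

text \<open>Expanded in the idempotents constructed from both filtrations, \<open>E' i\<close> has
  no component at l < i: there \<open>e l\<close> lies in the span of \<open>E' 0\<close>, ...,
  \<open>E' l\<close>, all orthogonal to \<open>E' i\<close>. The remaining components lie in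
  \<open>Vd i\<close>.\<close>

lemma E'_Vd:
  assumes i: "i \<le> w"
  shows "E' i \<in> Vd i"
proof -
  obtain e where e: "\<And>j. j \<le> w \<Longrightarrow> e j \<noteq> 0" "\<And>j. j \<le> w \<Longrightarrow> e j \<in> V j" "\<And>j. j \<le> w \<Longrightarrow> e j \<in> Vd j"
    "\<And>j. j \<le> w \<Longrightarrow> e j ** e j = e j"
    "\<And>i j. i \<le> w \<Longrightarrow> j \<le> w \<Longrightarrow> i \<noteq> j \<Longrightarrow> e i ** e j = 0"
    "BMY = cm.span (e ` {..w})"
    using exists_idempotents[of thesis] by blast
  obtain a where a: "E' i = (\<Sum>j\<le>w. cscale (a j) (e j))"
    using E'_BMY[OF i] unfolding e(6) by (auto simp: cm.in_span_image_iff)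
  have "a l = 0" if "l < i" for l
  proof -
    have l: "l \<le> w" using that i by simp
    have el: "e l \<in> cm.span (E' ` {..l})" using e(2)[OF l] E'_span[OF l] by simp
    have "M ** N = 0" if "M \<in> {E' i}" "N \<in> E' ` {..l}" for M N
      using that \<open>l < i\<close> i by (auto intro!: E'_orth)
    from mult_span_zero[OF this cm.span_base[OF singletonI] el] have "E' i ** e l = 0" .
    moreover have "E' i ** e l = (\<Sum>j\<le>w. if j = l then cscale (a l) (e l) else 0)"
      unfolding a sum_matrix_mult cscale_mult_left using l e by (intro sum.cong) auto
    ultimately show ?thesis using e(1)[OF l] l by simp
  qed
  moreover have "e j \<in> Vd i" if "i \<le> j" "j \<le> w" for j
    by (rule span_image_mono[OF e(3)[OF that(2)]]) (use that in auto)
  ultimately have "cscale (a j) (e j) \<in> Vd i" if "j \<le> w" for j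
    using that by (cases "j < i") (auto intro: cm.span_scale cm.span_zero)
  then show ?thesis unfolding a by (intro cm.span_sum) auto
qed

lemma E'_real: "i \<le> w \<Longrightarrow> cnj_matrix (E' i) = E' i"
  using primitive_idempotent_real[OF BMY_mult_closed BMY_commute cnj_matrix_BMY BMY_symmetric E'_prim]
  by blast

lemma trace_E'_ne_0:
  assumes "i \<le> w"
  shows "trace (E' i) \<noteq> 0"
proof -
  have r: "E' i $ x $ y = of_real (Re (E' i $ x $ y))" for x y
    using E'_real[OF assms] by (metis Reals_cnj_iff cnj_matrix_nth of_real_Re)
  obtain x y where xy: "E' i $ x $ y \<noteq> 0" using E'_nz[OF assms] by (auto simp: cvec_eq_iff)
  have "trace (E' i) = trace (E' i ** E' i)" using E'_idem[OF assms] by simp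
  also have "\<dots> = (\<Sum>x\<in>UNIV. \<Sum>y\<in>UNIV. E' i $ x $ y * E' i $ x $ y)"
    unfolding trace_def matrix_matrix_mult_def using BMY_symmetric[OF E'_BMY[OF assms]] by simp
  also have "\<dots> = (\<Sum>x\<in>UNIV. \<Sum>y\<in>UNIV. of_real ((Re (E' i $ x $ y))\<^sup>2))"
    by (intro sum.cong refl) (metis r of_real_mult power2_eq_square)
  also have "\<dots> = of_real (\<Sum>x\<in>UNIV. \<Sum>y\<in>UNIV. (Re (E' i $ x $ y))\<^sup>2)"
    by (simp only: of_real_sum)
  finally have tr: "trace (E' i) = of_real (\<Sum>x\<in>UNIV. \<Sum>y\<in>UNIV. (Re (E' i $ x $ y))\<^sup>2)" .
  have "Re (E' i $ x $ y) \<noteq> 0" using xy r[of x y] by auto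
  then have "0 < (\<Sum>y\<in>UNIV. (Re (E' i $ x $ y))\<^sup>2)"
    by (intro sum_pos2[of _ y]) auto
  then have "0 < (\<Sum>x\<in>UNIV. \<Sum>y\<in>UNIV. (Re (E' i $ x $ y))\<^sup>2)"
    by (rule sum_pos2[of _ x, rotated 2]) (auto intro: sum_nonneg)
  then show ?thesis unfolding tr of_real_eq_0_iff by simp
qed

lemma sE_0: "sE 0 = cscale (1 / of_nat (card X)) (all_ones Y)"
  using Y_sub by (auto simp: cvec_eq_iff E_0 all_ones_nth)

lemma E'_0: "E' 0 = cscale (1 / of_nat (card Y)) (all_ones Y)"
proof -
  let ?J = "all_ones Y :: complex ^ 'v ^ 'v"
  have "E' 0 \<in> cm.span {sE 0}" using E'_V[of 0] by simp
  then obtain k where "E' 0 = cscale k (sE 0)" by (auto simp: cm.span_singleton)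
  then obtain k where k: "E' 0 = cscale k ?J" unfolding sE_0 by (metis cm.scale_scale)
  have JJ: "?J ** ?J = cscale (of_nat (card Y)) ?J"
  proof -
    have "(\<Sum>z\<in>UNIV. ?J $ x $ z * ?J $ z $ y) = of_nat (card Y) * ?J $ x $ y" for x y
    proof -
      have "(\<Sum>z\<in>UNIV. ?J $ x $ z * ?J $ z $ y) = (\<Sum>z\<in>Y. ?J $ x $ y)"
        by (intro sum.mono_neutral_cong_right) (auto simp: all_ones_nth)
      then show ?thesis by simp
    qed
    then show ?thesis by (simp add: cvec_eq_iff matrix_matrix_mult_def)
  qed
  have "cscale k ?J = cscale (k * k * of_nat (card Y)) ?J"
    using E'_idem[of 0] unfolding k by (simp add: cscale_mult_left cscale_mult_right JJ)
  moreover have "?J \<noteq> 0" using E'_nz[of 0] k by auto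
  ultimately have "k = k * k * of_nat (card Y)" using cm.scale_right_imp_eq by blast
  moreover have "k \<noteq> 0" using E'_nz[of 0] k by auto
  ultimately have "k = 1 / of_nat (card Y)" using Y_ne by (simp add: field_simps)
  then show ?thesis using k by simp
qed

lemma hadamard_all_ones: "M \<in> BMY \<Longrightarrow> all_ones Y \<circ>\<^sub>H M = M"
  using Y_sub by (auto simp: BMY_def cvec_eq_iff all_ones_nth)

text \<open>\<open>V 1\<close> is spanned by the restrictions of E_0 and E_1, the former a multiple
  of the all-ones matrix; with p = 0 the idempotent would be a multiple of
  \<open>E' 0\<close>.\<close>

lemma E'_1_eq:
  obtains p r where "p \<noteq> 0" "E' 1 = cscale p (sE 1) + cscale r (all_ones Y)"
proof -
  have "E' 1 \<in> V 1" using w_pos by (rule E'_V)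
  then obtain a where a: "E' 1 = (\<Sum>i\<le>1. cscale (a i) (sE i))" by (auto simp: cm.in_span_image_iff)
  have "{..1::nat} = {0, 1}" by auto
  then have eq: "E' 1 = cscale (a 1) (sE 1) + cscale (a 0) (sE 0)" unfolding a by (simp add: add.commute)
  have "a 1 \<noteq> 0"
  proof
    assume "a 1 = 0"
    then have "E' 1 \<in> V 0" using eq by (auto intro: cm.span_scale cm.span_base)
    then have "E' 1 \<in> cm.span {E' 0}" using E'_span[of 0] by simp
    then obtain k where "E' 1 = cscale k (E' 0)" by (auto simp: cm.span_singleton)
    then have "E' 1 ** E' 1 = cscale k (E' 0 ** E' 1)" by (simp add: cscale_mult_left)
    then show False using w_pos E'_orth[of 0 1] E'_nz[of 1] by (simp add: E'_idem)
  qed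
  then show ?thesis using that[of "a 1" "a 0 / of_nat (card X)"] eq unfolding sE_0 by simp
qed

section \<open>Krein parameters of the induced scheme\<close>

lemma sE_hadamard_V:
  assumes "M \<in> V m" "m < d"
  shows "sE 1 \<circ>\<^sub>H M \<in> V (Suc m)"
proof -
  obtain a where a: "M = (\<Sum>i\<le>m. cscale (a i) (sE i))" using assms by (auto simp: cm.in_span_image_iff)
  have "sE 1 \<circ>\<^sub>H sE i \<in> V (Suc m)" if "i \<le> m" for i
    unfolding submatrix_on_hadamard[symmetric]
    using submatrix_on_span[OF hadamard_span_E[of "E i" m]] that assms(2) by (auto intro: cm.span_base)
  then show ?thesis unfolding a hadamard_sum_right by (intro cm.span_sum cm.span_scale) auto
qed

text \<open>Up to the factor |Y|, a Krein parameter of the induced scheme: the coefficient of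
  \<open>E' j\<close> in the entrywise product of \<open>E' 1\<close> and
  \<open>E' i\<close>.\<close>

definition T :: "nat \<Rightarrow> nat \<Rightarrow> complex" where
  "T i j = (SOME a. (E' 1 \<circ>\<^sub>H E' i) ** E' j = cscale a (E' j))"

lemma hadamard_BMY: "M \<in> BMY \<Longrightarrow> N \<in> BMY \<Longrightarrow> M \<circ>\<^sub>H N \<in> BMY"
  by (auto simp: BMY_def submatrix_on_hadamard[symmetric] dmat_hadamard)

lemma hadamard_E'_mult:
  assumes "i \<le> w" "j \<le> w"
  shows "(E' 1 \<circ>\<^sub>H E' i) ** E' j = cscale (T i j) (E' j)"
proof -
  have "E' 1 \<circ>\<^sub>H E' i \<in> BMY" using assms w_pos by (intro hadamard_BMY E'_BMY)
  then obtain a where a: "E' 1 \<circ>\<^sub>H E' i = (\<Sum>j\<le>w. cscale (a j) (E' j))" by (rule BMY_cases_E')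
  have "\<exists>a. (E' 1 \<circ>\<^sub>H E' i) ** E' j = cscale a (E' j)"
    unfolding a mult_E'_sum(1)[OF assms(2)] by blast
  then show ?thesis unfolding T_def by (rule someI_ex)
qed

lemma hadamard_E'_sum:
  assumes "i \<le> w"
  shows "E' 1 \<circ>\<^sub>H E' i = (\<Sum>j\<le>w. cscale (T i j) (E' j))"
proof -
  have "E' 1 \<circ>\<^sub>H E' i \<in> BMY" using assms w_pos by (intro hadamard_BMY E'_BMY)
  then obtain a where a: "E' 1 \<circ>\<^sub>H E' i = (\<Sum>j\<le>w. cscale (a j) (E' j))" by (rule BMY_cases_E')
  have "a j = T i j" if "j \<le> w" for j
  proof -
    have "cscale (a j) (E' j) = cscale (T i j) (E' j)"
      using hadamard_E'_mult[OF assms that] unfolding a mult_E'_sum(1)[OF that] .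
    then show ?thesis using E'_nz[OF that] cm.scale_right_imp_eq by blast
  qed
  then show ?thesis unfolding a by (intro sum.cong) auto
qed

text \<open>Both sides are the sum over all entries of the product of \<open>E' 1\<close>,
  \<open>E' i\<close> and \<open>E' j\<close>, which is symmetric in i and j.\<close>

lemma T_trace:
  assumes "i \<le> w" "j \<le> w"
  shows "T i j * trace (E' j) = T j i * trace (E' i)"
proof -
  have *: "T i j * trace (E' j) = (\<Sum>x\<in>UNIV. \<Sum>y\<in>UNIV. E' 1 $ x $ y * E' i $ x $ y * E' j $ x $ y)"
    if "i \<le> w" "j \<le> w" for i j
  proof -
    have "T i j * trace (E' j) = trace ((E' 1 \<circ>\<^sub>H E' i) ** E' j)"
      unfolding hadamard_E'_mult[OF that] by (simp add: trace_def sum_distrib_left)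
    also have "\<dots> = (\<Sum>x\<in>UNIV. \<Sum>y\<in>UNIV. E' 1 $ x $ y * E' i $ x $ y * E' j $ x $ y)"
      unfolding trace_def matrix_matrix_mult_def
      using BMY_symmetric[OF E'_BMY[OF that(2)]] by simp
    finally show ?thesis .
  qed
  show ?thesis unfolding *[OF assms] *[OF assms(2,1)] by (simp add: mult_ac)
qed

text \<open>Entrywise multiplication by E_1 raises the filtration by 1, so the product lies in
  \<open>V (Suc i)\<close>, which is annihilated by \<open>E' j\<close> in \<open>Vd j\<close> once
  j > i + 1.\<close>

lemma T_upper:
  assumes "i \<le> w" "j \<le> w" "Suc i < j"
  shows "T i j = 0"
proof -
  obtain p r where pr: "E' 1 = cscale p (sE 1) + cscale r (all_ones Y)" by (rule E'_1_eq)
  have "E' 1 \<circ>\<^sub>H E' i = cscale p (sE 1 \<circ>\<^sub>H E' i) + cscale r (E' i)"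
    unfolding pr using hadamard_all_ones[OF E'_BMY[OF assms(1)]] by (simp add: cvec_eq_iff algebra_simps)
  moreover have "sE 1 \<circ>\<^sub>H E' i \<in> V (Suc i)"
    using assms w_ws by (intro sE_hadamard_V E'_V) auto
  moreover have "E' i \<in> V (Suc i)"
    by (rule span_image_mono[OF E'_V[OF assms(1)]]) auto
  ultimately have "E' 1 \<circ>\<^sub>H E' i \<in> V (Suc i)"
    by (auto intro!: cm.span_add cm.span_scale)
  then have "(E' 1 \<circ>\<^sub>H E' i) ** E' j = 0"
    using V_mult_Vd(1)[OF _ E'_Vd[OF assms(2)] assms(3)] assms w_ws by auto
  then show ?thesis using hadamard_E'_mult[OF assms(1,2)] E'_nz[OF assms(2)] by simp
qed

lemma T_lower:
  assumes "i \<le> w" "j \<le> w" "Suc j < i"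
  shows "T i j = 0"
  using T_trace[OF assms(1,2)] T_upper[OF assms(2,1,3)] trace_E'_ne_0[OF assms(2)] by simp

text \<open>Otherwise entrywise multiplication by E_1 would keep \<open>E' i\<close>, hence also the
  restriction of E_i, inside \<open>V i\<close>; the three-term relation would then put the
  restriction of E_{i+1} into \<open>V i\<close>, against independence.\<close>

lemma T_Suc_ne_0:
  assumes "i < w"
  shows "T i (Suc i) \<noteq> 0"
proof
  assume z: "T i (Suc i) = 0"
  have i: "i \<le> w" "i < d" using assms w_ws by auto
  obtain p r where p: "p \<noteq> 0" and pr: "E' 1 = cscale p (sE 1) + cscale r (all_ones Y)" by (rule E'_1_eq)
  have Ei: "E' i \<in> V i" by (rule E'_V[OF i(1)])
  have "E' 1 \<circ>\<^sub>H E' i = cscale p (sE 1 \<circ>\<^sub>H E' i) + cscale r (E' i)"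
    unfolding pr using hadamard_all_ones[OF E'_BMY[OF i(1)]] by (simp add: cvec_eq_iff algebra_simps)
  then have eq: "sE 1 \<circ>\<^sub>H E' i = cscale (1 / p) (E' 1 \<circ>\<^sub>H E' i + cscale (- r) (E' i))"
    using p by (simp add: cvec_eq_iff field_simps)
  have "cscale (T i j) (E' j) \<in> V i" if "j \<le> w" for j
  proof (cases "j \<le> i")
    case True
    then show ?thesis
      by (intro cm.span_scale span_image_mono[OF E'_V[OF that]]) auto
  next
    case False
    then have "T i j = 0" using z T_upper[OF i(1) that] by (cases "j = Suc i") auto
    then show ?thesis by (simp add: cm.span_zero)
  qed
  then have "E' 1 \<circ>\<^sub>H E' i \<in> V i" unfolding hadamard_E'_sum[OF i(1)] by (intro cm.span_sum) auto
  then have h: "sE 1 \<circ>\<^sub>H E' i \<in> V i"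
    unfolding eq using Ei by (intro cm.span_scale cm.span_add)
  obtain a where a: "E' i = (\<Sum>l\<le>i. cscale (a l) (sE l))" using Ei by (auto simp: cm.in_span_image_iff)
  have split: "(\<Sum>l\<le>i. cscale (a l) (f l)) = cscale (a i) (f i) + (\<Sum>l<i. cscale (a l) (f l))" for f :: "nat \<Rightarrow> complex ^ 'v ^ 'v"
    by (simp add: lessThan_Suc_atMost[symmetric])
  have low: "(\<Sum>l<i. cscale (a l) (sE 1 \<circ>\<^sub>H sE l)) \<in> V i"
  proof (intro cm.span_sum cm.span_scale)
    fix l assume l: "l \<in> {..<i}"
    have "sE l \<in> V l" by (auto intro: cm.span_base)
    then have "sE 1 \<circ>\<^sub>H sE l \<in> V (Suc l)" using l i by (intro sE_hadamard_V) auto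
    then show "sE 1 \<circ>\<^sub>H sE l \<in> V i" by (rule span_image_mono) (use l in auto)
  qed
  \<comment> \<open>For i > 0 a vanishing top coefficient would put \<open>E' i\<close> into the
    span of the earlier idempotents and make it orthogonal to itself.\<close>
  have "a i \<noteq> 0"
  proof
    assume a0: "a i = 0"
    show False
    proof (cases i)
      case 0
      then show False using a a0 E'_nz[of 0] by simp
    next
      case (Suc m)
      have "E' i = (\<Sum>l<i. cscale (a l) (sE l))" unfolding a split using a0 by simp
      then have "E' i \<in> V m" unfolding Suc lessThan_Suc_atMost
        by (auto intro!: cm.span_sum cm.span_scale intro: cm.span_base)
      then have "E' i \<in> cm.span (E' ` {..m})" using E'_span[of m] i Suc by simp
      moreover have "M ** N = 0" if "M \<in> {E' i}" "N \<in> E' ` {..m}" for M N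
        using that Suc i by (auto intro!: E'_orth)
      ultimately have "E' i ** E' i = 0" using mult_span_zero[OF _ cm.span_base[OF singletonI], of "E' i" "E' ` {..m}" "E' i"]
        by blast
      then show False using E'_idem[OF i(1)] E'_nz[OF i(1)] by simp
    qed
  qed
  have "sE 1 \<circ>\<^sub>H E' i = cscale (a i) (sE 1 \<circ>\<^sub>H sE i) + (\<Sum>l<i. cscale (a l) (sE 1 \<circ>\<^sub>H sE l))"
    unfolding a hadamard_sum_right by (rule split)
  then have "sE 1 \<circ>\<^sub>H sE i = cscale (1 / a i) (sE 1 \<circ>\<^sub>H E' i + cscale (- 1) (\<Sum>l<i. cscale (a l) (sE 1 \<circ>\<^sub>H sE l)))"
    using \<open>a i \<noteq> 0\<close> by simp
  then have h': "sE 1 \<circ>\<^sub>H sE i \<in> V i"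
    using h low by (auto intro!: cm.span_scale cm.span_add cm.span_diff)
  obtain u v s where "u \<noteq> 0" and
    uvs: "\<And>t. t \<le> d \<Longrightarrow> eps (Suc i) t = u * (eps 1 t * eps i t) + v * eps i t + s * eps (i - 1) t"
    using eps_Suc[OF i(2), of thesis] by blast
  have "E (Suc i) = cscale u (E 1 \<circ>\<^sub>H E i) + cscale v (E i) + cscale s (E (i - 1))"
    using i d_pos by (simp add: E_eq dmat_hadamard dmat_scale dmat_add dmat_eq_iff uvs)
  then have "sE (Suc i) = cscale u (sE 1 \<circ>\<^sub>H sE i) + cscale v (sE i) + cscale s (sE (i - 1))"
    by (simp add: submatrix_on_add submatrix_on_cscale submatrix_on_hadamard)
  then have "sE (Suc i) \<in> V i"
    using h' by (auto intro!: cm.span_add cm.span_scale intro: cm.span_base)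
  then obtain g where g: "sE (Suc i) = (\<Sum>l\<le>i. cscale (g l) (sE l))" by (auto simp: cm.in_span_image_iff)
  have "(\<Sum>l\<le>Suc i. cscale (if l = Suc i then - 1 else g l) (sE l)) = 0"
    by (simp add: g)
  moreover have "cm.independent_family sE {..Suc i}"
    by (rule cm.independent_family_subset[OF sE_independent_low]) (use assms in auto)
  ultimately show False
    using cm.independent_familyD[of sE "{..Suc i}" "\<lambda>l. if l = Suc i then - 1 else g l" "Suc i"] by simp
qed

text \<open>The Krein matrix is tridiagonal by \<open>T_upper\<close> and \<open>T_lower\<close>,
  and the trace symmetry transfers nonvanishing from the superdiagonal to the subdiagonal.\<close>

lemma E'_three_term:
  "\<exists>as bs cs :: nat \<Rightarrow> complex. bs w = 0 \<and> cs 0 = 0 \<and>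
     (\<forall>i \<in> {1..w}. bs (i - 1) * cs i \<noteq> 0) \<and>
     (\<forall>i \<le> w. E' 1 \<circ>\<^sub>H E' i = cscale (1 / of_nat (card Y))
        ((if i = 0 then 0 else cscale (bs (i - 1)) (E' (i - 1))) +
         cscale (as i) (E' i) +
         (if i = w then 0 else cscale (cs (i + 1)) (E' (i + 1)))))"
proof -
  let ?n = "of_nat (card Y) :: complex"
  have n: "?n \<noteq> 0" using Y_ne by simp
  define as where "as i = ?n * T i i" for i
  define bs where "bs i = (if i = w then 0 else ?n * T (Suc i) i)" for i
  define cs where "cs i = (if i = 0 then 0 else ?n * T (i - 1) i)" for i
  have T_down: "T (Suc i) i \<noteq> 0" if "i < w" for i
    using T_trace[of "Suc i" i] T_Suc_ne_0[OF that] trace_E'_ne_0[of "Suc i"] trace_E'_ne_0[of i] that by auto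
  have prod: "bs (i - 1) * cs i \<noteq> 0" if i: "i \<in> {1..w}" for i
  proof -
    obtain m where "i = Suc m" using i not0_implies_Suc[of i] by auto
    moreover from this have "m < w" using i by simp
    ultimately show ?thesis using T_down[of m] T_Suc_ne_0[of m] n by (simp add: bs_def cs_def)
  qed
  have tt: "E' 1 \<circ>\<^sub>H E' i = cscale (1 / ?n)
        ((if i = 0 then 0 else cscale (bs (i - 1)) (E' (i - 1))) +
         cscale (as i) (E' i) +
         (if i = w then 0 else cscale (cs (i + 1)) (E' (i + 1))))" if i: "i \<le> w" for i
  proof -
    have "E' 1 \<circ>\<^sub>H E' i = (\<Sum>j\<in>{j. j \<le> w \<and> j \<le> Suc i \<and> i \<le> Suc j}. cscale (T i j) (E' j))"
      unfolding hadamard_E'_sum[OF i]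
    proof (intro sum.mono_neutral_right ballI)
      fix j assume "j \<in> {..w} - {j. j \<le> w \<and> j \<le> Suc i \<and> i \<le> Suc j}"
      then have "j \<le> w" "Suc i < j \<or> Suc j < i" by auto
      then have "T i j = 0" using T_upper[OF i] T_lower[OF i] by blast
      then show "cscale (T i j) (E' j) = 0" by simp
    qed auto
    also have "\<dots> = (if i = 0 then 0 else cscale (T i (i - 1)) (E' (i - 1))) + cscale (T i i) (E' i) +
         (if i = w then 0 else cscale (T i (Suc i)) (E' (Suc i)))"
    proof -
      have "{j. j \<le> w \<and> j \<le> Suc i \<and> i \<le> Suc j} =
          (if i = 0 then {} else {i - 1}) \<union> ({i} \<union> (if i = w then {} else {Suc i}))"
        using i by auto
      then show ?thesis by auto
    qed
    also have "\<dots> = cscale (1 / ?n)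
        ((if i = 0 then 0 else cscale (bs (i - 1)) (E' (i - 1))) + cscale (as i) (E' i) +
         (if i = w then 0 else cscale (cs (i + 1)) (E' (i + 1))))"
      using n i by (auto simp: bs_def as_def cs_def cm.scale_right_distrib)
    finally show ?thesis .
  qed
  have "bs w = 0 \<and> cs 0 = 0" by (simp add: bs_def cs_def)
  then show ?thesis using prod tt by blast
qed

text \<open>E_i annihilates the restriction of E_l unless |i - l| <= w*. Membership of
  \<open>E' j\<close> in \<open>Vd j\<close> settles the case i < j, membership in
  \<open>V j\<close> the case i > j + w*.\<close>

lemma E_mult_E'_eq_0:
  assumes "i \<le> d" "j \<le> w" "i < j \<or> i > j + ws"
  shows "E i ** E' j = 0"
proof -
  have zero: "E i ** sE l = 0" if "l \<le> d" "i > l + ws \<or> l > i + ws" for l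
  proof -
    have "E i ** sE l = (E i ** IY ** E l) ** IY" unfolding submatrix_on_eq by (simp add: matrix_mul_assoc)
    then show ?thesis using E_IY_E[OF assms(1) that] by simp
  qed
  from assms(3) show ?thesis
  proof
    assume "i < j"
    then have "M ** N = 0" if "M \<in> {E i}" "N \<in> sE ` {ws + j..d}" for M N
      using that zero by auto
    from mult_span_zero[OF this cm.span_base[OF singletonI] E'_Vd[OF assms(2)]] show ?thesis .
  next
    assume "i > j + ws"
    then have "M ** N = 0" if "M \<in> {E i}" "N \<in> sE ` {..j}" for M N
      using that zero assms by auto
    from mult_span_zero[OF this cm.span_base[OF singletonI] E'_V[OF assms(2)]] show ?thesis .
  qed
qed

end

section \<open>Neighbour counts inside Y\<close>

context descendent_scheme
begin

definition eps' :: "nat \<Rightarrow> nat \<Rightarrow> complex" where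
  "eps' j = (SOME f. E' j = sdmat f)"

lemma E'_eq: "j \<le> w \<Longrightarrow> E' j = sdmat (eps' j)"
  using someI_ex[of "\<lambda>f. E' j = sdmat f"] E'_BMY[of j] unfolding eps'_def BMY_def by blast

definition th' :: "nat \<Rightarrow> complex" where
  "th' j = (SOME a. sA 1 ** E' j = cscale a (E' j))"

lemma sA_1_mult_E': 
  assumes "j \<le> w"
  shows "sA 1 ** E' j = cscale (th' j) (E' j)"
proof -
  obtain a where a: "sA 1 = (\<Sum>j\<le>w. cscale (a j) (E' j))" using BMY_cases_E'[OF sA_in_BMY] by blast
  have "sA 1 ** E' j = cscale (a j) (E' j)"
    using mult_E'_sum(1)[OF assms, of a] unfolding a[symmetric] .
  then have "\<exists>a. sA 1 ** E' j = cscale a (E' j)" by blast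
  then show ?thesis unfolding th'_def by (rule someI_ex)
qed

lemma dl_Y_sym: "x \<in> Y \<Longrightarrow> y \<in> Y \<Longrightarrow> dl x y = dl y x"
  using Y_sub dl_sym by blast

lemma dl_Y_refl: "y \<in> Y \<Longrightarrow> dl y y = 0"
  using Y_sub dl_0 by blast

definition NY :: "'v \<Rightarrow> 'v set" where
  "NY y = {z \<in> Y. dl y z = 1}"

lemma sA_mult_nth:
  assumes "x \<in> Y" "y \<in> Y"
  shows "(sA 1 ** sdmat f) $ y $ x = (\<Sum>z\<in>NY y. f (dl x z))"
  unfolding matrix_matrix_mult_def Am_def sdmat_nth vec_lambda_beta
  using assms Y_sub dl_sym by (intro sum.mono_neutral_cong_right) (auto simp: NY_def subset_iff)

lemma sum_NY_eps':
  assumes "x \<in> Y" "y \<in> Y" "j \<le> w"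
  shows "(\<Sum>z\<in>NY y. eps' j (dl x z)) = th' j * eps' j (dl x y)"
proof -
  have "(\<Sum>z\<in>NY y. eps' j (dl x z)) = (sA 1 ** E' j) $ y $ x"
    using sA_mult_nth[OF assms(1,2)] E'_eq[OF assms(3)] by simp
  also have "\<dots> = th' j * E' j $ y $ x" unfolding sA_1_mult_E'[OF assms(3)] by simp
  also have "E' j $ y $ x = eps' j (dl x y)"
    unfolding E'_eq[OF assms(3)] sdmat_nth using assms dl_Y_sym[of x y] by auto
  finally show ?thesis .
qed

lemma th'_0:
  assumes "y \<in> Y"
  shows "th' 0 = of_nat (card (NY y))"
proof -
  have "sdmat (eps' 0) = sdmat (\<lambda>_. 1 / of_nat (card Y))"
    unfolding E'_eq[of 0, symmetric, simplified] E'_0 using Y_sub by (auto simp: cvec_eq_iff all_ones_nth dmat_nth)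
  then have e: "eps' 0 t = 1 / of_nat (card Y)" if "t \<le> w" for t using that by (simp add: sdmat_eq_iff)
  have "(\<Sum>z\<in>NY y. eps' 0 (dl y z)) = of_nat (card (NY y)) * (1 / of_nat (card Y))"
    using e[OF w_pos] by (simp add: NY_def)
  moreover have "eps' 0 (dl y y) = 1 / of_nat (card Y)" using e dl_Y assms by simp
  ultimately show ?thesis using sum_NY_eps'[OF assms assms, of 0] Y_ne by simp
qed

definition up :: "'v \<Rightarrow> 'v \<Rightarrow> nat" where
  "up x y = card {z \<in> Y. dl y z = 1 \<and> dl x z = dl x y + 1}"

definition down :: "'v \<Rightarrow> 'v \<Rightarrow> nat" where
  "down x y = card {z \<in> Y. dl y z = 1 \<and> dl x z + 1 = dl x y}"

text \<open>Written with differences to the value at y, so that the neighbours at the same distance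
  from x drop out and only \<open>down\<close> and \<open>up\<close> remain; \<open>th' 0\<close> is
  the valency inside Y.\<close>

lemma sum_NY:
  assumes "x \<in> Y" "y \<in> Y"
  shows "(\<Sum>z\<in>NY y. f (dl x z)) = of_nat (down x y) * (f (dl x y - 1) - f (dl x y))
    + of_nat (up x y) * (f (dl x y + 1) - f (dl x y)) + th' 0 * (f (dl x y) :: complex)"
proof -
  let ?i = "dl x y"
  let ?U = "{z \<in> Y. dl y z = 1 \<and> dl x z = ?i + 1}"
  let ?D = "{z \<in> Y. dl y z = 1 \<and> dl x z + 1 = ?i}"
  have sub: "?U \<subseteq> NY y" "?D \<subseteq> NY y" "?U \<inter> ?D = {}" by (auto simp: NY_def)
  have rest: "dl x z = ?i" if "z \<in> NY y" "z \<notin> ?U" "z \<notin> ?D" for z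
  proof -
    have "dl x z \<le> ?i + 1" using dl_step[of x y z] assms that Y_sub by (auto simp: NY_def)
    moreover have "?i \<le> dl x z + 1"
      using dl_step[of x z y] assms that Y_sub dl_sym[of y z] by (auto simp: NY_def)
    ultimately show ?thesis using that by (auto simp: NY_def)
  qed
  have "(\<Sum>z\<in>NY y. f (dl x z) - f ?i) = (\<Sum>z\<in>?U \<union> ?D. f (dl x z) - f ?i)"
  proof (intro sum.mono_neutral_right ballI)
    fix z assume "z \<in> NY y - (?U \<union> ?D)"
    then have "dl x z = ?i" using rest[of z] by blast
    then show "f (dl x z) - f ?i = 0" by simp
  qed (use sub in auto)
  also have "\<dots> = (\<Sum>z\<in>?U. f (dl x z) - f ?i) + (\<Sum>z\<in>?D. f (dl x z) - f ?i)"
    using sub by (intro sum.union_disjoint) auto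
  also have "(\<Sum>z\<in>?U. f (dl x z) - f ?i) = of_nat (up x y) * (f (?i + 1) - f ?i)"
    by (simp add: up_def)
  also have "(\<Sum>z\<in>?D. f (dl x z) - f ?i) = (\<Sum>z\<in>?D. f (?i - 1) - f ?i)"
    by (intro sum.cong refl) (auto intro!: arg_cong[of _ _ f])
  also have "\<dots> = of_nat (down x y) * (f (?i - 1) - f ?i)" by (simp add: down_def)
  finally show ?thesis using th'_0[OF assms(2)] by (simp add: sum_subtractf algebra_simps)
qed

lemma down_1:
  assumes "x \<in> Y" "y \<in> Y" "dl x y = 1"
  shows "down x y = 1"
proof -
  have "{z \<in> Y. dl y z = 1 \<and> dl x z + 1 = dl x y} = {x}"
    using assms dl_0[of x] dl_sym[of x y] Y_sub by auto
  then show ?thesis by (simp add: down_def)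
qed

lemma down_0: "dl x y = 0 \<Longrightarrow> down x y = 0"
  by (simp add: down_def)

lemma up_0:
  assumes "y \<in> Y"
  shows "of_nat (up y y) = th' 0"
proof -
  have "{z \<in> Y. dl y z = 1 \<and> dl y z = dl y y + 1} = NY y"
    using assms dl_0[of y y] Y_sub by (auto simp: NY_def)
  then show ?thesis using th'_0[OF assms] by (simp add: up_def)
qed

lemma th'_0_ne_0: "th' 0 \<noteq> 0"
proof -
  obtain x y where xy: "x \<in> Y" "y \<in> Y" "dl x y = 1" using exists_pair_Y[OF w_pos] by blast
  then have "y \<in> NY x" by (simp add: NY_def)
  then show ?thesis using th'_0[OF xy(1)] by (auto simp: NY_def)
qed

text \<open>\<open>sig\<close> is the cosine sequence of \<open>E d\<close>, \<open>ts\<close> the dual eigenvalue sequence \<open>\<theta>*\<close>.\<close>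

definition sig :: "nat \<Rightarrow> complex" where
  "sig t = eps d t / eps d 0"

definition ts :: "nat \<Rightarrow> complex" where
  "ts t = of_nat (card X) * eps 1 t"

lemma sig_0: "sig 0 = 1"
  using eps_0_ne_0[of d] by (simp add: sig_def)

lemma sig_1_ne_1: "sig 1 \<noteq> 1"
proof
  assume "sig 1 = 1"
  then have "eps d 1 = eps d 0" using eps_0_ne_0[of d] by (simp add: sig_def)
  then have "th d = th 0" using valency_mult_eps_1[of d] th_0 eps_0_ne_0[of d] by simp
  then show False using th_inj[of d 0] d_pos by simp
qed

lemma ts_inj: "ts i = ts j \<Longrightarrow> i \<le> d \<Longrightarrow> j \<le> d \<Longrightarrow> i = j"
  using eps_1_inj[of i j] card_X_ne_0 by (simp add: ts_def)

lemma sum_NY_sig: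
  assumes "x \<in> Y" "y \<in> Y"
  shows "(\<Sum>z\<in>NY y. sig (dl x z)) = th' w * sig (dl x y)"
proof -
  have "E' w \<in> cm.span {sE d}" using E'_Vd[of w] w_ws by (simp add: add.commute)
  then obtain k where k: "E' w = cscale k (sE d)" by (auto simp: cm.span_singleton)
  then have k0: "k \<noteq> 0" using E'_nz[of w] by auto
  have "sdmat (eps' w) = sdmat (\<lambda>t. k * eps d t)"
    using k E'_eq[of w] by (simp add: E_eq dmat_scale flip: submatrix_on_cscale)
  then have e: "eps' w t = k * eps d 0 * sig t" if "t \<le> w" for t
    using that eps_0_ne_0[of d] by (simp add: sdmat_eq_iff sig_def)
  have "(\<Sum>z\<in>NY y. eps' w (dl x z)) = k * eps d 0 * (\<Sum>z\<in>NY y. sig (dl x z))"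
    unfolding sum_distrib_left using e dl_Y assms by (intro sum.cong) (auto simp: NY_def)
  then show ?thesis using sum_NY_eps'[OF assms, of w] e[of "dl x y"] dl_Y[OF assms] k0 eps_0_ne_0[of d] by simp
qed

lemma th'_w: "th' w = th' 0 * sig 1"
proof -
  obtain y where y: "y \<in> Y" using Y_ne by blast
  then have "dl y y = 0" using dl_0[of y y] Y_sub by auto
  moreover have "(\<Sum>z\<in>NY y. sig (dl y z)) = of_nat (card (NY y)) * sig 1" by (simp add: NY_def)
  ultimately show ?thesis using sum_NY_sig[OF y y] th'_0[OF y] by (simp add: sig_0)
qed

lemma sig_eq:
  assumes "x \<in> Y" "y \<in> Y"
  shows "of_nat (down x y) * (sig (dl x y - 1) - sig (dl x y)) + of_nat (up x y) * (sig (dl x y + 1) - sig (dl x y))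
    = th' 0 * (sig 1 - 1) * sig (dl x y)"
  using sum_NY_sig[OF assms] sum_NY[OF assms, of sig] th'_w by (simp add: algebra_simps)

text \<open>The eigenvector equation of \<open>E' 1\<close>, whose entries are q times the dual
  eigenvalues plus a constant r. The pair of a vertex with itself gives a further equation by which
  r is eliminated.\<close>

lemma ts_eq:
  assumes "x \<in> Y" "y \<in> Y"
  shows "of_nat (down x y) * (ts (dl x y - 1) - ts (dl x y)) + of_nat (up x y) * (ts (dl x y + 1) - ts (dl x y))
    = (th' 1 - th' 0) * (ts (dl x y) - ts 0) + th' 0 * (ts 1 - ts 0)"
proof -
  obtain p r where p: "p \<noteq> 0" and pr: "E' 1 = cscale p (sE 1) + cscale r (all_ones Y)" by (rule E'_1_eq)
  define g where "g t = p / of_nat (card X) * ts t + r" for t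
  have "sdmat (eps' 1) = sdmat g"
    using pr E'_eq[of 1] w_pos d_pos Y_sub card_X_ne_0
    by (auto simp: cvec_eq_iff E_eq dmat_nth all_ones_nth g_def ts_def)
  then have e: "eps' 1 t = g t" if "t \<le> w" for t using that by (simp add: sdmat_eq_iff)
  have "(\<Sum>z\<in>NY y. eps' 1 (dl x z)) = (\<Sum>z\<in>NY y. g (dl x z))" if "x \<in> Y" "y \<in> Y" for x y
    using e dl_Y that by (intro sum.cong) (auto simp: NY_def)
  then have *: "of_nat (down x y) * (g (dl x y - 1) - g (dl x y)) + of_nat (up x y) * (g (dl x y + 1) - g (dl x y))
     + th' 0 * g (dl x y) = th' 1 * g (dl x y)" if "x \<in> Y" "y \<in> Y" for x y
    using sum_NY_eps'[OF that, of 1] sum_NY[OF that, of g] e[of "dl x y"] dl_Y[OF that] w_pos that by simp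
  obtain y0 where y0: "y0 \<in> Y" using Y_ne by blast
  then have d0: "dl y0 y0 = 0" using dl_0[of y0 y0] Y_sub by auto
  define q where "q = p / of_nat (card X)"
  have q: "q \<noteq> 0" using p card_X_ne_0 by (simp add: q_def)
  have g: "g t = q * ts t + r" for t by (simp add: g_def q_def)
  have 0: "th' 0 * (q * (ts 1 - ts 0)) = (th' 1 - th' 0) * (q * ts 0 + r)"
    using *[OF y0 y0] up_0[OF y0] unfolding g d0 by (simp add: down_0 d0 algebra_simps)
  define A where "A = of_nat (down x y) * (ts (dl x y - 1) - ts (dl x y)) + of_nat (up x y) * (ts (dl x y + 1) - ts (dl x y))"
  have "q * A = (th' 1 - th' 0) * (q * ts (dl x y) + r)"
    using *[OF assms] unfolding g A_def by (simp add: algebra_simps)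
  also have "\<dots> = (th' 1 - th' 0) * q * (ts (dl x y) - ts 0) + (th' 1 - th' 0) * (q * ts 0 + r)"
    by (simp add: algebra_simps)
  also have "\<dots> = q * ((th' 1 - th' 0) * (ts (dl x y) - ts 0) + th' 0 * (ts 1 - ts 0))"
    unfolding 0[symmetric] by (simp add: algebra_simps)
  finally show ?thesis using q unfolding A_def by simp
qed

text \<open>The condition on \<open>j\<close> for a pair at distance \<open>j\<close> without neighbours at distance \<open>j + 1\<close>
  inside \<open>Y\<close>, obtained by eliminating \<open>down\<close> from \<open>sig_eq\<close> and \<open>ts_eq\<close>.\<close>

definition terminal :: "nat \<Rightarrow> bool" where
  "terminal j \<longleftrightarrow> th' 0 * (ts (j - 1) - ts j) * (sig 1 - 1) * sig j
     = (sig (j - 1) - sig j) * ((th' 1 - th' 0) * (ts j - ts 0) + th' 0 * (ts 1 - ts 0))"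

lemma terminal_if_up_0:
  assumes "x \<in> Y" "y \<in> Y" "up x y = 0"
  shows "terminal (dl x y)"
proof -
  have "of_nat (down x y) * (sig (dl x y - 1) - sig (dl x y)) = th' 0 * (sig 1 - 1) * sig (dl x y)"
    using sig_eq[OF assms(1,2)] assms(3) by simp
  moreover have "of_nat (down x y) * (ts (dl x y - 1) - ts (dl x y)) =
      (th' 1 - th' 0) * (ts (dl x y) - ts 0) + th' 0 * (ts 1 - ts 0)"
    using ts_eq[OF assms(1,2)] assms(3) by simp
  moreover have "p * (ts (dl x y - 1) - ts (dl x y)) * q * r = a * b'"
    if "n * a = p * q * r" "n * (ts (dl x y - 1) - ts (dl x y)) = b'" for n a b' p q r
  proof -
    have "p * (ts (dl x y - 1) - ts (dl x y)) * q * r = (ts (dl x y - 1) - ts (dl x y)) * (p * q * r)"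
      by (simp add: mult_ac)
    also have "\<dots> = a * (n * (ts (dl x y - 1) - ts (dl x y)))" unfolding that(1)[symmetric] by (simp add: mult_ac)
    finally show ?thesis unfolding that(2) .
  qed
  ultimately show ?thesis unfolding terminal_def by blast
qed

lemma terminal_w: "terminal w"
proof -
  obtain x y where xy: "x \<in> Y" "y \<in> Y" "dl x y = w" using exists_pair_Y[OF order.refl] by blast
  have "dl x z \<noteq> dl x y + 1" if "z \<in> Y" for z using dl_Y[OF xy(1) that] xy(3) by simp
  then have "{z \<in> Y. dl y z = 1 \<and> dl x z = dl x y + 1} = {}" by blast
  then have "up x y = 0" unfolding up_def by (simp only: card.empty)
  then show ?thesis using terminal_if_up_0[OF xy(1,2)] xy(3) by simp
qed

text \<open>The entry of the product of \<open>sA 1\<close> and \<open>sA m\<close> at (y, x) is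
  this number, and the product lies in the algebra of the induced scheme, so it depends on the
  distance only.\<close>

lemma card_NY_dist:
  assumes "x \<in> Y" "y \<in> Y" "x' \<in> Y" "y' \<in> Y" "dl x y = dl x' y'"
  shows "card {z \<in> Y. dl y z = 1 \<and> dl x z = m} = card {z \<in> Y. dl y' z = 1 \<and> dl x' z = m}"
proof -
  have "sA 1 ** sA m \<in> BMY" by (intro BMY_mult_closed) auto
  then obtain f where f: "sA 1 ** sA m = sdmat f" by (auto simp: BMY_def)
  have *: "of_nat (card {z \<in> Y. dl y z = 1 \<and> dl x z = m}) = f (dl x y)" if "x \<in> Y" "y \<in> Y" for x y
  proof -
    have "f (dl x y) = (sA 1 ** sA m) $ y $ x"
      unfolding f sdmat_nth using that dl_Y_sym[of x y] by simp
    also have "\<dots> = (\<Sum>z\<in>NY y. of_bool (dl x z = m))"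
      unfolding Am_def[of m] by (rule sA_mult_nth[OF that])
    also have "\<dots> = of_nat (card ({z \<in> NY y. dl x z = m}))"
      by (simp add: sum.If_cases of_bool_def Int_def NY_def)
    also have "{z \<in> NY y. dl x z = m} = {z \<in> Y. dl y z = 1 \<and> dl x z = m}" by (auto simp: NY_def)
    finally show ?thesis by simp
  qed
  have "(of_nat (card {z \<in> Y. dl y z = 1 \<and> dl x z = m}) :: complex) = of_nat (card {z \<in> Y. dl y' z = 1 \<and> dl x' z = m})"
    using *[OF assms(1,2)] *[OF assms(3,4)] assms(5) by simp
  then show ?thesis by (simp only: of_nat_eq_iff)
qed

text \<open>Any two vertices of Y are joined by a shortest path of the big graph that stays inside
  Y. This is shown to be equivalent to connectedness of the induced subgraph.\<close>

definition geodetic :: bool where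
  "geodetic \<longleftrightarrow> (\<forall>x\<in>Y. \<forall>y\<in>Y. 0 < dl x y \<longrightarrow> (\<exists>z\<in>Y. dl y z = 1 \<and> dl x z + 1 = dl x y))"

text \<open>One pair at distance i without a closer neighbour inside Y suffices: the number of such
  neighbours depends on i only, so no edge of Y joins distances i - 1 and i from any x. Distance 1
  cannot be affected, as x itself is the closer neighbour.\<close>

lemma not_geodetic_cut:
  assumes "\<not> geodetic"
  obtains i where "2 \<le> i" "i \<le> w" "\<And>x y z. x \<in> Y \<Longrightarrow> y \<in> Y \<Longrightarrow> z \<in> Y \<Longrightarrow> dl x y = i - 1 \<Longrightarrow> dl y z = 1 \<Longrightarrow> dl x z \<noteq> i"
proof -
  obtain x0 y0 where xy: "x0 \<in> Y" "y0 \<in> Y" "0 < dl x0 y0"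
    and none: "\<And>z. z \<in> Y \<Longrightarrow> dl y0 z = 1 \<Longrightarrow> dl x0 z + 1 \<noteq> dl x0 y0"
    using assms unfolding geodetic_def by blast
  define i where "i = dl x0 y0"
  have "i \<noteq> 1"
  proof
    assume "i = 1"
    then show False using none[OF xy(1)] dl_Y_refl[OF xy(1)] dl_Y_sym[OF xy(1,2)] by (simp add: i_def)
  qed
  then have "2 \<le> i" using xy(3) by (simp add: i_def)
  moreover have "i \<le> w" using dl_Y xy by (simp add: i_def)
  moreover have "dl x z \<noteq> i" if "x \<in> Y" "y \<in> Y" "z \<in> Y" "dl x y = i - 1" "dl y z = 1" for x y z
  proof
    assume iz: "dl x z = i"
    have "card {u \<in> Y. dl z u = 1 \<and> dl x u = i - 1} = card {u \<in> Y. dl y0 u = 1 \<and> dl x0 u = i - 1}"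
      using that xy iz by (intro card_NY_dist) (auto simp: i_def)
    also have "{u \<in> Y. dl y0 u = 1 \<and> dl x0 u = i - 1} = {}" using none \<open>2 \<le> i\<close> by (force simp: i_def)
    finally have "{u \<in> Y. dl z u = 1 \<and> dl x u = i - 1} = {}" by simp
    moreover have "dl z y = 1" using that Y_sub dl_sym[of y z] by auto
    ultimately show False using that by blast
  qed
  ultimately show ?thesis using that by blast
qed

lemma not_geodetic_terminal:
  assumes "\<not> geodetic"
  obtains j where "1 \<le> j" "j < w" "terminal j"
proof -
  obtain i where i: "2 \<le> i" "i \<le> w"
    and cut: "\<And>x y z. x \<in> Y \<Longrightarrow> y \<in> Y \<Longrightarrow> z \<in> Y \<Longrightarrow> dl x y = i - 1 \<Longrightarrow> dl y z = 1 \<Longrightarrow> dl x z \<noteq> i"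
    using not_geodetic_cut[OF assms, of thesis] by blast
  have "i - 1 \<le> w" using i by simp
  then obtain x y where xy: "x \<in> Y" "y \<in> Y" "dl x y = i - 1" using exists_pair_Y by blast
  have "up x y = 0" using cut[OF xy(1,2) _ xy(3)] xy(3) i by (auto simp: up_def card_eq_0_iff)
  then have "terminal (i - 1)" using terminal_if_up_0[OF xy(1,2)] xy(3) by simp
  then show ?thesis using that[of "i - 1"] i by simp
qed

text \<open>If \<open>sig 1 = sig 2\<close>, then \<open>sig 1\<close> is minus the reciprocal of the valency both for \<open>X\<close> and
  for \<open>Y\<close>, so no edge leaves \<open>Y\<close>.\<close>

lemma sig_1_ne_sig_2: "sig 1 \<noteq> sig 2"
proof
  assume eq: "sig 1 = sig 2"
  obtain x y where xy: "x \<in> Y" "y \<in> Y" "dl x y = 1" using exists_pair_Y[OF w_pos] by blast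
  \<comment> \<open>At distance 1 the term of \<open>up\<close> disappears, since its factor is
    \<open>sig 2 - sig 1\<close>.\<close>
  have "1 - sig 1 = th' 0 * (sig 1 - 1) * sig 1"
    using sig_eq[OF xy(1,2)] down_1[OF xy] unfolding xy(3) by (simp add: sig_0 numeral_2_eq_2[symmetric] eq)
  moreover have "(1 - sig 1) * (1 + th' 0 * sig 1) = (1 - sig 1) - th' 0 * (sig 1 - 1) * sig 1"
    by (simp add: algebra_simps)
  ultimately have "1 + th' 0 * sig 1 = 0" using sig_1_ne_1 by auto
  then have k': "th' 0 * sig 1 = - 1" by (simp add: eq_neg_iff_add_eq_0 add.commute)
  have c1: "c 1 = 1"
  proof -
    have "{z \<in> X. dl y z = 1 \<and> dl x z + 1 = dl x y} = {x}"
      using xy dl_0[of x] dl_sym[of x y] Y_sub by auto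
    then show ?thesis using card_c[of x y] xy Y_sub by (auto simp flip: One_nat_def)
  qed
  have thd: "th d = of_nat (b 0) * sig 1"
    using valency_mult_eps_1[of d] eps_0_ne_0[of d] by (simp add: sig_def field_simps)
  have "shift (eps d) 1 = th d * eps d 1" using d_pos by (intro shift_eps) auto
  then have "eps d 0 + (of_nat (b 0) - of_nat (b 1) - 1) * eps d 1 + of_nat (b 1) * eps d 2 = th d * eps d 1"
    by (simp add: shift_def c1)
  then have "(eps d 0 + (of_nat (b 0) - of_nat (b 1) - 1) * eps d 1 + of_nat (b 1) * eps d 2) / eps d 0 = th d * eps d 1 / eps d 0"
    by simp
  then have "1 + (of_nat (b 0) - of_nat (b 1) - 1) * sig 1 + of_nat (b 1) * sig 2 = th d * sig 1"
    using eps_0_ne_0[of d] by (simp add: sig_def add_divide_distrib)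
  moreover have "(1 - sig 1) * (1 + of_nat (b 0) * sig 1)
      = (1 + (of_nat (b 0) - of_nat (b 1) - 1) * sig 1 + of_nat (b 1) * sig 2) - th d * sig 1"
    unfolding thd eq[symmetric] by (simp add: algebra_simps)
  ultimately have "1 + of_nat (b 0) * sig 1 = 0" using sig_1_ne_1 by auto
  then have "of_nat (b 0) * sig 1 = - 1" by (simp add: eq_neg_iff_add_eq_0 add.commute)
  then have "th' 0 * sig 1 = of_nat (b 0) * sig 1" "sig 1 \<noteq> 0" using k' by auto
  then have th'b: "th' 0 = of_nat (b 0)" by simp
  have closed: "z \<in> Y" if "u \<in> Y" "z \<in> X" "dl u z = 1" for u z
  proof -
    have "card (NY u) = b 0" using th'_0[OF that(1)] th'b by (metis of_nat_eq_iff)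
    then have "card (NY u) = card {z \<in> X. dl u z = 1}" using valency[of u] that Y_sub by auto
    moreover have "NY u \<subseteq> {z \<in> X. dl u z = 1}" using Y_sub by (auto simp: NY_def)
    ultimately have "NY u = {z \<in> X. dl u z = 1}" by (intro card_subset_eq) auto
    then have "z \<in> NY u" using that by simp
    then show ?thesis by (simp add: NY_def)
  qed
  have all: "z \<in> Y" if "z \<in> X" "dl x z = n" for z n
    using that
  proof (induction n arbitrary: z)
    case 0
    then show ?case using dl_0[of x z] xy Y_sub by auto
  next
    case (Suc n)
    have xX: "x \<in> X" using xy Y_sub by auto
    have "card {u \<in> X. dl z u = 1 \<and> dl x u + 1 = dl x z} > 0"
      using card_c[OF xX Suc.prems(1)] c_pos[of "dl x z"] Suc.prems dl_le[OF xX Suc.prems(1)] by simp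
    then obtain u where u: "u \<in> X" "dl z u = 1" "dl x u + 1 = dl x z" by (auto simp: card_gt_0_iff)
    then have "u \<in> Y" using Suc by auto
    moreover have "dl u z = 1" using u Suc.prems dl_sym[of u z] by auto
    ultimately show ?case using closed Suc.prems by auto
  qed
  \<comment> \<open>Y would now contain a vertex at distance d > w from x.\<close>
  have "x \<in> X" using xy Y_sub by auto
  then obtain z where "z \<in> X" "dl x z = d" using exists_at_dist[of x d] by blast
  then show False using all dl_Y[OF xy(1), of z] w_ws ws_pos by auto
qed

end

text \<open>Pure algebra for \<open>terminal_relation\<close>. There u, e, e0, e1 are the dual
  eigenvalues at j - 1, j, 0, 1; su, s, s1 the cosines of E_d at j - 1, j, 1; v, p and v1, p1 the
  two split sequences at j and at 1; a0, ad, a the eigenvalues at 0, d, d + 1 - j; k and L are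
  \<open>th' 0\<close> and \<open>th' 1 - th' 0\<close>. The ratio su : s is replaced by v : p,
  after which the cosines cancel.\<close>

lemma terminal_cross:
  fixes k L :: complex
  assumes R: "k * (u - e) * (s1 - 1) * s = (su - s) * (L * (e - e0) + k * (e1 - e0))"
    and s: "su * p = v * s" "s \<noteq> 0" "p1 = v1 * s1"
    and vp: "v - p = (e - u) * t" and v1p1: "v1 - p1 = (e1 - e0) * (a0 - ad)"
    and pp: "p * (a0 - ad) = v1 * t + (e - e0) * (a0 - ad) * (a - a0)"
    and ne: "e \<noteq> u" "e \<noteq> e0"
  shows "k * (e1 - e0) * (a0 - ad) * (a - a0) = t * L * v1"
proof -
  let ?B = "L * (e - e0) + k * (e1 - e0)"
  have "s * ((e - u) * (- (k * (s1 - 1) * p))) = (k * (u - e) * (s1 - 1) * s) * p" by (simp add: algebra_simps)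
  also have "\<dots> = (su * p - s * p) * ?B" unfolding R by (simp add: algebra_simps)
  also have "\<dots> = s * ((v - p) * ?B)" unfolding s(1) by (simp add: algebra_simps)
  also have "\<dots> = s * ((e - u) * (t * ?B))" unfolding vp by (simp add: algebra_simps)
  finally have "s * ((e - u) * (- (k * (s1 - 1) * p))) = s * ((e - u) * (t * ?B))" .
  moreover have "e - u \<noteq> 0" using ne by simp
  ultimately have 1: "- (k * (s1 - 1) * p) = t * ?B" using s(2) mult_left_cancel by blast
  have "k * (v1 - p1) * p = v1 * (- (k * (s1 - 1) * p))" unfolding s(3) by (simp add: algebra_simps)
  then have 2: "k * (e1 - e0) * (p * (a0 - ad)) = v1 * (t * ?B)" unfolding 1 v1p1 by (simp add: algebra_simps)
  \<comment> \<open>Inserting \<open>pp\<close> on the left cancels the common term k (e1 - e0) v1 t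
    and leaves a factor e - e0 on both sides.\<close>
  have "(e - e0) * (k * (e1 - e0) * (a0 - ad) * (a - a0)) = (e - e0) * (t * L * v1)"
    using 2 unfolding pp by (simp add: algebra_simps)
  then show ?thesis using ne by simp
qed

section \<open>Parameter arrays\<close>

text \<open>The relations between the two split sequences and the eigenvalues that hold in all cases;
  \<open>t j\<close> is \<open>\<Sum>l<j. \<theta> l - \<theta> (d - l)\<close>.\<close>

definition split_relations ::
    "nat \<Rightarrow> (nat \<Rightarrow> complex) \<Rightarrow> (nat \<Rightarrow> complex) \<Rightarrow> (nat \<Rightarrow> complex) \<Rightarrow> (nat \<Rightarrow> complex) \<Rightarrow> (nat \<Rightarrow> complex) \<Rightarrow> bool" where
  "split_relations d \<theta> \<theta>s vphi phi t \<longleftrightarrow> t 1 = \<theta> 0 - \<theta> d \<and> (\<forall>j\<in>{1..d}.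
     vphi j - phi j = (\<theta>s j - \<theta>s (j - 1)) * t j \<and>
     phi j * (\<theta> 0 - \<theta> d) = vphi 1 * t j + (\<theta>s j - \<theta>s 0) * (\<theta> 0 - \<theta> d) * (\<theta> (d + 1 - j) - \<theta> 0))"

text \<open>The quotients of \<open>t\<close> by the eigenvalue differences take distinct values at
  i and j, with denominators cleared.\<close>

definition separated :: "nat \<Rightarrow> (nat \<Rightarrow> complex) \<Rightarrow> (nat \<Rightarrow> complex) \<Rightarrow> nat \<Rightarrow> nat \<Rightarrow> bool" where
  "separated d \<theta> t i j \<longleftrightarrow> t j * (\<theta> (d + 1 - i) - \<theta> 0) \<noteq> t i * (\<theta> (d + 1 - j) - \<theta> 0)"

text \<open>Here x stands for q^j, Q for q^{d+1} and r for r1 + r2, the product r1 r2 having been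
  replaced by s s* Q. In this form the second split sequence has one expression for zero and nonzero
  s*. The function \<open>th\<close> is \<theta>_j - \<theta>_0 in terms of x, so
  \<open>th (Q / q)\<close> belongs to index d and \<open>th (Q / x)\<close> to d + 1 - j;
  \<open>t\<close> is the closed form of a sum of geometric progressions.\<close>

lemma q_algebra:
  fixes q x Q h hs r s ss :: complex
  assumes nz: "q \<noteq> 0" "x \<noteq> 0" "Q \<noteq> 0" "q \<noteq> 1"
  defines "v \<equiv> \<lambda>x. h * hs * (q / x\<^sup>2) * (1 - x) * (1 - x / Q) * (1 - r * x + s * ss * Q * x\<^sup>2)"
    and "p \<equiv> \<lambda>x. h * hs * (q / x\<^sup>2) * (1 - x) * (1 - x / Q) * (s * Q - r * x + ss * x\<^sup>2)"
    and "th \<equiv> \<lambda>x. h * (1 - x) * (1 - s * q * x) / x"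
    and "ths \<equiv> \<lambda>x. hs * (1 - x) * (1 - ss * q * x) / x"
    and "t \<equiv> \<lambda>x. h * (1 - s * Q) * (q / Q) * (x - 1) * (Q / x - 1) / (q - 1)"
  shows "v x - p x = (ths x - ths (x / q)) * t x"
    and "p x * (- th (Q / q)) = v q * t x + ths x * (- th (Q / q)) * th (Q / x)"
    and "t q = - th (Q / q)"
proof -
  have q1: "q - 1 \<noteq> 0" using nz by simp
  have v: "v x - p x = h * hs * q * (1 - x) * (Q - x) * (1 - s * Q) * (1 - ss * x\<^sup>2) / (x\<^sup>2 * Q)"
    unfolding v_def p_def using nz by (simp add: field_simps power2_eq_square)
  have ths: "ths x - ths (x / q) = hs * (1 - q) * (1 - ss * x\<^sup>2) / x"
    unfolding ths_def using nz by (simp add: field_simps power2_eq_square)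
  have t: "t x = h * (1 - s * Q) * q * (x - 1) * (Q - x) / (Q * x * (q - 1))"
    unfolding t_def using nz q1 by (simp add: field_simps)
  show "v x - p x = (ths x - ths (x / q)) * t x"
    unfolding v ths t using nz q1 by (simp add: divide_simps) (simp add: algebra_simps power2_eq_square)
  have thQ: "- th (Q / q) = h * (1 - s * Q) * (Q - q) / Q"
    unfolding th_def using nz by (simp add: divide_simps) (simp add: algebra_simps)
  show "t q = - th (Q / q)"
    unfolding thQ t_def using nz q1 by (simp add: divide_simps)
  have vq: "v q * t x = h * (1 - s * Q) * (Q - q) / Q * (h * hs * (1 - x) * (Q - x) * (1 - r * q + s * ss * Q * q\<^sup>2) / (Q * x))"
    unfolding v_def t using nz q1 by (simp add: divide_simps) (simp add: algebra_simps power2_eq_square)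
  have "p x = h * hs * (1 - x) * (Q - x) * (1 - r * q + s * ss * Q * q\<^sup>2) / (Q * x) + ths x * th (Q / x)"
    unfolding p_def ths_def th_def using nz
    by (simp add: divide_simps) (simp add: algebra_simps power2_eq_square power3_eq_cube)
  then show "p x * (- th (Q / q)) = v q * t x + ths x * (- th (Q / q)) * th (Q / x)"
    unfolding vq thQ by (simp add: algebra_simps)
qed

section \<open>The closed forms, case by case\<close>

lemma q_powers:
  fixes q :: complex
  assumes "q \<noteq> 0"
  shows "q powi (1 - 2 * int i) = q / (q ^ i)\<^sup>2" "q powi (int i - int d - 1) = q ^ i / q ^ (d + 1)"
    "q powi (int d + 2 - 2 * int i) = q * q ^ (d + 1) / (q ^ i)\<^sup>2" "q powi (- int i) = 1 / q ^ i"
    "q powi (1 - int i) = q / q ^ i"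
proof -
  have pw: "q powi (int m - int n) = q ^ m / q ^ n" for m n
    using assms by (simp add: power_int_diff)
  have sq: "(q ^ i)\<^sup>2 = q ^ (2 * i)" by (simp add: power_mult[symmetric] mult.commute)
  have "int i - int d - 1 = int i - int (d + 1)" "int d + 2 - 2 * int i = int (d + 2) - int (2 * i)"
    "1 - 2 * int i = int 1 - int (2 * i)" "1 - int i = int 1 - int i" by simp_all
  then show "q powi (int i - int d - 1) = q ^ i / q ^ (d + 1)"
    "q powi (int d + 2 - 2 * int i) = q * q ^ (d + 1) / (q ^ i)\<^sup>2"
    "q powi (1 - 2 * int i) = q / (q ^ i)\<^sup>2" "q powi (1 - int i) = q / q ^ i"
    by (simp_all only: pw sq) simp_all
  show "q powi (- int i) = 1 / q ^ i" by (simp add: power_int_minus field_simps)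
qed

text \<open>Distinct eigenvalues exclude the degenerate values: q = 1 or h = 0 would give \<theta>_1
  = \<theta>_0, s Q = 1 would give \<theta>_d = \<theta>_0, and s q Q = 1 would make \<theta>_i
  equal to \<theta>_{d+1-i}, so that \<theta>_1 = \<theta>_d. After cancellation, equality of the
  quotients becomes (q^j - q^i)(1 - s q Q) = 0.\<close>

lemma case_I_relations:
  assumes "case_I d \<theta> \<theta>s vphi phi" "inj_on \<theta> {..d}" "2 \<le> d"
  obtains t where "split_relations d \<theta> \<theta>s vphi phi t"
    "\<And>i j. 1 \<le> i \<Longrightarrow> i < j \<Longrightarrow> j < d \<Longrightarrow> separated d \<theta> t i j"
proof -
  obtain q h hs r1 r2 s ss where q: "q \<noteq> 0" and r: "r1 * r2 = s * ss * q ^ (d + 1)"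
    and th: "\<And>i. i \<le> d \<Longrightarrow> \<theta> i = \<theta> 0 + h * (1 - q ^ i) * (1 - s * q ^ (i + 1)) * q powi (- int i)"
    and ths: "\<And>i. i \<le> d \<Longrightarrow> \<theta>s i = \<theta>s 0 + hs * (1 - q ^ i) * (1 - ss * q ^ (i + 1)) * q powi (- int i)"
    and vp: "\<And>i. i \<in> {1..d} \<Longrightarrow> vphi i = h * hs * q powi (1 - 2 * int i) * (1 - q ^ i) * (1 - q powi (int i - int d - 1)) *
                (1 - r1 * q ^ i) * (1 - r2 * q ^ i)"
    and ph: "\<And>i. i \<in> {1..d} \<Longrightarrow> phi i = (if ss \<noteq> 0
             then h * hs * q powi (1 - 2 * int i) * (1 - q ^ i) * (1 - q powi (int i - int d - 1)) *
                  (r1 - ss * q ^ i) * (r2 - ss * q ^ i) / ss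
             else h * hs * q powi (int d + 2 - 2 * int i) * (1 - q ^ i) *
                  (1 - q powi (int i - int d - 1)) *
                  (s - r1 * q powi (int i - int d - 1) - r2 * q powi (int i - int d - 1)))"
    using assms(1) unfolding case_I_def by blast
  define Q where "Q = q ^ (d + 1)"
  have Q: "Q \<noteq> 0" using q by (simp add: Q_def)
  define T where "T x = h * (1 - s * q * x) * (1 - x) / x" for x
  have th': "\<theta> i = \<theta> 0 + h * (1 - q ^ i) * (1 - s * q * q ^ i) / q ^ i" if "i \<le> d" for i
    using th[OF that] q by (simp add: q_powers mult_ac)
  have ths': "\<theta>s i = \<theta>s 0 + hs * (1 - q ^ i) * (1 - ss * q * q ^ i) / q ^ i" if "i \<le> d" for i
    using ths[OF that] q by (simp add: q_powers mult_ac)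
  have vp': "vphi i = h * hs * (q / (q ^ i)\<^sup>2) * (1 - q ^ i) * (1 - q ^ i / Q)
      * (1 - (r1 + r2) * q ^ i + s * ss * Q * (q ^ i)\<^sup>2)" if "i \<in> {1..d}" for i
  proof -
    have "(1 - r1 * q ^ i) * (1 - r2 * q ^ i) = 1 - (r1 + r2) * q ^ i + (r1 * r2) * (q ^ i)\<^sup>2"
      by (simp add: algebra_simps power2_eq_square)
    then show ?thesis using vp[OF that] unfolding r Q_def[symmetric]
      by (simp only: q_powers[OF q] Q_def[symmetric] mult.assoc)
  qed
  \<comment> \<open>Both branches lead here: the division by s* is absorbed through r1 r2 = s s* Q,
    and for s* = 0 the extra power of q through its factor Q.\<close>
  have ph': "phi i = h * hs * (q / (q ^ i)\<^sup>2) * (1 - q ^ i) * (1 - q ^ i / Q)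
      * (s * Q - (r1 + r2) * q ^ i + ss * (q ^ i)\<^sup>2)" if "i \<in> {1..d}" for i
  proof (cases "ss = 0")
    case True
    have "h * hs * (q * Q / (q ^ i)\<^sup>2) * (1 - q ^ i) * (1 - q ^ i / Q) * (s - r1 * (q ^ i / Q) - r2 * (q ^ i / Q))
      = h * hs * (q / (q ^ i)\<^sup>2) * (1 - q ^ i) * (1 - q ^ i / Q) * (Q * (s - r1 * (q ^ i / Q) - r2 * (q ^ i / Q)))"
      by (simp add: mult_ac)
    also have "Q * (s - r1 * (q ^ i / Q) - r2 * (q ^ i / Q)) = s * Q - (r1 + r2) * q ^ i"
      using Q by (simp add: algebra_simps)
    finally have "h * hs * (q * Q / (q ^ i)\<^sup>2) * (1 - q ^ i) * (1 - q ^ i / Q) * (s - r1 * (q ^ i / Q) - r2 * (q ^ i / Q))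
      = h * hs * (q / (q ^ i)\<^sup>2) * (1 - q ^ i) * (1 - q ^ i / Q) * (s * Q - (r1 + r2) * q ^ i)" .
    moreover have "phi i = h * hs * (q * Q / (q ^ i)\<^sup>2) * (1 - q ^ i) * (1 - q ^ i / Q) * (s - r1 * (q ^ i / Q) - r2 * (q ^ i / Q))"
      using ph[OF that] True unfolding q_powers[OF q] Q_def[symmetric] by simp
    ultimately show ?thesis using True by simp
  next
    case False
    have "(r1 - ss * q ^ i) * (r2 - ss * q ^ i) = r1 * r2 - ss * (r1 + r2) * q ^ i + ss * ss * (q ^ i)\<^sup>2"
      by (simp add: algebra_simps power2_eq_square)
    then have "(r1 - ss * q ^ i) * (r2 - ss * q ^ i) / ss = s * Q - (r1 + r2) * q ^ i + ss * (q ^ i)\<^sup>2"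
      unfolding r Q_def[symmetric] using False by (simp add: field_simps)
    then show ?thesis using ph[OF that] False
      by (simp only: q_powers[OF q] Q_def[symmetric] mult.assoc times_divide_eq_right[symmetric] if_True not_False_eq_True)
  qed
  have inj: "i = j" if "\<theta> i = \<theta> j" "i \<le> d" "j \<le> d" for i j using assms(2) that unfolding inj_on_def by auto
  have q1: "q \<noteq> 1" using inj[of 0 1] th'[of 1] assms(3) by auto
  define t where "t j = h * (1 - s * Q) * (q / Q) * (q ^ j - 1) * (Q / q ^ j - 1) / (q - 1)" for j
  have pd: "q ^ d = Q / q" using q by (simp add: Q_def)
  have pj: "q ^ (d + 1 - j) = Q / q ^ j" if "j \<le> d + 1" for j
    using q that by (simp add: Q_def power_diff)
  have pj1: "q ^ (j - 1) = q ^ j / q" if "1 \<le> j" for j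
    using q that by (cases j) auto
  have rel: "split_relations d \<theta> \<theta>s vphi phi t"
    unfolding split_relations_def
  proof (intro conjI ballI)
    have D0: "\<theta> 0 - \<theta> d = - (h * (1 - Q / q) * (1 - s * q * (Q / q)) / (Q / q))"
      using th'[of d] unfolding pd by simp
    show "t 1 = \<theta> 0 - \<theta> d"
      unfolding D0 t_def power_one_right by (rule q_algebra(3)[OF q q Q q1])
    fix j assume j: "j \<in> {1..d}"
    define x where "x = q ^ j"
    have x: "x \<noteq> 0" using q by (simp add: x_def)
    have 1: "1 \<in> {1..d}" using assms(3) by simp
    have j': "1 \<le> j" "j \<le> d" "j - 1 \<le> d" "d + 1 - j \<le> d" "j \<le> d + 1" using j by auto
    have "\<theta>s (j - 1) = \<theta>s 0 + hs * (1 - x / q) * (1 - ss * q * (x / q)) / (x / q)"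
      unfolding ths'[OF j'(3)] pj1[OF j'(1)] x_def ..
    moreover have "\<theta>s j = \<theta>s 0 + hs * (1 - x) * (1 - ss * q * x) / x"
      unfolding ths'[OF j'(2)] x_def ..
    ultimately have D1: "\<theta>s j - \<theta>s (j - 1) = hs * (1 - x) * (1 - ss * q * x) / x
        - hs * (1 - x / q) * (1 - ss * q * (x / q)) / (x / q)"
      and D2: "\<theta>s j - \<theta>s 0 = hs * (1 - x) * (1 - ss * q * x) / x" by simp_all
    have D3: "\<theta> (d + 1 - j) - \<theta> 0 = h * (1 - Q / x) * (1 - s * q * (Q / x)) / (Q / x)"
      unfolding th'[OF j'(4)] pj[OF j'(5)] x_def by simp
    show "vphi j - phi j = (\<theta>s j - \<theta>s (j - 1)) * t j"
      unfolding vp'[OF j] ph'[OF j] t_def D1 x_def[symmetric] by (rule q_algebra(1)[OF q x Q q1])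
    show "phi j * (\<theta> 0 - \<theta> d) = vphi 1 * t j + (\<theta>s j - \<theta>s 0) * (\<theta> 0 - \<theta> d) * (\<theta> (d + 1 - j) - \<theta> 0)"
      unfolding ph'[OF j] vp'[OF 1] t_def D0 D2 D3 x_def[symmetric] power_one_right
      by (rule q_algebra(2)[OF q x Q q1])
  qed
  have sep: "separated d \<theta> t i j" if ij: "1 \<le> i" "i < j" "j < d" for i j
    unfolding separated_def
  proof
    assume eq: "t j * (\<theta> (d + 1 - i) - \<theta> 0) = t i * (\<theta> (d + 1 - j) - \<theta> 0)"
    have ij': "d + 1 - i \<le> d" "d + 1 - j \<le> d" "d + 1 - i \<noteq> 0" "d + 1 - j \<noteq> 0" "i \<le> d + 1" "j \<le> d + 1"
      using ij by auto
    define x where "x = q ^ i"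
    define y where "y = q ^ j"
    have xy: "x \<noteq> 0" "y \<noteq> 0" using q by (auto simp: x_def y_def)
    have ne: "x \<noteq> y" using inj[of i j] th'[of i] th'[of j] ij by (auto simp: x_def y_def)
    have thi: "\<theta> (d + 1 - i) - \<theta> 0 = h * (1 - Q / x) * (1 - s * q * (Q / x)) / (Q / x)"
      unfolding th'[OF ij'(1)] pj[OF ij'(5)] x_def by simp
    have thj: "\<theta> (d + 1 - j) - \<theta> 0 = h * (1 - Q / y) * (1 - s * q * (Q / y)) / (Q / y)"
      unfolding th'[OF ij'(2)] pj[OF ij'(6)] y_def by simp
    have h0: "h \<noteq> 0" using inj[of 0 1] th'[of 1] assms(3) by auto
    have Qx: "Q \<noteq> x" using inj[OF _ ij'(1), of 0] thi ij' xy by auto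
    have Qy: "Q \<noteq> y" using inj[OF _ ij'(2), of 0] thj ij' xy by auto
    have sQ: "s * Q \<noteq> 1" using inj[of 0 d] th'[of d] pd q assms(3) by auto
    have sqQ: "s * q * Q \<noteq> 1"
    proof
      assume z: "s * q * Q = 1"
      have "h * (1 - q) * (1 - s * q * q) / q = h * (1 - Q / q) * (1 - s * Q) / (Q / q)"
      proof -
        have s: "s = 1 / (q * Q)" using z q Q by (simp add: field_simps)
        show ?thesis unfolding s using q Q by (simp add: divide_simps) (simp add: algebra_simps)
      qed
      then have "\<theta> 1 = \<theta> d" using th'[of 1] th'[of d] assms(3) q by (simp add: pd)
      then show False using inj[of 1 d] assms(3) by simp
    qed
    have "h * (1 - s * Q) * (q / Q) * h * (y - 1) * (Q - y) * (Q - x) * (x - s * q * Q)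
        = h * (1 - s * Q) * (q / Q) * h * (x - 1) * (Q - x) * (Q - y) * (y - s * q * Q)"
    proof -
      have 1: "t j * (\<theta> (d + 1 - i) - \<theta> 0) * (x * y * (q - 1) * Q * (- 1))
          = h * (1 - s * Q) * (q / Q) * h * (y - 1) * (Q - y) * (Q - x) * (x - s * q * Q)"
        unfolding thi t_def y_def[symmetric] using xy q1 Q by (simp add: divide_simps) (simp add: algebra_simps)
      have 2: "t i * (\<theta> (d + 1 - j) - \<theta> 0) * (x * y * (q - 1) * Q * (- 1))
          = h * (1 - s * Q) * (q / Q) * h * (x - 1) * (Q - x) * (Q - y) * (y - s * q * Q)"
        unfolding thj t_def x_def[symmetric] using xy q1 Q by (simp add: divide_simps) (simp add: algebra_simps)
      show ?thesis unfolding 1[symmetric] 2[symmetric] eq ..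
    qed
    then have "(y - 1) * (x - s * q * Q) = (x - 1) * (y - s * q * Q)"
      using h0 sQ q Q Qx Qy by (simp add: mult_ac)
    then have "(y - x) * (1 - s * q * Q) = 0" by (simp add: algebra_simps)
    then show False using ne sqQ by simp
  qed
  show ?thesis using that rel sep by blast
qed

text \<open>The quotient at j is -(q^j - 1)/(q - 1), a value that determines q^j and with it
  \<theta>_j.\<close>

lemma case_IA_relations:
  assumes "case_IA d \<theta> \<theta>s vphi phi" "inj_on \<theta> {..d}" "2 \<le> d"
  obtains t where "split_relations d \<theta> \<theta>s vphi phi t"
    "\<And>i j. 1 \<le> i \<Longrightarrow> i < j \<Longrightarrow> j < d \<Longrightarrow> separated d \<theta> t i j"
proof -
  obtain q hs r s where q: "q \<noteq> 0"
    and th: "\<And>i. i \<le> d \<Longrightarrow> \<theta> i = \<theta> 0 - s * q * (1 - q ^ i)"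
    and ths: "\<And>i. i \<le> d \<Longrightarrow> \<theta>s i = \<theta>s 0 + hs * (1 - q ^ i) * q powi (- int i)"
    and vp: "\<And>i. i \<in> {1..d} \<Longrightarrow> vphi i = - r * hs * q powi (1 - int i) * (1 - q ^ i) * (1 - q powi (int i - int d - 1))"
    and ph: "\<And>i. i \<in> {1..d} \<Longrightarrow> phi i = hs * q powi (int d + 2 - 2 * int i) * (1 - q ^ i) * (1 - q powi (int i - int d - 1)) *
                (s - r * q powi (int i - int d - 1))"
    using assms(1) unfolding case_IA_def by blast
  define Q where "Q = q ^ (d + 1)"
  have Q: "Q \<noteq> 0" using q by (simp add: Q_def)
  have ths': "\<theta>s i = \<theta>s 0 + hs * (1 - q ^ i) / q ^ i" if "i \<le> d" for i
    using ths[OF that] q by (simp add: q_powers)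
  have vp': "vphi i = - r * hs * (q / q ^ i) * (1 - q ^ i) * (1 - q ^ i / Q)" if "i \<in> {1..d}" for i
    using vp[OF that] by (simp only: q_powers[OF q] Q_def[symmetric])
  have ph': "phi i = hs * (q * Q / (q ^ i)\<^sup>2) * (1 - q ^ i) * (1 - q ^ i / Q) * (s - r * (q ^ i / Q))"
    if "i \<in> {1..d}" for i
    using ph[OF that] by (simp only: q_powers[OF q] Q_def[symmetric])
  have inj: "i = j" if "\<theta> i = \<theta> j" "i \<le> d" "j \<le> d" for i j using assms(2) that unfolding inj_on_def by auto
  have q1: "q \<noteq> 1" using inj[of 0 1] th[of 1] assms(3) by auto
  have s0: "s \<noteq> 0" using inj[of 0 1] th[of 1] assms(3) by auto
  define t where "t j = - s * q * (q ^ j - 1) * (Q / q ^ j - 1) / (q - 1)" for j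
  have pd: "q ^ d = Q / q" using q by (simp add: Q_def)
  have pj: "q ^ (d + 1 - j) = Q / q ^ j" if "j \<le> d + 1" for j
    using q that by (simp add: Q_def power_diff)
  have pj1: "q ^ (j - 1) = q ^ j / q" if "1 \<le> j" for j
    using q that by (cases j) auto
  have rel: "split_relations d \<theta> \<theta>s vphi phi t"
    unfolding split_relations_def
  proof (intro conjI ballI)
    have D0: "\<theta> 0 - \<theta> d = s * q * (1 - Q / q)" using th[of d] by (simp add: pd)
    show "t 1 = \<theta> 0 - \<theta> d" unfolding D0 t_def using q q1 by (simp add: field_simps)
    fix j assume j: "j \<in> {1..d}"
    define x where "x = q ^ j"
    have x: "x \<noteq> 0" using q by (simp add: x_def)
    have 1: "1 \<in> {1..d}" using assms(3) by simp
    have j': "1 \<le> j" "j \<le> d" "j - 1 \<le> d" "d + 1 - j \<le> d" "j \<le> d + 1" using j by auto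
    have "\<theta>s j - \<theta>s (j - 1) = hs * (1 - x) / x - hs * (1 - x / q) / (x / q)"
      unfolding ths'[OF j'(2)] ths'[OF j'(3)] pj1[OF j'(1)] x_def by simp
    also have "\<dots> = hs * (1 - q) / x" using q x by (simp add: field_simps)
    finally have D: "\<theta>s j - \<theta>s (j - 1) = hs * (1 - q) / x" .
    show "vphi j - phi j = (\<theta>s j - \<theta>s (j - 1)) * t j"
      unfolding D vp'[OF j] ph'[OF j] t_def x_def[symmetric] using q q1 x Q
      by (simp add: divide_simps) (simp add: algebra_simps power2_eq_square)
    have D2: "\<theta>s j - \<theta>s 0 = hs * (1 - x) / x" unfolding ths'[OF j'(2)] x_def by simp
    have D3: "\<theta> (d + 1 - j) - \<theta> 0 = - s * q * (1 - Q / x)"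
      unfolding th[OF j'(4)] pj[OF j'(5)] x_def by simp
    show "phi j * (\<theta> 0 - \<theta> d) = vphi 1 * t j + (\<theta>s j - \<theta>s 0) * (\<theta> 0 - \<theta> d) * (\<theta> (d + 1 - j) - \<theta> 0)"
      unfolding ph'[OF j] vp'[OF 1] t_def D0 D2 D3 x_def[symmetric] using q q1 x Q
      by (simp add: divide_simps) (simp add: algebra_simps power2_eq_square)
  qed
  have sep: "separated d \<theta> t i j" if ij: "1 \<le> i" "i < j" "j < d" for i j
    unfolding separated_def
  proof
    assume eq: "t j * (\<theta> (d + 1 - i) - \<theta> 0) = t i * (\<theta> (d + 1 - j) - \<theta> 0)"
    have ij': "d + 1 - i \<le> d" "d + 1 - j \<le> d" "d + 1 - i \<noteq> 0" "d + 1 - j \<noteq> 0" "i \<le> d + 1" "j \<le> d + 1"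
      using ij by auto
    define x where "x = q ^ i"
    define y where "y = q ^ j"
    have ne: "x \<noteq> y" using inj[of i j] th[of i] th[of j] ij by (auto simp: x_def y_def)
    define A where "A = Q / x - 1"
    define B where "B = Q / y - 1"
    have thi: "\<theta> (d + 1 - i) - \<theta> 0 = s * q * A"
      unfolding th[OF ij'(1)] pj[OF ij'(5)] A_def x_def by (simp add: algebra_simps)
    have thj: "\<theta> (d + 1 - j) - \<theta> 0 = s * q * B"
      unfolding th[OF ij'(2)] pj[OF ij'(6)] B_def y_def by (simp add: algebra_simps)
    have Qx: "A \<noteq> 0" using inj[OF _ ij'(1), of 0] thi ij' by auto
    have Qy: "B \<noteq> 0" using inj[OF _ ij'(2), of 0] thj ij' by auto
    have "- s * q * (y - 1) * B / (q - 1) * (s * q * A) = - s * q * (x - 1) * A / (q - 1) * (s * q * B)"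
      using eq unfolding thi thj t_def x_def[symmetric] y_def[symmetric] A_def[symmetric] B_def[symmetric] .
    then show False using ne s0 q q1 Qx Qy by (simp add: mult_ac)
  qed
  show ?thesis using that rel sep by blast
qed


text \<open>Cases II and IIA share the form of the eigenvalues, and \<open>t\<close> depends on
  these only, so they are treated together. Equality of the quotients reduces to (j - i)(s + d + 2)
  = 0, and s + d + 2 = 0 would give \<theta>_1 = \<theta>_d.\<close>

lemma case_II_relations:
  assumes "case_II d \<theta> \<theta>s vphi phi \<or> case_IIA d \<theta> \<theta>s vphi phi" "inj_on \<theta> {..d}" "2 \<le> d"
  obtains t where "split_relations d \<theta> \<theta>s vphi phi t"
    "\<And>i j. 1 \<le> i \<Longrightarrow> i < j \<Longrightarrow> j < d \<Longrightarrow> separated d \<theta> t i j"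
proof -
  let ?n = "of_nat :: nat \<Rightarrow> complex"
  have inj: "i = j" if "\<theta> i = \<theta> j" "i \<le> d" "j \<le> d" for i j using assms(2) that unfolding inj_on_def by auto
  obtain h s where th: "\<And>i. i \<le> d \<Longrightarrow> \<theta> i = \<theta> 0 + h * ?n i * (?n i + 1 + s)"
    and rel: "split_relations d \<theta> \<theta>s vphi phi (\<lambda>j. h * ?n j * (?n j - ?n d - 1) * (s + ?n d + 1))"
    using assms(1)
  proof
    assume "case_II d \<theta> \<theta>s vphi phi"
    then obtain h hs r1 r2 s ss where r: "r1 + r2 = s + ss + ?n d + 1"
      and th: "\<And>i. i \<le> d \<Longrightarrow> \<theta> i = \<theta> 0 + h * ?n i * (?n i + 1 + s)"
      and ths: "\<And>i. i \<le> d \<Longrightarrow> \<theta>s i = \<theta>s 0 + hs * ?n i * (?n i + 1 + ss)"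
      and vp: "\<And>i. i \<in> {1..d} \<Longrightarrow> vphi i = h * hs * ?n i * (?n i - ?n d - 1) * (?n i + r1) * (?n i + r2)"
      and ph: "\<And>i. i \<in> {1..d} \<Longrightarrow> phi i = h * hs * ?n i * (?n i - ?n d - 1) * (?n i + ss - r1) * (?n i + ss - r2)"
      unfolding case_II_def by blast
    have r2: "r2 = s + ss + ?n d + 1 - r1" using r by (simp add: algebra_simps)
    have "split_relations d \<theta> \<theta>s vphi phi (\<lambda>j. h * ?n j * (?n j - ?n d - 1) * (s + ?n d + 1))"
      unfolding split_relations_def
    proof (intro conjI ballI)
      have D0: "\<theta> 0 - \<theta> d = - h * ?n d * (?n d + 1 + s)" using th[of d] by simp
      show "h * ?n 1 * (?n 1 - ?n d - 1) * (s + ?n d + 1) = \<theta> 0 - \<theta> d"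
        unfolding D0 by (simp add: algebra_simps)
      fix j assume j: "j \<in> {1..d}"
      then have j': "j \<le> d" "j - 1 \<le> d" "d + 1 - j \<le> d" by auto
      have 1: "1 \<in> {1..d}" using assms(3) by simp
      have n: "?n (j - 1) = ?n j - 1" "?n (d + 1 - j) = ?n d + 1 - ?n j" using j by (auto simp: of_nat_diff)
      show "vphi j - phi j = (\<theta>s j - \<theta>s (j - 1)) * (h * ?n j * (?n j - ?n d - 1) * (s + ?n d + 1))"
        unfolding vp[OF j] ph[OF j] ths[OF j'(1)] ths[OF j'(2)] n r2 by (simp add: algebra_simps)
      have D2: "\<theta>s j - \<theta>s 0 = hs * ?n j * (?n j + 1 + ss)" using ths[OF j'(1)] by simp
      have D3: "\<theta> (d + 1 - j) - \<theta> 0 = h * (?n d + 1 - ?n j) * (?n d + 1 - ?n j + 1 + s)"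
        unfolding th[OF j'(3)] n by simp
      show "phi j * (\<theta> 0 - \<theta> d) = vphi 1 * (h * ?n j * (?n j - ?n d - 1) * (s + ?n d + 1))
          + (\<theta>s j - \<theta>s 0) * (\<theta> 0 - \<theta> d) * (\<theta> (d + 1 - j) - \<theta> 0)"
        unfolding vp[OF 1] ph[OF j] D0 D2 D3 r2 by (simp add: algebra_simps)
    qed
    then show ?thesis using that th by blast
  next
    assume "case_IIA d \<theta> \<theta>s vphi phi"
    then obtain h r s ss where
      th: "\<And>i. i \<le> d \<Longrightarrow> \<theta> i = \<theta> 0 + h * ?n i * (?n i + 1 + s)"
      and ths: "\<And>i. i \<le> d \<Longrightarrow> \<theta>s i = \<theta>s 0 + ss * ?n i"
      and vp: "\<And>i. i \<in> {1..d} \<Longrightarrow> vphi i = h * ss * ?n i * (?n i - ?n d - 1) * (?n i + r)"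
      and ph: "\<And>i. i \<in> {1..d} \<Longrightarrow> phi i = h * ss * ?n i * (?n i - ?n d - 1) * (?n i + r - s - ?n d - 1)"
      unfolding case_IIA_def by blast
    have "split_relations d \<theta> \<theta>s vphi phi (\<lambda>j. h * ?n j * (?n j - ?n d - 1) * (s + ?n d + 1))"
      unfolding split_relations_def
    proof (intro conjI ballI)
      have D0: "\<theta> 0 - \<theta> d = - h * ?n d * (?n d + 1 + s)" using th[of d] by simp
      show "h * ?n 1 * (?n 1 - ?n d - 1) * (s + ?n d + 1) = \<theta> 0 - \<theta> d"
        unfolding D0 by (simp add: algebra_simps)
      fix j assume j: "j \<in> {1..d}"
      then have j': "j \<le> d" "j - 1 \<le> d" "d + 1 - j \<le> d" by auto
      have 1: "1 \<in> {1..d}" using assms(3) by simp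
      have n: "?n (j - 1) = ?n j - 1" "?n (d + 1 - j) = ?n d + 1 - ?n j" using j by (auto simp: of_nat_diff)
      show "vphi j - phi j = (\<theta>s j - \<theta>s (j - 1)) * (h * ?n j * (?n j - ?n d - 1) * (s + ?n d + 1))"
        unfolding vp[OF j] ph[OF j] ths[OF j'(1)] ths[OF j'(2)] n by (simp add: algebra_simps)
      have D2: "\<theta>s j - \<theta>s 0 = ss * ?n j" using ths[OF j'(1)] by simp
      have D3: "\<theta> (d + 1 - j) - \<theta> 0 = h * (?n d + 1 - ?n j) * (?n d + 1 - ?n j + 1 + s)"
        unfolding th[OF j'(3)] n by simp
      show "phi j * (\<theta> 0 - \<theta> d) = vphi 1 * (h * ?n j * (?n j - ?n d - 1) * (s + ?n d + 1))
          + (\<theta>s j - \<theta>s 0) * (\<theta> 0 - \<theta> d) * (\<theta> (d + 1 - j) - \<theta> 0)"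
        unfolding vp[OF 1] ph[OF j] D0 D2 D3 by (simp add: algebra_simps)
    qed
    then show ?thesis using that th by blast
  qed
  have h0: "h \<noteq> 0" using inj[of 0 1] th[of 1] assms(3) by auto
  have sd: "s + ?n d + 1 \<noteq> 0"
  proof
    assume "s + ?n d + 1 = 0"
    then have "\<theta> d = \<theta> 0" using th[of d] by (simp add: algebra_simps)
    then show False using inj[of d 0] assms(3) by simp
  qed
  have sd2: "s + ?n d + 2 \<noteq> 0"
  proof
    assume "s + ?n d + 2 = 0"
    then have s: "s = - ?n d - 2" by (simp add: algebra_simps eq_neg_iff_add_eq_0)
    have "\<theta> d = \<theta> 0 - h * ?n d" using th[of d] unfolding s by simp
    moreover have "\<theta> 1 = \<theta> 0 - h * ?n d" using th[of 1] assms(3) unfolding s by (simp add: algebra_simps)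
    ultimately have "\<theta> d = \<theta> 1" by simp
    then show False using inj[of d 1] assms(3) by simp
  qed
  have "separated d \<theta> (\<lambda>j. h * ?n j * (?n j - ?n d - 1) * (s + ?n d + 1)) i j" if ij: "1 \<le> i" "i < j" "j < d" for i j
    unfolding separated_def
  proof
    assume eq: "h * ?n j * (?n j - ?n d - 1) * (s + ?n d + 1) * (\<theta> (d + 1 - i) - \<theta> 0)
      = h * ?n i * (?n i - ?n d - 1) * (s + ?n d + 1) * (\<theta> (d + 1 - j) - \<theta> 0)"
    have ij': "d + 1 - i \<le> d" "d + 1 - j \<le> d" using ij by auto
    have n: "?n (d + 1 - i) = ?n d + 1 - ?n i" "?n (d + 1 - j) = ?n d + 1 - ?n j" using ij by (auto simp: of_nat_diff)
    define a where "a = ?n d + 1 - ?n i"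
    define b where "b = ?n d + 1 - ?n j"
    have "?n (d + 1 - i) \<noteq> 0" "?n (d + 1 - j) \<noteq> 0" using ij by (simp_all only: of_nat_eq_0_iff)
    then have ab: "a \<noteq> 0" "b \<noteq> 0" unfolding a_def b_def n by simp_all
    have thi: "\<theta> (d + 1 - i) - \<theta> 0 = h * a * (a + 1 + s)" unfolding th[OF ij'(1)] n a_def by simp
    have thj: "\<theta> (d + 1 - j) - \<theta> 0 = h * b * (b + 1 + s)" unfolding th[OF ij'(2)] n b_def by simp
    have a': "?n i - ?n d - 1 = - a" "?n j - ?n d - 1 = - b" by (simp_all add: a_def b_def)
    have "?n j * (a + 1 + s) = ?n i * (b + 1 + s)"
      using eq h0 sd ab unfolding thi thj a' by (simp add: mult_ac)
    then have "(?n j - ?n i) * (s + ?n d + 2) = 0" by (simp add: a_def b_def algebra_simps)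
    then have "?n j = ?n i" using sd2 by simp
    then show False using ij by (simp only: of_nat_eq_iff)
  qed
  then show ?thesis using that rel by blast
qed

text \<open>Here the eigenvalues are linear in the index and the quotient at j is simply -j.\<close>

lemma case_IIB_relations:
  assumes "case_IIB d \<theta> \<theta>s vphi phi \<or> case_IIC d \<theta> \<theta>s vphi phi" "inj_on \<theta> {..d}" "2 \<le> d"
  obtains t where "split_relations d \<theta> \<theta>s vphi phi t"
    "\<And>i j. 1 \<le> i \<Longrightarrow> i < j \<Longrightarrow> j < d \<Longrightarrow> separated d \<theta> t i j"
proof -
  let ?n = "of_nat :: nat \<Rightarrow> complex"
  have inj: "i = j" if "\<theta> i = \<theta> j" "i \<le> d" "j \<le> d" for i j using assms(2) that unfolding inj_on_def by auto
  obtain s where th: "\<And>i. i \<le> d \<Longrightarrow> \<theta> i = \<theta> 0 + s * ?n i"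
    and rel: "split_relations d \<theta> \<theta>s vphi phi (\<lambda>j. s * ?n j * (?n j - ?n d - 1))"
    using assms(1)
  proof
    assume "case_IIB d \<theta> \<theta>s vphi phi"
    then obtain hs r s ss where
      th: "\<And>i. i \<le> d \<Longrightarrow> \<theta> i = \<theta> 0 + s * ?n i"
      and ths: "\<And>i. i \<le> d \<Longrightarrow> \<theta>s i = \<theta>s 0 + hs * ?n i * (?n i + 1 + ss)"
      and vp: "\<And>i. i \<in> {1..d} \<Longrightarrow> vphi i = hs * s * ?n i * (?n i - ?n d - 1) * (?n i + r)"
      and ph: "\<And>i. i \<in> {1..d} \<Longrightarrow> phi i = - hs * s * ?n i * (?n i - ?n d - 1) * (?n i + ss - r)"
      unfolding case_IIB_def by blast
    have "split_relations d \<theta> \<theta>s vphi phi (\<lambda>j. s * ?n j * (?n j - ?n d - 1))"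
      unfolding split_relations_def
    proof (intro conjI ballI)
      have D0: "\<theta> 0 - \<theta> d = - s * ?n d" using th[of d] by simp
      show "s * ?n 1 * (?n 1 - ?n d - 1) = \<theta> 0 - \<theta> d" unfolding D0 by simp
      fix j assume j: "j \<in> {1..d}"
      then have j': "j \<le> d" "j - 1 \<le> d" "d + 1 - j \<le> d" by auto
      have 1: "1 \<in> {1..d}" using assms(3) by simp
      have n: "?n (j - 1) = ?n j - 1" "?n (d + 1 - j) = ?n d + 1 - ?n j" using j by (auto simp: of_nat_diff)
      show "vphi j - phi j = (\<theta>s j - \<theta>s (j - 1)) * (s * ?n j * (?n j - ?n d - 1))"
        unfolding vp[OF j] ph[OF j] ths[OF j'(1)] ths[OF j'(2)] n by (simp add: algebra_simps)
      have D2: "\<theta>s j - \<theta>s 0 = hs * ?n j * (?n j + 1 + ss)" using ths[OF j'(1)] by simp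
      have D3: "\<theta> (d + 1 - j) - \<theta> 0 = s * (?n d + 1 - ?n j)" unfolding th[OF j'(3)] n by simp
      show "phi j * (\<theta> 0 - \<theta> d) = vphi 1 * (s * ?n j * (?n j - ?n d - 1))
          + (\<theta>s j - \<theta>s 0) * (\<theta> 0 - \<theta> d) * (\<theta> (d + 1 - j) - \<theta> 0)"
        unfolding vp[OF 1] ph[OF j] D0 D2 D3 by (simp add: algebra_simps)
    qed
    then show ?thesis using that th by blast
  next
    assume "case_IIC d \<theta> \<theta>s vphi phi"
    then obtain r s ss where
      th: "\<And>i. i \<le> d \<Longrightarrow> \<theta> i = \<theta> 0 + s * ?n i"
      and ths: "\<And>i. i \<le> d \<Longrightarrow> \<theta>s i = \<theta>s 0 + ss * ?n i"
      and vp: "\<And>i. i \<in> {1..d} \<Longrightarrow> vphi i = r * ?n i * (?n i - ?n d - 1)"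
      and ph: "\<And>i. i \<in> {1..d} \<Longrightarrow> phi i = (r - s * ss) * ?n i * (?n i - ?n d - 1)"
      unfolding case_IIC_def by blast
    have "split_relations d \<theta> \<theta>s vphi phi (\<lambda>j. s * ?n j * (?n j - ?n d - 1))"
      unfolding split_relations_def
    proof (intro conjI ballI)
      have D0: "\<theta> 0 - \<theta> d = - s * ?n d" using th[of d] by simp
      show "s * ?n 1 * (?n 1 - ?n d - 1) = \<theta> 0 - \<theta> d" unfolding D0 by simp
      fix j assume j: "j \<in> {1..d}"
      then have j': "j \<le> d" "j - 1 \<le> d" "d + 1 - j \<le> d" by auto
      have 1: "1 \<in> {1..d}" using assms(3) by simp
      have n: "?n (j - 1) = ?n j - 1" "?n (d + 1 - j) = ?n d + 1 - ?n j" using j by (auto simp: of_nat_diff)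
      show "vphi j - phi j = (\<theta>s j - \<theta>s (j - 1)) * (s * ?n j * (?n j - ?n d - 1))"
        unfolding vp[OF j] ph[OF j] ths[OF j'(1)] ths[OF j'(2)] n by (simp add: algebra_simps)
      have D2: "\<theta>s j - \<theta>s 0 = ss * ?n j" using ths[OF j'(1)] by simp
      have D3: "\<theta> (d + 1 - j) - \<theta> 0 = s * (?n d + 1 - ?n j)" unfolding th[OF j'(3)] n by simp
      show "phi j * (\<theta> 0 - \<theta> d) = vphi 1 * (s * ?n j * (?n j - ?n d - 1))
          + (\<theta>s j - \<theta>s 0) * (\<theta> 0 - \<theta> d) * (\<theta> (d + 1 - j) - \<theta> 0)"
        unfolding vp[OF 1] ph[OF j] D0 D2 D3 by (simp add: algebra_simps)
    qed
    then show ?thesis using that th by blast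
  qed
  have s0: "s \<noteq> 0" using inj[of 0 1] th[of 1] assms(3) by auto
  have "separated d \<theta> (\<lambda>j. s * ?n j * (?n j - ?n d - 1)) i j" if ij: "1 \<le> i" "i < j" "j < d" for i j
    unfolding separated_def
  proof
    assume eq: "s * ?n j * (?n j - ?n d - 1) * (\<theta> (d + 1 - i) - \<theta> 0)
      = s * ?n i * (?n i - ?n d - 1) * (\<theta> (d + 1 - j) - \<theta> 0)"
    have ij': "d + 1 - i \<le> d" "d + 1 - j \<le> d" using ij by auto
    have n: "?n (d + 1 - i) = ?n d + 1 - ?n i" "?n (d + 1 - j) = ?n d + 1 - ?n j" using ij by (auto simp: of_nat_diff)
    define a where "a = ?n d + 1 - ?n i"
    define b where "b = ?n d + 1 - ?n j"
    have "?n (d + 1 - i) \<noteq> 0" "?n (d + 1 - j) \<noteq> 0" using ij by (simp_all only: of_nat_eq_0_iff)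
    then have ab: "a \<noteq> 0" "b \<noteq> 0" unfolding a_def b_def n by simp_all
    have thi: "\<theta> (d + 1 - i) - \<theta> 0 = s * a" unfolding th[OF ij'(1)] n a_def by simp
    have thj: "\<theta> (d + 1 - j) - \<theta> 0 = s * b" unfolding th[OF ij'(2)] n b_def by simp
    have a': "?n i - ?n d - 1 = - a" "?n j - ?n d - 1 = - b" by (simp_all add: a_def b_def)
    have "?n j = ?n i" using eq s0 ab unfolding thi thj a' by (simp add: mult_ac del: of_nat_eq_iff)
    then show False using ij by (simp only: of_nat_eq_iff)
  qed
  then show ?thesis using that rel by blast
qed

lemma case_I_or_II_relations:
  assumes "case_I_or_II d \<theta> \<theta>s vphi phi" "inj_on \<theta> {..d}" "2 \<le> d"
  obtains t where "split_relations d \<theta> \<theta>s vphi phi t"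
    "\<And>i j. 1 \<le> i \<Longrightarrow> i < j \<Longrightarrow> j < d \<Longrightarrow> separated d \<theta> t i j"
proof -
  let ?c = "case_I d \<theta> \<theta>s vphi phi" and ?c' = "case_IA d \<theta> \<theta>s vphi phi"
  let ?c2 = "case_II d \<theta> \<theta>s vphi phi \<or> case_IIA d \<theta> \<theta>s vphi phi"
  let ?c3 = "case_IIB d \<theta> \<theta>s vphi phi \<or> case_IIC d \<theta> \<theta>s vphi phi"
  from assms(1) consider ?c | ?c' | ?c2 | ?c3 unfolding case_I_or_II_def by argo
  then show ?thesis
  proof cases
    case 1
    then show ?thesis by (rule case_I_relations[OF _ assms(2,3)]) (rule that)
  next
    case 2
    then show ?thesis by (rule case_IA_relations[OF _ assms(2,3)]) (rule that)
  next
    case 3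
    then show ?thesis by (rule case_II_relations[OF _ assms(2,3)]) (rule that)
  next
    case 4
    then show ?thesis by (rule case_IIB_relations[OF _ assms(2,3)]) (rule that)
  qed
qed

text \<open>For odd d the formulas of both split sequences coincide at even indices; the smallest
  one, 2, leads to a contradiction with \<open>sig_1_ne_sig_2\<close>.\<close>

lemma case_III_odd_relation:
  assumes "case_III d \<theta> \<theta>s vphi phi" "odd d" "2 \<le> d"
  shows "vphi 2 = phi 2"
  using assms unfolding case_III_def by force

text \<open>The quotient is -1 at odd j and -j / (j + s - d - 2) at even j. The latter is injective
  in j and never -1, because s = d + 2 would give \<theta>_1 = \<theta>_d.\<close>

lemma case_III_relations:
  assumes "case_III d \<theta> \<theta>s vphi phi" "inj_on \<theta> {..d}" "2 \<le> d" "even d"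
  obtains t where "split_relations d \<theta> \<theta>s vphi phi t"
    "\<And>i j. 1 \<le> i \<Longrightarrow> i < j \<Longrightarrow> j < d \<Longrightarrow> even j \<Longrightarrow> separated d \<theta> t i j"
    "\<And>j. 1 \<le> j \<Longrightarrow> j < d \<Longrightarrow> odd j \<Longrightarrow> t j \<noteq> 0 \<and> \<theta> (d + 1 - j) - \<theta> 0 = - t j"
proof -
  let ?n = "of_nat :: nat \<Rightarrow> complex"
  have inj: "i = j" if "\<theta> i = \<theta> j" "i \<le> d" "j \<le> d" for i j using assms(2) that unfolding inj_on_def by auto
  obtain h hs r1 r2 s ss where r: "r1 + r2 = - s - ss + ?n d + 1"
    and th: "\<And>i. i \<le> d \<Longrightarrow> \<theta> i = \<theta> 0 + h * (s - 1 + (1 - s + 2 * ?n i) * (-1) ^ i)"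
    and ths: "\<And>i. i \<le> d \<Longrightarrow> \<theta>s i = \<theta>s 0 + hs * (ss - 1 + (1 - ss + 2 * ?n i) * (-1) ^ i)"
    and vp': "\<And>i. i \<in> {1..d} \<Longrightarrow> vphi i = (if even d
             then (if even i then - 4 * h * hs * of_nat i * (of_nat i + r1)
                   else - 4 * h * hs * (of_nat i - of_nat d - 1) * (of_nat i + r2))
             else (if even i then - 4 * h * hs * of_nat i * (of_nat i - of_nat d - 1)
                   else - 4 * h * hs * (of_nat i + r1) * (of_nat i + r2)))"
    and ph': "\<And>i. i \<in> {1..d} \<Longrightarrow> phi i = (if even d
             then (if even i then 4 * h * hs * of_nat i * (of_nat i - ss - r1)
                   else 4 * h * hs * (of_nat i - of_nat d - 1) * (of_nat i - ss - r2))
             else (if even i then - 4 * h * hs * of_nat i * (of_nat i - of_nat d - 1)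
                   else - 4 * h * hs * (of_nat i - ss - r1) * (of_nat i - ss - r2)))"
    using assms(1) unfolding case_III_def by blast
  note vp = vp'[unfolded if_P[OF assms(4)]] and ph = ph'[unfolded if_P[OF assms(4)]]
  have r2: "r2 = - s - ss + ?n d + 1 - r1" using r by (simp add: algebra_simps)
  have the: "\<theta> i = \<theta> 0 + 2 * h * ?n i" if "i \<le> d" "even i" for i using th[OF that(1)] that(2) by (simp add: algebra_simps)
  have tho: "\<theta> i = \<theta> 0 + 2 * h * (s - 1 - ?n i)" if "i \<le> d" "odd i" for i using th[OF that(1)] that(2) by (simp add: algebra_simps)
  have thse: "\<theta>s i = \<theta>s 0 + 2 * hs * ?n i" if "i \<le> d" "even i" for i using ths[OF that(1)] that(2) by (simp add: algebra_simps)
  have thso: "\<theta>s i = \<theta>s 0 + 2 * hs * (ss - 1 - ?n i)" if "i \<le> d" "odd i" for i using ths[OF that(1)] that(2) by (simp add: algebra_simps)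
  define t where "t j = (if even j then - 2 * h * ?n j else 2 * h * (?n j - ?n d - 1))" for j
  have D0: "\<theta> 0 - \<theta> d = - 2 * h * ?n d" using the[of d] assms(4) by simp
  have n: "?n (j - 1) = ?n j - 1" "?n (d + 1 - j) = ?n d + 1 - ?n j" if "j \<in> {1..d}" for j using that by (auto simp: of_nat_diff)
  have odd1: "odd (j - 1) \<longleftrightarrow> even j" "odd (d + 1 - j) \<longleftrightarrow> even j" if "j \<in> {1..d}" for j using that assms(4) by auto
  have rel: "split_relations d \<theta> \<theta>s vphi phi t"
    unfolding split_relations_def
  proof (intro conjI ballI)
    show "t 1 = \<theta> 0 - \<theta> d" unfolding D0 t_def by simp
    fix j assume j: "j \<in> {1..d}"
    then have j': "j \<le> d" "j - 1 \<le> d" "d + 1 - j \<le> d" by auto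
    have 1: "1 \<in> {1..d}" using assms(3) by simp
    have v1: "vphi 1 = 4 * h * hs * ?n d * (1 + r2)" using vp[OF 1] by simp
    show "vphi j - phi j = (\<theta>s j - \<theta>s (j - 1)) * t j"
    proof (cases "even j")
      case True
      then show ?thesis using odd1[OF j]
        by (simp add: vp[OF j] ph[OF j] thse[OF j'(1)] thso[OF j'(2)] n[OF j] t_def algebra_simps)
    next
      case False
      then show ?thesis using odd1[OF j]
        by (simp add: vp[OF j] ph[OF j] thso[OF j'(1)] thse[OF j'(2)] n[OF j] t_def algebra_simps)
    qed
    show "phi j * (\<theta> 0 - \<theta> d) = vphi 1 * t j + (\<theta>s j - \<theta>s 0) * (\<theta> 0 - \<theta> d) * (\<theta> (d + 1 - j) - \<theta> 0)"
    proof (cases "even j")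
      case True
      have D2: "\<theta>s j - \<theta>s 0 = 2 * hs * ?n j" using thse[OF j'(1) True] by simp
      have "odd (d + 1 - j)" using odd1[OF j] True by simp
      then have D3: "\<theta> (d + 1 - j) - \<theta> 0 = 2 * h * (s - 1 - (?n d + 1 - ?n j))"
        using tho[OF j'(3)] unfolding n[OF j] by simp
      have p: "phi j = 4 * h * hs * ?n j * (?n j - ss - r1)" "t j = - 2 * h * ?n j"
        using ph[OF j] True by (auto simp: t_def)
      show ?thesis unfolding v1 D0 D2 D3 p r2 by (simp add: algebra_simps)
    next
      case False
      have D2: "\<theta>s j - \<theta>s 0 = 2 * hs * (ss - 1 - ?n j)" using thso[OF j'(1) False] by simp
      have "even (d + 1 - j)" using odd1[OF j] False by simp
      then have D3: "\<theta> (d + 1 - j) - \<theta> 0 = 2 * h * (?n d + 1 - ?n j)"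
        using the[OF j'(3)] unfolding n[OF j] by simp
      have p: "phi j = 4 * h * hs * (?n j - ?n d - 1) * (?n j - ss - r2)" "t j = 2 * h * (?n j - ?n d - 1)"
        using ph[OF j] False by (auto simp: t_def)
      show ?thesis unfolding v1 D0 D2 D3 p r2 by (simp add: algebra_simps)
    qed
  qed
  have h0: "h \<noteq> 0" using inj[of 0 2] the[of 2] assms(3) by auto
  have sd2: "s - 2 - ?n d \<noteq> 0"
  proof
    assume "s - 2 - ?n d = 0"
    then have "s = ?n d + 2" by (simp add: algebra_simps)
    then have "\<theta> 1 = \<theta> d" using tho[of 1] the[of d] assms(3,4) by simp
    then show False using inj[of 1 d] assms(3) by simp
  qed
  have sep: "separated d \<theta> t i j" if ij: "1 \<le> i" "i < j" "j < d" "even j" for i j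
    unfolding separated_def
  proof
    assume eq: "t j * (\<theta> (d + 1 - i) - \<theta> 0) = t i * (\<theta> (d + 1 - j) - \<theta> 0)"
    have ij': "d + 1 - i \<le> d" "d + 1 - j \<le> d" "i \<in> {1..d}" "j \<in> {1..d}" using ij by auto
    have j0: "?n j \<noteq> 0" using ij by simp
    have "odd (d + 1 - j)" using odd1[OF ij'(4)] ij by simp
    then have thj: "\<theta> (d + 1 - j) - \<theta> 0 = 2 * h * (s - 1 - (?n d + 1 - ?n j))"
      using tho[OF ij'(2)] unfolding n[OF ij'(4)] by simp
    show False
    proof (cases "even i")
      case True
      then have "odd (d + 1 - i)" using odd1[OF ij'(3)] by simp
      then have thi: "\<theta> (d + 1 - i) - \<theta> 0 = 2 * h * (s - 1 - (?n d + 1 - ?n i))"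
        using tho[OF ij'(1)] unfolding n[OF ij'(3)] by simp
      define A where "A = s - 1 - (?n d + 1 - ?n i)"
      define B where "B = s - 1 - (?n d + 1 - ?n j)"
      have "?n j * A = ?n i * B"
        using eq h0 ij(4) True unfolding thi thj t_def A_def[symmetric] B_def[symmetric] by (simp add: mult_ac)
      then have "?n j * (s - 1 - (?n d + 1 - ?n i)) = ?n i * (s - 1 - (?n d + 1 - ?n j))"
        unfolding A_def B_def .
      then have "(?n j - ?n i) * (s - 2 - ?n d) = 0" by (simp add: algebra_simps)
      then have "?n j = ?n i" using sd2 by simp
      then show False using ij by (simp only: of_nat_eq_iff)
    next
      case False
      then have "even (d + 1 - i)" using odd1[OF ij'(3)] by simp
      then have thi: "\<theta> (d + 1 - i) - \<theta> 0 = 2 * h * (?n d + 1 - ?n i)"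
        using the[OF ij'(1)] unfolding n[OF ij'(3)] by simp
      define a where "a = ?n d + 1 - ?n i"
      have "?n (d + 1 - i) \<noteq> 0" using ij by (simp only: of_nat_eq_0_iff)
      then have a0: "a \<noteq> 0" unfolding n[OF ij'(3)] a_def .
      have ti: "t i = - (2 * h * a)" using False by (simp add: t_def a_def algebra_simps)
      have tj: "t j = - (2 * h * ?n j)" using ij(4) by (simp add: t_def)
      define B where "B = s - 1 - (?n d + 1 - ?n j)"
      have "?n j = B"
        using eq h0 a0 unfolding thi thj ti tj a_def[symmetric] B_def[symmetric] by (simp add: mult_ac)
      then have "s - 2 - ?n d = 0" by (simp add: B_def algebra_simps)
      then show False using sd2 by simp
    qed
  qed
  have "t j \<noteq> 0 \<and> \<theta> (d + 1 - j) - \<theta> 0 = - t j" if j: "1 \<le> j" "j < d" "odd j" for j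
  proof -
    have j': "d + 1 - j \<le> d" "j \<in> {1..d}" using j by auto
    have "even (d + 1 - j)" using odd1[OF j'(2)] j by simp
    then have thj: "\<theta> (d + 1 - j) - \<theta> 0 = 2 * h * (?n d + 1 - ?n j)"
      using the[OF j'(1)] unfolding n[OF j'(2)] by simp
    have "?n (d + 1 - j) \<noteq> 0" using j by (simp only: of_nat_eq_0_iff)
    then have a0: "?n d + 1 - ?n j \<noteq> 0" unfolding n[OF j'(2)] .
    have tj: "t j = - (2 * h * (?n d + 1 - ?n j))" using j(3) by (simp add: t_def algebra_simps)
    show ?thesis unfolding thj tj using a0 h0 by simp
  qed
  then show ?thesis using that rel sep by blast
qed

section \<open>Leonard systems of Q-polynomial distance-regular graphs\<close>

lemma diag_mult_vec: "diag u *v v = (\<chi> y. u $ y * v $ y)"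
proof -
  have "(\<Sum>k\<in>UNIV. diag u $ y $ k * v $ k) = (\<Sum>k\<in>{y}. diag u $ y $ k * v $ k)" for y
    by (intro sum.mono_neutral_right) (auto simp: diag_def)
  then show ?thesis by (simp add: cvec_eq_iff matrix_vector_mult_def diag_def)
qed

lemma matrix_mult_axis_nth: "(M *v axis x 1) $ y = (M :: complex ^ 'v ^ 'v) $ y $ x"
proof -
  have "(\<Sum>k\<in>UNIV. M $ y $ k * axis x 1 $ k) = (\<Sum>k\<in>{x}. M $ y $ k * axis x 1 $ k)"
    by (intro sum.mono_neutral_right) (auto simp: axis_def)
  then show ?thesis by (simp add: matrix_vector_mult_def axis_def)
qed

text \<open>Newton interpolation: the polynomial for the first n nodes is corrected by a multiple of
  the product of the linear factors at these nodes.\<close>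

lemma interpolation_poly:
  fixes t f :: "nat \<Rightarrow> complex"
  assumes "inj_on t {..<n}"
  shows "\<exists>p. \<forall>i<n. poly p (t i) = f i"
  using assms
proof (induction n)
  case (Suc n)
  then have "inj_on t {..<n}" by (simp add: lessThan_Suc)
  then obtain p where p: "\<forall>i<n. poly p (t i) = f i" using Suc.IH by blast
  let ?m = "\<Prod>l<n. [:- t l, 1:]"
  have ne: "poly ?m (t n) \<noteq> 0"
  proof -
    have "t n \<noteq> t l" if "l < n" for l using inj_onD[OF Suc.prems, of n l] that by auto
    then show ?thesis by (auto simp: poly_prod)
  qed
  have z: "poly ?m (t i) = 0" if "i < n" for i using that by (auto simp: poly_prod)
  let ?p = "p + Polynomial.smult ((f n - poly p (t n)) / poly ?m (t n)) ?m"
  have "poly ?p (t i) = f i" if "i < Suc n" for i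
    using that p z ne by (cases "i = n") auto
  then show ?case by blast
qed simp

text \<open>An operator a on W with its spectral resolution into idempotents e_i and distinct
  eigenvalues t_i. It is used twice, for the adjacency matrix with the E_i and for the dual
  adjacency matrix with the dual idempotents.\<close>

locale resolution =
  fixes W :: "(complex ^ 'n::finite) set" and n :: nat and e :: "nat \<Rightarrow> complex ^ 'n \<Rightarrow> complex ^ 'n"
    and a :: "complex ^ 'n \<Rightarrow> complex ^ 'n" and t :: "nat \<Rightarrow> complex"
  assumes sub: "vec.subspace W"
    and e_endo: "i \<le> n \<Longrightarrow> e i \<in> endo W"
    and e_e: "i \<le> n \<Longrightarrow> j \<le> n \<Longrightarrow> v \<in> W \<Longrightarrow> e i (e j v) = (if i = j then e i v else 0)"
    and sum_e: "v \<in> W \<Longrightarrow> (\<Sum>i\<le>n. e i v) = v"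
    and e_nz: "i \<le> n \<Longrightarrow> \<exists>v\<in>W. e i v \<noteq> 0"
    and a_endo: "a \<in> endo W"
    and a_e: "i \<le> n \<Longrightarrow> v \<in> W \<Longrightarrow> a (e i v) = t i *s e i v"
    and t_inj: "inj_on t {..n}"
begin

text \<open>The elements of the algebra spanned by the e_i; composition becomes pointwise
  multiplication of the coefficient functions.\<close>

definition D :: "(nat \<Rightarrow> complex) \<Rightarrow> complex ^ 'n \<Rightarrow> complex ^ 'n" where
  "D f = (\<lambda>v\<in>W. \<Sum>i\<le>n. f i *s e i v)"

lemma endo_add: "f \<in> endo W \<Longrightarrow> u \<in> W \<Longrightarrow> v \<in> W \<Longrightarrow> f (u + v) = f u + f v"
  and endo_scale: "f \<in> endo W \<Longrightarrow> u \<in> W \<Longrightarrow> f (c *s u) = c *s f u"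
  and endo_closed: "f \<in> endo W \<Longrightarrow> u \<in> W \<Longrightarrow> f u \<in> W"
  and endo_ext: "f \<in> endo W \<Longrightarrow> u \<notin> W \<Longrightarrow> f u = undefined"
  unfolding endo_def by (auto simp: PiE_def extensional_def Pi_def)

lemma endo_sum:
  assumes "f \<in> endo W" "\<And>i. i \<in> I \<Longrightarrow> u i \<in> W"
  shows "f (\<Sum>i\<in>I. u i) = (\<Sum>i\<in>I. f (u i))"
  using assms(2)
proof (induction I rule: infinite_finite_induct)
  case empty
  have "f (0 *s 0) = 0 *s f 0" using assms(1) vec.subspace_0[OF sub] by (rule endo_scale)
  then show ?case by simp
next
  case (infinite I)
  have "f (0 *s 0) = 0 *s f 0" using assms(1) vec.subspace_0[OF sub] by (rule endo_scale)
  then show ?case using infinite by simp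
next
  case (insert i I)
  then have "u i \<in> W" "sum u I \<in> W" by (auto intro: vec.subspace_sum[OF sub])
  then show ?case using insert endo_add[OF assms(1)] by simp
qed

lemma e_W: "i \<le> n \<Longrightarrow> v \<in> W \<Longrightarrow> e i v \<in> W"
  using endo_closed[OF e_endo] .

lemma D_W: "v \<in> W \<Longrightarrow> D f v \<in> W"
  unfolding D_def by (auto intro!: vec.subspace_sum[OF sub] vec.subspace_scale[OF sub] e_W)

lemma e_D:
  assumes "j \<le> n" "v \<in> W"
  shows "e j (D f v) = f j *s e j v"
proof -
  have "e j (D f v) = (\<Sum>i\<le>n. e j (f i *s e i v))"
    unfolding D_def restrict_apply'[OF assms(2)] using assms
    by (intro endo_sum e_endo) (auto intro: vec.subspace_scale[OF sub] e_W)
  also have "\<dots> = (\<Sum>i\<le>n. if i = j then f j *s e j v else 0)"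
    using assms by (intro sum.cong refl) (auto simp: endo_scale[OF e_endo] e_W e_e)
  finally show ?thesis using assms by simp
qed

lemma D_eq_iff: "D f = D g \<longleftrightarrow> (\<forall>i\<le>n. f i = g i)"
proof
  assume eq: "D f = D g"
  show "\<forall>i\<le>n. f i = g i"
  proof (intro allI impI)
    fix i assume i: "i \<le> n"
    obtain v where v: "v \<in> W" "e i v \<noteq> 0" using e_nz[OF i] by blast
    have "f i *s e i v = g i *s e i v" unfolding e_D[OF i v(1), symmetric] eq ..
    then show "f i = g i" using v(2) vec.scale_right_imp_eq by blast
  qed
next
  assume "\<forall>i\<le>n. f i = g i"
  then show "D f = D g" unfolding D_def by (intro restrict_ext sum.cong) auto
qed

lemma compose_D: "compose W (D f) (D g) = D (\<lambda>i. f i * g i)"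
proof -
  have "D f (D g v) = (\<Sum>i\<le>n. (f i * g i) *s e i v)" if "v \<in> W" for v
  proof -
    have "D f (D g v) = (\<Sum>i\<le>n. f i *s e i (D g v))" using D_W[OF that] by (simp add: D_def)
    also have "\<dots> = (\<Sum>i\<le>n. f i *s (g i *s e i v))" using that by (intro sum.cong refl) (simp add: e_D)
    finally show ?thesis by simp
  qed
  then show ?thesis unfolding compose_def D_def[of "\<lambda>i. f i * g i"] by (intro restrict_ext) auto
qed

lemma e_eq_D: "i \<le> n \<Longrightarrow> e i = D (\<lambda>j. of_bool (j = i))"
proof
  fix v assume i: "i \<le> n"
  show "e i v = D (\<lambda>j. of_bool (j = i)) v"
  proof (cases "v \<in> W")
    case True
    have "(\<Sum>j\<le>n. of_bool (j = i) *s e j v) = (\<Sum>j\<le>n. if j = i then e i v else 0)"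
      by (intro sum.cong) auto
    then show ?thesis using i True by (simp add: D_def)
  next
    case False
    then show ?thesis using endo_ext[OF e_endo[OF i]] by (simp add: D_def)
  qed
qed

lemma a_power: "v \<in> W \<Longrightarrow> (a ^^ k) v = (\<Sum>i\<le>n. t i ^ k *s e i v)"
proof (induction k)
  case 0
  then show ?case using sum_e by simp
next
  case (Suc k)
  have "(a ^^ Suc k) v = a (\<Sum>i\<le>n. t i ^ k *s e i v)" using Suc by simp
  also have "\<dots> = (\<Sum>i\<le>n. a (t i ^ k *s e i v))"
    using Suc.prems by (intro endo_sum a_endo) (auto intro: vec.subspace_scale[OF sub] e_W)
  also have "\<dots> = (\<Sum>i\<le>n. t i ^ Suc k *s e i v)"
    using Suc.prems by (intro sum.cong refl) (auto simp: endo_scale[OF a_endo] e_W a_e mult.commute)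
  finally show ?case .
qed

text \<open>A polynomial p in a has the coefficients p(t_i), and by interpolation every coefficient
  function occurs, the t_i being distinct.\<close>

lemma generated_algebra_eq: "generated_algebra W a = range D"
proof (intro equalityI subsetI)
  fix g assume "g \<in> generated_algebra W a"
  then obtain m c where g: "g = (\<lambda>v\<in>W. \<Sum>k\<le>m. c k *s (a ^^ k) v)" unfolding generated_algebra_def by blast
  have "g = D (\<lambda>i. \<Sum>k\<le>m. c k * t i ^ k)"
    unfolding g D_def
  proof (intro restrict_ext)
    fix v assume v: "v \<in> W"
    have "(\<Sum>k\<le>m. c k *s (a ^^ k) v) = (\<Sum>k\<le>m. \<Sum>i\<le>n. (c k * t i ^ k) *s e i v)"
      by (simp add: a_power[OF v] vec.scale_sum_right)
    also have "\<dots> = (\<Sum>i\<le>n. \<Sum>k\<le>m. (c k * t i ^ k) *s e i v)" by (rule sum.swap)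
    finally show "(\<Sum>k\<le>m. c k *s (a ^^ k) v) = (\<Sum>i\<le>n. (\<Sum>k\<le>m. c k * t i ^ k) *s e i v)"
      by (simp add: vec.scale_sum_left)
  qed
  then show "g \<in> range D" by simp
next
  fix g assume "g \<in> range D"
  then obtain f where g: "g = D f" by blast
  have "inj_on t {..<Suc n}" using t_inj by (simp add: lessThan_Suc_atMost)
  then obtain p where p: "\<forall>i<Suc n. poly p (t i) = f i" using interpolation_poly by blast
  have "g = (\<lambda>v\<in>W. \<Sum>k\<le>degree p. coeff p k *s (a ^^ k) v)"
    unfolding g D_def
  proof (intro restrict_ext)
    fix v assume v: "v \<in> W"
    have "(\<Sum>k\<le>degree p. coeff p k *s (a ^^ k) v) = (\<Sum>k\<le>degree p. \<Sum>i\<le>n. (coeff p k * t i ^ k) *s e i v)"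
      by (simp add: a_power[OF v] vec.scale_sum_right)
    also have "\<dots> = (\<Sum>i\<le>n. \<Sum>k\<le>degree p. (coeff p k * t i ^ k) *s e i v)" by (rule sum.swap)
    also have "\<dots> = (\<Sum>i\<le>n. poly p (t i) *s e i v)"
      by (simp add: vec.scale_sum_left poly_altdef)
    also have "\<dots> = (\<Sum>i\<le>n. f i *s e i v)" using p by (intro sum.cong refl) auto
    finally show "(\<Sum>i\<le>n. f i *s e i v) = (\<Sum>k\<le>degree p. coeff p k *s (a ^^ k) v)" by simp
  qed
  then show "g \<in> generated_algebra W a" unfolding generated_algebra_def by blast
qed

lemma endo_zero_eq: "endo_zero W = D (\<lambda>_. 0)"
  by (simp add: D_def)

text \<open>In the algebra of functions on n + 1 points the idempotents are the functions with
  values 0 and 1, and the minimal nonzero ones are the indicators of single points.\<close>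

lemma primitive_idempotents_eq: "primitive_idempotents (compose W) (endo_zero W) (generated_algebra W a) = e ` {..n}"
proof (intro equalityI subsetI)
  fix g assume "g \<in> primitive_idempotents (compose W) (endo_zero W) (generated_algebra W a)"
  then have g: "g \<in> range D" "g \<noteq> D (\<lambda>_. 0)" "compose W g g = g"
    and min: "\<And>f. f \<in> range D \<Longrightarrow> compose W f f = f \<Longrightarrow> compose W g f = f \<Longrightarrow> f = D (\<lambda>_. 0) \<or> f = g"
    unfolding primitive_idempotents_def generated_algebra_eq endo_zero_eq by auto
  obtain f where f: "g = D f" using g by blast
  obtain i where i: "i \<le> n" "f i \<noteq> 0" using g(2) unfolding f D_eq_iff by blast
  have "f i * f i = f i" using g(3) i(1) unfolding f compose_D D_eq_iff by blast
  then have fi: "f i = 1" using i(2) by simp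
  have "D (\<lambda>j. of_bool (j = i)) = D (\<lambda>_. 0) \<or> D (\<lambda>j. of_bool (j = i)) = g"
    using fi by (intro min) (auto simp: f compose_D D_eq_iff)
  moreover have "D (\<lambda>j. of_bool (j = i)) \<noteq> D (\<lambda>_. 0)" using i(1) by (auto simp: D_eq_iff)
  ultimately have "g = e i" using e_eq_D[OF i(1)] by simp
  then show "g \<in> e ` {..n}" using i(1) by simp
next
  fix g assume "g \<in> e ` {..n}"
  then obtain i where i: "i \<le> n" "g = D (\<lambda>j. of_bool (j = i))" using e_eq_D by auto
  have "f = D (\<lambda>_. 0) \<or> f = g" if f: "f \<in> range D" "compose W f f = f" "compose W g f = f" for f
  proof -
    obtain h where h: "f = D h" using f by blast
    have h1: "h j * h j = h j" if "j \<le> n" for j using f(2) that unfolding h compose_D D_eq_iff by blast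
    have h2: "of_bool (j = i) * h j = h j" if "j \<le> n" for j using f(3) that unfolding h i(2) compose_D D_eq_iff by blast
    have h3: "h j = 0" if "j \<le> n" "j \<noteq> i" for j using h2[OF that(1)] that by simp
    have "h i = 0 \<or> h i = 1" using h1[OF i(1)] by simp
    then show ?thesis
    proof
      assume "h i = 0"
      then have "f = D (\<lambda>_. 0)" unfolding h D_eq_iff using h3 by metis
      then show ?thesis ..
    next
      assume "h i = 1"
      then have "f = g" unfolding h i(2) D_eq_iff using h3 by (auto simp: of_bool_def)
      then show ?thesis ..
    qed
  qed
  moreover have "g \<in> range D" "g \<noteq> D (\<lambda>_. 0)" "compose W g g = g"
    using i by (auto simp: compose_D D_eq_iff)
  ultimately show "g \<in> primitive_idempotents (compose W) (endo_zero W) (generated_algebra W a)"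
    unfolding primitive_idempotents_def generated_algebra_eq endo_zero_eq by blast
qed

lemma eigenvalues_eq: "eigenvalues_on W a = t ` {..n}"
proof (intro equalityI subsetI)
  fix s assume "s \<in> eigenvalues_on W a"
  then obtain v where v: "v \<in> W" "v \<noteq> 0" "a v = s *s v" unfolding eigenvalues_on_def by blast
  have "\<exists>i\<le>n. e i v \<noteq> 0"
  proof (rule ccontr)
    assume "\<not> (\<exists>i\<le>n. e i v \<noteq> 0)"
    then have "(\<Sum>i\<le>n. e i v) = 0" by (intro sum.neutral) auto
    then show False using sum_e[OF v(1)] v(2) by simp
  qed
  then obtain i where i: "i \<le> n" "e i v \<noteq> 0" by blast
  have "a v = D t v" using a_power[OF v(1), of "Suc 0"] v(1) by (simp add: D_def)
  then have "e i (s *s v) = t i *s e i v" using e_D[OF i(1) v(1), of t] v(3) by simp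
  then have "s *s e i v = t i *s e i v" using endo_scale[OF e_endo[OF i(1)] v(1)] by simp
  then have "s = t i" using i(2) vec.scale_right_imp_eq by blast
  then show "s \<in> t ` {..n}" using i(1) by blast
next
  fix s assume "s \<in> t ` {..n}"
  then obtain i where i: "i \<le> n" "s = t i" by blast
  obtain v where v: "v \<in> W" "e i v \<noteq> 0" using e_nz[OF i(1)] by blast
  then show "s \<in> eigenvalues_on W a"
    unfolding eigenvalues_on_def using a_e[OF i(1) v(1)] e_W[OF i(1) v(1)] i(2) by blast
qed

lemma multiplicity_free: "multiplicity_free_ordering W n a e"
proof -
  have "inj_on e {..n}"
  proof
    fix i j assume ij: "i \<in> {..n}" "j \<in> {..n}" "e i = e j"
    then have "D (\<lambda>k. of_bool (k = i)) = D (\<lambda>k. of_bool (k = j))" using e_eq_D by auto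
    then have "of_bool (i = i) = (of_bool (i = j) :: complex)" using ij(1) unfolding D_eq_iff by blast
    then show "i = j" by (simp split: if_splits)
  qed
  then show ?thesis
    unfolding multiplicity_free_ordering_def eigenvalues_eq primitive_idempotents_eq bij_betw_def
    using a_endo card_image[OF t_inj] by simp
qed

end

lemma endoI_matrix:
  assumes "vec.subspace W" "\<And>v. v \<in> W \<Longrightarrow> M *v v \<in> W"
  shows "(\<lambda>v\<in>W. M *v v) \<in> endo W"
proof -
  have "M *v (c *s v) = c *s (M *v v)" for c v
    by (simp add: cvec_eq_iff matrix_vector_mult_def sum_distrib_left mult_ac)
  then show ?thesis
    using assms vec.subspace_add[OF assms(1)] vec.subspace_scale[OF assms(1)]
    unfolding endo_def by (auto simp: matrix_vector_right_distrib)
qed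

section \<open>The primary module and its Leonard system\<close>

context qdrg
begin

definition hat :: "'a \<Rightarrow> (nat \<Rightarrow> complex) \<Rightarrow> complex ^ 'a" where
  "hat x f = dmat f *v axis x 1"

lemma hat_nth: "x \<in> X \<Longrightarrow> hat x f $ y = (if y \<in> X then f (dl y x) else 0)"
  by (simp add: hat_def matrix_mult_axis_nth dmat_nth)

lemma hat_eq_iff:
  assumes "x \<in> X"
  shows "hat x f = hat x g \<longleftrightarrow> (\<forall>t\<le>d. f t = g t)"
proof
  assume eq: "hat x f = hat x g"
  show "\<forall>t\<le>d. f t = g t"
  proof (intro allI impI)
    fix t assume "t \<le> d"
    then obtain y where y: "y \<in> X" "dl x y = t" using exists_at_dist[OF assms] by blast
    have "hat x f $ y = hat x g $ y" using eq by simp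
    then show "f t = g t" unfolding hat_nth[OF assms] dl_sym[OF y(1) assms] y(2) using y(1) by simp
  qed
next
  assume "\<forall>t\<le>d. f t = g t"
  then have "dmat f = dmat g" by (simp add: dmat_eq_iff)
  then show "hat x f = hat x g" by (simp add: hat_def)
qed

lemma hat_0: "hat x (\<lambda>_. 0) = 0"
  by (simp add: hat_def dmat_zero)

lemma hat_add: "hat x f + hat x g = hat x (\<lambda>t. f t + g t)"
  unfolding hat_def dmat_add[symmetric] by (simp add: matrix_vector_mult_add_rdistrib)

lemma hat_scale: "k *s hat x f = hat x (\<lambda>t. k * f t)"
  unfolding hat_def dmat_scale[symmetric] cscale_mult_vec ..

lemma hat_sum: "(\<Sum>i\<in>I. hat x (f i)) = hat x (\<lambda>t. \<Sum>i\<in>I. f i t)"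
  by (induction I rule: infinite_finite_induct) (simp_all add: hat_0 hat_add)

lemma diag_hat: "x \<in> X \<Longrightarrow> diag (hat x f) *v hat x g = hat x (\<lambda>t. f t * g t)"
  by (simp add: cvec_eq_iff diag_mult_vec hat_nth)

text \<open>The primary module of the Terwilliger algebra at x; by \<open>primary_eq\<close> its
  vectors are the functions of the distance to x.\<close>

definition primary :: "'a \<Rightarrow> (complex ^ 'a) set" where
  "primary x = (\<lambda>M. M *v axis x 1) ` BM"

lemma primary_eq: "primary x = range (hat x)"
  by (auto simp: primary_def BM_def hat_def)

lemma mult_primary:
  assumes "M \<in> BM" "v \<in> primary x"
  shows "M *v v \<in> primary x"
  using assms BM_mult_closed by (force simp: primary_def matrix_vector_mul_assoc)

lemma primary_subspace: "vec.subspace (primary x)"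
proof -
  have "0 \<in> primary x" unfolding primary_eq using hat_0 by (metis rangeI)
  then show ?thesis
    unfolding vec.subspace_def by (auto simp: primary_eq hat_add hat_scale)
qed

lemma dim_primary:
  assumes x: "x \<in> X"
  shows "vec.dim (primary x) = d + 1"
proof -
  let ?u = "\<lambda>i. hat x (\<lambda>t. of_bool (t = i))"
  have inj: "inj_on ?u {..d}"
  proof
    fix i j assume ij: "i \<in> {..d}" "j \<in> {..d}" "?u i = ?u j"
    then have "of_bool (i = i) = (of_bool (i = j) :: complex)" unfolding hat_eq_iff[OF x] by blast
    then show "i = j" by (simp split: if_splits)
  qed
  have comb: "(\<Sum>i\<le>d. f i *s ?u i) = hat x f" for f
    unfolding hat_scale hat_sum hat_eq_iff[OF x] by (auto simp: of_bool_def if_distrib cong: if_cong)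
  have indep: "vec.independent (?u ` {..d})"
  proof
    assume "vec.dependent (?u ` {..d})"
    then obtain g v where g: "(\<Sum>w\<in>?u ` {..d}. g w *s w) = 0" and v: "v \<in> ?u ` {..d}" "g v \<noteq> 0"
      using vec.dependent_finite[of "?u ` {..d}"] by auto
    have "hat x (\<lambda>i. g (?u i)) = hat x (\<lambda>_. 0)"
      using g unfolding sum.reindex[OF inj] comb[of "\<lambda>i. g (?u i)", symmetric] o_def hat_0 .
    then show False using v unfolding hat_eq_iff[OF x] by auto
  qed
  have "primary x = vec.span (?u ` {..d})"
  proof
    show "primary x \<subseteq> vec.span (?u ` {..d})"
    proof
      fix v assume "v \<in> primary x"
      then obtain f where v: "v = hat x f" by (auto simp: primary_eq)
      show "v \<in> vec.span (?u ` {..d})"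
        unfolding v comb[of f, symmetric] by (intro vec.span_sum vec.span_scale vec.span_base imageI) auto
    qed
    show "vec.span (?u ` {..d}) \<subseteq> primary x"
      by (intro vec.span_minimal primary_subspace) (auto simp: primary_eq)
  qed
  then show ?thesis
    using vec.dim_span_eq_card_independent[OF indep] card_image[OF inj] by simp
qed

lemma resolution_E:
  assumes x: "x \<in> X"
  shows "resolution (primary x) d (\<lambda>i. \<lambda>v\<in>primary x. E i *v v) (\<lambda>v\<in>primary x. Am 1 *v v) th"
proof
  let ?W = "primary x"
  show "vec.subspace ?W" by (rule primary_subspace)
  show "(\<lambda>v\<in>?W. E i *v v) \<in> endo ?W" if "i \<le> d" for i
    using that by (intro endoI_matrix primary_subspace mult_primary E_BM)
  show "(\<lambda>v\<in>?W. Am 1 *v v) \<in> endo ?W"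
    by (intro endoI_matrix primary_subspace mult_primary Am_in_BM)
  show "(\<lambda>v\<in>?W. E i *v v) ((\<lambda>v\<in>?W. E j *v v) v) = (if i = j then (\<lambda>v\<in>?W. E i *v v) v else 0)"
    if "i \<le> d" "j \<le> d" "v \<in> ?W" for i j v
    using that by (auto simp: mult_primary E_BM matrix_vector_mul_assoc E_idem E_orth)
  show "(\<Sum>i\<le>d. (\<lambda>v\<in>?W. E i *v v) v) = v" if "v \<in> ?W" for v
  proof -
    have "(\<Sum>i\<in>I. E i *v v) = (\<Sum>i\<in>I. E i) *v v" for I
      by (induction I rule: infinite_finite_induct) (simp_all add: matrix_vector_mult_add_rdistrib)
    moreover have "Am 0 *v v = v"
      using that Am_0_mult_BM by (force simp: primary_def matrix_vector_mul_assoc)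
    ultimately show ?thesis using that sum_E by simp
  qed
  show "\<exists>v\<in>?W. (\<lambda>v\<in>?W. E i *v v) v \<noteq> 0" if "i \<le> d" for i
  proof
    have "Am 0 *v axis x 1 \<in> ?W" by (simp add: primary_def)
    moreover have "(E i *v (Am 0 *v axis x 1)) $ x = eps i 0"
      using that x dl_0[of x x] by (simp add: matrix_vector_mul_assoc BM_mult_Am_0 E_BM matrix_mult_axis_nth E_nth)
    ultimately show "(\<lambda>v\<in>?W. E i *v v) (Am 0 *v axis x 1) \<noteq> 0" "Am 0 *v axis x 1 \<in> ?W"
      using eps_0_ne_0[OF that] by auto
  qed
  show "(\<lambda>v\<in>?W. Am 1 *v v) ((\<lambda>v\<in>?W. E i *v v) v) = th i *s (\<lambda>v\<in>?W. E i *v v) v"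
    if "i \<le> d" "v \<in> ?W" for i v
    using that by (simp add: mult_primary E_BM matrix_vector_mul_assoc Am_1_mult_E cscale_mult_vec)
  show "inj_on th {..d}" using th_inj by (auto intro: inj_onI)
qed

abbreviation dual_op :: "'a \<Rightarrow> complex ^ 'a ^ 'a" where
  "dual_op x \<equiv> cscale (of_nat (card X)) (diag (E 1 *v axis x 1))"

lemma dual_op_hat: "x \<in> X \<Longrightarrow> dual_op x *v hat x f = hat x (\<lambda>t. of_nat (card X) * eps 1 t * f t)"
  using d_pos by (simp add: cscale_mult_vec E_eq flip: hat_def) (simp add: diag_hat hat_scale mult.assoc)

lemma dual_idem_hat: "x \<in> X \<Longrightarrow> diag (Am i *v axis x 1) *v hat x f = hat x (\<lambda>t. of_bool (t = i) * f t)"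
  by (simp add: Am_def diag_hat flip: hat_def)

lemma hat_primary [simp]: "hat x f \<in> primary x"
  by (simp add: primary_eq)

lemma resolution_dual:
  assumes x: "x \<in> X"
  shows "resolution (primary x) d (\<lambda>i. \<lambda>v\<in>primary x. diag (Am i *v axis x 1) *v v)
    (\<lambda>v\<in>primary x. dual_op x *v v) (\<lambda>t. of_nat (card X) * eps 1 t)"
proof
  let ?W = "primary x"
  show "vec.subspace ?W" by (rule primary_subspace)
  show "(\<lambda>v\<in>?W. diag (Am i *v axis x 1) *v v) \<in> endo ?W" for i
    by (intro endoI_matrix primary_subspace) (auto simp: primary_eq dual_idem_hat[OF x])
  show "(\<lambda>v\<in>?W. dual_op x *v v) \<in> endo ?W"
    by (intro endoI_matrix primary_subspace) (auto simp: primary_eq dual_op_hat[OF x])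
  show "(\<lambda>v\<in>?W. diag (Am i *v axis x 1) *v v) ((\<lambda>v\<in>?W. diag (Am j *v axis x 1) *v v) v)
      = (if i = j then (\<lambda>v\<in>?W. diag (Am i *v axis x 1) *v v) v else 0)"
    if prem: "i \<le> d" "j \<le> d" "v \<in> ?W" for i j v
  proof -
    obtain f where f: "v = hat x f" using prem by (auto simp: primary_eq)
    show ?thesis unfolding f hat_0[of x, symmetric]
      by (auto simp: dual_idem_hat[OF x] hat_eq_iff[OF x])
  qed
  show "(\<Sum>i\<le>d. (\<lambda>v\<in>?W. diag (Am i *v axis x 1) *v v) v) = v" if prem: "v \<in> ?W" for v
  proof -
    obtain f where f: "v = hat x f" using prem by (auto simp: primary_eq)
    have "(\<Sum>i\<le>d. of_bool (t = i) * f t) = f t" if "t \<le> d" for t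
    proof -
      have "(\<Sum>i\<le>d. of_bool (t = i) * f t) = (\<Sum>i\<le>d. if i = t then f t else 0)" by (intro sum.cong) auto
      then show ?thesis using that by simp
    qed
    then show ?thesis unfolding f by (simp add: dual_idem_hat[OF x] hat_sum hat_eq_iff[OF x])
  qed
  show "\<exists>v\<in>?W. (\<lambda>v\<in>?W. diag (Am i *v axis x 1) *v v) v \<noteq> 0" if "i \<le> d" for i
  proof
    show "(\<lambda>v\<in>?W. diag (Am i *v axis x 1) *v v) (hat x (\<lambda>_. 1)) \<noteq> 0"
      unfolding hat_0[of x, symmetric] using that by (auto simp: dual_idem_hat[OF x] hat_eq_iff[OF x])
  qed simp
  show "(\<lambda>v\<in>?W. dual_op x *v v) ((\<lambda>v\<in>?W. diag (Am i *v axis x 1) *v v) v)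
      = (of_nat (card X) * eps 1 i) *s (\<lambda>v\<in>?W. diag (Am i *v axis x 1) *v v) v"
    if prem: "i \<le> d" "v \<in> ?W" for i v
  proof -
    obtain f where f: "v = hat x f" using prem by (auto simp: primary_eq)
    show ?thesis unfolding f
      by (simp add: dual_idem_hat[OF x] dual_op_hat[OF x] hat_scale hat_eq_iff[OF x] del: cscale_mult_vec)
  qed
  show "inj_on (\<lambda>t. of_nat (card X) * eps 1 t) {..d}"
    using eps_1_inj card_X_ne_0 by (auto intro!: inj_onI)
qed

lemma shift_indicator_far: "t > Suc j \<or> j > Suc t \<Longrightarrow> shift (\<lambda>s. of_bool (s = j)) t = 0"
  by (auto simp: shift_def)

lemma shift_indicator_near:
  assumes "i \<le> d" "j \<le> d" "i = Suc j \<or> j = Suc i"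
  shows "shift (\<lambda>s. of_bool (s = j)) i \<noteq> 0"
  using assms c_pos[of i] b_pos[of i] by (auto simp: shift_def)

text \<open>The component at distance i of A applied to a vector supported at distance j is governed
  by an entry of the intersection matrix: 0 off the tridiagonal band, and b or c, hence nonzero,
  next to the diagonal.\<close>

lemma tridiagonal_A:
  assumes x: "x \<in> X"
  shows "tridiagonal_wrt (primary x) d (\<lambda>v\<in>primary x. Am 1 *v v) (\<lambda>i. \<lambda>v\<in>primary x. diag (Am i *v axis x 1) *v v)"
proof -
  let ?W = "primary x"
  let ?e = "\<lambda>i. \<lambda>v\<in>?W. diag (Am i *v axis x 1) *v v"
  let ?a = "\<lambda>v\<in>?W. Am 1 *v v"
  have Ah: "Am 1 *v hat x f = hat x (shift f)" for f
    by (simp add: hat_def matrix_vector_mul_assoc Am_1_mult_dmat)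
  have *: "compose ?W (?e i) (compose ?W ?a (?e j)) (hat x f) = hat x (\<lambda>t. of_bool (t = i) * (f j * shift (\<lambda>s. of_bool (s = j)) i))" for i j f
  proof -
    have "compose ?W (?e i) (compose ?W ?a (?e j)) (hat x f) = hat x (\<lambda>t. of_bool (t = i) * shift (\<lambda>s. of_bool (s = j) * f s) t)"
      by (simp add: compose_def dual_idem_hat[OF x] Ah)
    also have "shift (\<lambda>s. of_bool (s = j) * f s) = (\<lambda>t. f j * shift (\<lambda>s. of_bool (s = j)) t)"
      by (auto simp: shift_def fun_eq_iff algebra_simps)
    also have "(\<lambda>t. of_bool (t = i) * (f j * shift (\<lambda>s. of_bool (s = j)) t)) = (\<lambda>t. of_bool (t = i) * (f j * shift (\<lambda>s. of_bool (s = j)) i))"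
      by (auto simp: fun_eq_iff)
    finally show ?thesis .
  qed
  show ?thesis
    unfolding tridiagonal_wrt_def
  proof (intro allI impI conjI)
    fix i j assume ij: "i \<le> d" "j \<le> d"
    show "compose ?W (?e i) (compose ?W ?a (?e j)) = endo_zero ?W" if "\<bar>int i - int j\<bar> > 1"
    proof
      fix v
      have z: "shift (\<lambda>s. of_bool (s = j)) i = 0" using that by (intro shift_indicator_far) auto
      show "compose ?W (?e i) (compose ?W ?a (?e j)) v = endo_zero ?W v"
      proof (cases "v \<in> ?W")
        case True
        then obtain f where "v = hat x f" by (auto simp: primary_eq)
        then show ?thesis by (simp only: * z) (simp add: hat_0)
      qed (simp add: compose_def)
    qed
    show "compose ?W (?e i) (compose ?W ?a (?e j)) \<noteq> endo_zero ?W" if "\<bar>int i - int j\<bar> = 1"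
    proof
      assume eq: "compose ?W (?e i) (compose ?W ?a (?e j)) = endo_zero ?W"
      have "hat x (\<lambda>t. of_bool (t = i) * ((\<lambda>_. 1) j * shift (\<lambda>s. of_bool (s = j)) i)) = hat x (\<lambda>_. 0)"
        using fun_cong[OF eq, of "hat x (\<lambda>_. 1)"] unfolding * by (simp add: hat_0)
      then have "shift (\<lambda>s. of_bool (s = j)) i = 0" unfolding hat_eq_iff[OF x] using ij by auto
      moreover have "i = Suc j \<or> j = Suc i" using that by auto
      ultimately show False using shift_indicator_near ij by blast
    qed
  qed
qed

text \<open>\<open>T i j\<close> is the coefficient of E_i in E_1 o E_j, so the second index names
  the three-term relation: b*_i stands at i = j - 1 and c*_i at i = j + 1.\<close>

lemma hadamard_E_mult_E:
  obtains T where "\<And>i j. i \<le> d \<Longrightarrow> j \<le> d \<Longrightarrow> E i ** (E 1 \<circ>\<^sub>H E j) = cscale (T i j) (E i)"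
    "\<And>i j. i \<le> d \<Longrightarrow> j \<le> d \<Longrightarrow> i > Suc j \<or> j > Suc i \<Longrightarrow> T i j = 0"
    "\<And>i j. i \<le> d \<Longrightarrow> j \<le> d \<Longrightarrow> i = Suc j \<or> j = Suc i \<Longrightarrow> T i j \<noteq> 0"
proof -
  obtain as bs cs where nz: "\<forall>i \<in> {1..d}. bs (i - 1) * cs i \<noteq> 0"
    and tt: "\<forall>i \<le> d. E 1 \<circ>\<^sub>H E i = cscale (1 / of_nat (card X))
            ((if i = 0 then 0 else cscale (bs (i - 1)) (E (i - 1))) +
             cscale (as i) (E i) +
             (if i = d then 0 else cscale (cs (i + 1)) (E (i + 1))))" using E_three_term by blast
  define T where "T i j = (if Suc i = j then bs i else if i = j then as i else if i = Suc j then cs i else 0) / of_nat (card X)" for i j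
  have "E i ** (E 1 \<circ>\<^sub>H E j) = cscale (T i j) (E i)" if ij: "i \<le> d" "j \<le> d" for i j
  proof -
    have "E i ** (if j = 0 then 0 else cscale (bs (j - 1)) (E (j - 1))) = (if Suc i = j then cscale (bs i) (E i) else 0)"
      using ij E_orth[of i "j - 1"] E_idem[of i] by (auto simp: cscale_mult_right)
    moreover have "E i ** cscale (as j) (E j) = (if i = j then cscale (as i) (E i) else 0)"
      using ij E_orth[of i j] E_idem[of i] by (auto simp: cscale_mult_right)
    moreover have "E i ** (if j = d then 0 else cscale (cs (j + 1)) (E (j + 1))) = (if i = Suc j then cscale (cs i) (E i) else 0)"
      using ij E_orth[of i "Suc j"] E_idem[of i] by (auto simp: cscale_mult_right)
    ultimately have "E i ** (E 1 \<circ>\<^sub>H E j) = cscale (1 / of_nat (card X)) ((if Suc i = j then cscale (bs i) (E i) else 0) +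
        (if i = j then cscale (as i) (E i) else 0) + (if i = Suc j then cscale (cs i) (E i) else 0))"
      unfolding tt[rule_format, OF ij(2)] cscale_mult_right matrix_add_ldistrib by (simp only:)
    then show ?thesis by (auto simp: T_def)
  qed
  moreover have "T i j = 0" if "i > Suc j \<or> j > Suc i" for i j using that by (auto simp: T_def)
  moreover have "T i j \<noteq> 0" if ij: "i \<le> d" "j \<le> d" "i = Suc j \<or> j = Suc i" for i j
  proof -
    have "i = Suc j \<Longrightarrow> bs (i - 1) * cs i \<noteq> 0" "j = Suc i \<Longrightarrow> bs (j - 1) * cs j \<noteq> 0"
      using nz[rule_format, of i] nz[rule_format, of j] ij by simp_all
    then show ?thesis using ij(3) card_X_ne_0 by (auto simp: T_def)
  qed
  ultimately show ?thesis using that[of T] by blast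
qed

text \<open>The dual adjacency matrix sends the column of E_j at x to |X| times that of E_1 o E_j,
  so in the basis of these columns its entries are the Krein parameters of the three-term
  relation.\<close>

lemma tridiagonal_dual:
  assumes x: "x \<in> X"
  shows "tridiagonal_wrt (primary x) d (\<lambda>v\<in>primary x. dual_op x *v v) (\<lambda>i. \<lambda>v\<in>primary x. E i *v v)"
proof -
  let ?W = "primary x"
  let ?e = "\<lambda>i. \<lambda>v\<in>?W. E i *v v"
  let ?a = "\<lambda>v\<in>?W. dual_op x *v v"
  obtain T where T: "\<And>i j. i \<le> d \<Longrightarrow> j \<le> d \<Longrightarrow> E i ** (E 1 \<circ>\<^sub>H E j) = cscale (T i j) (E i)"
    and T0: "\<And>i j. i \<le> d \<Longrightarrow> j \<le> d \<Longrightarrow> i > Suc j \<or> j > Suc i \<Longrightarrow> T i j = 0"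
    and T1: "\<And>i j. i \<le> d \<Longrightarrow> j \<le> d \<Longrightarrow> i = Suc j \<or> j = Suc i \<Longrightarrow> T i j \<noteq> 0"
    using hadamard_E_mult_E[of thesis] by blast
  have dual: "dual_op x *v (E j *v axis x 1) = of_nat (card X) *s ((E 1 \<circ>\<^sub>H E j) *v axis x 1)" if "j \<le> d" for j
    using that d_pos by (simp add: cscale_mult_vec diag_mult_vec matrix_mult_axis_nth cvec_eq_iff)
  have EE: "E i *v ((E 1 \<circ>\<^sub>H E j) *v axis x 1) = T i j *s (E i *v axis x 1)" if "i \<le> d" "j \<le> d" for i j
    using T[OF that] by (simp add: matrix_vector_mul_assoc cscale_mult_vec)
  have scale: "M *v (k *s v) = k *s (M *v v)" for M :: "complex ^ 'a ^ 'a" and k v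
    by (simp add: cvec_eq_iff matrix_vector_mult_def sum_distrib_left mult_ac)
  have Ex: "E j *v axis x 1 \<in> ?W" "(E 1 \<circ>\<^sub>H E j) *v axis x 1 \<in> ?W" if "j \<le> d" for j
    using that E_BM d_pos by (auto simp: primary_def E_eq dmat_hadamard)
  have *: "compose ?W (?e i) (compose ?W ?a (?e j)) (M *v axis x 1) = (k * of_nat (card X) * T i j) *s (E i *v axis x 1)"
    if ij: "i \<le> d" "j \<le> d" and M: "M \<in> BM" "M ** E j = cscale k (E j)" for i j M k
  proof -
    have "E j *v (M *v axis x 1) = k *s (E j *v axis x 1)"
      using M BM_commute[OF E_BM[OF ij(2)] M(1)] by (simp add: matrix_vector_mul_assoc cscale_mult_vec)
    moreover have "M *v axis x 1 \<in> ?W" using M by (auto simp: primary_def)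
    moreover have "k *s (E j *v axis x 1) \<in> ?W" "(k * of_nat (card X)) *s ((E 1 \<circ>\<^sub>H E j) *v axis x 1) \<in> ?W"
      using Ex[OF ij(2)] by (auto intro: vec.subspace_scale[OF primary_subspace])
    moreover have "dual_op x *v (k *s (E j *v axis x 1)) = (k * of_nat (card X)) *s ((E 1 \<circ>\<^sub>H E j) *v axis x 1)"
      unfolding scale dual[OF ij(2)] by simp
    ultimately have "compose ?W (?e i) (compose ?W ?a (?e j)) (M *v axis x 1)
        = E i *v ((k * of_nat (card X)) *s ((E 1 \<circ>\<^sub>H E j) *v axis x 1))"
      by (simp add: compose_def del: cscale_mult_vec)
    also have "\<dots> = (k * of_nat (card X) * T i j) *s (E i *v axis x 1)"
      unfolding scale EE[OF ij] by simp
    finally show ?thesis .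
  qed
  have Ex0: "E i *v axis x 1 \<noteq> 0" if "i \<le> d" for i
  proof
    assume "E i *v axis x 1 = 0"
    then have "(E i *v axis x 1) $ x = 0" by simp
    then show False using eps_0_ne_0[OF that] E_nth[OF that x x] dl_0[OF x x] by (simp add: matrix_mult_axis_nth)
  qed
  show ?thesis
    unfolding tridiagonal_wrt_def
  proof (intro allI impI conjI)
    fix i j assume ij: "i \<le> d" "j \<le> d"
    show "compose ?W (?e i) (compose ?W ?a (?e j)) = endo_zero ?W" if "\<bar>int i - int j\<bar> > 1"
    proof
      fix v
      have z: "T i j = 0" using that ij by (intro T0) auto
      show "compose ?W (?e i) (compose ?W ?a (?e j)) v = endo_zero ?W v"
      proof (cases "v \<in> ?W")
        case True
        then obtain M where M: "M \<in> BM" "v = M *v axis x 1" by (auto simp: primary_def)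
        obtain k where "M ** E j = cscale k (E j)" using BM_mult_E[OF M(1) ij(2)] by blast
        from *[OF ij M(1) this] show ?thesis unfolding z M(2)[symmetric] using True by simp
      qed (simp add: compose_def)
    qed
    show "compose ?W (?e i) (compose ?W ?a (?e j)) \<noteq> endo_zero ?W" if "\<bar>int i - int j\<bar> = 1"
    proof
      assume eq: "compose ?W (?e i) (compose ?W ?a (?e j)) = endo_zero ?W"
      have "E j ** E j = cscale 1 (E j)" using E_idem[OF ij(2)] by simp
      from *[OF ij E_BM[OF ij(2)] this] have "(1 * of_nat (card X) * T i j) *s (E i *v axis x 1) = 0"
        unfolding eq using Ex(1)[OF ij(2)] by simp
      then have "T i j = 0" using Ex0[OF ij(1)] card_X_ne_0 by simp
      moreover have "i = Suc j \<or> j = Suc i" using that by auto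
      ultimately show False using T1[OF ij] by blast
    qed
  qed
qed

definition leonard :: "'a \<Rightarrow> 'a leonard_data" where
  "leonard x = \<lparr> lspace = primary x, ldiam = d,
        lop = (\<lambda>v \<in> primary x. Am 1 *v v),
        ldop = (\<lambda>v \<in> primary x. dual_op x *v v),
        lidem = (\<lambda>i. \<lambda>v \<in> primary x. E i *v v),
        ldidem = (\<lambda>i. \<lambda>v \<in> primary x. diag (Am i *v axis x 1) *v v) \<rparr>"

lemma leonard_system_leonard: "x \<in> X \<Longrightarrow> leonard_system (leonard x)"
  unfolding leonard_system_def leonard_def
  using primary_subspace dim_primary resolution.multiplicity_free[OF resolution_E]
    resolution.multiplicity_free[OF resolution_dual] tridiagonal_A tridiagonal_dual by simp

end

section \<open>Split sequences\<close>

lemma mat_mult_index: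
  assumes "A \<in> carrier_mat n n" "B \<in> carrier_mat n n" "i < n" "j < n"
  shows "(A * B) $$ (i, j) = (\<Sum>k<n. A $$ (i, k) * B $$ (k, j))"
  using assms by (simp add: scalar_prod_def lessThan_atLeast0)

lemma lower_bidiagonal_mult:
  fixes B :: "complex Matrix.mat"
  assumes "B \<in> carrier_mat n n" "i < n" "j < n"
  shows "(Matrix.mat n n (\<lambda>(i, j). if i = j then \<theta> i else if i = j + 1 then 1 else 0) * B) $$ (i, j)
    = \<theta> i * B $$ (i, j) + (if i = 0 then 0 else B $$ (i - 1, j))"
proof -
  let ?L = "Matrix.mat n n (\<lambda>(i, j). if i = j then \<theta> i else if i = j + 1 then 1 else 0) :: complex Matrix.mat"
  have "(?L * B) $$ (i, j) = (\<Sum>k<n. ?L $$ (i, k) * B $$ (k, j))"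
    using assms by (intro mat_mult_index) auto
  also have "\<dots> = (\<Sum>k<n. (if k = i then \<theta> i * B $$ (i, j) else 0) + (if k + 1 = i then B $$ (i - 1, j) else 0))"
    using assms by (intro sum.cong) auto
  also have "\<dots> = \<theta> i * B $$ (i, j) + (\<Sum>k<n. if k + 1 = i then B $$ (i - 1, j) else 0)"
    using assms by (simp add: sum.distrib)
  also have "(\<Sum>k<n. if k + 1 = i then B $$ (i - 1, j) else 0) = (if i = 0 then 0 else B $$ (i - 1, j))"
    using assms by (cases i) auto
  finally show ?thesis .
qed

lemma upper_bidiagonal_mult:
  fixes B :: "complex Matrix.mat"
  assumes "B \<in> carrier_mat n n" "i < n" "j < n"
  shows "(Matrix.mat n n (\<lambda>(i, j). if i = j then \<theta>s i else if j = i + 1 then vphi j else 0) * B) $$ (i, j)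
    = \<theta>s i * B $$ (i, j) + (if Suc i < n then vphi (Suc i) * B $$ (Suc i, j) else 0)"
proof -
  let ?U = "Matrix.mat n n (\<lambda>(i, j). if i = j then \<theta>s i else if j = i + 1 then vphi j else 0) :: complex Matrix.mat"
  have "(?U * B) $$ (i, j) = (\<Sum>k<n. ?U $$ (i, k) * B $$ (k, j))"
    using assms by (intro mat_mult_index) auto
  also have "\<dots> = (\<Sum>k<n. (if k = i then \<theta>s i * B $$ (i, j) else 0) + (if k = Suc i then vphi (Suc i) * B $$ (Suc i, j) else 0))"
    using assms by (intro sum.cong) auto
  also have "\<dots> = \<theta>s i * B $$ (i, j) + (if Suc i < n then vphi (Suc i) * B $$ (Suc i, j) else 0)"
    using assms by (simp add: sum.distrib)
  finally show ?thesis .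
qed

text \<open>The operator (a - \<theta>_{i-1}) ... (a - \<theta>_0) e, built inside
  \<open>endo W\<close> so that an algebra isomorphism can be applied to it.\<close>

fun split_map :: "(complex ^ 'n) set \<Rightarrow> (complex ^ 'n \<Rightarrow> complex ^ 'n) \<Rightarrow> (complex ^ 'n \<Rightarrow> complex ^ 'n) \<Rightarrow>
    (nat \<Rightarrow> complex) \<Rightarrow> nat \<Rightarrow> complex ^ 'n \<Rightarrow> complex ^ 'n" where
  "split_map W a e \<theta> 0 = e"
| "split_map W a e \<theta> (Suc i) = (\<lambda>v\<in>W. compose W a (split_map W a e \<theta> i) v + (\<lambda>v\<in>W. (- \<theta> i) *s split_map W a e \<theta> i v) v)"

lemma endo_comb:
  assumes W: "vec.subspace W" and f: "f \<in> endo W"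
  shows "(\<lambda>v\<in>W. c *s f v) \<in> endo W"
    and "g \<in> endo W \<Longrightarrow> (\<lambda>v\<in>W. f v + g v) \<in> endo W"
    and "g \<in> endo W \<Longrightarrow> compose W f g \<in> endo W"
proof -
  note sub = vec.subspace_add[OF W] vec.subspace_scale[OF W]
  show "(\<lambda>v\<in>W. c *s f v) \<in> endo W"
    using f sub unfolding endo_def by (auto simp: vec.scale_right_distrib PiE_def Pi_def mult.commute)
  show "(\<lambda>v\<in>W. f v + g v) \<in> endo W" if g: "g \<in> endo W"
    using f g sub unfolding endo_def by (auto simp: vec.scale_right_distrib PiE_def Pi_def)
  show "compose W f g \<in> endo W" if g: "g \<in> endo W"
    using f g sub unfolding endo_def by (auto simp: compose_def PiE_def Pi_def)
qed

lemma split_map_endo: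
  assumes "vec.subspace W" "a \<in> endo W" "e \<in> endo W"
  shows "split_map W a e \<theta> i \<in> endo W"
proof (induction i)
  case (Suc i)
  then show ?case unfolding split_map.simps by (intro endo_comb assms)
qed (simp add: assms)

text \<open>In the bidiagonal model the dual idempotent \<open>e\<close> has its only nonzero row at \<open>0\<close>, and the
  \<open>i\<close>-th split map moves this row to position \<open>i\<close>.\<close>

lemma split_map_relation:
  fixes a as e :: "complex ^ 'n \<Rightarrow> complex ^ 'n" and d :: nat
  defines "n \<equiv> d + 1"
  assumes W: "vec.subspace W" and iso: "matrix_algebra_iso W n F"
    and a: "a \<in> endo W" "F a = Matrix.mat n n (\<lambda>(i, j). if i = j then \<theta> i else if i = j + 1 then 1 else 0)"
    and as: "as \<in> endo W" "F as = Matrix.mat n n (\<lambda>(i, j). if i = j then \<theta>s i else if j = i + 1 then vphi j else 0)"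
    and e: "e \<in> endo W" "\<And>v. v \<in> W \<Longrightarrow> as (e v) = \<theta>s 0 *s e v"
    and inj: "inj_on \<theta>s {..d}" and i: "1 \<le> i" "i \<le> d" and v: "v \<in> W"
  shows "as (split_map W a e \<theta> i v) = \<theta>s i *s split_map W a e \<theta> i v + vphi i *s split_map W a e \<theta> (i - 1) v"
proof -
  let ?T = "split_map W a e \<theta>"
  let ?U = "Matrix.mat n n (\<lambda>(i, j). if i = j then \<theta>s i else if j = i + 1 then vphi j else 0) :: complex Matrix.mat"
  have bij: "bij_betw F (endo W) (carrier_mat n n)"
    and Fadd: "\<And>f g. f \<in> endo W \<Longrightarrow> g \<in> endo W \<Longrightarrow> F (\<lambda>v \<in> W. f v + g v) = F f + F g"
    and Fscale: "\<And>c f. f \<in> endo W \<Longrightarrow> F (\<lambda>v \<in> W. c *s f v) = c \<cdot>\<^sub>m F f"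
    and Fmult: "\<And>f g. f \<in> endo W \<Longrightarrow> g \<in> endo W \<Longrightarrow> F (compose W f g) = F f * F g"
    using iso unfolding matrix_algebra_iso_def by auto
  have carr: "F f \<in> carrier_mat n n" if "f \<in> endo W" for f using bij that by (auto simp: bij_betw_def)
  have T: "?T i \<in> endo W" for i using W a(1) e(1) by (rule split_map_endo)
  note comb = endo_comb[OF W]
  define P where "P = F e"
  have P: "P \<in> carrier_mat n n" unfolding P_def by (rule carr[OF e(1)])
  have UP: "?U * P = \<theta>s 0 \<cdot>\<^sub>m P"
  proof -
    have "compose W as e = (\<lambda>v\<in>W. \<theta>s 0 *s e v)"
      unfolding compose_def using e(2) by (intro restrict_ext) auto
    then show ?thesis using Fmult[OF as(1) e(1)] Fscale[OF e(1)] unfolding as(2) P_def by simp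
  qed
  \<comment> \<open>Downward induction on the row: the equation for an upper bidiagonal matrix
    forces the rows r >= 1 to vanish, since \<open>\<theta>s r\<close> differs from
    \<open>\<theta>s 0\<close>.\<close>
  have rows: "P $$ (r, j) = 0" if "1 \<le> r" "r < n" "j < n" for r j
    using that
  proof (induction "n - r" arbitrary: r)
    case (Suc m)
    have "(?U * P) $$ (r, j) = \<theta>s 0 * P $$ (r, j)" unfolding UP using Suc.prems P by simp
    moreover have "(?U * P) $$ (r, j) = \<theta>s r * P $$ (r, j)"
    proof (cases "Suc r < n")
      case True
      then have "P $$ (Suc r, j) = 0" using Suc by (intro Suc.hyps(1)) auto
      then show ?thesis unfolding upper_bidiagonal_mult[OF P Suc.prems(2,3)] by simp
    next
      case False
      then show ?thesis unfolding upper_bidiagonal_mult[OF P Suc.prems(2,3)] by simp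
    qed
    ultimately have "(\<theta>s r - \<theta>s 0) * P $$ (r, j) = 0" by (simp add: algebra_simps)
    moreover have "\<theta>s r \<noteq> \<theta>s 0" using inj_onD[OF inj, of r 0] Suc.prems by (auto simp: n_def)
    ultimately show ?case by simp
  qed simp
  have Q: "F (?T i) $$ (r, j) = (if r = i then P $$ (0, j) else 0)" if "i \<le> d" "r < n" "j < n" for i r j
    using that
  proof (induction i arbitrary: r)
    case 0
    then show ?case using rows[of r j] by (auto simp: P_def)
  next
    case (Suc i)
    have "F (?T (Suc i)) = F a * F (?T i) + (- \<theta> i) \<cdot>\<^sub>m F (?T i)"
      unfolding split_map.simps Fadd[OF comb(3)[OF a(1) T] comb(1)[OF T]] Fmult[OF a(1) T] Fscale[OF T] ..
    then have "F (?T (Suc i)) $$ (r, j) = (F a * F (?T i)) $$ (r, j) + (- \<theta> i) * F (?T i) $$ (r, j)"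
      using carr[OF T[of i]] carr[OF a(1)] Suc.prems by simp
    also have "(F a * F (?T i)) $$ (r, j) = \<theta> r * F (?T i) $$ (r, j) + (if r = 0 then 0 else F (?T i) $$ (r - 1, j))"
      unfolding a(2) by (rule lower_bidiagonal_mult[OF carr[OF T] Suc.prems(2,3)])
    finally show ?case
      using Suc.IH[of r] Suc.IH[of "r - 1"] Suc.prems by auto
  qed
  \<comment> \<open>The upper bidiagonal matrix sends row i to rows i and i - 1 only; injectivity of
    \<open>F\<close> then carries the identity back to W.\<close>
  have eq: "F (compose W as (?T i)) = F (\<lambda>v\<in>W. (\<lambda>v\<in>W. \<theta>s i *s ?T i v) v + (\<lambda>v\<in>W. vphi i *s ?T (i - 1) v) v)"
    (is "_ = F ?R")
  proof (rule eq_matI)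
    have R: "F ?R = \<theta>s i \<cdot>\<^sub>m F (?T i) + vphi i \<cdot>\<^sub>m F (?T (i - 1))"
      unfolding Fadd[OF comb(1)[OF T] comb(1)[OF T]] Fscale[OF T] ..
    have FR: "F ?R \<in> carrier_mat n n" by (intro carr comb T)
    show "dim_row (F (compose W as (?T i))) = dim_row (F ?R)" "dim_col (F (compose W as (?T i))) = dim_col (F ?R)"
      using carr[OF comb(3)[OF as(1) T[of i]]] carrier_matD[OF FR] by auto
    fix r j assume "r < dim_row (F ?R)" "j < dim_col (F ?R)"
    then have rj: "r < n" "j < n" unfolding carrier_matD[OF FR] .
    have "F (compose W as (?T i)) $$ (r, j) = (?U * F (?T i)) $$ (r, j)"
      using Fmult[OF as(1) T[of i]] unfolding as(2) by simp
    also have "\<dots> = \<theta>s r * F (?T i) $$ (r, j) + (if Suc r < n then vphi (Suc r) * F (?T i) $$ (Suc r, j) else 0)"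
      by (rule upper_bidiagonal_mult[OF carr[OF T] rj])
    also have "\<dots> = \<theta>s i * F (?T i) $$ (r, j) + vphi i * F (?T (i - 1)) $$ (r, j)"
      using i rj Q[of i r j] Q[of i "Suc r" j] Q[of "i - 1" r j] by (auto simp: n_def)
    also have "\<dots> = F ?R $$ (r, j)"
      unfolding R using carr[OF T[of i]] carr[OF T[of "i - 1"]] rj by simp
    finally show "F (compose W as (?T i)) $$ (r, j) = F ?R $$ (r, j)" .
  qed
  have "?R \<in> endo W" by (intro comb T)
  then have "compose W as (?T i) = ?R"
    using eq bij comb(3)[OF as(1) T] unfolding bij_betw_def by (auto dest: inj_onD)
  from fun_cong[OF this, of v] show ?thesis using v by (simp add: compose_def)
qed

section \<open>Split bases of the primary module\<close>

context qdrg
begin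

text \<open>The vector (A - \<theta>_{i-1}) ... (A - \<theta>_0) x-hat as a function of the distance
  to x, where x-hat is the unit vector; it is supported at distances up to i.\<close>

fun split_poly :: "(nat \<Rightarrow> complex) \<Rightarrow> nat \<Rightarrow> nat \<Rightarrow> complex" where
  "split_poly \<theta> 0 = (\<lambda>t. of_bool (t = 0))"
| "split_poly \<theta> (Suc i) = (\<lambda>t. shift (split_poly \<theta> i) t - \<theta> i * split_poly \<theta> i t)"

lemma split_poly_above: "t > i \<Longrightarrow> split_poly \<theta> i t = 0"
proof (induction i arbitrary: t)
  case (Suc i)
  then show ?case by (simp add: shift_def)
qed simp

text \<open>Each step moves the top of the support by one, with a factor \<open>c\<close>, and the
  subtracted multiple does not reach it. The value is therefore the same for every ordering of the
  eigenvalues, which starts the telescoping in \<open>split_ratio\<close>.\<close>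

lemma split_poly_diag: "i \<le> d \<Longrightarrow> split_poly \<theta> i i = (\<Prod>l<i. of_nat (c (Suc l)))"
proof (induction i)
  case (Suc i)
  then show ?case by (simp add: shift_def split_poly_above mult.commute)
qed simp

lemma dmat_split_poly: "dmat (split_poly \<theta> i) = (\<Sum>j\<le>d. cscale (\<Prod>l<i. th j - \<theta> l) (E j))"
proof (induction i)
  case 0
  show ?case using sum_E by (simp add: Am_def)
next
  case (Suc i)
  have "dmat (split_poly \<theta> (Suc i)) = Am 1 ** dmat (split_poly \<theta> i) + cscale (- \<theta> i) (dmat (split_poly \<theta> i))"
    by (simp add: Am_1_mult_dmat dmat_scale dmat_add dmat_eq_iff del: cm.scale_minus_left)
  also have "\<dots> = (\<Sum>j\<le>d. cscale (\<Prod>l<i. th j - \<theta> l) (cscale (th j) (E j)) + cscale (- \<theta> i) (cscale (\<Prod>l<i. th j - \<theta> l) (E j)))"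
    unfolding Suc matrix_mult_sum cscale_mult_right sum.distrib cm.scale_sum_right
    by (intro arg_cong2[of _ _ _ _ "(+)"] sum.cong refl) (simp add: Am_1_mult_E)
  also have "\<dots> = (\<Sum>j\<le>d. cscale (\<Prod>l<Suc i. th j - \<theta> l) (E j))"
    by (intro sum.cong refl) (simp add: cvec_eq_iff algebra_simps)
  finally show ?case .
qed

text \<open>The d factors run over all eigenvalues but that of E_k, so of the identity, written as
  the sum of the idempotents, only the component E_k survives.\<close>

lemma split_poly_last:
  assumes "k \<le> d" "\<And>l. l < d \<Longrightarrow> th (p l) = \<theta> l" "bij_betw p {..<d} ({..d} - {k})"
  obtains a where "a \<noteq> 0" "\<And>t. t \<le> d \<Longrightarrow> split_poly \<theta> d t = a * eps k t"
proof -
  have p: "p l \<le> d" "p l \<noteq> k" if "l < d" for l using assms(3) that by (auto simp: bij_betw_def)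
  have "(\<Prod>l<d. th j - \<theta> l) = 0" if "j \<le> d" "j \<noteq> k" for j
  proof -
    have "j \<in> p ` {..<d}" using assms(3) that by (auto simp: bij_betw_def)
    then obtain l where "l < d" "p l = j" by auto
    then show ?thesis using assms(2)[of l] by (auto intro!: bexI[of _ l])
  qed
  then have "dmat (split_poly \<theta> d) = (\<Sum>j\<le>d. if j = k then cscale (\<Prod>l<d. th k - \<theta> l) (E k) else 0)"
    unfolding dmat_split_poly by (intro sum.cong) auto
  also have "\<dots> = dmat (\<lambda>t. (\<Prod>l<d. th k - \<theta> l) * eps k t)"
    using assms(1) by (simp add: E_eq dmat_scale)
  finally have "split_poly \<theta> d t = (\<Prod>l<d. th k - \<theta> l) * eps k t" if "t \<le> d" for t
    using that by (simp add: dmat_eq_iff)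
  moreover have "(\<Prod>l<d. th k - \<theta> l) \<noteq> 0"
  proof -
    have "th k \<noteq> \<theta> l" if "l < d" for l using th_inj[of k "p l"] p[OF that] assms(1,2) that by metis
    then show ?thesis by auto
  qed
  ultimately show ?thesis using that by blast
qed

text \<open>Entries of both split bases against the dual eigenbasis: their quotient telescopes to a product
  of ratios of the split sequences, while the last vectors of the bases span \<open>E d\<close> and \<open>E 0\<close>.\<close>

lemma split_ratio:
  assumes V: "\<And>i t. 1 \<le> i \<Longrightarrow> i \<le> d \<Longrightarrow> t \<le> d \<Longrightarrow> \<theta>s t * V i t = \<theta>s i * V i t + vphi i * V (i - 1) t"
    and V': "\<And>i t. 1 \<le> i \<Longrightarrow> i \<le> d \<Longrightarrow> t \<le> d \<Longrightarrow> \<theta>s t * V' i t = \<theta>s i * V' i t + phi i * V' (i - 1) t"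
    and diag: "\<And>i. i \<le> d \<Longrightarrow> V i i = V' i i"
    and inj: "inj_on \<theta>s {..d}"
    and last: "\<And>t. t \<le> d \<Longrightarrow> V d t = a * s t" "\<And>t. t \<le> d \<Longrightarrow> V' d t = (a' :: complex)" "a \<noteq> 0" "a' \<noteq> 0"
    and j: "1 \<le> j" "j \<le> d"
  shows "s (j - 1) * phi j = vphi j * s j" "phi j \<noteq> 0"
proof -
  \<comment> \<open>At t = 0 a nonzero value of \<open>V' i\<close> forces \<open>phi i\<close> and
    the value of \<open>V' (i - 1)\<close> to be nonzero; the chain starts from the constant last
    vector.\<close>
  have phi0: "phi i \<noteq> 0 \<and> V' (i - 1) 0 \<noteq> 0" if "1 \<le> i" "i \<le> d" "V' i 0 \<noteq> 0" for i
  proof -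
    have "\<theta>s 0 \<noteq> \<theta>s i" using inj_onD[OF inj, of 0 i] that by auto
    then have "(\<theta>s 0 - \<theta>s i) * V' i 0 \<noteq> 0" using that by simp
    moreover have "(\<theta>s 0 - \<theta>s i) * V' i 0 = phi i * V' (i - 1) 0"
      using V'[OF that(1,2), of 0] by (simp add: algebra_simps)
    ultimately show ?thesis by auto
  qed
  have V'0: "V' (d - m) 0 \<noteq> 0" if "m \<le> d" for m
    using that
  proof (induction m)
    case 0
    then show ?case using last(2)[of 0] last(4) by simp
  next
    case (Suc m)
    then have "V' (d - m - 1) 0 \<noteq> 0" using phi0[of "d - m"] by simp
    then show ?case by simp
  qed
  have phi_nz: "phi i \<noteq> 0" if "1 \<le> i" "i \<le> d" for i
    using phi0[OF that] V'0[of "d - i"] that by simp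
  show "phi j \<noteq> 0" using phi_nz j by blast
  \<comment> \<open>Both families satisfy recurrences in i with the same factors
    \<open>\<theta>s t - \<theta>s i\<close> and start with equal values at i = t.\<close>
  have key: "V i t * (\<Prod>l\<in>{t<..i}. phi l) = V' i t * (\<Prod>l\<in>{t<..i}. vphi l)" if "t \<le> i" "i \<le> d" for i t
    using that
  proof (induction i rule: dec_induct)
    case base
    then show ?case using diag by simp
  next
    case (step i)
    have t: "{t<..Suc i} = insert (Suc i) {t<..i}" using step by auto
    have nz: "\<theta>s t - \<theta>s (Suc i) \<noteq> 0" using inj_onD[OF inj, of t "Suc i"] step by auto
    have a: "(\<theta>s t - \<theta>s (Suc i)) * V (Suc i) t = vphi (Suc i) * V i t"
      using V[of "Suc i" t] step by (simp add: algebra_simps)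
    have b: "(\<theta>s t - \<theta>s (Suc i)) * V' (Suc i) t = phi (Suc i) * V' i t"
      using V'[of "Suc i" t] step by (simp add: algebra_simps)
    have "(\<theta>s t - \<theta>s (Suc i)) * (V (Suc i) t * (\<Prod>l\<in>{t<..Suc i}. phi l))
        = ((\<theta>s t - \<theta>s (Suc i)) * V (Suc i) t) * phi (Suc i) * (\<Prod>l\<in>{t<..i}. phi l)"
      unfolding t by simp
    also have "\<dots> = vphi (Suc i) * phi (Suc i) * (V i t * (\<Prod>l\<in>{t<..i}. phi l))"
      unfolding a by (simp add: mult_ac)
    also have "\<dots> = vphi (Suc i) * phi (Suc i) * (V' i t * (\<Prod>l\<in>{t<..i}. vphi l))"
      using step by simp
    also have "\<dots> = ((\<theta>s t - \<theta>s (Suc i)) * V' (Suc i) t) * vphi (Suc i) * (\<Prod>l\<in>{t<..i}. vphi l)"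
      unfolding b by (simp add: mult_ac)
    also have "\<dots> = (\<theta>s t - \<theta>s (Suc i)) * (V' (Suc i) t * (\<Prod>l\<in>{t<..Suc i}. vphi l))"
      unfolding t by simp
    finally show ?case using nz by simp
  qed
  let ?p = "\<Prod>l\<in>{j<..d}. phi l" and ?v = "\<Prod>l\<in>{j<..d}. vphi l"
  have ins: "{j - 1<..d} = insert j {j<..d}" using j by auto
  \<comment> \<open>Comparing the identity at t = j and t = j - 1, where the products differ by the
    factors at j, isolates one ratio.\<close>
  have 1: "a * s j * ?p = a' * ?v" using key[of j d] last(1,2)[of j] j by simp
  have 2: "a * s (j - 1) * (phi j * ?p) = a' * (vphi j * ?v)"
    using key[of "j - 1" d] last(1,2)[of "j - 1"] j unfolding ins by simp
  have "a * ?p * (s (j - 1) * phi j) = vphi j * (a' * ?v)" using 2 by (simp add: mult_ac)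
  also have "\<dots> = a * ?p * (vphi j * s j)" unfolding 1[symmetric] by (simp add: mult_ac)
  finally have "a * ?p * (s (j - 1) * phi j) = a * ?p * (vphi j * s j)" .
  moreover have "a * ?p \<noteq> 0" using phi_nz j last(3) by auto
  ultimately show "s (j - 1) * phi j = vphi j * s j" using mult_left_cancel by blast
qed

text \<open>Stated for any system that agrees with \<open>leonard x\<close> up to the ordering of
  the E_i, so that it also covers the reversed system defining the second split sequence. The
  recurrence is \<open>split_map_relation\<close> applied to the unit vector at x, which the dual
  idempotent at 0 fixes.\<close>

lemma split_sequence_split_poly:
  assumes x: "x \<in> X" and W: "lspace \<Phi> = primary x" "ldiam \<Phi> = d" "lop \<Phi> = lop (leonard x)"
    "ldop \<Phi> = ldop (leonard x)" "ldidem \<Phi> = ldidem (leonard x)"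
    and split: "split_sequence \<Phi> \<theta> \<theta>s vphi"
  shows "\<And>t. t \<le> d \<Longrightarrow> \<theta>s t = of_nat (card X) * eps 1 t"
    and "1 \<le> i \<Longrightarrow> i \<le> d \<Longrightarrow> t \<le> d \<Longrightarrow>
      \<theta>s t * split_poly \<theta> i t = \<theta>s i * split_poly \<theta> i t + vphi i * split_poly \<theta> (i - 1) t"
proof -
  let ?W = "primary x" and ?n = "d + 1"
  let ?a = "\<lambda>v\<in>?W. Am 1 *v v" and ?as = "\<lambda>v\<in>?W. dual_op x *v v" and ?e = "\<lambda>v\<in>?W. diag (Am 0 *v axis x 1) *v v"
  have es: "eigenvalue_sequence ?W d ?as (\<lambda>i. \<lambda>v\<in>?W. diag (Am i *v axis x 1) *v v) \<theta>s"
    and ex: "\<exists>F. matrix_algebra_iso ?W ?n F \<and>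
         F ?a = Matrix.mat ?n ?n (\<lambda>(i, j). if i = j then \<theta> i else if i = j + 1 then 1 else 0) \<and>
         F ?as = Matrix.mat ?n ?n (\<lambda>(i, j). if i = j then \<theta>s i else if j = i + 1 then vphi j else 0)"
    using split W unfolding split_sequence_def Let_def by (simp_all add: leonard_def)
  show ths: "\<theta>s t = of_nat (card X) * eps 1 t" if t: "t \<le> d" for t
  proof -
    have "?as ((\<lambda>v\<in>?W. diag (Am t *v axis x 1) *v v) (hat x (\<lambda>_. 1))) = \<theta>s t *s (\<lambda>v\<in>?W. diag (Am t *v axis x 1) *v v) (hat x (\<lambda>_. 1))"
      using es t unfolding eigenvalue_sequence_def by simp
    then have "hat x (\<lambda>s. of_nat (card X) * eps 1 s * (of_bool (s = t) * 1)) = hat x (\<lambda>s. \<theta>s t * (of_bool (s = t) * 1))"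
      by (simp only: restrict_apply' hat_primary dual_idem_hat[OF x] dual_op_hat[OF x] hat_scale)
    then have "\<forall>s\<le>d. of_nat (card X) * eps 1 s * (of_bool (s = t) * 1) = \<theta>s t * (of_bool (s = t) * 1)"
      unfolding hat_eq_iff[OF x] .
    then show ?thesis using t by auto
  qed
  have inj: "inj_on \<theta>s {..d}"
    using ths eps_1_inj card_X_ne_0 by (auto intro!: inj_onI)
  obtain F where F: "matrix_algebra_iso ?W ?n F"
    "F ?a = Matrix.mat ?n ?n (\<lambda>(i, j). if i = j then \<theta> i else if i = j + 1 then 1 else 0)"
    "F ?as = Matrix.mat ?n ?n (\<lambda>(i, j). if i = j then \<theta>s i else if j = i + 1 then vphi j else 0)"
    using ex by blast
  interpret rE: resolution ?W d "\<lambda>i. \<lambda>v\<in>?W. E i *v v" ?a th by (rule resolution_E[OF x])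
  interpret rD: resolution ?W d "\<lambda>i. \<lambda>v\<in>?W. diag (Am i *v axis x 1) *v v" ?as "\<lambda>t. of_nat (card X) * eps 1 t"
    by (rule resolution_dual[OF x])
  have e: "?e \<in> endo ?W" by (rule rD.e_endo) simp
  have ae: "?as (?e v) = \<theta>s 0 *s ?e v" if "v \<in> ?W" for v
    using rD.a_e[of 0 v] that ths[of 0] by simp
  have T: "split_map ?W ?a ?e \<theta> i (hat x (\<lambda>t. of_bool (t = 0))) = hat x (split_poly \<theta> i)" for i
  proof (induction i)
    case 0
    have "(\<lambda>t. of_bool (t = 0) * of_bool (t = 0)) = (\<lambda>t::nat. of_bool (t = 0) :: complex)" by auto
    then show ?case by (simp add: dual_idem_hat[OF x])
  next
    case (Suc i)
    have A: "Am 1 *v hat x f = hat x (shift f)" for f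
      by (simp add: hat_def matrix_vector_mul_assoc Am_1_mult_dmat)
    have "split_map ?W ?a ?e \<theta> (Suc i) (hat x (\<lambda>t. of_bool (t = 0))) = hat x (\<lambda>t. shift (split_poly \<theta> i) t + (- \<theta> i) * split_poly \<theta> i t)"
      by (simp only: split_map.simps restrict_apply' compose_def hat_primary Suc A hat_scale hat_add)
    also have "\<dots> = hat x (split_poly \<theta> (Suc i))" by simp
    finally show ?case .
  qed
  show "\<theta>s t * split_poly \<theta> i t = \<theta>s i * split_poly \<theta> i t + vphi i * split_poly \<theta> (i - 1) t"
    if i: "1 \<le> i" "i \<le> d" and t: "t \<le> d"
  proof -
    have "?as (split_map ?W ?a ?e \<theta> i (hat x (\<lambda>t. of_bool (t = 0)))) =
        \<theta>s i *s split_map ?W ?a ?e \<theta> i (hat x (\<lambda>t. of_bool (t = 0))) + vphi i *s split_map ?W ?a ?e \<theta> (i - 1) (hat x (\<lambda>t. of_bool (t = 0)))"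
      by (rule split_map_relation[OF primary_subspace F(1) rE.a_endo F(2) rD.a_endo F(3) e ae inj i hat_primary])
    then have "hat x (\<lambda>t. of_nat (card X) * eps 1 t * split_poly \<theta> i t) = hat x (\<lambda>t. \<theta>s i * split_poly \<theta> i t + vphi i * split_poly \<theta> (i - 1) t)"
      unfolding T by (simp only: restrict_apply' hat_primary dual_op_hat[OF x] hat_scale hat_add)
    then show ?thesis using t ths[OF t] unfolding hat_eq_iff[OF x] by simp
  qed
qed

lemma parameter_array_eigenvalues:
  assumes x: "x \<in> X" and pa: "parameter_array (leonard x) \<theta> \<theta>s vphi phi"
  shows "i \<le> d \<Longrightarrow> \<theta> i = th i" "i \<le> d \<Longrightarrow> \<theta>s i = of_nat (card X) * eps 1 i"
proof -
  let ?W = "primary x"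
  have sp: "split_sequence (leonard x) \<theta> \<theta>s vphi" using pa by (simp add: parameter_array_def)
  then show "\<theta>s i = of_nat (card X) * eps 1 i" if "i \<le> d"
    using split_sequence_split_poly(1)[OF x _ _ _ _ _ sp that] by (simp add: leonard_def)
  show "\<theta> i = th i" if i: "i \<le> d"
  proof -
    interpret rE: resolution ?W d "\<lambda>i. \<lambda>v\<in>?W. E i *v v" "\<lambda>v\<in>?W. Am 1 *v v" th by (rule resolution_E[OF x])
    obtain v where v: "v \<in> ?W" "(\<lambda>v\<in>?W. E i *v v) v \<noteq> 0" using rE.e_nz[OF i] by blast
    have "eigenvalue_sequence ?W d (\<lambda>v\<in>?W. Am 1 *v v) (\<lambda>i. \<lambda>v\<in>?W. E i *v v) \<theta>"
      using sp unfolding split_sequence_def Let_def by (simp add: leonard_def)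
    then have "(\<lambda>v\<in>?W. Am 1 *v v) ((\<lambda>v\<in>?W. E i *v v) v) = \<theta> i *s (\<lambda>v\<in>?W. E i *v v) v"
      using i v(1) unfolding eigenvalue_sequence_def by blast
    then have "th i *s (\<lambda>v\<in>?W. E i *v v) v = \<theta> i *s (\<lambda>v\<in>?W. E i *v v) v"
      unfolding rE.a_e[OF i v(1)] .
    then show ?thesis using v(2) vec.scale_right_imp_eq by metis
  qed
qed

text \<open>The split basis for the natural ordering ends in a multiple of the column of E_d at x,
  the one for the reversed ordering in a multiple of the column of E_0, which is constant. Their
  comparison expresses quotients of consecutive cosines of E_d by the split sequences.\<close>

lemma parameter_array_ratio:
  assumes x: "x \<in> X" and pa: "parameter_array (leonard x) \<theta> \<theta>s vphi phi" and j: "1 \<le> j" "j \<le> d"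
  shows "eps d (j - 1) * phi j = vphi j * eps d j" "phi j \<noteq> 0"
proof -
  note th = parameter_array_eigenvalues[OF x pa]
  have sp: "split_sequence (leonard x) \<theta> \<theta>s vphi"
    and sp': "split_sequence (reverse_idempotents (leonard x)) (\<lambda>i. \<theta> (d - i)) \<theta>s phi"
    using pa by (simp_all add: parameter_array_def leonard_def)
  let ?V = "split_poly \<theta>" and ?V' = "split_poly (\<lambda>i. \<theta> (d - i))"
  have V: "\<theta>s t * ?V i t = \<theta>s i * ?V i t + vphi i * ?V (i - 1) t" if "1 \<le> i" "i \<le> d" "t \<le> d" for i t
    by (rule split_sequence_split_poly(2)[OF x _ _ _ _ _ sp that]) (simp_all add: leonard_def)
  have V': "\<theta>s t * ?V' i t = \<theta>s i * ?V' i t + phi i * ?V' (i - 1) t" if "1 \<le> i" "i \<le> d" "t \<le> d" for i t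
    by (rule split_sequence_split_poly(2)[OF x _ _ _ _ _ sp' that]) (simp_all add: leonard_def reverse_idempotents_def)
  have diag: "?V i i = ?V' i i" if "i \<le> d" for i using that by (simp add: split_poly_diag)
  have inj: "inj_on \<theta>s {..d}"
    using th(2) eps_1_inj card_X_ne_0 by (auto intro!: inj_onI)
  have "bij_betw (\<lambda>l. l) {..<d} ({..d} - {d})" by (auto simp: bij_betw_def)
  then obtain a where a: "a \<noteq> 0" "\<And>t. t \<le> d \<Longrightarrow> ?V d t = a * eps d t"
    using split_poly_last[of d "\<lambda>l. l" \<theta> thesis] th(1) by auto
  have "bij_betw (\<lambda>l. d - l) {..<d} ({..d} - {0})"
    by (rule bij_betwI[where g="\<lambda>l. d - l"]) auto
  then obtain a' where a': "a' \<noteq> 0" "\<And>t. t \<le> d \<Longrightarrow> ?V' d t = a' * eps 0 t"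
    using split_poly_last[of 0 "\<lambda>l. d - l" "\<lambda>i. \<theta> (d - i)" thesis] th(1) by auto
  have V'd: "?V' d t = a' / of_nat (card X)" if "t \<le> d" for t using a'(2)[OF that] eps_0[OF that] by simp
  have nz: "a' / of_nat (card X) \<noteq> 0" using a'(1) card_X_ne_0 by simp
  show "eps d (j - 1) * phi j = vphi j * eps d j" "phi j \<noteq> 0"
    using split_ratio[where V="?V" and V'="?V'" and s="eps d", OF V V' diag inj a(2) V'd a(1) nz j] by auto
qed

end

section \<open>Induced subgraphs of descendents\<close>

context descendent_scheme
begin

lemma dist_function_exists:
  fixes N :: "'v \<Rightarrow> 'v \<Rightarrow> nat"
  assumes "\<And>x y x' y'. x \<in> Y \<Longrightarrow> y \<in> Y \<Longrightarrow> x' \<in> Y \<Longrightarrow> y' \<in> Y \<Longrightarrow> dl x y = dl x' y' \<Longrightarrow> N x y = N x' y'"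
  shows "\<exists>f. \<forall>x\<in>Y. \<forall>y\<in>Y. N x y = f (dl x y)"
proof -
  define S where "S i p \<longleftrightarrow> fst p \<in> Y \<and> snd p \<in> Y \<and> dl (fst p) (snd p) = i" for i and p :: "'v \<times> 'v"
  define f where "f i = (let p = SOME p. S i p in N (fst p) (snd p))" for i
  have "N x y = f (dl x y)" if "x \<in> Y" "y \<in> Y" for x y
  proof -
    have "S (dl x y) (x, y)" using that by (simp add: S_def)
    then have S: "S (dl x y) (SOME p. S (dl x y) p)" by (rule someI)
    define p where "p = (SOME p. S (dl x y) p)"
    have "N x y = N (fst p) (snd p)"
      by (rule assms) (use S that in \<open>simp_all add: S_def[of _ p] flip: p_def\<close>)
    then show ?thesis unfolding f_def Let_def p_def .
  qed
  then show ?thesis by blast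
qed

text \<open>On a geodetic Y the inherited distance satisfies the axioms of \<open>drg\<close>:
  constancy of the counts comes from the scheme, positivity from the existence of closer neighbours.
  The results on Q-polynomial structures then apply to Y itself.\<close>

lemma geodetic_qdrg:
  assumes geo: geodetic
  obtains bY cY where "qdrg Y dl w bY cY E'"
proof -
  have "\<exists>f. \<forall>x\<in>Y. \<forall>y\<in>Y. up x y = f (dl x y)"
  proof (rule dist_function_exists)
    fix x y x' y' assume "x \<in> Y" "y \<in> Y" "x' \<in> Y" "y' \<in> Y" "dl x y = dl x' y'"
    then show "up x y = up x' y'"
      using card_NY_dist[of x y x' y' "dl x y + 1"] by (simp add: up_def)
  qed
  then obtain bY where bY: "\<And>x y. x \<in> Y \<Longrightarrow> y \<in> Y \<Longrightarrow> up x y = bY (dl x y)" by blast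
  \<comment> \<open>Distance 0 is separated because the truncated \<open>dl x y - 1\<close> would
    denote 0 there.\<close>
  have down: "down x y = (if dl x y = 0 then 0 else card {z \<in> Y. dl y z = 1 \<and> dl x z = dl x y - 1})" for x y
    unfolding down_def by (auto intro!: arg_cong[of _ _ card])
  have "\<exists>f. \<forall>x\<in>Y. \<forall>y\<in>Y. down x y = f (dl x y)"
  proof (rule dist_function_exists)
    fix x y x' y' assume "x \<in> Y" "y \<in> Y" "x' \<in> Y" "y' \<in> Y" "dl x y = dl x' y'"
    then show "down x y = down x' y'"
      using card_NY_dist[of x y x' y' "dl x y - 1"] unfolding down by simp
  qed
  then obtain cY where cY: "\<And>x y. x \<in> Y \<Longrightarrow> y \<in> Y \<Longrightarrow> down x y = cY (dl x y)" by blast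
  have drgY: "drg Y dl w bY cY"
  proof
    show "Y \<noteq> {}" by (rule Y_ne)
    show "dl x y = 0 \<longleftrightarrow> x = y" if "x \<in> Y" "y \<in> Y" for x y
      by (rule dl_0) (use that Y_sub in auto)
    show "dl x y = dl y x" if "x \<in> Y" "y \<in> Y" for x y using that by (rule dl_Y_sym)
    show "dl x y \<le> w" if "x \<in> Y" "y \<in> Y" for x y using that by (rule dl_Y)
    show "dl x z \<le> dl x y + 1" if "x \<in> Y" "y \<in> Y" "z \<in> Y" "dl y z = 1" for x y z
      by (rule dl_step) (use that Y_sub in auto)
    show "card {z \<in> Y. dl y z = 1 \<and> dl x z = dl x y + 1} = bY (dl x y)"
      "card {z \<in> Y. dl y z = 1 \<and> dl x z + 1 = dl x y} = cY (dl x y)" if "x \<in> Y" "y \<in> Y" for x y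
      using bY[OF that] cY[OF that] unfolding up_def down_def .
    show "cY i > 0" if i: "1 \<le> i" "i \<le> w" for i
    proof -
      obtain x y where xy: "x \<in> Y" "y \<in> Y" "dl x y = i" using exists_pair_Y[OF i(2)] by blast
      then have "0 < dl x y" using i by simp
      then obtain z where "z \<in> Y" "dl y z = 1" "dl x z + 1 = dl x y"
        using geo xy unfolding geodetic_def by blast
      then have "down x y > 0" unfolding down_def by (auto simp: card_gt_0_iff)
      then show ?thesis using cY[OF xy(1,2)] xy(3) by simp
    qed
    \<comment> \<open>A pair at distance i + 1 is taken; its y is a farther neighbour of the vertex
      z that lies one step closer to x.\<close>
    show "bY i > 0" if "i < w" for i
    proof -
      have "Suc i \<le> w" using that by simp
      then obtain x y where xy: "x \<in> Y" "y \<in> Y" "dl x y = Suc i" using exists_pair_Y by blast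
      then have "0 < dl x y" by simp
      then obtain z where z: "z \<in> Y" "dl y z = 1" "dl x z + 1 = dl x y"
        using geo xy unfolding geodetic_def by blast
      then have "dl z y = 1" using dl_Y_sym[of y z] xy by simp
      then have "up x z > 0" unfolding up_def using xy z by (auto simp: card_gt_0_iff)
      then show ?thesis using bY[OF xy(1) z(1)] xy(3) z(3) by simp
    qed
  qed
  interpret YD: drg Y dl w bY cY by (rule drgY)
  have dmat: "YD.dmat f = sdmat f" for f
    unfolding cvec_eq_iff YD.dmat_nth sdmat_nth by simp
  have BM: "YD.BM = BMY" unfolding YD.BM_def BMY_def dmat ..
  have "qdrg Y dl w bY cY E'"
  proof (intro qdrg.intro drgY qdrg_axioms.intro)
    show "1 \<le> w" by (rule w_pos)
    show "bij_betw E' {..w} (primitive_idempotents (**) 0 YD.BM)" unfolding BM by (rule E'_bij)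
    show "E' 0 = cscale (1 / of_nat (card Y)) (all_ones Y)" by (rule E'_0)
  qed (rule E'_three_term)
  then show ?thesis by (rule that)
qed

lemma geodetic_th'_inj:
  assumes geodetic "i \<le> w" "j \<le> w" "th' i = th' j"
  shows "i = j"
proof -
  obtain bY cY where q: "qdrg Y dl w bY cY E'" using geodetic_qdrg[OF assms(1)] by blast
  interpret YD: qdrg Y dl w bY cY E' by (rule q)
  have A: "YD.Am 1 = sA 1"
    unfolding cvec_eq_iff YD.Am_def Am_def YD.dmat_nth sdmat_nth by simp
  have "YD.th k = th' k" if "k \<le> w" for k
  proof -
    have "cscale (YD.th k) (E' k) = cscale (th' k) (E' k)"
      using YD.Am_1_mult_E[OF that] sA_1_mult_E'[OF that] unfolding A by (rule trans[OF sym])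
    then show ?thesis using E'_nz[OF that] cm.scale_right_imp_eq by blast
  qed
  then show ?thesis using YD.th_inj[OF assms(2,3)] assms by simp
qed

section \<open>Balancedness of the bilinear form\<close>

lemma tprod_symmetric:
  fixes M :: "complex ^ 'v ^ 'v"
  assumes sym: "\<And>x y. M $ x $ y = M $ y $ x"
  shows "tprod (M *v u) v = tprod u (M *v v)"
proof -
  have "tprod (M *v u) v = (\<Sum>x\<in>UNIV. \<Sum>y\<in>UNIV. M $ x $ y * u $ y * v $ x)"
    by (simp add: tprod_def matrix_vector_mult_def sum_distrib_right)
  also have "\<dots> = (\<Sum>y\<in>UNIV. \<Sum>x\<in>UNIV. M $ x $ y * u $ y * v $ x)" by (rule sum.swap)
  also have "\<dots> = (\<Sum>y\<in>UNIV. \<Sum>x\<in>UNIV. u $ y * (M $ y $ x * v $ x))"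
  proof (intro sum.cong refl)
    fix y x
    show "M $ x $ y * u $ y * v $ x = u $ y * (M $ y $ x * v $ x)" unfolding sym[of x y] by simp
  qed
  also have "\<dots> = tprod u (M *v v)"
    by (simp add: tprod_def matrix_vector_mult_def sum_distrib_left)
  finally show ?thesis .
qed

lemma tprod_E_E':
  assumes "i \<le> d" "j \<le> w" "i < j \<or> i > j + ws"
  shows "tprod (E i *v u) (E' j *v v) = 0"
proof -
  have "tprod (E i *v u) (E' j *v v) = tprod u ((E i ** E' j) *v v)"
    using tprod_symmetric[of "E i" u "E' j *v v"] E_symmetric[OF assms(1)] by (simp add: matrix_vector_mul_assoc)
  then show ?thesis unfolding E_mult_E'_eq_0[OF assms] by (simp add: tprod_def matrix_vector_mult_def)
qed

text \<open>For the dual idempotents the supports at distances i and j from x are disjoint; for the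
  others the form becomes u^T E_i E'_j u', which is 0 off the band of width w* = d - w. The form is
  nonzero at the unit vector of x paired with itself.\<close>

lemma balanced_leonard:
  assumes geo: geodetic and x: "x \<in> Y" and q: "qdrg Y dl w bY cY E'"
  shows "balanced 0 (leonard x) (qdrg.leonard Y dl w E' x) tprod"
proof -
  interpret YD: qdrg Y dl w bY cY E' by (rule q)
  have xX: "x \<in> X" using x Y_sub by blast
  have lin: "bilinear_form_on A B tprod" for A B :: "(complex ^ 'v) set"
    unfolding bilinear_form_on_def tprod_def
    by (auto simp: algebra_simps sum.distrib sum_distrib_left)
  have "\<exists>u\<in>primary x. \<exists>u'\<in>YD.primary x. tprod u u' \<noteq> 0"
  proof (intro bexI)
    have "hat x (\<lambda>t. of_bool (t = 0)) $ y * YD.hat x (\<lambda>t. of_bool (t = 0)) $ y = (if y = x then 1 else 0)" for y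
      using x xX dl_0[of y x] Y_sub by (auto simp: hat_nth YD.hat_nth)
    then show "tprod (hat x (\<lambda>t. of_bool (t = 0))) (YD.hat x (\<lambda>t. of_bool (t = 0))) \<noteq> 0"
      by (simp add: tprod_def)
  qed simp_all
  moreover have "tprod (diag (Am i *v axis x 1) *v u) (diag (YD.Am j *v axis x 1) *v u') = 0" if "i \<noteq> j" for i j u u'
  proof -
    have "(Am i *v axis x 1) $ y * (YD.Am j *v axis x 1) $ y = 0" for y
      using that by (auto simp: Am_def YD.Am_def dmat_nth YD.dmat_nth matrix_mult_axis_nth)
    then have "(Am i *v axis x 1) $ y * u $ y * ((YD.Am j *v axis x 1) $ y * u' $ y) = 0" for y
      by (metis mult.commute mult.left_commute mult_eq_0_iff)
    then show ?thesis unfolding tprod_def diag_mult_vec vec_lambda_beta by (intro sum.neutral ballI)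
  qed
  moreover have "tprod (E i *v u) (E' j *v u') = 0" if "i \<le> d" "j \<le> w" "i < j \<or> i > j + d - w" for i j u u'
    using that w_ws by (intro tprod_E_E') auto
  ultimately show ?thesis
    unfolding balanced_def Let_def
    using leonard_system_leonard[OF xX] YD.leonard_system_leonard[OF x] lin w_ws
    by (simp add: leonard_def YD.leonard_def)
qed

text \<open>The condition \<open>terminal\<close> with the cosines at j eliminated in favour of the
  split sequences. Only \<open>t j\<close>, an eigenvalue of the big graph and constants independent
  of j remain, which makes different j comparable.\<close>

lemma terminal_relation:
  assumes x: "x \<in> X" and pa: "parameter_array (leonard x) \<theta> \<theta>s vphi phi"
    and t: "split_relations d \<theta> \<theta>s vphi phi t"
    and j: "1 \<le> j" "j \<le> d" "terminal j"
  shows "th' 0 * (ts 1 - ts 0) * (\<theta> 0 - \<theta> d) * (\<theta> (d + 1 - j) - \<theta> 0) = t j * (th' 1 - th' 0) * vphi 1"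
proof -
  have ths: "\<theta>s i = ts i" if "i \<le> d" for i
    using parameter_array_eigenvalues(2)[OF x pa that] by (simp add: ts_def)
  have ratio: "sig (i - 1) * phi i = vphi i * sig i" "phi i \<noteq> 0" if "1 \<le> i" "i \<le> d" for i
    using parameter_array_ratio[OF x pa that] eps_0_ne_0[of d] by (simp_all add: sig_def)
  \<comment> \<open>No cosine of E_d vanishes, because \<open>sig (i - 1) * phi i\<close> is nonzero
    inductively.\<close>
  have "sig i \<noteq> 0" if "i \<le> d" for i
    using that
  proof (induction i)
    case (Suc i)
    then have "vphi (Suc i) * sig (Suc i) \<noteq> 0" using ratio[of "Suc i"] by force
    then show ?case by simp
  qed (simp add: sig_0)
  then have sj: "sig j \<noteq> 0" using j by simp
  have 1: "1 \<in> {1..d}" "j \<in> {1..d}" using j d_pos by auto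
  have t1: "t 1 = \<theta> 0 - \<theta> d" using t by (simp add: split_relations_def)
  have t1': "vphi 1 - phi 1 = (\<theta>s 1 - \<theta>s (1 - 1)) * t 1"
    using t 1(1) unfolding split_relations_def by blast
  have tj: "vphi j - phi j = (\<theta>s j - \<theta>s (j - 1)) * t j"
    "phi j * (\<theta> 0 - \<theta> d) = vphi 1 * t j + (\<theta>s j - \<theta>s 0) * (\<theta> 0 - \<theta> d) * (\<theta> (d + 1 - j) - \<theta> 0)"
    using t 1(2) unfolding split_relations_def by blast+
  show ?thesis
  proof (rule terminal_cross[where p="phi j" and v="vphi j" and s="sig j" and su="sig (j - 1)" and u="ts (j - 1)"
        and e="ts j" and ?p1.0="phi 1" and ?s1.0="sig 1"])
    show "phi 1 = vphi 1 * sig 1" using ratio[of 1] d_pos sig_0 by simp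
    show "vphi 1 - phi 1 = (ts 1 - ts 0) * (\<theta> 0 - \<theta> d)" using t1' t1 ths d_pos by simp
    have "j - 1 \<le> d" "j \<noteq> j - 1" "j \<noteq> 0" using j by linarith+
    then show "ts j \<noteq> ts (j - 1)" "ts j \<noteq> ts 0" using ts_inj[of j "j - 1"] ts_inj[of j 0] j(2) by blast+
  qed (use j sj ratio[of j] tj ths in \<open>auto simp: terminal_def\<close>)
qed

lemma vphi_1_relation:
  assumes x: "x \<in> X" and pa: "parameter_array (leonard x) \<theta> \<theta>s vphi phi"
  shows "phi 1 = vphi 1 * sig 1" "vphi 1 \<noteq> 0"
proof -
  show "phi 1 = vphi 1 * sig 1"
    using parameter_array_ratio[OF x pa, of 1] d_pos eps_0_ne_0[of d] by (simp add: sig_def field_simps)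
  then show "vphi 1 \<noteq> 0" using parameter_array_ratio(2)[OF x pa, of 1] d_pos by auto
qed

text \<open>At index 2 the common nonzero value of both split sequences cancels from the ratio
  formula, leaving equal cosines of E_d at distances 1 and 2.\<close>

lemma case_III_even:
  assumes x: "x \<in> X" and pa: "parameter_array (leonard x) \<theta> \<theta>s vphi phi" and d: "3 \<le> d"
    and III: "case_III d \<theta> \<theta>s vphi phi"
  shows "even d"
proof (rule ccontr)
  assume "odd d"
  then have "vphi 2 = phi 2" using case_III_odd_relation[OF III] d by simp
  moreover have "(2::nat) - 1 = 1" "1 \<le> (2::nat)" "2 \<le> d" using d by simp_all
  moreover note parameter_array_ratio[OF x pa, of 2]
  ultimately have "eps d 1 = eps d 2" using mult_right_cancel[of "phi 2"] by (metis mult.commute)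
  then show False using sig_1_ne_sig_2 by (simp add: sig_def)
qed

lemma geodetic_if_case:
  assumes x: "x \<in> X" and pa: "parameter_array (leonard x) \<theta> \<theta>s vphi phi" and d: "3 \<le> d"
    and cases: "case_I_or_II d \<theta> \<theta>s vphi phi \<or> case_III d \<theta> \<theta>s vphi phi \<and> even ws"
  shows geodetic
proof (rule ccontr)
  assume "\<not> geodetic"
  then obtain j where j: "1 \<le> j" "j < w" "terminal j" using not_geodetic_terminal by blast
  have inj: "inj_on \<theta> {..d}"
    using parameter_array_eigenvalues(1)[OF x pa] th_inj by (auto intro!: inj_onI)
  have wd: "w < d" using w_ws ws_pos by simp
  obtain t where t: "split_relations d \<theta> \<theta>s vphi phi t" and sep: "separated d \<theta> t j w"
  proof (cases "case_I_or_II d \<theta> \<theta>s vphi phi")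
    case True
    then obtain t where "split_relations d \<theta> \<theta>s vphi phi t"
      "\<And>i j. 1 \<le> i \<Longrightarrow> i < j \<Longrightarrow> j < d \<Longrightarrow> separated d \<theta> t i j"
      using case_I_or_II_relations[OF _ inj, of \<theta>s vphi phi thesis] d by auto
    then show ?thesis using that j wd by blast
  next
    case False
    then have III: "case_III d \<theta> \<theta>s vphi phi" "even ws" using cases by auto
    have "even d" by (rule case_III_even[OF x pa d III(1)])
    moreover from this have "even w" using III w_ws by auto
    ultimately show ?thesis
      using case_III_relations[OF III(1) inj, of thesis] d that j wd by auto
  qed
  \<comment> \<open>The nonzero constant common to the relations at j and at w; eliminating the
    other constant, \<open>(th' 1 - th' 0) * vphi 1\<close>, between them yields equality of the two
    quotients.\<close>
  define K where "K = th' 0 * (ts 1 - ts 0) * (\<theta> 0 - \<theta> d)"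
  have "\<theta> 0 \<noteq> \<theta> d" using inj_onD[OF inj, of 0 d] d by auto
  then have K: "K \<noteq> 0" using th'_0_ne_0 ts_inj[of 1 0] d_pos by (auto simp: K_def)
  have rj: "K * (\<theta> (d + 1 - j) - \<theta> 0) = t j * (th' 1 - th' 0) * vphi 1"
    unfolding K_def using j wd by (intro terminal_relation[OF x pa t]) auto
  have rw: "K * (\<theta> (d + 1 - w) - \<theta> 0) = t w * (th' 1 - th' 0) * vphi 1"
    unfolding K_def using w_pos wd terminal_w by (intro terminal_relation[OF x pa t]) auto
  have "K * (t w * (\<theta> (d + 1 - j) - \<theta> 0)) = t w * (K * (\<theta> (d + 1 - j) - \<theta> 0))" by (simp add: mult_ac)
  also have "\<dots> = t j * (K * (\<theta> (d + 1 - w) - \<theta> 0))" unfolding rj rw by (simp add: mult_ac)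
  also have "\<dots> = K * (t j * (\<theta> (d + 1 - w) - \<theta> 0))" by (simp add: mult_ac)
  finally have "t w * (\<theta> (d + 1 - j) - \<theta> 0) = t j * (\<theta> (d + 1 - w) - \<theta> 0)" using K by simp
  then show False using sep unfolding separated_def by simp
qed

text \<open>With w odd the terminal relation at w reduces to
  \<open>th' 1 - th' 0 = th' 0 * (sig 1 - 1)\<close>, that is \<open>th' 1 = th' w\<close>. For w >
  1 this contradicts the distinctness of the eigenvalues of the subgraph.\<close>

lemma case_if_geodetic:
  assumes x: "x \<in> X" and pa: "parameter_array (leonard x) \<theta> \<theta>s vphi phi" and d: "3 \<le> d"
    and w: "1 < w" and geo: geodetic and III: "case_III d \<theta> \<theta>s vphi phi"
  shows "even ws"
proof (rule ccontr)
  assume odd: "odd ws"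
  have inj: "inj_on \<theta> {..d}"
    using parameter_array_eigenvalues(1)[OF x pa] th_inj by (auto intro!: inj_onI)
  have wd: "w < d" using w_ws ws_pos by simp
  have "even d" by (rule case_III_even[OF x pa d III])
  moreover from this have "odd w" using odd w_ws by auto
  ultimately obtain t where t: "split_relations d \<theta> \<theta>s vphi phi t" and tw: "t w \<noteq> 0" "\<theta> (d + 1 - w) - \<theta> 0 = - t w"
    using case_III_relations[OF III inj, of thesis] d wd w_pos by auto
  have "th' 0 * (ts 1 - ts 0) * (\<theta> 0 - \<theta> d) * (- t w) = t w * (th' 1 - th' 0) * vphi 1"
    using terminal_relation[OF x pa t w_pos _ terminal_w] wd unfolding tw(2) by simp
  then have "t w * (- (th' 0 * (ts 1 - ts 0) * (\<theta> 0 - \<theta> d))) = t w * ((th' 1 - th' 0) * vphi 1)"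
    by (simp add: mult_ac)
  then have eq: "- (th' 0 * (ts 1 - ts 0) * (\<theta> 0 - \<theta> d)) = (th' 1 - th' 0) * vphi 1"
    using tw(1) mult_left_cancel by blast
  have "vphi 1 - phi 1 = (\<theta>s 1 - \<theta>s (1 - 1)) * t 1" "t 1 = \<theta> 0 - \<theta> d"
    using t d_pos unfolding split_relations_def by auto
  then have "vphi 1 - phi 1 = (ts 1 - ts 0) * (\<theta> 0 - \<theta> d)"
    using parameter_array_eigenvalues(2)[OF x pa] d_pos by (simp add: ts_def)
  then have "(ts 1 - ts 0) * (\<theta> 0 - \<theta> d) = vphi 1 * (1 - sig 1)"
    using vphi_1_relation(1)[OF x pa] by (simp add: algebra_simps)
  then have "vphi 1 * (- (th' 0 * (1 - sig 1))) = vphi 1 * (th' 1 - th' 0)"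
    using eq by (simp add: mult.assoc) (simp add: mult_ac)
  then have "- (th' 0 * (1 - sig 1)) = th' 1 - th' 0"
    using vphi_1_relation(2)[OF x pa] mult_left_cancel by blast
  then have "th' 1 = th' w" using th'_w by (simp add: algebra_simps)
  then show False using geodetic_th'_inj[OF geo, of 1 w] w by simp
qed

end

section \<open>Distances in graphs\<close>

context wf_digraph
begin

lemma gdist_le: "awalk x p y \<Longrightarrow> gdist G x y \<le> length p"
  unfolding gdist_def by (intro Least_le) blast

text \<open>Being a least element, \<open>gdist\<close> is meaningful only where a walk exists;
  reachability supplies one.\<close>

lemma gdist_awalk:
  assumes "x \<rightarrow>\<^sup>* y"
  obtains p where "awalk x p y" "length p = gdist G x y"
proof -
  obtain q where "awalk x q y" using assms by (auto simp: reachable_awalk)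
  then have "\<exists>n. \<exists>p. awalk x p y \<and> length p = n" by blast
  then have "\<exists>p. awalk x p y \<and> length p = gdist G x y" unfolding gdist_def by (rule LeastI_ex)
  then show ?thesis using that by blast
qed

lemma gdist_step:
  assumes "x \<rightarrow>\<^sup>* y" "y \<rightarrow> z"
  shows "gdist G x z \<le> gdist G x y + 1"
proof -
  obtain p where p: "awalk x p y" "length p = gdist G x y" using gdist_awalk[OF assms(1)] by blast
  obtain e where e: "e \<in> arcs G" "tail G e = y" "head G e = z" using assms(2) by auto
  then have "awalk y [e] z" using arc_implies_awalk by blast
  then have "awalk x (p @ [e]) z" using p(1) awalk_appendI by blast
  from gdist_le[OF this] show ?thesis using p(2) by simp
qed

lemma gdist_predecessor:
  assumes "x \<rightarrow>\<^sup>* z" "gdist G x z = Suc n"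
  obtains y where "x \<rightarrow>\<^sup>* y" "y \<rightarrow> z" "gdist G x y = n"
proof -
  obtain p where p: "awalk x p z" "length p = Suc n" using gdist_awalk[OF assms(1)] assms(2) by metis
  then obtain q e where qe: "p = q @ [e]" by (metis append_butlast_last_id length_0_conv nat.simps(3))
  define y where "y = tail G e"
  have q: "awalk x q (awlast x q)" "awalk (awlast x q) [e] z" using p(1) unfolding qe by auto
  then have y: "awlast x q = y" "z = head G e" "e \<in> arcs G" by (auto simp: y_def awalk_simps)
  have yz: "y \<rightarrow> z" using y by (auto simp: y_def arcs_ends_conv)
  have xy: "x \<rightarrow>\<^sup>* y" using q(1) y(1) by (auto simp: reachable_awalk)
  have "gdist G x y \<le> n" using gdist_le[OF q(1)] y(1) p(2) qe by simp
  moreover have "Suc n \<le> gdist G x y + 1" using gdist_step[OF xy yz] assms(2) by simp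
  ultimately show ?thesis using that[OF xy yz] by simp
qed

lemma gdist_eq_0_iff:
  assumes "x \<rightarrow>\<^sup>* y"
  shows "gdist G x y = 0 \<longleftrightarrow> x = y"
proof
  assume "gdist G x y = 0"
  then obtain p where "awalk x p y" "length p = 0" using gdist_awalk[OF assms] by metis
  then show "x = y" by (auto simp: awalk_simps)
next
  assume "x = y"
  then have "awalk x [] y" using assms by (auto simp: awalk_simps elim: reachable_in_vertsE)
  from gdist_le[OF this] show "gdist G x y = 0" by simp
qed

end

locale connected_graph = graph G for G :: "('v, 'e) pre_digraph" (structure) +
  assumes conn: "Digraph_Component.connected G"
begin

lemma reach: "x \<in> verts G \<Longrightarrow> y \<in> verts G \<Longrightarrow> x \<rightarrow>\<^sup>* y"
  using symmetric_connected_imp_strongly_connected[OF sym_arcs conn] unfolding strongly_connected_def by blast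

lemma verts_ne: "verts G \<noteq> {}"
  using symmetric_connected_imp_strongly_connected[OF sym_arcs conn] unfolding strongly_connected_def by blast

lemma adj_sym: "u \<rightarrow> v \<Longrightarrow> v \<rightarrow> u"
  using arcs_ends_symmetric[OF sym_arcs] .

text \<open>Induction on the distance: the last arc of a shortest walk is reversed and followed by a
  shortest walk from its tail back to x.\<close>

lemma gdist_le_sym:
  assumes "x \<in> verts G" "y \<in> verts G"
  shows "gdist G y x \<le> gdist G x y"
  using assms
proof (induction "gdist G x y" arbitrary: y)
  case 0
  then have "x = y" using gdist_eq_0_iff[OF reach] by metis
  then show ?case using 0 by simp
next
  case (Suc n)
  obtain z where z: "x \<rightarrow>\<^sup>* z" "z \<rightarrow> y" "gdist G x z = n"
    using gdist_predecessor[OF reach[OF Suc.prems] Suc.hyps(2)[symmetric]] by blast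
  have zv: "z \<in> verts G" using adj_in_verts[OF z(2)] by simp
  have le: "gdist G z x \<le> n" using Suc.hyps(1)[OF _ Suc.prems(1) zv] z(3) by simp
  obtain p where p: "awalk z p x" "length p = gdist G z x" using gdist_awalk[OF reach[OF zv Suc.prems(1)]] by blast
  obtain e where e: "e \<in> arcs G" "tail G e = y" "head G e = z" using adj_sym[OF z(2)] by auto
  then have "awalk y [e] z" using arc_implies_awalk by blast
  then have "awalk y ([e] @ p) x" using p(1) awalk_appendI by blast
  from gdist_le[OF this] have "gdist G y x \<le> Suc (length p)" by simp
  then show ?case using le p(2) Suc.hyps(2) by simp
qed

lemma gdist_sym: "x \<in> verts G \<Longrightarrow> y \<in> verts G \<Longrightarrow> gdist G x y = gdist G y x"
  using gdist_le_sym[of x y] gdist_le_sym[of y x] by simp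

lemma gdist_eq_1_iff:
  assumes "y \<in> verts G" "z \<in> verts G"
  shows "gdist G y z = 1 \<longleftrightarrow> y \<rightarrow> z"
proof
  assume "gdist G y z = 1"
  then obtain u where "y \<rightarrow>\<^sup>* u" "u \<rightarrow> z" "gdist G y u = 0"
    using gdist_predecessor[OF reach[OF assms], of 0] by (metis One_nat_def)
  then show "y \<rightarrow> z" using gdist_eq_0_iff by metis
next
  assume yz: "y \<rightarrow> z"
  have "gdist G y y = 0" using gdist_eq_0_iff[OF reach] assms by blast
  then have "gdist G y z \<le> 1" using gdist_step[OF reach yz] assms by force
  moreover have "gdist G y z \<noteq> 0" using gdist_eq_0_iff[OF reach] assms adj_not_same yz by metis
  ultimately show "gdist G y z = 1" by simp
qed

lemma finite_dists: "finite {gdist G x y | x y. x \<in> verts G \<and> y \<in> verts G}"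
proof -
  have "{gdist G x y | x y. x \<in> verts G \<and> y \<in> verts G} = (\<lambda>(x, y). gdist G x y) ` (verts G \<times> verts G)" by auto
  then show ?thesis by simp
qed

lemma gdist_le_diameter: "x \<in> verts G \<Longrightarrow> y \<in> verts G \<Longrightarrow> gdist G x y \<le> graph_diameter G"
  unfolding graph_diameter_def using finite_dists by (intro Max_ge) auto

lemma diameter_attained:
  obtains x y where "x \<in> verts G" "y \<in> verts G" "gdist G x y = graph_diameter G"
proof -
  have "graph_diameter G \<in> {gdist G x y | x y. x \<in> verts G \<and> y \<in> verts G}"
    unfolding graph_diameter_def using finite_dists verts_ne by (intro Max_in) auto
  then show ?thesis using that by auto
qed

lemma exists_gdist:
  assumes "i \<le> graph_diameter G"
  obtains x y where "x \<in> verts G" "y \<in> verts G" "gdist G x y = i"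
proof -
  obtain x y where xy: "x \<in> verts G" "y \<in> verts G" "gdist G x y = graph_diameter G" by (rule diameter_attained)
  have "\<exists>y\<in>verts G. gdist G x y = graph_diameter G - m" if "m \<le> graph_diameter G" for m
    using that
  proof (induction m)
    case (Suc m)
    then obtain z where z: "z \<in> verts G" "gdist G x z = graph_diameter G - m" by auto
    then have "gdist G x z = Suc (graph_diameter G - Suc m)" using Suc.prems by simp
    then obtain u where "u \<rightarrow> z" "gdist G x u = graph_diameter G - Suc m"
      using gdist_predecessor[OF reach[OF xy(1) z(1)]] by blast
    then show ?case using adj_in_verts by blast
  qed (use xy in auto)
  from this[of "graph_diameter G - i"] show ?thesis using that xy(1) assms by auto
qed

end

text \<open>Positivity of b_i and c_i is read off from the last arc of a shortest walk, which joins
  consecutive distances from its start; such walks exist for every length up to the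
  diameter.\<close>

lemma distance_regular_drg:
  fixes G :: "('v::finite, 'e) pre_digraph"
  assumes "distance_regular G"
  obtains b c where "drg (verts G) (gdist G) (graph_diameter G) b c"
proof -
  have G: "graph G" "Digraph_Component.connected G" using assms by (auto simp: distance_regular_def)
  interpret connected_graph G using G by (simp add: connected_graph_def connected_graph_axioms_def)
  obtain b c where bc: "\<And>x y. x \<in> verts G \<Longrightarrow> y \<in> verts G \<Longrightarrow>
       card {z \<in> verts G. y \<rightarrow>\<^bsub>G\<^esub> z \<and> gdist G x z = gdist G x y + 1} = b (gdist G x y) \<and>
       card {z \<in> verts G. y \<rightarrow>\<^bsub>G\<^esub> z \<and> gdist G x z + 1 = gdist G x y} = c (gdist G x y)"
    using assms unfolding distance_regular_def by blast
  have adj: "{z \<in> verts G. gdist G y z = 1 \<and> P z} = {z \<in> verts G. y \<rightarrow>\<^bsub>G\<^esub> z \<and> P z}" if "y \<in> verts G" for y P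
    using gdist_eq_1_iff[OF that] by auto
  have "drg (verts G) (gdist G) (graph_diameter G) b c"
  proof
    show "verts G \<noteq> {}" by (rule verts_ne)
    show "gdist G x y = 0 \<longleftrightarrow> x = y" "gdist G x y = gdist G y x" "gdist G x y \<le> graph_diameter G"
      if "x \<in> verts G" "y \<in> verts G" for x y
      using that gdist_eq_0_iff[OF reach] gdist_sym gdist_le_diameter by auto
    show "gdist G x z \<le> gdist G x y + 1"
      if "x \<in> verts G" "y \<in> verts G" "z \<in> verts G" "gdist G y z = 1" for x y z
      using gdist_step[OF reach] gdist_eq_1_iff that by blast
    show "card {z \<in> verts G. gdist G y z = 1 \<and> gdist G x z = gdist G x y + 1} = b (gdist G x y)"
      "card {z \<in> verts G. gdist G y z = 1 \<and> gdist G x z + 1 = gdist G x y} = c (gdist G x y)"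
      if "x \<in> verts G" "y \<in> verts G" for x y
      using bc[OF that] unfolding adj[OF that(2)] by blast+
    have pair: "\<exists>x y z. x \<in> verts G \<and> y \<in> verts G \<and> z \<in> verts G \<and> y \<rightarrow>\<^bsub>G\<^esub> z \<and> gdist G x y = i \<and> gdist G x z = i + 1"
      if i: "Suc i \<le> graph_diameter G" for i
    proof -
      obtain x z where xz: "x \<in> verts G" "z \<in> verts G" "gdist G x z = Suc i" using exists_gdist[OF i] by blast
      then obtain y where y: "y \<rightarrow>\<^bsub>G\<^esub> z" "gdist G x y = i" using gdist_predecessor[OF reach[OF xz(1,2)]] by blast
      have "gdist G x z = i + 1" using xz(3) by simp
      then show ?thesis using xz(1,2) y adj_in_verts(1)[OF y(1)] by blast
    qed
    show "c i > 0" if i: "1 \<le> i" "i \<le> graph_diameter G" for i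
    proof -
      have "Suc (i - 1) \<le> graph_diameter G" using i by simp
      from pair[OF this] obtain x y z where xyz: "x \<in> verts G" "y \<in> verts G" "z \<in> verts G" "y \<rightarrow>\<^bsub>G\<^esub> z"
        "gdist G x y = i - 1" "gdist G x z = i - 1 + 1" by blast
      have "y \<in> {u \<in> verts G. z \<rightarrow>\<^bsub>G\<^esub> u \<and> gdist G x u + 1 = gdist G x z}" using xyz adj_sym by simp
      then have "card {u \<in> verts G. z \<rightarrow>\<^bsub>G\<^esub> u \<and> gdist G x u + 1 = gdist G x z} > 0"
        by (subst card_gt_0_iff) auto
      then show ?thesis using bc[OF xyz(1,3)] xyz(6) i by simp
    qed
    show "b i > 0" if i: "i < graph_diameter G" for i
    proof -
      obtain x y z where xyz: "x \<in> verts G" "y \<in> verts G" "z \<in> verts G" "y \<rightarrow>\<^bsub>G\<^esub> z"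
        "gdist G x y = i" "gdist G x z = i + 1" using pair[of i] i by auto
      have "z \<in> {u \<in> verts G. y \<rightarrow>\<^bsub>G\<^esub> u \<and> gdist G x u = gdist G x y + 1}" using xyz by simp
      then have "card {u \<in> verts G. y \<rightarrow>\<^bsub>G\<^esub> u \<and> gdist G x u = gdist G x y + 1} > 0"
        by (subst card_gt_0_iff) auto
      then show ?thesis using bc[OF xyz(1,2)] xyz(5) by simp
    qed
  qed
  then show ?thesis by (rule that)
qed

lemma dist_matrix_eq: "drg X dl d b c \<Longrightarrow> X = verts G \<Longrightarrow> dl = gdist G \<Longrightarrow> dist_matrix G i = drg.Am X dl i"
  by (simp add: cvec_eq_iff dist_matrix_def drg.Am_def drg.dmat_nth)

lemma induce_subgraph_adj: "u \<rightarrow>\<^bsub>G \<restriction> Y\<^esub> v \<longleftrightarrow> u \<rightarrow>\<^bsub>G\<^esub> v \<and> u \<in> Y \<and> v \<in> Y"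
  by (auto simp: arcs_ends_conv)

lemma graph_induce_subgraph:
  assumes "graph G" "Y \<subseteq> verts G" "finite Y"
  shows "graph (G \<restriction> Y)"
proof -
  interpret graph G by (rule assms(1))
  have "symmetric (G \<restriction> Y)"
    unfolding symmetric_def sym_def using arcs_ends_symmetric[OF sym_arcs] induce_subgraph_adj[of _ _ G Y] by blast
  then show ?thesis
    using assms no_loops no_multi_arcs by unfold_locales (auto simp: arc_to_ends_def)
qed

section \<open>The induced subgraph\<close>

locale graph_descendent = descendent_scheme X dl d b c E Y w ws E' + connected_graph G
  for X :: "'v::finite set" and dl d b c E Y w ws E' and G :: "('v, 'e) pre_digraph" +
  assumes X_eq: "X = verts G" and dl_eq: "dl = gdist G"
begin

abbreviation H :: "('v, 'e) pre_digraph" where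
  "H \<equiv> G \<restriction> Y"

lemma graph_H: "graph H"
  using graph_induce_subgraph[of G Y] Y_sub graph_axioms unfolding X_eq by simp

lemma adj_H: "u \<rightarrow>\<^bsub>H\<^esub> v \<longleftrightarrow> u \<in> Y \<and> v \<in> Y \<and> dl u v = 1"
  using gdist_eq_1_iff[of u v] Y_sub unfolding dl_eq X_eq induce_subgraph_adj by auto

lemma geodetic_awalk:
  assumes "geodetic" "x \<in> Y" "y \<in> Y"
  shows "\<exists>p. pre_digraph.awalk H x p y \<and> length p = dl x y"
proof -
  interpret H: graph H by (rule graph_H)
  show ?thesis
    using assms(3)
  proof (induction "dl x y" arbitrary: y)
    case 0
    then have "x = y" using dl_0[of x y] assms(2) Y_sub by auto
    then have "H.awalk x [] y" using 0 by (simp add: H.awalk_simps)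
    then show ?case using 0 by auto
  next
    case (Suc n)
    then have "0 < dl x y" by simp
    then obtain z where z: "z \<in> Y" "dl y z = 1" "dl x z + 1 = dl x y"
      using assms Suc.prems unfolding geodetic_def by blast
    then obtain p where p: "H.awalk x p z" "length p = dl x z" using Suc by force
    have "z \<rightarrow>\<^bsub>H\<^esub> y" using z Suc.prems dl_Y_sym[of y z] by (simp add: adj_H)
    then obtain e where "e \<in> arcs H" "tail H e = z" "head H e = y" by (rule reachableE)
    then have "H.awalk z [e] y" using H.arc_implies_awalk by blast
    then have "H.awalk x (p @ [e]) y" using p(1) H.awalk_appendI by blast
    then show ?case using p(2) z(3) by (intro exI[of _ "p @ [e]"]) auto
  qed
qed

lemma gdist_H_ge:
  assumes "pre_digraph.awalk H x p y"
  shows "dl x y \<le> length p"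
proof -
  interpret H: graph H by (rule graph_H)
  have "awalk x p y"
    using assms compatible_cas[OF compatible_induce_subgraph, of G Y] Y_sub
    unfolding H.awalk_def awalk_def X_eq by auto
  then show ?thesis unfolding dl_eq by (rule gdist_le)
qed

lemma gdist_H:
  assumes "geodetic" "x \<in> Y" "y \<in> Y"
  shows "gdist H x y = dl x y"
proof -
  obtain p where p: "pre_digraph.awalk H x p y" "length p = dl x y" using geodetic_awalk[OF assms] by blast
  show ?thesis
    unfolding gdist_def by (rule Least_equality) (use p gdist_H_ge in blast)+
qed

lemma connected_H_if_geodetic:
  assumes "geodetic"
  shows "Digraph_Component.connected H"
proof -
  interpret H: graph H by (rule graph_H)
  have sub: "arcs_ends H \<subseteq> (arcs_ends H)\<^sup>s" by (auto simp: symcl_def)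
  have "(u, v) \<in> rtrancl_on (verts H) ((arcs_ends H)\<^sup>s)" if uv: "u \<in> Y" "v \<in> Y" for u v
  proof -
    obtain p where "H.awalk u p v" using geodetic_awalk[OF assms uv] by blast
    then have "u \<rightarrow>\<^sup>*\<^bsub>H\<^esub> v" unfolding H.reachable_awalk ..
    then have "(u, v) \<in> rtrancl_on (verts H) (arcs_ends H)" unfolding reachable_def .
    then show ?thesis by (rule rtrancl_on_mono[OF sub order.refl])
  qed
  then show ?thesis unfolding connected_conv using Y_ne by simp
qed

text \<open>If not, the vertices of Y at distance less than i from x would be closed under adjacency
  in the subgraph, by the cut, although Y contains a vertex at distance i.\<close>

lemma geodetic_if_connected_H:
  assumes "Digraph_Component.connected H"
  shows geodetic
proof (rule ccontr)
  assume "\<not> geodetic"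
  then obtain i where i: "2 \<le> i" "i \<le> w"
    and cut: "\<And>x y z. x \<in> Y \<Longrightarrow> y \<in> Y \<Longrightarrow> z \<in> Y \<Longrightarrow> dl x y = i - 1 \<Longrightarrow> dl y z = 1 \<Longrightarrow> dl x z \<noteq> i"
    using not_geodetic_cut by blast
  interpret H: connected_graph H
    using graph_H assms by (simp add: connected_graph_def connected_graph_axioms_def)
  obtain x y where xy: "x \<in> Y" "y \<in> Y" "dl x y = i" using exists_pair_Y[OF i(2)] by blast
  have "x \<rightarrow>\<^sup>*\<^bsub>H\<^esub> y" using xy by (intro H.reach) auto
  then have "y \<in> Y \<and> dl x y < i"
  proof (induction rule: H.reachable_induct)
    case base
    then show ?case using i dl_Y_refl[OF xy(1)] xy(1) by simp
  next
    case (step u v)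
    then have uv: "u \<in> Y" "v \<in> Y" "dl u v = 1" "dl x u < i" by (auto simp: adj_H)
    have "dl x v \<le> dl x u + 1" using dl_step[of x u v] uv xy(1) Y_sub by auto
    moreover have "dl x u = i - 1 \<Longrightarrow> dl x v \<noteq> i" using cut[OF xy(1) uv(1,2) _ uv(3)] .
    ultimately show ?case using uv i by linarith
  qed
  then show False using xy by simp
qed

lemma diameter_H:
  assumes geodetic
  shows "graph_diameter H = w"
proof -
  have eq: "{gdist H x y | x y. x \<in> verts H \<and> y \<in> verts H} = {dl x y | x y. x \<in> Y \<and> y \<in> Y}"
    using gdist_H[OF assms] by (auto; metis)
  have fin: "finite {dl x y | x y. x \<in> Y \<and> y \<in> Y}"
    by (rule finite_subset[of _ "{..w}"]) (use dl_Y in auto)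
  obtain x y where "x \<in> Y" "y \<in> Y" "dl x y = w" using exists_pair_Y[OF order.refl] by blast
  then have "Max {dl x y | x y. x \<in> Y \<and> y \<in> Y} = w"
    using fin dl_Y by (intro Max_eqI) auto
  then show ?thesis unfolding graph_diameter_def eq .
qed

lemma dist_matrix_H:
  assumes geodetic
  shows "dist_matrix H i = sA i"
  using gdist_H[OF assms] Y_sub by (auto simp: cvec_eq_iff dist_matrix_def Am_def dmat_nth)

lemma bose_mesner_H: "geodetic \<Longrightarrow> bose_mesner H = BMY"
  unfolding bose_mesner_def cspan_upto_eq_span BMY_eq_span by (simp add: diameter_H dist_matrix_H)

lemma distance_regular_H:
  assumes geo: geodetic
  shows "distance_regular H"
proof -
  obtain bY cY where "qdrg Y dl w bY cY E'" using geodetic_qdrg[OF geo] by blast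
  then interpret YD: qdrg Y dl w bY cY E' .
  have set: "{z \<in> verts H. y \<rightarrow>\<^bsub>H\<^esub> z \<and> P (gdist H x z)} = {z \<in> Y. dl y z = 1 \<and> P (dl x z)}"
    if "x \<in> Y" "y \<in> Y" for x y P
    using that gdist_H[OF geo] by (auto simp: adj_H)
  have "\<forall>x \<in> verts H. \<forall>y \<in> verts H.
       card {z \<in> verts H. y \<rightarrow>\<^bsub>H\<^esub> z \<and> gdist H x z = gdist H x y + 1} = bY (gdist H x y) \<and>
       card {z \<in> verts H. y \<rightarrow>\<^bsub>H\<^esub> z \<and> gdist H x z + 1 = gdist H x y} = cY (gdist H x y)"
  proof (intro ballI)
    fix x y assume "x \<in> verts H" "y \<in> verts H"
    then have xy: "x \<in> Y" "y \<in> Y" by auto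
    show "card {z \<in> verts H. y \<rightarrow>\<^bsub>H\<^esub> z \<and> gdist H x z = gdist H x y + 1} = bY (gdist H x y) \<and>
       card {z \<in> verts H. y \<rightarrow>\<^bsub>H\<^esub> z \<and> gdist H x z + 1 = gdist H x y} = cY (gdist H x y)"
      unfolding gdist_H[OF geo xy] set[OF xy, of "\<lambda>n. n = dl x y + 1"] set[OF xy, of "\<lambda>n. n + 1 = dl x y"]
      using YD.card_b[OF xy] YD.card_c[OF xy] by blast
  qed
  then show ?thesis
    unfolding distance_regular_def using graph_H connected_H_if_geodetic[OF geo] by blast
qed

lemma Q_polynomial_H:
  assumes geo: geodetic
  shows "Q_polynomial H E'"
  unfolding Q_polynomial_def Let_def diameter_H[OF geo] bose_mesner_H[OF geo] idempotent_ordering_def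
    induce_subgraph_verts
  using E'_bij E'_0 E'_three_term by blast

text \<open>Distance-regularity includes connectedness, which makes Y geodetic; for the converse the
  given ordering \<open>E'\<close> witnesses the Q-polynomial property.\<close>

lemma Q_polynomial_drg_H_iff: "Q_polynomial_drg H \<longleftrightarrow> geodetic"
  using distance_regular_H Q_polynomial_H geodetic_if_connected_H
  unfolding Q_polynomial_drg_def distance_regular_def by blast

lemma graph_leonard_G: "graph_diameter G = d \<Longrightarrow> graph_leonard G (bose_mesner G) E x = leonard x"
proof -
  assume d: "graph_diameter G = d"
  have A: "dist_matrix G = Am"
    by (rule ext) (rule dist_matrix_eq[OF drg_axioms X_eq dl_eq])
  have BM: "bose_mesner G = BM"
    unfolding bose_mesner_def cspan_upto_eq_span BM_eq_span A d ..
  show ?thesis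
    unfolding graph_leonard_def leonard_def primary_def Let_def BM A d by (simp flip: X_eq)
qed

lemma graph_leonard_H:
  assumes geo: geodetic and q: "qdrg Y dl w bY cY E'"
  shows "graph_leonard H BMY E' x = qdrg.leonard Y dl w E' x"
proof -
  interpret YD: qdrg Y dl w bY cY E' by (rule q)
  have dmat: "YD.dmat f = sdmat f" for f
    unfolding cvec_eq_iff YD.dmat_nth sdmat_nth by simp
  have BM: "YD.BM = BMY" unfolding YD.BM_def BMY_def dmat ..
  have A: "dist_matrix H = YD.Am"
    unfolding fun_eq_iff YD.Am_def dmat dist_matrix_H[OF geo] Am_def by simp
  show ?thesis
    unfolding graph_leonard_def YD.leonard_def YD.primary_def Let_def A BM diameter_H[OF geo] by simp
qed

end

section \<open>Translation of width and dual width\<close>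

lemma tprod_char_vec: "tprod (char_vec Y) (M *v char_vec Y) = (\<Sum>x\<in>Y. \<Sum>y\<in>Y. M $ x $ y)"
proof -
  have "tprod (char_vec Y) (M *v char_vec Y) = (\<Sum>x\<in>UNIV. if x \<in> Y then (\<Sum>y\<in>UNIV. if y \<in> Y then M $ x $ y else 0) else 0)"
    unfolding tprod_def matrix_vector_mult_def by (intro sum.cong) (auto simp: char_vec_def intro!: sum.cong)
  then show ?thesis by (simp add: sum.If_cases)
qed

text \<open>The bilinear form counts the ordered pairs of Y at the given distance; counting in the
  natural numbers shows that it is nonzero as soon as one pair exists.\<close>

lemma le_width:
  fixes G :: "('v::finite, 'e) pre_digraph"
  assumes "x \<in> Y" "y \<in> Y" "Y \<subseteq> verts G" "gdist G x y \<le> graph_diameter G"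
  shows "gdist G x y \<le> width G Y"
proof -
  let ?i = "gdist G x y"
  let ?n = "\<Sum>u\<in>Y. \<Sum>v\<in>Y. of_bool (gdist G u v = ?i) :: nat"
  have "?n \<noteq> 0"
  proof
    assume "?n = 0"
    then have "\<forall>u\<in>Y. (\<Sum>v\<in>Y. of_bool (gdist G u v = ?i)) = (0 :: nat)"
      by (subst (asm) sum_eq_0_iff) simp
    then have "(\<Sum>v\<in>Y. of_bool (gdist G x v = ?i)) = (0 :: nat)" using assms(1) ..
    then have "\<forall>v\<in>Y. of_bool (gdist G x v = ?i) = (0 :: nat)"
      by (subst (asm) sum_eq_0_iff) simp
    then have "of_bool (gdist G x y = ?i) = (0 :: nat)" using assms(2) ..
    then show False by simp
  qed
  then have "of_nat ?n \<noteq> (0 :: complex)" unfolding of_nat_eq_0_iff .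
  moreover have "tprod (char_vec Y) (dist_matrix G ?i *v char_vec Y) = of_nat ?n"
    unfolding tprod_char_vec dist_matrix_def of_nat_sum of_nat_of_bool
    using assms(3) by (intro sum.cong refl) auto
  ultimately show ?thesis
    unfolding width_def using assms(4) by (intro Max_ge) simp_all
qed

text \<open>As E_i is a real symmetric idempotent, the bilinear form at the characteristic vector is
  the squared norm of its image under E_i.\<close>

lemma (in qdrg) dual_width_zero:
  assumes "Y \<subseteq> X" "graph_diameter G = d" "dual_width G E Y < i" "i \<le> d"
  shows "E i *v char_vec Y = 0"
proof -
  have "tprod (char_vec Y) (E i *v char_vec Y) = 0"
  proof (rule ccontr)
    assume "tprod (char_vec Y) (E i *v char_vec Y) \<noteq> 0"
    then have "i \<le> dual_width G E Y"
      unfolding dual_width_def assms(2) using assms(4) by (intro Max_ge) auto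
    then show False using assms(3) by simp
  qed
  define u where "u = E i *v char_vec Y"
  have ux: "u $ x = (\<Sum>y\<in>Y. E i $ x $ y)" for x
    unfolding u_def matrix_vector_mult_def
    by (simp add: char_vec_def if_distrib cong: if_cong) (simp add: sum.If_cases)
  have "u $ x \<in> \<real>" for x unfolding ux using E_nth_real[OF assms(4)] by (intro sum_in_Reals)
  then have r: "u $ x = of_real (Re (u $ x))" for x by (metis of_real_Re)
  have "0 = tprod (char_vec Y) (E i *v (E i *v char_vec Y))"
    using \<open>tprod _ _ = 0\<close> by (simp add: matrix_vector_mul_assoc E_idem[OF assms(4)])
  also have "\<dots> = (\<Sum>z\<in>UNIV. \<Sum>x\<in>UNIV. char_vec Y $ z * (E i $ z $ x * u $ x))"
    by (simp add: tprod_def matrix_vector_mult_def[of _ "_ *v _"] u_def sum_distrib_left)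
  also have "\<dots> = (\<Sum>x\<in>UNIV. \<Sum>z\<in>UNIV. char_vec Y $ z * (E i $ z $ x * u $ x))" by (rule sum.swap)
  also have "\<dots> = (\<Sum>x\<in>UNIV. u $ x * u $ x)"
  proof (intro sum.cong refl)
    fix x
    have "(\<Sum>z\<in>UNIV. char_vec Y $ z * (E i $ z $ x * u $ x)) = (\<Sum>z\<in>UNIV. E i $ x $ z * char_vec Y $ z) * u $ x"
      unfolding sum_distrib_right by (intro sum.cong refl) (simp add: E_symmetric[OF assms(4), of x])
    then show "(\<Sum>z\<in>UNIV. char_vec Y $ z * (E i $ z $ x * u $ x)) = u $ x * u $ x"
      by (simp add: u_def matrix_vector_mult_def)
  qed
  also have "\<dots> = (\<Sum>x\<in>UNIV. of_real ((Re (u $ x))\<^sup>2))"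
    by (intro sum.cong refl) (metis r of_real_mult power2_eq_square)
  also have "\<dots> = of_real (\<Sum>x\<in>UNIV. (Re (u $ x))\<^sup>2)" by (simp only: of_real_sum)
  finally have "complex_of_real (\<Sum>x\<in>UNIV. (Re (u $ x))\<^sup>2) = 0" by (rule sym)
  then have "(\<Sum>x\<in>UNIV. (Re (u $ x))\<^sup>2) = 0" by (simp only: of_real_eq_0_iff)
  then have "(Re (u $ x))\<^sup>2 = 0" for x by (subst (asm) sum_nonneg_eq_0_iff) auto
  then have "u $ x = 0" for x using r[of x] by simp
  then show ?thesis unfolding u_def by (simp add: cvec_eq_iff)
qed

theorem mainTheorem3:
  fixes \<Gamma> :: "('v::finite, 'e) pre_digraph"
    and E E' :: "nat \<Rightarrow> complex ^ 'v ^ 'v"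
    and Y :: "'v set" and x :: 'v
    and \<theta> \<theta>s vphi phi :: "nat \<Rightarrow> complex"
  defines "d \<equiv> graph_diameter \<Gamma>"
    and "w \<equiv> width \<Gamma> Y"
    and "ws \<equiv> dual_width \<Gamma> E Y"
    and "\<Gamma>Y \<equiv> \<Gamma> \<restriction> Y"
    and "\<Phi> \<equiv> graph_leonard \<Gamma> (bose_mesner \<Gamma>) E x"
    and "\<Phi>Y \<equiv> graph_leonard (\<Gamma> \<restriction> Y) (induced_bose_mesner \<Gamma> Y) E' x"
  assumes "distance_regular \<Gamma>" and "d \<ge> 3" and "Q_polynomial \<Gamma> E"
    and "nontrivial_descendent \<Gamma> E Y" and "x \<in> Y"
    and "induced_ordering \<Gamma> E Y E'"
    and "parameter_array \<Phi> \<theta> \<theta>s vphi phi"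
    and "case_I_or_II d \<theta> \<theta>s vphi phi \<or> case_III d \<theta> \<theta>s vphi phi"
    and "w > 1"
  shows "(Q_polynomial_drg \<Gamma>Y \<longleftrightarrow>
            case_I_or_II d \<theta> \<theta>s vphi phi \<or> (case_III d \<theta> \<theta>s vphi phi \<and> even ws)) \<and>
         (Q_polynomial_drg \<Gamma>Y \<longrightarrow> Q_polynomial \<Gamma>Y E' \<and> balanced 0 \<Phi> \<Phi>Y tprod)"
proof -
  have G: "graph \<Gamma>" "Digraph_Component.connected \<Gamma>" using assms(7) by (auto simp: distance_regular_def)
  interpret G: connected_graph \<Gamma> using G by (simp add: connected_graph_def connected_graph_axioms_def)
  obtain b c where "drg (verts \<Gamma>) (gdist \<Gamma>) d b c" using distance_regular_drg[OF assms(7)] unfolding d_def by blast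
  then interpret D: drg "verts \<Gamma>" "gdist \<Gamma>" d b c .
  have A: "dist_matrix \<Gamma> = D.Am"
    by (rule ext) (rule dist_matrix_eq[OF D.drg_axioms refl refl])
  have BM: "bose_mesner \<Gamma> = D.BM"
    unfolding bose_mesner_def cspan_upto_eq_span D.BM_eq_span A d_def ..
  have "qdrg (verts \<Gamma>) (gdist \<Gamma>) d b c E"
  proof (intro qdrg.intro D.drg_axioms qdrg_axioms.intro)
    show "1 \<le> d" using assms(8) by simp
  qed (use assms(9) in \<open>unfold Q_polynomial_def Let_def idempotent_ordering_def BM d_def[symmetric], blast+\<close>)
  then interpret Q: qdrg "verts \<Gamma>" "gdist \<Gamma>" d b c E .
  have Y: "Y \<noteq> {}" "Y \<subseteq> verts \<Gamma>" "w + ws = d" "w \<noteq> 0" "w \<noteq> d"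
    using assms(10) by (auto simp: nontrivial_descendent_def descendent_def w_def ws_def d_def)
  have "narrow_subset (verts \<Gamma>) (gdist \<Gamma>) d b c E Y w ws"
  proof (intro narrow_subset.intro Q.qdrg_axioms narrow_subset_axioms.intro Y)
    show "1 \<le> w" "1 \<le> ws" using Y by auto
    show "gdist \<Gamma> u v \<le> w" if "u \<in> Y" "v \<in> Y" for u v
      unfolding w_def using that Y(2) D.dl_le[of u v] by (intro le_width) (auto simp: d_def)
    show "E i *v char_vec Y = 0" if "ws < i" "i \<le> d" for i
      using Q.dual_width_zero[OF Y(2) _ _ that(2), of \<Gamma>] that(1) by (simp add: d_def ws_def)
  qed
  then interpret N: narrow_subset "verts \<Gamma>" "gdist \<Gamma>" d b c E Y w ws .
  have BMY: "induced_bose_mesner \<Gamma> Y = N.BMY"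
    unfolding induced_bose_mesner_def cspan_upto_eq_span N.BMY_eq_span A w_def ..
  have "descendent_scheme (verts \<Gamma>) (gdist \<Gamma>) d b c E Y w ws E'"
  proof (intro descendent_scheme.intro N.narrow_subset_axioms descendent_scheme_axioms.intro)
    show "bij_betw E' {..w} (primitive_idempotents (**) 0 N.BMY)"
      using assms(12) by (simp add: induced_ordering_def idempotent_ordering_def BMY w_def)
    show "cm.span (E' ` {..i}) = N.V i" if "i \<le> w" for i
      using assms(12) that by (simp add: induced_ordering_def w_def cspan_upto_eq_span)
  qed
  then interpret graph_descendent "verts \<Gamma>" "gdist \<Gamma>" d b c E Y w ws E' \<Gamma>
    by (intro graph_descendent.intro graph_descendent_axioms.intro G.connected_graph_axioms refl)
  have \<Phi>: "\<Phi> = Q.leonard x" unfolding \<Phi>_def by (rule graph_leonard_G) (simp add: d_def)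
  have x: "x \<in> verts \<Gamma>" using assms(11) Y(2) by blast
  have pa: "parameter_array (Q.leonard x) \<theta> \<theta>s vphi phi" using assms(13) unfolding \<Phi> .
  have iff: "Q_polynomial_drg \<Gamma>Y \<longleftrightarrow> geodetic" unfolding \<Gamma>Y_def by (rule Q_polynomial_drg_H_iff)
  have "geodetic \<longleftrightarrow> case_I_or_II d \<theta> \<theta>s vphi phi \<or> (case_III d \<theta> \<theta>s vphi phi \<and> even ws)"
    using geodetic_if_case[OF x pa assms(8)] case_if_geodetic[OF x pa assms(8,15)] assms(14) by blast
  moreover have "Q_polynomial \<Gamma>Y E' \<and> balanced 0 \<Phi> \<Phi>Y tprod" if geo: geodetic
  proof
    show "Q_polynomial \<Gamma>Y E'" unfolding \<Gamma>Y_def by (rule Q_polynomial_H[OF geo])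
    obtain bY cY where q: "qdrg Y (gdist \<Gamma>) w bY cY E'" using geodetic_qdrg[OF geo] by blast
    have "\<Phi>Y = qdrg.leonard Y (gdist \<Gamma>) w E' x" unfolding \<Phi>Y_def BMY by (rule graph_leonard_H[OF geo q])
    then show "balanced 0 \<Phi> \<Phi>Y tprod"
      unfolding \<Phi> using balanced_leonard[OF geo assms(11) q] by simp
  qed
  ultimately show ?thesis unfolding iff by blast
qed

end
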